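(* If $\mu$ and $\lambda$ are strict partitions then $gp_{\lambda/\mu}=gp^{\mathrm{comb}}_{\lambda/\mu}$ and $gq_{\lambda/\mu}=gq^{\mathrm{comb}}_{\lambda/\mu}$.
   Context: Strict partitions $\lambda=(\lambda_1>\dots>\lambda_k>0)$, $|\lambda|=\sum\lambda_i$, shifted diagram $\mathsf{SD}_\lambda=\{(i,i+j-1):1\le i\le k,1\le j\le\lambda_i\}$; for strict $\mu\subseteq\lambda$, $\mathsf{SD}_{\lambda/\mu}=\mathsf{SD}_\lambda\setminus\mathsf{SD}_\mu$ and $|\lambda/\mu|=|\lambda|-|\mu|$; diagonal boxes $(i,i)$. Primed numbers $i'=i-\tfrac12$, ordered $1'<1<2'<2<\dots$; $\beta,x_i,y_i$ commuting indeterminates. A semistandard shifted set-valued tableau of shape $\lambda$ fills each box $(i,j)$ with a nonempty finite subset $T_{ij}$ of $\{1'<1<\dots\}$ with $\max T_{ij}\le\min T_{i+1,j}$, $\max T_{ij}\le\min T_{i,j+1}$ (when boxes exist), no unprimed number in two boxes of a column, no primed number in two boxes of a row; $|T|=\sum|T_{ij}|$, ${\bf x}^T=\prod x_i^{(\#i)+(\#i')}$. $GQ_\lambda=\sum\beta^{|\lambda|-|T|}{\bf x}^T$ over all such tableaux; $GP_\lambda$ the same over those with no primed diagonal entries. $gp_\lambda,gq_\lambda$ are the unique power series with $\sum_\lambda GQ_\lambda({\bf x})gp_\lambda({\bf y})=\sum_\lambda GP_\lambda({\bf x})gq_\lambda({\bf y})=\prod_{i,j}\frac{1-\overline{x_i}y_j}{1-x_iy_j}$,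 $\overline{x}=\frac{-x}{1+\beta x}$. With $f({\bf x},{\bf y}):=f(x_1,y_1,x_2,y_2,\dots)$, the skew functions are defined (for all strict $\mu$) by $gp_\lambda({\bf x},{\bf y})=\sum_\mu gp_\mu({\bf x})gp_{\lambda/\mu}({\bf y})$ and $gq_\lambda({\bf x},{\bf y})=\sum_\mu gq_\mu({\bf x})gq_{\lambda/\mu}({\bf y})$. A shifted plane partition of shape $\lambda/\mu$ is a filling of $\mathsf{SD}_{\lambda/\mu}$ by elements of $\{1'<1<2'<\dots\}$ with weakly increasing rows and columns; for such $T$, $c_i$ is the number of distinct columns containing $i$, $r_i$ the number of distinct rows containing $i'$, $|\operatorname{wt}_{\mathrm{PP}}(T)|=\sum_i(c_i+r_i)$, ${\bf x}^{\operatorname{wt}_{\mathrm{PP}}(T)}=\prod_ix_i^{c_i+r_i}$. $\mathsf{ShPP}_Q(\lambda/\mu)$ is the set of such fillings, $\mathsf{ShPP}_P(\lambda/\mu)$ those with no unprimed diagonal entries (both empty if $\mu\not\subseteq\lambda$). $gp^{\mathrm{comb}}_{\lambda/\mu}=\sum_{T\in\mathsf{ShPP}_P(\lambda/\mu)}(-\beta)^{|\lambda/\mu|-|\operatorname{wt}_{\mathrm{PP}}(T)|}{\bf x}^{\operatorname{wt}_{\mathrm{PP}}(T)}$ and $gq^{\mathrm{comb}}_{\lambda/\mu}$ is the same sum over $\mathsf{ShPP}_Q(\lambda/\mu)$.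
   Formalization: In the definitions of GQ and GP the power of β is taken as |T|−|λ| instead of the printed |λ|−|T|, which would be negative and for which the identity already fails at the coefficient of x₁²y₁ in the Cauchy identity. *)

theory Defs
  imports
    "HOL-Analysis.Infinite_Sum"
    "HOL-Library.Poly_Mapping"
    "HOL-Computational_Algebra.Polynomial"
begin

section \<open>Formal power series in an arbitrary set of commuting variables\<close>

text \<open>
  A series over \<^typ>\<open>'a\<close> in variables indexed by \<^typ>\<open>'v\<close> is a function from exponent vectors
  (finitely supported, but of arbitrarily many variables) to coefficients.
\<close>

typedef ('v, 'a) mpser = "UNIV :: (('v \<Rightarrow>\<^sub>0 nat) \<Rightarrow> 'a) set"
  morphisms mps_nth Abs_mpser ..

setup_lifting type_definition_mpser

lemma mpser_eqI: "(\<And>m. mps_nth f m = mps_nth g m) \<Longrightarrow> f = g"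
  by transfer auto

lemma finite_exponent_le:
  fixes m :: "'v \<Rightarrow>\<^sub>0 nat"
  shows "finite {a. \<exists>b. a + b = m}"
proof -
  define K where "K = Poly_Mapping.keys m"
  define B where "B = (\<Sum>k\<in>K. Poly_Mapping.lookup m k)"
  let ?F = "{f :: 'v \<Rightarrow> nat. \<forall>k. (k \<in> K \<longrightarrow> f k \<in> {..B}) \<and> (k \<notin> K \<longrightarrow> f k = 0)}"
  have K: "finite K"
    by (simp add: K_def)
  then have "finite ?F"
    by (intro finite_set_of_finite_funs) auto
  moreover have "Poly_Mapping.lookup ` {a. \<exists>b. a + b = m} \<subseteq> ?F"
  proof (rule image_subsetI, unfold mem_Collect_eq, intro allI)
    fix a k
    assume "\<exists>b. a + b = m"
    then have *: "Poly_Mapping.lookup a k \<le> Poly_Mapping.lookup m k"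
      by (metis lookup_add le_add1)
    moreover have "Poly_Mapping.lookup m k \<le> B" if "k \<in> K"
      unfolding B_def using that K by (intro member_le_sum) auto
    moreover have "Poly_Mapping.lookup m k = 0" if "k \<notin> K"
      using that by (simp add: K_def in_keys_iff)
    ultimately show "(k \<in> K \<longrightarrow> Poly_Mapping.lookup a k \<in> {..B}) \<and>
        (k \<notin> K \<longrightarrow> Poly_Mapping.lookup a k = 0)"
      by fastforce
  qed
  ultimately have "finite (Poly_Mapping.lookup ` {a. \<exists>b. a + b = m})"
    by (rule finite_subset[rotated])
  then show ?thesis
    by (rule finite_imageD) (simp add: inj_on_def poly_mapping_eqI)
qed

lemma finite_exponent_splits:
  fixes m :: "'v \<Rightarrow>\<^sub>0 nat"
  shows "finite {(a, b). a + b = m}"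
proof (rule finite_subset)
  show "{(a, b). a + b = m} \<subseteq> {a. \<exists>b. a + b = m} \<times> {b. \<exists>a. b + a = m}"
    by auto (metis add.commute)
qed (intro finite_cartesian_product finite_exponent_le)

instantiation mpser :: (type, comm_ring_1) comm_ring_1
begin

lift_definition zero_mpser :: "('a, 'b) mpser" is "\<lambda>_. 0" .
lift_definition one_mpser :: "('a, 'b) mpser" is "\<lambda>m. if m = 0 then 1 else 0" .
lift_definition plus_mpser :: "('a, 'b) mpser \<Rightarrow> ('a, 'b) mpser \<Rightarrow> ('a, 'b) mpser"
  is "\<lambda>f g m. f m + g m" .
lift_definition minus_mpser :: "('a, 'b) mpser \<Rightarrow> ('a, 'b) mpser \<Rightarrow> ('a, 'b) mpser"
  is "\<lambda>f g m. f m - g m" .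
lift_definition uminus_mpser :: "('a, 'b) mpser \<Rightarrow> ('a, 'b) mpser"
  is "\<lambda>f m. - f m" .
lift_definition times_mpser :: "('a, 'b) mpser \<Rightarrow> ('a, 'b) mpser \<Rightarrow> ('a, 'b) mpser"
  is "\<lambda>f g m. \<Sum>(a, b)\<in>{(a, b). a + b = m}. f a * g b" .

instance
proof
  fix f g h :: "('a, 'b) mpser"
  show "f * g * h = f * (g * h)"
  proof (transfer, rule ext)
    fix f g h :: "('a \<Rightarrow>\<^sub>0 nat) \<Rightarrow> 'b" and m
    let ?S = "\<lambda>m :: 'a \<Rightarrow>\<^sub>0 nat. {(a, b). a + b = m}"
    have "(\<Sum>(a, b)\<in>?S m. (\<Sum>(c, d)\<in>?S a. f c * g d) * h b) =
        (\<Sum>p\<in>?S m. \<Sum>q\<in>?S (fst p). f (fst q) * g (snd q) * h (snd p))"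
      by (simp add: sum_distrib_right case_prod_unfold)
    also have "\<dots> = (\<Sum>(p, q)\<in>(SIGMA p:?S m. ?S (fst p)). f (fst q) * g (snd q) * h (snd p))"
      by (rule sum.Sigma) (auto intro: finite_exponent_splits)
    also have "\<dots> = (\<Sum>(p, q)\<in>(SIGMA p:?S m. ?S (snd p)). f (fst p) * (g (fst q) * h (snd q)))"
      by (rule sum.reindex_bij_witness[of _
            "\<lambda>((a, b), (c, d)). ((a + c, d), (a, c))" "\<lambda>((a, b), (c, d)). ((c, d + b), (d, b))"])
         (auto simp: add.assoc mult.assoc)
    also have "\<dots> = (\<Sum>p\<in>?S m. \<Sum>q\<in>?S (snd p). f (fst p) * (g (fst q) * h (snd q)))"
      by (rule sum.Sigma[symmetric]) (auto intro: finite_exponent_splits)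
    also have "\<dots> = (\<Sum>(a, b)\<in>?S m. f a * (\<Sum>(c, d)\<in>?S b. g c * h d))"
      by (simp add: sum_distrib_left case_prod_unfold)
    finally show "(\<Sum>(a, b)\<in>?S m. (\<Sum>(c, d)\<in>?S a. f c * g d) * h b) =
        (\<Sum>(a, b)\<in>?S m. f a * (\<Sum>(c, d)\<in>?S b. g c * h d))" .
  qed
  show "f * g = g * f"
  proof (transfer, rule ext)
    fix f g :: "('a \<Rightarrow>\<^sub>0 nat) \<Rightarrow> 'b" and m
    show "(\<Sum>(a, b)\<in>{(a, b). a + b = m}. f a * g b) = (\<Sum>(a, b)\<in>{(a, b). a + b = m}. g a * f b)"
      by (rule sum.reindex_bij_witness[of _ prod.swap prod.swap]) (auto simp: add.commute mult.commute)
  qed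
  show "1 * f = f"
  proof (transfer, rule ext)
    fix f :: "('a \<Rightarrow>\<^sub>0 nat) \<Rightarrow> 'b" and m
    have "(\<Sum>(a, b)\<in>{(a, b). a + b = m}. (if a = 0 then 1 else 0) * f b) =
        (\<Sum>(a, b)\<in>{(0 :: 'a \<Rightarrow>\<^sub>0 nat, m)}. (if a = 0 then 1 else 0) * f b)"
      by (rule sum.mono_neutral_right) (auto intro: finite_exponent_splits split: if_splits)
    then show "(\<Sum>(a, b)\<in>{(a, b). a + b = m}. (if a = 0 then 1 else 0) * f b) = f m"
      by simp
  qed
  show "(f + g) * h = f * h + g * h"
    by (transfer, rule ext) (simp add: case_prod_unfold distrib_right sum.distrib)
  show "(0 :: ('a, 'b) mpser) \<noteq> 1"
    by transfer (auto simp: fun_eq_iff)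
qed (transfer, auto simp: fun_eq_iff algebra_simps)+

end

text \<open>
  The product topology of the discrete topologies on the coefficients, so that
  \<^const>\<open>HAS_SUM\<close>, \<^const>\<open>infsum\<close> and \<^const>\<open>Lim\<close> have the usual formal meaning: every
  coefficient is eventually constant.
\<close>

instantiation mpser :: (type, type) topological_space
begin

definition open_mpser :: "('a, 'b) mpser set \<Rightarrow> bool" where
  "open_mpser U \<longleftrightarrow> (\<forall>f\<in>U. \<exists>M. finite M \<and> (\<forall>g. (\<forall>m\<in>M. mps_nth g m = mps_nth f m) \<longrightarrow> g \<in> U))"

instance
proof
  show "open (UNIV :: ('a, 'b) mpser set)"
    by (auto simp: open_mpser_def)
  show "open (S \<inter> T)" if S: "open S" and T: "open T" for S T :: "('a, 'b) mpser set"
    unfolding open_mpser_def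
  proof
    fix f assume "f \<in> S \<inter> T"
    then have "f \<in> S" and "f \<in> T" by auto
    obtain M where "finite M" "\<forall>g. (\<forall>m\<in>M. mps_nth g m = mps_nth f m) \<longrightarrow> g \<in> S"
      using bspec[OF S[unfolded open_mpser_def] \<open>f \<in> S\<close>] by auto
    moreover obtain N where "finite N" "\<forall>g. (\<forall>m\<in>N. mps_nth g m = mps_nth f m) \<longrightarrow> g \<in> T"
      using bspec[OF T[unfolded open_mpser_def] \<open>f \<in> T\<close>] by auto
    ultimately show "\<exists>M. finite M \<and> (\<forall>g. (\<forall>m\<in>M. mps_nth g m = mps_nth f m) \<longrightarrow> g \<in> S \<inter> T)"
      by (intro exI[of _ "M \<union> N"]) auto
  qed
  show "open (\<Union>K)" if "\<forall>S\<in>K. open S" for K :: "('a, 'b) mpser set set"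
    using that unfolding open_mpser_def by (meson Union_iff)
qed

end

instance mpser :: (type, type) t2_space
proof
  fix f g :: "('a, 'b) mpser"
  assume "f \<noteq> g"
  then obtain m where m: "mps_nth f m \<noteq> mps_nth g m"
    using mpser_eqI by blast
  have "open {h. mps_nth h m = c}" for c :: 'b
    unfolding open_mpser_def by (auto intro!: exI[of _ "{m}"])
  with m show "\<exists>U V. open U \<and> open V \<and> f \<in> U \<and> g \<in> V \<and> U \<inter> V = {}"
    by (intro exI[of _ "{h. mps_nth h m = mps_nth f m}"] exI[of _ "{h. mps_nth h m = mps_nth g m}"]) auto
qed

lemma tendsto_mpser_iff:
  fixes f :: "('v, 'a) mpser"
  shows "(F \<longlongrightarrow> f) A \<longleftrightarrow> (\<forall>m. eventually (\<lambda>i. mps_nth (F i) m = mps_nth f m) A)"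
proof
  assume lim: "(F \<longlongrightarrow> f) A"
  show "\<forall>m. eventually (\<lambda>i. mps_nth (F i) m = mps_nth f m) A"
  proof
    fix m
    have "open {h. mps_nth h m = mps_nth f m}"
      unfolding open_mpser_def by (auto intro!: exI[of _ "{m}"])
    from topological_tendstoD[OF lim this]
    show "eventually (\<lambda>i. mps_nth (F i) m = mps_nth f m) A" by simp
  qed
next
  assume ev: "\<forall>m. eventually (\<lambda>i. mps_nth (F i) m = mps_nth f m) A"
  show "(F \<longlongrightarrow> f) A"
  proof (rule topological_tendstoI)
    fix U :: "('v, 'a) mpser set"
    assume "open U" "f \<in> U"
    then obtain M where "finite M" and M: "\<forall>g. (\<forall>m\<in>M. mps_nth g m = mps_nth f m) \<longrightarrow> g \<in> U"
      unfolding open_mpser_def by blast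
    have "eventually (\<lambda>i. \<forall>m\<in>M. mps_nth (F i) m = mps_nth f m) A"
      using \<open>finite M\<close> ev by (simp add: eventually_ball_finite)
    then show "eventually (\<lambda>i. F i \<in> U) A"
      by (rule eventually_mono) (use M in blast)
  qed
qed

text \<open>The inverse is meaningful for units only, where it is unique.\<close>

instantiation mpser :: (type, comm_ring_1) inverse
begin

definition inverse_mpser :: "('a, 'b) mpser \<Rightarrow> ('a, 'b) mpser" where
  "inverse_mpser f = (THE g. f * g = 1)"

definition divide_mpser :: "('a, 'b) mpser \<Rightarrow> ('a, 'b) mpser \<Rightarrow> ('a, 'b) mpser" where
  "divide_mpser f g = f * inverse g"

instance ..

end

lift_definition mps_const :: "'a :: zero \<Rightarrow> ('v, 'a) mpser"
  is "\<lambda>c m. if m = 0 then c else 0" .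

lift_definition mps_var :: "'v \<Rightarrow> ('v, 'a :: zero_neq_one) mpser"
  is "\<lambda>v m. if m = Poly_Mapping.single v 1 then 1 else 0" .

text \<open>
  For injective \<open>\<phi>\<close>, the series \<open>mps_rename \<phi> f\<close> is obtained from \<open>f\<close> by substituting
  the variable \<open>\<phi> v\<close> for every variable \<open>v\<close>.
\<close>

lift_definition mps_rename :: "('v \<Rightarrow> 'w) \<Rightarrow> ('v, 'a :: zero) mpser \<Rightarrow> ('w, 'a) mpser"
  is "\<lambda>\<phi> f m. if Poly_Mapping.keys m \<subseteq> range \<phi> then f (Poly_Mapping.map_key \<phi> m) else 0" .


section \<open>Series over the integer polynomials in \<open>\<beta>\<close>, in one and two alphabets\<close>

text \<open>
  Variables are numbered from 0, so index \<open>i\<close> stands for the variable with subscript \<open>i + 1\<close>.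
  In two alphabets, \<open>Inl i\<close> indexes the \<open>x\<close>-variables and \<open>Inr i\<close> the \<open>y\<close>-variables.
\<close>

type_synonym series = "(nat, int poly) mpser"
type_synonym series2 = "(nat + nat, int poly) mpser"

definition beta :: "('v, int poly) mpser" where
  "beta = mps_const [:0, 1:]"

definition in_x :: "series \<Rightarrow> series2" where
  "in_x = mps_rename Inl"

definition in_y :: "series \<Rightarrow> series2" where
  "in_y = mps_rename Inr"

text \<open>The substitution \<open>f(x\<^sub>1, y\<^sub>1, x\<^sub>2, y\<^sub>2, \<dots>)\<close>.\<close>

definition in_xy :: "series \<Rightarrow> series2" where
  "in_xy = mps_rename (\<lambda>k. if even k then Inl (k div 2) else Inr (k div 2))"

definition mps_bar :: "('v, int poly) mpser \<Rightarrow> ('v, int poly) mpser" where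
  "mps_bar x = - x / (1 + beta * x)"

definition cauchy_kernel :: series2 where
  "cauchy_kernel = Lim (finite_subsets_at_top UNIV)
     (\<lambda>I. \<Prod>(i, j)\<in>I. (1 - mps_bar (mps_var (Inl i)) * mps_var (Inr j)) /
                      (1 - mps_var (Inl i) * mps_var (Inr j)))"


section \<open>Strict partitions and shifted diagrams\<close>

definition strict_partitions :: "nat list set" where
  "strict_partitions = {lam. sorted_wrt (>) lam \<and> (\<forall>p\<in>set lam. p > 0)}"

definition shifted_diagram :: "nat list \<Rightarrow> (nat \<times> nat) set" where
  "shifted_diagram lam = {(i, i + j - 1) | i j. 1 \<le> i \<and> i \<le> length lam \<and> 1 \<le> j \<and> j \<le> lam ! (i - 1)}"

definition part_subset :: "nat list \<Rightarrow> nat list \<Rightarrow> bool" where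
  "part_subset mu lam \<longleftrightarrow> shifted_diagram mu \<subseteq> shifted_diagram lam"

definition skew_diagram :: "nat list \<Rightarrow> nat list \<Rightarrow> (nat \<times> nat) set" where
  "skew_diagram lam mu = shifted_diagram lam - shifted_diagram mu"

text \<open>
  The alphabet \<open>1' < 1 < 2' < 2 < \<dots>\<close> is encoded order-isomorphically as \<open>0 < 1 < 2 < 3 < \<dots>\<close>;
  indices are shifted by one as for the variables.
\<close>

definition primed :: "nat \<Rightarrow> nat" where
  "primed i = 2 * i"

definition unprimed :: "nat \<Rightarrow> nat" where
  "unprimed i = 2 * i + 1"


section \<open>Shifted set-valued tableaux\<close>

text \<open>Fillings are made unique by \<^const>\<open>extensional\<close>: they are undefined off the diagram.\<close>

definition set_tableaux_Q :: "nat list \<Rightarrow> (nat \<times> nat \<Rightarrow> nat set) set" where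
  "set_tableaux_Q lam = {T \<in> extensional (shifted_diagram lam).
     (\<forall>b\<in>shifted_diagram lam. finite (T b) \<and> T b \<noteq> {}) \<and>
     (\<forall>i j. (i, j) \<in> shifted_diagram lam \<and> (i + 1, j) \<in> shifted_diagram lam \<longrightarrow>
        Max (T (i, j)) \<le> Min (T (i + 1, j))) \<and>
     (\<forall>i j. (i, j) \<in> shifted_diagram lam \<and> (i, j + 1) \<in> shifted_diagram lam \<longrightarrow>
        Max (T (i, j)) \<le> Min (T (i, j + 1))) \<and>
     (\<forall>a i i' j. (i, j) \<in> shifted_diagram lam \<and> (i', j) \<in> shifted_diagram lam \<and> i \<noteq> i' \<longrightarrow>
        \<not> (unprimed a \<in> T (i, j) \<and> unprimed a \<in> T (i', j))) \<and>
     (\<forall>a i j j'. (i, j) \<in> shifted_diagram lam \<and> (i, j') \<in> shifted_diagram lam \<and> j \<noteq> j' \<longrightarrow>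
        \<not> (primed a \<in> T (i, j) \<and> primed a \<in> T (i, j')))}"

definition set_tableaux_P :: "nat list \<Rightarrow> (nat \<times> nat \<Rightarrow> nat set) set" where
  "set_tableaux_P lam = {T \<in> set_tableaux_Q lam.
     \<forall>a i. (i, i) \<in> shifted_diagram lam \<longrightarrow> primed a \<notin> T (i, i)}"

definition st_size :: "nat list \<Rightarrow> (nat \<times> nat \<Rightarrow> nat set) \<Rightarrow> nat" where
  "st_size lam T = (\<Sum>b\<in>shifted_diagram lam. card (T b))"

definition st_monomial :: "nat list \<Rightarrow> (nat \<times> nat \<Rightarrow> nat set) \<Rightarrow> series" where
  "st_monomial lam T = Prod_any (\<lambda>i. mps_var i ^
     (card {b \<in> shifted_diagram lam. unprimed i \<in> T b} + card {b \<in> shifted_diagram lam. primed i \<in> T b}))"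

text \<open>Boxes are nonempty, so \<open>|T| \<ge> |\<lambda>|\<close> and the exponent of \<open>\<beta>\<close> is never truncated.\<close>

definition GQ :: "nat list \<Rightarrow> series" where
  "GQ lam = infsum (\<lambda>T. beta ^ (st_size lam T - sum_list lam) * st_monomial lam T) (set_tableaux_Q lam)"

definition GP :: "nat list \<Rightarrow> series" where
  "GP lam = infsum (\<lambda>T. beta ^ (st_size lam T - sum_list lam) * st_monomial lam T) (set_tableaux_P lam)"


section \<open>The dual functions and their skew versions\<close>

text \<open>
  As for fillings, families indexed by strict partitions are taken in \<^const>\<open>extensional\<close>, which
  makes them unique as functions on all lists.
\<close>

definition gp :: "nat list \<Rightarrow> series" where
  "gp = (THE g. g \<in> extensional strict_partitions \<and>
     ((\<lambda>lam. in_x (GQ lam) * in_y (g lam)) has_sum cauchy_kernel) strict_partitions)"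

definition gq :: "nat list \<Rightarrow> series" where
  "gq = (THE g. g \<in> extensional strict_partitions \<and>
     ((\<lambda>lam. in_x (GP lam) * in_y (g lam)) has_sum cauchy_kernel) strict_partitions)"

definition gp_skew :: "nat list \<Rightarrow> nat list \<Rightarrow> series" where
  "gp_skew lam = (THE g. g \<in> extensional strict_partitions \<and>
     ((\<lambda>mu. in_x (gp mu) * in_y (g mu)) has_sum in_xy (gp lam)) strict_partitions)"

definition gq_skew :: "nat list \<Rightarrow> nat list \<Rightarrow> series" where
  "gq_skew lam = (THE g. g \<in> extensional strict_partitions \<and>
     ((\<lambda>mu. in_x (gq mu) * in_y (g mu)) has_sum in_xy (gq lam)) strict_partitions)"


section \<open>Shifted plane partitions\<close>

definition ShPP_Q :: "nat list \<Rightarrow> nat list \<Rightarrow> (nat \<times> nat \<Rightarrow> nat) set" where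
  "ShPP_Q lam mu = {T \<in> extensional (skew_diagram lam mu). part_subset mu lam \<and>
     (\<forall>i j j'. (i, j) \<in> skew_diagram lam mu \<and> (i, j') \<in> skew_diagram lam mu \<and> j \<le> j' \<longrightarrow>
        T (i, j) \<le> T (i, j')) \<and>
     (\<forall>i i' j. (i, j) \<in> skew_diagram lam mu \<and> (i', j) \<in> skew_diagram lam mu \<and> i \<le> i' \<longrightarrow>
        T (i, j) \<le> T (i', j))}"

definition ShPP_P :: "nat list \<Rightarrow> nat list \<Rightarrow> (nat \<times> nat \<Rightarrow> nat) set" where
  "ShPP_P lam mu = {T \<in> ShPP_Q lam mu.
     \<forall>a i. (i, i) \<in> skew_diagram lam mu \<longrightarrow> T (i, i) \<noteq> unprimed a}"

text \<open>The exponent \<open>c\<^sub>i + r\<^sub>i\<close>.\<close>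

definition wt_PP :: "nat list \<Rightarrow> nat list \<Rightarrow> (nat \<times> nat \<Rightarrow> nat) \<Rightarrow> nat \<Rightarrow> nat" where
  "wt_PP lam mu T i =
     card {c. \<exists>r. (r, c) \<in> skew_diagram lam mu \<and> T (r, c) = unprimed i} +
     card {r. \<exists>c. (r, c) \<in> skew_diagram lam mu \<and> T (r, c) = primed i}"

text \<open>Distinct columns (rows) need distinct boxes, so here too the exponent is never truncated.\<close>

definition pp_term :: "nat list \<Rightarrow> nat list \<Rightarrow> (nat \<times> nat \<Rightarrow> nat) \<Rightarrow> series" where
  "pp_term lam mu T =
     (- beta) ^ (sum_list lam - sum_list mu - Sum_any (wt_PP lam mu T)) *
     Prod_any (\<lambda>i. mps_var i ^ wt_PP lam mu T i)"

definition gp_comb :: "nat list \<Rightarrow> nat list \<Rightarrow> series" where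
  "gp_comb lam mu = infsum (pp_term lam mu) (ShPP_P lam mu)"

definition gq_comb :: "nat list \<Rightarrow> nat list \<Rightarrow> series" where
  "gq_comb lam mu = infsum (pp_term lam mu) (ShPP_Q lam mu)"

end

theory Submission
  imports Defs
begin

text \<open>
  A strict partition is identified with the set of its parts, viewed as particles on the sites
  \<open>1, 2, \<dots>\<close>. Adding a box of content \<open>c\<close> moves a particle from site \<open>c\<close> to \<open>c + 1\<close> (for \<open>c = 0\<close> it
  creates one at site 1), and a set-valued tableau in one variable becomes an ordered product of
  operators \<open>1 + x u\<^sub>c\<close>, with \<open>c\<close> first descending (primed letter) and then ascending (unprimed
  letter). A letter of a plane partition is a line operator: a boson line crosses all sites and
  carries the number of boxes of each content. The two families commute up to the factor of the Cauchy
  kernel, by a train argument: the operators \<open>1 + x u\<^sub>c\<close> transport a special site with modified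
  weights through the line, from infinity to the wall at site 0 and back. This yields the Cauchy
  identity for the plane partition generating functions. Triangularity with respect to
  semistandard shifted tableaux shows that both families of functions are linearly independent, which
  gives uniqueness of the dual functions and, because the kernel is symmetric in the variables, symmetry of
  their combinatorial versions. By symmetry the alphabets \<open>x\<close> and \<open>y\<close> may be taken consecutively
  instead of interleaved, and then the skew functions are read off from the matrix product.
\<close>

section \<open>Strict partitions as particle configurations\<close>

text \<open>A plain line does not commute with \<open>1 + x u\<^sub>c\<close>: for a column line
  with site \<open>c\<close> occupied and site \<open>c + 1\<close> empty before and after, and
  nothing on the bond to the right, one side of the relation is 1 + x y and the other is 1. Altering
  the weights of a single site absorbs the defect, provided that the alteration moves to the
  neighbouring site whenever an operator is passed. A variable runs through all contents downwards
  and then upwards, so the altered site makes a round trip; on an empty site far out it acts by a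
  scalar, and the two scalars at the ends of the trip give the kernel factor. At the wall the row
  line and the column line are handled as a pair, summed over the state between them, and each
  leaves with the weights with which the other arrived. The two uniqueness questions differ in
  nature: \<open>GQ\<close> and \<open>GP\<close> start in the degree given by the size of the
  partition, so a monomial meets finitely many of them; the dual functions end in that degree, so a
  monomial may meet infinitely many, and the powers of \<open>\<beta>\<close> have to serve as a
  second grading.\<close>

text \<open>The number of boxes of content \<open>c\<close> in the shifted diagram with parts \<open>S\<close>.\<close>

definition cnt :: "nat set \<Rightarrow> nat \<Rightarrow> nat" where
  "cnt S c = card {p \<in> S. c < p}"

text \<open>The occupation number of the line on the bond between the sites \<open>c\<close> and
  \<open>c + 1\<close>. It is an integer so that \<open>dif_rec\<close> holds without truncation;
  negative values are excluded later by zero weights.\<close>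

definition dif :: "nat set \<Rightarrow> nat set \<Rightarrow> nat \<Rightarrow> int" where
  "dif S R c = int (cnt S c) - int (cnt R c)"

lemma cnt_rec:
  assumes "finite S"
  shows "cnt S c = cnt S (Suc c) + of_bool (Suc c \<in> S)"
proof -
  have "c < p \<longleftrightarrow> Suc c < p \<or> p = Suc c" for p by arith
  then have "{p \<in> S. c < p} = {p \<in> S. Suc c < p} \<union> (if Suc c \<in> S then {Suc c} else {})"
    by auto
  then show ?thesis
    using assms by (auto simp: cnt_def)
qed

lemma dif_rec:
  assumes "finite S" "finite R"
  shows "dif S R c = dif S R (Suc c) + of_bool (Suc c \<in> S) - of_bool (Suc c \<in> R)"
  using assms by (simp add: dif_def cnt_rec[of S c] cnt_rec[of R c])

lemma cnt_eq_0: "S \<subseteq> {1..M} \<Longrightarrow> M \<le> c \<Longrightarrow> cnt S c = 0"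
proof -
  assume "S \<subseteq> {1..M}" "M \<le> c"
  then have "{p \<in> S. c < p} = {}" by force
  then show ?thesis unfolding cnt_def by (simp only: card.empty)
qed

text \<open>Index 0 is the wall and not a site: for content 0 a particle appears or disappears at
  site 1, hence the exception, and hence also the removal of 0 in \<open>rem_box\<close>.\<close>

definition removable :: "nat \<Rightarrow> nat set \<Rightarrow> bool" where
  "removable c S \<longleftrightarrow> Suc c \<in> S \<and> (c = 0 \<or> c \<notin> S)"

definition addable :: "nat \<Rightarrow> nat set \<Rightarrow> bool" where
  "addable c S \<longleftrightarrow> Suc c \<notin> S \<and> (c = 0 \<or> c \<in> S)"

definition rem_box :: "nat \<Rightarrow> nat set \<Rightarrow> nat set" where
  "rem_box c S = insert c (S - {Suc c}) - {0}"

definition add_box :: "nat \<Rightarrow> nat set \<Rightarrow> nat set" where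
  "add_box c S = insert (Suc c) (S - {c})"

text \<open>The three terms are the possible fates of a new letter in the corner of content
  \<open>c\<close>: it is absent, it joins letters already there (\<open>b * x\<close>), or it is
  the only letter of a new box.\<close>

definition box_step ::
    "'r::comm_ring_1 \<Rightarrow> 'r \<Rightarrow> nat \<Rightarrow> (nat set \<Rightarrow> 'r) \<Rightarrow> nat set \<Rightarrow> 'r" where
  "box_step b x c F S = F S + (if removable c S then b * x * F S + x * F (rem_box c S) else 0)"

definition box_step_adj ::
    "'r::comm_ring_1 \<Rightarrow> 'r \<Rightarrow> nat \<Rightarrow> (nat set \<Rightarrow> 'r) \<Rightarrow> nat set \<Rightarrow> 'r" where
  "box_step_adj b x c G S = G S + (if removable c S then b * x * G S else 0) +
     (if addable c S then x * G (add_box c S) else 0)"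

lemma rem_box_subset: "c < M \<Longrightarrow> S \<subseteq> {1..M} \<Longrightarrow> rem_box c S \<subseteq> {1..M}"
  by (auto simp: rem_box_def)

lemma add_box_subset: "c < M \<Longrightarrow> S \<subseteq> {1..M} \<Longrightarrow> add_box c S \<subseteq> {1..M}"
  by (auto simp: add_box_def)

text \<open>Summation by parts: \<open>rem_box c\<close> and \<open>add_box c\<close> are inverse
  bijections between the shapes with a removable and those with an addable corner, and
  \<open>c < M\<close> keeps both within the sites.\<close>

lemma sum_box_step:
  assumes "c < M"
  shows "(\<Sum>S\<in>Pow {1..M}. G S * box_step b x c F S) =
         (\<Sum>S\<in>Pow {1..M}. box_step_adj b x c G S * F S)"
proof -
  have *: "(\<Sum>S\<in>{S\<in>Pow {1..M}. removable c S}. x * G S * F (rem_box c S)) =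
      (\<Sum>S\<in>{S\<in>Pow {1..M}. addable c S}. x * G (add_box c S) * F S)"
    using assms
    by (intro sum.reindex_bij_witness[of _ "add_box c" "rem_box c"])
      (auto simp: removable_def addable_def rem_box_def add_box_def insert_absorb
        intro!: arg_cong2[where f = "(*)"] arg_cong[where f = G])
  have "(\<Sum>S\<in>Pow {1..M}. G S * box_step b x c F S) =
      (\<Sum>S\<in>Pow {1..M}. G S * F S + (if removable c S then b * x * G S else 0) * F S) +
      (\<Sum>S\<in>Pow {1..M}. if removable c S then x * G S * F (rem_box c S) else 0)"
    unfolding sum.distrib[symmetric]
    by (intro sum.cong refl) (auto simp: box_step_def algebra_simps)
  also have "(\<Sum>S\<in>Pow {1..M}. if removable c S then x * G S * F (rem_box c S) else 0) =
      (\<Sum>S\<in>Pow {1..M}. if addable c S then x * G (add_box c S) * F S else 0)"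
    unfolding sum.inter_filter[OF finite_Pow_iff[THEN iffD2, OF finite_atLeastAtMost], symmetric] by (fact *)
  also have "(\<Sum>S\<in>Pow {1..M}. G S * F S + (if removable c S then b * x * G S else 0) * F S) +
      (\<Sum>S\<in>Pow {1..M}. if addable c S then x * G (add_box c S) * F S else 0) =
      (\<Sum>S\<in>Pow {1..M}. box_step_adj b x c G S * F S)"
    unfolding sum.distrib[symmetric]
    by (intro sum.cong refl) (auto simp: box_step_adj_def algebra_simps)
  finally show ?thesis .
qed

section \<open>Line operators and the exchange relations\<close>

text \<open>
  The arguments of a site weight are the occupation number of the line to the right of the site
  (an integer, with weight 0 if negative) and the occupation of the site before and after.
\<close>

type_synonym 'r site_weight = "int \<Rightarrow> bool \<Rightarrow> bool \<Rightarrow> 'r"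

text \<open>\<open>S\<close> is the outer and \<open>R\<close> the inner shape of the region filled
  by one letter, so applying a line strips boxes. The factor \<open>bd\<close> weighs the boxes of
  content 0, which belong to no site.\<close>

definition line :: "nat \<Rightarrow> (nat \<Rightarrow> 'r::comm_ring_1 site_weight) \<Rightarrow> (int \<Rightarrow> 'r) \<Rightarrow>
    nat set \<Rightarrow> nat set \<Rightarrow> 'r" where
  "line M W bd R S = (\<Prod>c\<in>{1..M}. W c (dif S R c) (c \<in> S) (c \<in> R)) * bd (dif S R 0)"

definition apply_op :: "nat \<Rightarrow> (nat set \<Rightarrow> nat set \<Rightarrow> 'r::comm_ring_1) \<Rightarrow>
    (nat set \<Rightarrow> 'r) \<Rightarrow> nat set \<Rightarrow> 'r" where
  "apply_op M K F R = (\<Sum>S\<in>Pow {1..M}. K R S * F S)"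

definition site_pair :: "'r::comm_ring_1 site_weight \<Rightarrow> 'r site_weight \<Rightarrow>
    int \<Rightarrow> bool \<Rightarrow> bool \<Rightarrow> bool \<Rightarrow> bool \<Rightarrow> 'r" where
  "site_pair w1 w2 m a1 a2 b1 b2 = w2 m a2 b2 * w1 (m + of_bool a2 - of_bool b2) a1 b1"

text \<open>The local form of the commutation on two neighbouring sites: on the left the adjoint
  step acts on the outer states \<open>a1\<close>, \<open>a2\<close>, on the right the step acts on
  the inner states \<open>b1\<close>, \<open>b2\<close>. Only nonnegative occupations of the two
  outer bonds are required, because otherwise both sides of the global relation vanish.\<close>

definition exchanges :: "'r::comm_ring_1 \<Rightarrow> 'r \<Rightarrow> 'r site_weight \<Rightarrow> 'r site_weight \<Rightarrow>
    'r site_weight \<Rightarrow> 'r site_weight \<Rightarrow> bool" where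
  "exchanges b x w1 w2 w1' w2' \<longleftrightarrow> (\<forall>m a1 a2 b1 b2.
     0 \<le> m \<longrightarrow> 0 \<le> m + of_bool a1 + of_bool a2 - of_bool b1 - of_bool b2 \<longrightarrow>
     site_pair w1 w2 m a1 a2 b1 b2 +
       (if a2 \<and> \<not> a1 then b * x * site_pair w1 w2 m a1 a2 b1 b2 else 0) +
       (if a1 \<and> \<not> a2 then x * site_pair w1 w2 m False True b1 b2 else 0) =
     site_pair w1' w2' m a1 a2 b1 b2 +
       (if b2 \<and> \<not> b1 then b * x * site_pair w1' w2' m a1 a2 b1 b2 +
          x * site_pair w1' w2' m a1 a2 True False else 0))"

lemma cnt_add_box:
  assumes "finite S" "addable c S" "d \<noteq> c" "c \<noteq> 0"
  shows "cnt (add_box c S) d = cnt S d"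
proof (cases "d < c")
  case True
  have "{p \<in> add_box c S. d < p} = insert (Suc c) ({p \<in> S. d < p} - {c})"
    using True by (auto simp: add_box_def)
  moreover have "c \<in> {p \<in> S. d < p}" "Suc c \<notin> {p \<in> S. d < p}"
    using assms True by (auto simp: addable_def)
  ultimately show ?thesis
    using assms(1) card_Suc_Diff1[of "{p \<in> S. d < p}" c]
    by (simp add: cnt_def del: mem_Collect_eq card_Diff_insert)
next
  case False
  with assms have "{p \<in> add_box c S. d < p} = {p \<in> S. d < p}"
    by (auto simp: add_box_def)
  then show ?thesis by (simp add: cnt_def)
qed

lemma cnt_rem_box:
  assumes "finite S" "removable c S" "d \<noteq> c" "c \<noteq> 0" "0 \<notin> S"
  shows "cnt (rem_box c S) d = cnt S d"
proof -
  have "add_box c (rem_box c S) = S" "addable c (rem_box c S)" "finite (rem_box c S)"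
    using assms by (auto simp: rem_box_def add_box_def addable_def removable_def)
  then show ?thesis using cnt_add_box[of "rem_box c S" c d] assms by simp
qed

text \<open>Moving a box of content \<open>c\<close> changes only the sites \<open>c\<close>,
  \<open>c + 1\<close> and the bond between them. All other factors form the common factor
  \<open>rest\<close>, so the local relation suffices.\<close>

lemma line_exchange:
  fixes W W' :: "nat \<Rightarrow> 'r::comm_ring_1 site_weight"
  assumes c: "1 \<le> c" "Suc c \<le> M" and SR: "S \<subseteq> {1..M}" "R \<subseteq> {1..M}"
    and ex: "exchanges b x (W c) (W (Suc c)) (W' c) (W' (Suc c))"
    and W': "\<And>d. d \<noteq> c \<Longrightarrow> d \<noteq> Suc c \<Longrightarrow> W' d = W d"
    and neg: "\<And>d m a b. m < 0 \<Longrightarrow> W d m a b = 0" "\<And>d m a b. m < 0 \<Longrightarrow> W' d m a b = 0"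
    and bd: "\<And>m. m < 0 \<Longrightarrow> bd m = 0"
  shows "box_step_adj b x c (line M W bd R) S = box_step b x c (\<lambda>R. line M W' bd R S) R"
proof -
  define rest where "rest R S = (\<Prod>d\<in>{1..M} - {c, Suc c}. W d (dif S R d) (d \<in> S) (d \<in> R)) *
    bd (dif S R 0)" for R S
  have fin: "finite S" "finite R"
    using SR by (auto intro: finite_subset)
  have split: "{1..M} = insert c (insert (Suc c) ({1..M} - {c, Suc c}))"
    using c by auto
  have line_W: "line M V bd R S =
      site_pair (V c) (V (Suc c)) (dif S R (Suc c)) (c \<in> S) (Suc c \<in> S) (c \<in> R) (Suc c \<in> R) * rest R S"
    if "S \<subseteq> {1..M}" "R \<subseteq> {1..M}" "\<And>d. d \<noteq> c \<Longrightarrow> d \<noteq> Suc c \<Longrightarrow> V d = W d" for V S R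
  proof -
    have "finite S" "finite R" using that by (auto intro: finite_subset)
    then have "dif S R c = dif S R (Suc c) + of_bool (Suc c \<in> S) - of_bool (Suc c \<in> R)"
      by (rule dif_rec)
    moreover have "(\<Prod>d\<in>{1..M} - {c, Suc c}. V d (dif S R d) (d \<in> S) (d \<in> R)) =
        (\<Prod>d\<in>{1..M} - {c, Suc c}. W d (dif S R d) (d \<in> S) (d \<in> R))"
      using that by (intro prod.cong) auto
    ultimately show ?thesis
      unfolding line_def rest_def site_pair_def
      by (subst split) (simp add: mult_ac)
  qed
  have restS: "rest R (add_box c S) = rest R S" if "addable c S"
  proof -
    have "dif (add_box c S) R d = dif S R d" if "d \<noteq> c" for d
      using cnt_add_box[OF fin(1) \<open>addable c S\<close> that] c by (simp add: dif_def)
    moreover have "d \<in> add_box c S \<longleftrightarrow> d \<in> S" if "d \<noteq> c" "d \<noteq> Suc c" for d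
      using that by (auto simp: add_box_def)
    ultimately show ?thesis
      using c unfolding rest_def by (intro arg_cong2[where f = "(*)"] prod.cong) auto
  qed
  have restR: "rest (rem_box c R) S = rest R S" if "removable c R"
  proof -
    have "0 \<notin> R" using SR by auto
    then have "dif S (rem_box c R) d = dif S R d" if "d \<noteq> c" for d
      using cnt_rem_box[OF fin(2) \<open>removable c R\<close> that] c by (simp add: dif_def)
    moreover have "d \<in> rem_box c R \<longleftrightarrow> d \<in> R" if "d \<noteq> c" "d \<noteq> Suc c" "d \<noteq> 0" for d
      using that by (auto simp: rem_box_def)
    ultimately show ?thesis
      using c unfolding rest_def by (intro arg_cong2[where f = "(*)"] prod.cong) auto
  qed
  let ?m = "dif S R (Suc c)" and ?m' = "dif S R (c - 1)"
  have m': "?m' = ?m + of_bool (c \<in> S) + of_bool (Suc c \<in> S) - of_bool (c \<in> R) - of_bool (Suc c \<in> R)"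
    using dif_rec[OF fin, of "c - 1"] dif_rec[OF fin, of c] c by simp
  let ?p = "\<lambda>V::nat \<Rightarrow> 'r site_weight. site_pair (V c) (V (Suc c)) ?m"
  have l1: "line M W bd R S = ?p W (c \<in> S) (Suc c \<in> S) (c \<in> R) (Suc c \<in> R) * rest R S"
    using line_W[OF SR] by blast
  have l2: "line M W' bd R S = ?p W' (c \<in> S) (Suc c \<in> S) (c \<in> R) (Suc c \<in> R) * rest R S"
    using line_W[OF SR] W' by blast
  have l3: "line M W bd R (add_box c S) = ?p W False True (c \<in> R) (Suc c \<in> R) * rest R S"
    if "addable c S"
  proof -
    have "dif (add_box c S) R (Suc c) = ?m"
      using cnt_add_box[OF fin(1) that, of "Suc c"] c by (simp add: dif_def)
    moreover have "c \<notin> add_box c S" "Suc c \<in> add_box c S"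
      by (auto simp: add_box_def)
    ultimately show ?thesis
      using line_W[OF _ SR(2), of "add_box c S" W] add_box_subset[OF _ SR(1), of c] c restS[OF that] by simp
  qed
  have l4: "line M W' bd (rem_box c R) S = ?p W' (c \<in> S) (Suc c \<in> S) True False * rest R S"
    if "removable c R"
  proof -
    have "0 \<notin> R" using SR by auto
    then have "dif S (rem_box c R) (Suc c) = ?m"
      using cnt_rem_box[OF fin(2) that, of "Suc c"] c by (simp add: dif_def)
    moreover have "c \<in> rem_box c R" "Suc c \<notin> rem_box c R"
      using c by (auto simp: rem_box_def)
    ultimately show ?thesis
      using line_W[OF SR(1), of "rem_box c R" W'] W' rem_box_subset[OF _ SR(2), of c] c restR[OF that] by simp
  qed
  have rem: "removable c U \<longleftrightarrow> Suc c \<in> U \<and> c \<notin> U" and add: "addable c U \<longleftrightarrow> c \<in> U \<and> Suc c \<notin> U" for U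
    using c by (auto simp: removable_def addable_def)
  \<comment> \<open>\<open>?m\<close> and \<open>?m'\<close> are the occupations of the bonds
    enclosing the two sites. A negative one annihilates both sides, through a site weight or, to the
    left of site 1, through \<open>bd\<close>; otherwise the local relation applies.\<close>
  consider "?m < 0" | "?m' < 0" | "0 \<le> ?m" "0 \<le> ?m'" by linarith
  then show ?thesis
  proof cases
    case 1
    then have "?p W a1 a2 b1 b2 = 0" "?p W' a1 a2 b1 b2 = 0" for a1 a2 b1 b2
      using neg by (auto simp: site_pair_def)
    then have "line M W bd R S = 0" "line M W' bd R S = 0"
        "addable c S \<Longrightarrow> line M W bd R (add_box c S) = 0"
        "removable c R \<Longrightarrow> line M W' bd (rem_box c R) S = 0"
      unfolding l1 l2 by (simp_all add: l3 l4)
    then show ?thesis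
      by (simp add: box_step_def box_step_adj_def)
  next
    case 2
    have "rest R S = 0"
    proof (cases "c = 1")
      case True
      then show ?thesis using 2 bd by (simp add: rest_def)
    next
      case False
      then have "c - 1 \<in> {1..M} - {c, Suc c}" using c by auto
      moreover have "W (c - 1) (dif S R (c - 1)) (c - 1 \<in> S) (c - 1 \<in> R) = 0"
        using neg 2 by blast
      ultimately have "(\<Prod>d\<in>{1..M} - {c, Suc c}. W d (dif S R d) (d \<in> S) (d \<in> R)) = 0"
        by (intro prod_zero) auto
      then show ?thesis by (simp add: rest_def)
    qed
    then have "line M W bd R S = 0" "line M W' bd R S = 0"
        "addable c S \<Longrightarrow> line M W bd R (add_box c S) = 0"
        "removable c R \<Longrightarrow> line M W' bd (rem_box c R) S = 0"
      unfolding l1 l2 by (simp_all add: l3 l4)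
    then show ?thesis
      by (simp add: box_step_def box_step_adj_def)
  next
    case 3
    have e: "?p W a1 a2 b1 b2 +
       (if a2 \<and> \<not> a1 then b * x * ?p W a1 a2 b1 b2 else 0) +
       (if a1 \<and> \<not> a2 then x * ?p W False True b1 b2 else 0) =
     ?p W' a1 a2 b1 b2 +
       (if b2 \<and> \<not> b1 then b * x * ?p W' a1 a2 b1 b2 + x * ?p W' a1 a2 True False else 0)"
      if "a1 = (c \<in> S)" "a2 = (Suc c \<in> S)" "b1 = (c \<in> R)" "b2 = (Suc c \<in> R)" for a1 a2 b1 b2
    proof (rule ex[unfolded exchanges_def, rule_format])
      show "0 \<le> ?m" by (fact 3)
      show "0 \<le> ?m + of_bool a1 + of_bool a2 - of_bool b1 - of_bool b2"
        using 3(2) unfolding m' that .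
    qed
    have "box_step_adj b x c (line M W bd R) S =
      (?p W (c \<in> S) (Suc c \<in> S) (c \<in> R) (Suc c \<in> R) +
       (if Suc c \<in> S \<and> c \<notin> S then b * x * ?p W (c \<in> S) (Suc c \<in> S) (c \<in> R) (Suc c \<in> R) else 0) +
       (if c \<in> S \<and> Suc c \<notin> S then x * ?p W False True (c \<in> R) (Suc c \<in> R) else 0)) * rest R S"
    proof (cases "addable c S")
      case True
      then show ?thesis
        unfolding box_step_adj_def l1 l3[OF True] by (auto simp: rem add distrib_right mult.assoc)
    next
      case False
      then show ?thesis
        unfolding box_step_adj_def l1 by (auto simp: rem add distrib_right mult.assoc)
    qed
    also have "\<dots> = (?p W' (c \<in> S) (Suc c \<in> S) (c \<in> R) (Suc c \<in> R) +
       (if Suc c \<in> R \<and> c \<notin> R then b * x * ?p W' (c \<in> S) (Suc c \<in> S) (c \<in> R) (Suc c \<in> R)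
         + x * ?p W' (c \<in> S) (Suc c \<in> S) True False else 0)) * rest R S"
      using e[OF refl refl refl refl] by (rule arg_cong)
    also have "\<dots> = box_step b x c (\<lambda>R. line M W' bd R S) R"
    proof (cases "removable c R")
      case True
      then show ?thesis
        unfolding box_step_def l2 l4[OF True] by (auto simp: rem distrib_right mult.assoc)
    next
      case False
      then show ?thesis
        unfolding box_step_def l2 by (auto simp: rem)
    qed
    finally show ?thesis .
  qed
qed

text \<open>The step is moved from \<open>F\<close> to the kernel with the adjoint, exchanged there,
  and pulled out of the sum as an operator on \<open>R\<close>.\<close>

lemma apply_op_exchange:
  fixes W W' :: "nat \<Rightarrow> 'r::comm_ring_1 site_weight"
  assumes c: "1 \<le> c" "Suc c \<le> M" and R: "R \<subseteq> {1..M}"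
    and ex: "exchanges b x (W c) (W (Suc c)) (W' c) (W' (Suc c))"
    and W': "\<And>d. d \<noteq> c \<Longrightarrow> d \<noteq> Suc c \<Longrightarrow> W' d = W d"
    and neg: "\<And>d m a b. m < 0 \<Longrightarrow> W d m a b = 0" "\<And>d m a b. m < 0 \<Longrightarrow> W' d m a b = 0"
    and bd: "\<And>m. m < 0 \<Longrightarrow> bd m = 0"
  shows "apply_op M (line M W bd) (box_step b x c F) R =
         box_step b x c (apply_op M (line M W' bd) F) R"
proof -
  have "apply_op M (line M W bd) (box_step b x c F) R =
      (\<Sum>S\<in>Pow {1..M}. box_step b x c (\<lambda>R. line M W' bd R S) R * F S)"
    unfolding apply_op_def using c
    by (subst sum_box_step) (auto intro!: sum.cong simp: line_exchange[OF c _ R ex W' neg bd])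
  also have "\<dots> = box_step b x c (apply_op M (line M W' bd) F) R"
    by (auto simp: box_step_def apply_op_def sum.distrib sum_distrib_left algebra_simps)
  finally show ?thesis .
qed

text \<open>
  \<open>col_weight\<close> counts the columns and \<open>row_weight\<close> the rows of the boxes occupied by one letter; the
  parameters \<open>(1, 1, 1)\<close> are those of an ordinary site.
\<close>

definition line_factor :: "'r \<times> 'r \<times> 'r \<Rightarrow> 'r \<Rightarrow> 'r \<Rightarrow> bool \<Rightarrow> nat \<Rightarrow> 'r::comm_ring_1" where
  "line_factor p y t s n = (case p of (al, de, ep) \<Rightarrow>
     if s then al * t ^ n else if n = 0 then de else ep * y * t ^ (n - 1))"

definition col_weight :: "'r \<times> 'r \<times> 'r \<Rightarrow> 'r \<Rightarrow> 'r \<Rightarrow> 'r::comm_ring_1 site_weight" where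
  "col_weight p y t m a b = (if m < 0 then 0 else line_factor p y t a (nat m))"

definition row_weight :: "'r \<times> 'r \<times> 'r \<Rightarrow> 'r \<Rightarrow> 'r \<Rightarrow> 'r::comm_ring_1 site_weight" where
  "row_weight p y t m a b = (if m < 0 then 0 else line_factor p y t (\<not> a) (nat (m + of_bool a - of_bool b)))"

text \<open>\<open>line_factor\<close> is exceptional at occupation 0 and contains
  \<open>n - 1\<close>, so the relations below are checked for 0, for 1 and for the generic value
  \<open>k + 2\<close>.\<close>

lemma int_cases3:
  assumes "(0::int) \<le> m"
  obtains "m = 0" | "m = 1" | k where "m = int k + 2"
proof -
  consider "m = 0" | "m = 1" | "m = int (nat (m - 2)) + 2" using assms by linarith
  then show ?thesis using that by cases blast+
qed

lemma nat_shift: "nat (int k + 2) = Suc (Suc k)" "nat (int k + 1) = Suc k" "nat (int k + 3) = Suc (Suc (Suc k))"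
  "nat (2 + int k) = Suc (Suc k)" "nat (1 + int k) = Suc k" "nat (3 + int k) = Suc (Suc (Suc k))"
  "nat (4 + int k) = Suc (Suc (Suc (Suc k)))" "nat (int k + 4) = Suc (Suc (Suc (Suc k)))"
  by auto

text \<open>
  The weights of the special site on its way towards the wall and back, obtained by solving the
  exchange relations; here \<open>t = - \<beta>\<close>. The ratio of the vacuum weights
  \<open>1 - t x + x y\<close> and \<open>(1 - t x) (1 - x y)\<close> is the factor of the Cauchy kernel.
\<close>

abbreviation (input) "in_C x y t \<equiv> (1 - t * x, 1 - t * x + x * y, 1)"
abbreviation (input) "in_R x y t \<equiv> (1, 1 - x * y, 1 - t * x)"
abbreviation (input) "out_C x y t \<equiv> (1, 1 - x * y, 1 - t * x)"
abbreviation (input) "out_R x y t \<equiv> (1 - t * x, 1 - t * x + x * y, 1)"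

context
  fixes x y t :: "'r::comm_ring_1"
begin

lemma exchanges_nneg:
  assumes "\<And>a1 a2 b1 b2. 0 \<le> of_bool a1 + of_bool a2 - of_bool b1 - (of_bool b2 :: int) \<Longrightarrow> P 0 a1 a2 b1 b2"
   and "\<And>a1 a2 b1 b2. 0 \<le> 1 + of_bool a1 + of_bool a2 - of_bool b1 - (of_bool b2 :: int) \<Longrightarrow> P 1 a1 a2 b1 b2"
   and "\<And>k a1 a2 b1 b2. P (int k + 2) a1 a2 b1 b2"
  shows "\<forall>m a1 a2 b1 b2.
     0 \<le> m \<longrightarrow> 0 \<le> m + of_bool a1 + of_bool a2 - of_bool b1 - of_bool b2 \<longrightarrow> P m a1 a2 b1 b2"
proof (intro allI impI)
  fix m :: int and a1 a2 b1 b2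
  assume m: "0 \<le> m" and *: "0 \<le> m + of_bool a1 + of_bool a2 - of_bool b1 - of_bool b2"
  from m show "P m a1 a2 b1 b2"
    by (cases rule: int_cases3) (use assms * in auto)
qed

text \<open>A finite check: for each kind of occupation there are sixteen states, each giving an
  identity of polynomials in \<open>x\<close>, \<open>y\<close>, \<open>t\<close> and, in the
  generic case, \<open>t ^ k\<close>. The same holds for the three relations after it.\<close>

lemma exchanges_C_in: "exchanges (-t) x (col_weight (in_C x y t) y t) (col_weight (1, 1, 1) y t) (col_weight (1, 1, 1) y t) (col_weight (in_C x y t) y t)"
  unfolding exchanges_def
proof (rule exchanges_nneg, goal_cases)
  case (1 a1 a2 b1 b2)
  then show ?case
    by (cases a1; cases a2; cases b1; cases b2;
       simp add: site_pair_def col_weight_def line_factor_def nat_shift;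
       simp add: algebra_simps power2_eq_square power3_eq_cube)
next
  case (2 a1 a2 b1 b2)
  then show ?case
    by (cases a1; cases a2; cases b1; cases b2;
       simp add: site_pair_def col_weight_def line_factor_def nat_shift;
       simp add: algebra_simps power2_eq_square power3_eq_cube)
next
  case (3 k a1 a2 b1 b2)
  then show ?case
    by (cases a1; cases a2; cases b1; cases b2;
       simp add: site_pair_def col_weight_def line_factor_def nat_shift;
       simp add: algebra_simps power2_eq_square power3_eq_cube)
qed

lemma exchanges_C_out: "exchanges (-t) x (col_weight (1, 1, 1) y t) (col_weight (out_C x y t) y t) (col_weight (out_C x y t) y t) (col_weight (1, 1, 1) y t)"
  unfolding exchanges_def
proof (rule exchanges_nneg, goal_cases)
  case (1 a1 a2 b1 b2)
  then show ?case
    by (cases a1; cases a2; cases b1; cases b2;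
       simp add: site_pair_def col_weight_def line_factor_def nat_shift;
       simp add: algebra_simps power2_eq_square power3_eq_cube)
next
  case (2 a1 a2 b1 b2)
  then show ?case
    by (cases a1; cases a2; cases b1; cases b2;
       simp add: site_pair_def col_weight_def line_factor_def nat_shift;
       simp add: algebra_simps power2_eq_square power3_eq_cube)
next
  case (3 k a1 a2 b1 b2)
  then show ?case
    by (cases a1; cases a2; cases b1; cases b2;
       simp add: site_pair_def col_weight_def line_factor_def nat_shift;
       simp add: algebra_simps power2_eq_square power3_eq_cube)
qed

lemma exchanges_R_in: "exchanges (-t) x (row_weight (in_R x y t) y t) (row_weight (1, 1, 1) y t) (row_weight (1, 1, 1) y t) (row_weight (in_R x y t) y t)"
  unfolding exchanges_def
proof (rule exchanges_nneg, goal_cases)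
  case (1 a1 a2 b1 b2)
  then show ?case
    by (cases a1; cases a2; cases b1; cases b2;
       simp add: site_pair_def row_weight_def line_factor_def nat_shift;
       simp add: algebra_simps power2_eq_square power3_eq_cube)
next
  case (2 a1 a2 b1 b2)
  then show ?case
    by (cases a1; cases a2; cases b1; cases b2;
       simp add: site_pair_def row_weight_def line_factor_def nat_shift;
       simp add: algebra_simps power2_eq_square power3_eq_cube)
next
  case (3 k a1 a2 b1 b2)
  then show ?case
    by (cases a1; cases a2; cases b1; cases b2;
       simp add: site_pair_def row_weight_def line_factor_def nat_shift;
       simp add: algebra_simps power2_eq_square power3_eq_cube)
qed

lemma exchanges_R_out: "exchanges (-t) x (row_weight (1, 1, 1) y t) (row_weight (out_R x y t) y t) (row_weight (out_R x y t) y t) (row_weight (1, 1, 1) y t)"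
  unfolding exchanges_def
proof (rule exchanges_nneg, goal_cases)
  case (1 a1 a2 b1 b2)
  then show ?case
    by (cases a1; cases a2; cases b1; cases b2;
       simp add: site_pair_def row_weight_def line_factor_def nat_shift;
       simp add: algebra_simps power2_eq_square power3_eq_cube)
next
  case (2 a1 a2 b1 b2)
  then show ?case
    by (cases a1; cases a2; cases b1; cases b2;
       simp add: site_pair_def row_weight_def line_factor_def nat_shift;
       simp add: algebra_simps power2_eq_square power3_eq_cube)
next
  case (3 k a1 a2 b1 b2)
  then show ?case
    by (cases a1; cases a2; cases b1; cases b2;
       simp add: site_pair_def row_weight_def line_factor_def nat_shift;
       simp add: algebra_simps power2_eq_square power3_eq_cube)
qed


end

section \<open>Reflection at the wall\<close>

text \<open>
  Throughout, \<open>pm = True\<close> refers to the pair \<open>GQ\<close>, \<open>gp\<close> and \<open>pm = False\<close> to the pair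
  \<open>GP\<close>, \<open>gq\<close>: a primed letter may add diagonal boxes only in the first case, and an unprimed
  letter of a plane partition only in the second.
\<close>

definition bd_R :: "int \<Rightarrow> 'r::comm_ring_1" where
  "bd_R m = (if m < 0 then 0 else 1)"

text \<open>Diagonal boxes lie in distinct columns and each is the lowest box of its column, whence
  \<open>y ^ m\<close>; for \<open>pm\<close> an unprimed letter may not occupy the diagonal at all.
  Rows are counted at their right ends, so \<open>bd_R\<close> only rules out negative
  occupations.\<close>

definition bd_C :: "bool \<Rightarrow> 'r::comm_ring_1 \<Rightarrow> int \<Rightarrow> 'r" where
  "bd_C pm y m = (if pm then (if m = 0 then 1 else 0) else if m < 0 then 0 else y ^ nat m)"

definition line_C :: "nat \<Rightarrow> bool \<Rightarrow> nat \<Rightarrow> 'r \<times> 'r \<times> 'r \<Rightarrow> 'r \<Rightarrow> 'r \<Rightarrow>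
    nat set \<Rightarrow> nat set \<Rightarrow> 'r::comm_ring_1" where
  "line_C M pm s p y t = line M (\<lambda>c. if c = s then col_weight p y t else col_weight (1, 1, 1) y t) (bd_C pm y)"

definition line_R :: "nat \<Rightarrow> nat \<Rightarrow> 'r \<times> 'r \<times> 'r \<Rightarrow> 'r \<Rightarrow> 'r \<Rightarrow>
    nat set \<Rightarrow> nat set \<Rightarrow> 'r::comm_ring_1" where
  "line_R M s p y t = line M (\<lambda>c. if c = s then row_weight p y t else row_weight (1, 1, 1) y t) bd_R"

definition vstep :: "'r::comm_ring_1 \<Rightarrow> 'r \<Rightarrow> (nat set \<Rightarrow> 'r) \<Rightarrow> nat set \<Rightarrow> 'r" where
  "vstep q z F S = (if 1 \<in> S then q * F S + z * F (S - {1}) else F S)"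

definition vadj :: "'r::comm_ring_1 \<Rightarrow> 'r \<Rightarrow> (nat set \<Rightarrow> 'r) \<Rightarrow> nat set \<Rightarrow> 'r" where
  "vadj q z G S = (if 1 \<in> S then q * G S else G S + z * G (insert 1 S))"

definition bd_step :: "bool \<Rightarrow> 'r::comm_ring_1 \<Rightarrow> 'r \<Rightarrow> (nat set \<Rightarrow> 'r) \<Rightarrow> nat set \<Rightarrow> 'r" where
  "bd_step pm b x F = (if pm then box_step b x 0 (box_step b x 0 F) else box_step b x 0 F)"

lemma box_step_0: "0 \<notin> S \<Longrightarrow> box_step b x 0 F S = vstep (1 + b * x) x F S"
  by (auto simp: box_step_def vstep_def removable_def rem_box_def algebra_simps)

text \<open>Two diagonal steps have the form of one with other coefficients, because a shape whose
  diagonal corner has been removed has no further one and is fixed by the second step.\<close>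

lemma bd_step_eq:
  assumes "0 \<notin> S"
  shows "bd_step pm b x F S =
    vstep (if pm then (1 + b * x) * (1 + b * x) else 1 + b * x) (if pm then x + (1 + b * x) * x else x) F S"
proof -
  have "box_step b x 0 F (S - {1}) = F (S - {1})"
    by (simp add: box_step_def removable_def)
  then show ?thesis
    using assms box_step_0[OF assms, of b x F] box_step_0[OF assms, of b x "box_step b x 0 F"]
    by (auto simp: bd_step_def vstep_def algebra_simps)
qed

lemma sum_Pow_1:
  fixes M :: nat
  assumes "1 \<le> M"
  shows "(\<Sum>S\<in>Pow {1..M}. f S) = (\<Sum>S\<in>Pow {2..M}. f S + f (insert 1 S))"
proof -
  have "{1..M} = insert 1 {2..M}" using assms by auto
  then have "(\<Sum>S\<in>Pow {1..M}. f S) = (\<Sum>S\<in>Pow {2..M} \<union> insert 1 ` Pow {2..M}. f S)"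
    by (simp only: Pow_insert)
  also have "\<dots> = (\<Sum>S\<in>Pow {2..M}. f S) + (\<Sum>S\<in>insert 1 ` Pow {2..M}. f S)"
    by (rule sum.union_disjoint) auto
  also have "(\<Sum>S\<in>insert 1 ` Pow {2..M}. f S) = (\<Sum>S\<in>Pow {2..M}. f (insert 1 S))"
  proof (subst sum.reindex)
    have "1 \<notin> (S::nat set)" if "S \<in> Pow {2..M}" for S using that by auto
    then show "inj_on (insert 1) (Pow {2..M})"
      by (intro inj_onI) (metis insert_ident)
  qed simp
  finally show ?thesis by (simp add: sum.distrib)
qed

lemma sum_vstep:
  assumes "1 \<le> M"
  shows "(\<Sum>S\<in>Pow {1..M}. G S * vstep q z F S) = (\<Sum>S\<in>Pow {1..M}. vadj q z G S * F S)"
  unfolding sum_Pow_1[OF assms]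
proof (intro sum.cong refl)
  fix S assume "S \<in> Pow {2..M}"
  then have "1 \<notin> S" by auto
  then show "G S * vstep q z F S + G (insert 1 S) * vstep q z F (insert 1 S) =
      vadj q z G S * F S + vadj q z G (insert 1 S) * F (insert 1 S)"
    by (simp add: vstep_def vadj_def algebra_simps)
qed

lemma sum_vstep_mult: "(\<Sum>S\<in>A. vstep q z (\<lambda>R. H R S) R * F S) = vstep q z (\<lambda>R. \<Sum>S\<in>A. H R S * F S) R"
  by (auto simp: vstep_def sum.distrib sum_distrib_left algebra_simps)

text \<open>Isolates the site next to the wall: the occupations of the bonds from 1 on do not see
  the particle at site 1.\<close>

lemma line_split_1:
  fixes W :: "nat \<Rightarrow> 'r::comm_ring_1 site_weight"
  assumes "1 \<le> M" "S \<subseteq> {1..M}" "R \<subseteq> {1..M}"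
  shows "line M W bd R S =
    (\<Prod>c\<in>{2..M}. W c (dif (S - {1}) (R - {1}) c) (c \<in> S - {1}) (c \<in> R - {1})) *
    (W 1 (dif (S - {1}) (R - {1}) 1) (1 \<in> S) (1 \<in> R) *
     bd (dif (S - {1}) (R - {1}) 1 + of_bool (1 \<in> S) - of_bool (1 \<in> R)))"
proof -
  have "cnt (U - {1}) c = cnt U c" if "1 \<le> c" for U c
    using that unfolding cnt_def by (intro arg_cong[where f = card]) auto
  then have d: "dif (S - {1}) (R - {1}) c = dif S R c" if "1 \<le> c" for c
    using that by (simp add: dif_def)
  have "finite S" "finite R" using assms by (auto intro: finite_subset)
  from dif_rec[OF this, of 0] have d0: "dif S R 0 = dif S R 1 + of_bool (1 \<in> S) - of_bool (1 \<in> R)"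
    by simp
  have e: "{1..M} = insert 1 {2..M}" using assms by auto
  have "line M W bd R S = (\<Prod>c\<in>{2..M}. W c (dif S R c) (c \<in> S) (c \<in> R)) *
      (W 1 (dif S R 1) (1 \<in> S) (1 \<in> R) * bd (dif S R 1 + of_bool (1 \<in> S) - of_bool (1 \<in> R)))"
    unfolding line_def d0 e by (subst prod.insert) (simp_all add: mult_ac)
  also have "(\<Prod>c\<in>{2..M}. W c (dif S R c) (c \<in> S) (c \<in> R)) =
     (\<Prod>c\<in>{2..M}. W c (dif (S - {1}) (R - {1}) c) (c \<in> S - {1}) (c \<in> R - {1}))"
    by (intro prod.cong) (auto simp: d[unfolded One_nat_def])
  finally show ?thesis unfolding d[OF order.refl] .
qed

text \<open>Weight of a row line composed with a column line at site 1 and the wall, for given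
  occupations of the bonds to the right of that site; the two terms are the states of site 1 in the
  shape between the lines.\<close>

definition bd_pair :: "bool \<Rightarrow> 'r \<Rightarrow> 'r site_weight \<Rightarrow> 'r site_weight \<Rightarrow> int \<Rightarrow> int \<Rightarrow>
    bool \<Rightarrow> bool \<Rightarrow> 'r::comm_ring_1" where
  "bd_pair pm y rw cw mR mC a b =
     rw mR False b * bd_R (mR - of_bool b) * (cw mC a False * bd_C pm y (mC + of_bool a)) +
     rw mR True b * bd_R (mR + 1 - of_bool b) * (cw mC a True * bd_C pm y (mC + of_bool a - 1))"

context
  fixes x y t :: "'r::comm_ring_1"
begin

text \<open>The reflection relation, again checked on the occupations 0, 1 and \<open>k + 2\<close>
  of both bonds. Both values of \<open>pm\<close> are covered, since the number of diagonal steps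
  and the wall weight of the column line change together.\<close>

lemma boundary_local:
  fixes pm :: bool
  defines "q \<equiv> (if pm then (1 - t * x) * (1 - t * x) else 1 - t * x)"
    and "z \<equiv> (if pm then x + (1 - t * x) * x else x)"
    and "X \<equiv> bd_pair pm y (row_weight (in_R x y t) y t) (col_weight (in_C x y t) y t)"
    and "X' \<equiv> bd_pair pm y (row_weight (out_R x y t) y t) (col_weight (out_C x y t) y t)"
  shows "(if a then q * X' mR mC a b else X' mR mC a b + z * X' mR mC True b) =
         (if b then q * X mR mC a b + z * X mR mC a False else X mR mC a b)"
proof -
  consider "mR < 0" | "mC < 0" | "0 \<le> mR" "0 \<le> mC" by linarith
  then show ?thesis
  proof cases
    case 3
    have "mR = 0 \<or> mR = 1 \<or> (\<exists>k. mR = int k + 2)" "mC = 0 \<or> mC = 1 \<or> (\<exists>k. mC = int k + 2)"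
      using 3 int_cases3 by metis+
    then show ?thesis
      by (elim disjE exE; cases a; cases b; cases pm;
        simp add: X_def X'_def q_def z_def bd_pair_def row_weight_def col_weight_def line_factor_def bd_R_def bd_C_def nat_shift;
        simp add: algebra_simps power2_eq_square power3_eq_cube)
  qed (auto simp: X_def X'_def q_def z_def bd_pair_def row_weight_def col_weight_def)
qed

text \<open>A diagonal step does not affect the sites from 2 on. For each intermediate shape
  \<open>K\<close> on those sites they contribute the common factor \<open>PR K R * PC K S\<close>,
  and \<open>boundary_local\<close> settles site 1.\<close>

lemma boundary_kernel:
  fixes pm :: bool
  defines "q \<equiv> (if pm then (1 - t * x) * (1 - t * x) else 1 - t * x)"
    and "z \<equiv> (if pm then x + (1 - t * x) * x else x)"
  assumes M: "1 \<le> M" and SR: "S \<subseteq> {1..M}" "R \<subseteq> {1..M}"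
  shows "(\<Sum>K\<in>Pow {1..M}. line_R M 1 (out_R x y t) y t R K * vadj q z (line_C M pm 1 (out_C x y t) y t K) S) =
    vstep q z (\<lambda>R. \<Sum>K\<in>Pow {1..M}. line_R M 1 (in_R x y t) y t R K * line_C M pm 1 (in_C x y t) y t K S) R"
proof -
  define PR where "PR K R = (\<Prod>c\<in>{2..M}. row_weight (1,1,1) y t (dif K (R - {1}) c) (c \<in> K) (c \<in> R - {1}))" for K R
  define PC where "PC K S = (\<Prod>c\<in>{2..M}. col_weight (1,1,1) y t (dif (S - {1}) K c) (c \<in> S - {1}) (c \<in> K))" for K S
  have K1: "1 \<notin> K" "K - {1} = K" "insert 1 K - {1} = K" if "K \<in> Pow {2..M}" for K :: "nat set"
    using that by auto
  have R: "line_R M 1 p y t R' (if k then insert 1 K else K) = PR K R *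
      (row_weight p y t (dif K (R - {1}) 1) k (1 \<in> R') * bd_R (dif K (R - {1}) 1 + of_bool k - of_bool (1 \<in> R')))"
    if "K \<in> Pow {2..M}" "R' - {1} = R - {1}" "R' \<subseteq> {1..M}" for K k p R'
  proof -
    let ?K = "if k then insert 1 K else K"
    have sub: "?K \<subseteq> {1..M}" using M that by auto
    have K: "?K - {1} = K" "1 \<in> ?K \<longleftrightarrow> k" using K1[OF that(1)] by auto
    show ?thesis
      unfolding line_R_def line_split_1[OF M sub that(3)] K that(2) PR_def
      by (auto intro!: arg_cong2[where f = "(*)"] prod.cong)
  qed
  have C: "line_C M pm 1 p y t (if k then insert 1 K else K) S' = PC K S *
      (col_weight p y t (dif (S - {1}) K 1) (1 \<in> S') k * bd_C pm y (dif (S - {1}) K 1 + of_bool (1 \<in> S') - of_bool k))"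
    if "K \<in> Pow {2..M}" "S' - {1} = S - {1}" "S' \<subseteq> {1..M}" for K k p S'
  proof -
    let ?K = "if k then insert 1 K else K"
    have sub: "?K \<subseteq> {1..M}" using M that by auto
    have K: "?K - {1} = K" "1 \<in> ?K \<longleftrightarrow> k" using K1[OF that(1)] by auto
    show ?thesis
      unfolding line_C_def line_split_1[OF M that(3) sub] K that(2) PC_def
      by (auto intro!: arg_cong2[where f = "(*)"] prod.cong)
  qed
  have RC: "line_R M 1 p y t R' K * line_C M pm 1 p' y t K S' +
      line_R M 1 p y t R' (insert 1 K) * line_C M pm 1 p' y t (insert 1 K) S' =
      PR K R * PC K S * bd_pair pm y (row_weight p y t) (col_weight p' y t) (dif K (R - {1}) 1) (dif (S - {1}) K 1)
        (1 \<in> S') (1 \<in> R')"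
    if "K \<in> Pow {2..M}" "R' - {1} = R - {1}" "R' \<subseteq> {1..M}" "S' - {1} = S - {1}" "S' \<subseteq> {1..M}"
    for K R' S' p p'
    using R[OF that(1-3), of p False] R[OF that(1-3), of p True]
      C[OF that(1,4,5), of p' False] C[OF that(1,4,5), of p' True]
    by (simp add: bd_pair_def algebra_simps)
  have S': "insert 1 S - {1} = S - {1}" "insert 1 S \<subseteq> {1..M}" "R - {1} - {1} = R - {1}" "R - {1} \<subseteq> {1..M}"
    using SR M by auto
  have "(\<Sum>K\<in>Pow {1..M}. line_R M 1 (out_R x y t) y t R K * vadj q z (line_C M pm 1 (out_C x y t) y t K) S) =
    (\<Sum>K\<in>Pow {2..M}. if 1 \<in> S then q * (line_R M 1 (out_R x y t) y t R K * line_C M pm 1 (out_C x y t) y t K S +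
          line_R M 1 (out_R x y t) y t R (insert 1 K) * line_C M pm 1 (out_C x y t) y t (insert 1 K) S)
       else (line_R M 1 (out_R x y t) y t R K * line_C M pm 1 (out_C x y t) y t K S +
          line_R M 1 (out_R x y t) y t R (insert 1 K) * line_C M pm 1 (out_C x y t) y t (insert 1 K) S) +
         z * (line_R M 1 (out_R x y t) y t R K * line_C M pm 1 (out_C x y t) y t K (insert 1 S) +
          line_R M 1 (out_R x y t) y t R (insert 1 K) * line_C M pm 1 (out_C x y t) y t (insert 1 K) (insert 1 S)))"
    unfolding sum_Pow_1[OF M] by (intro sum.cong) (auto simp: vadj_def algebra_simps)
  also have "\<dots> = (\<Sum>K\<in>Pow {2..M}. if 1 \<in> R then q * (line_R M 1 (in_R x y t) y t R K * line_C M pm 1 (in_C x y t) y t K S +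
          line_R M 1 (in_R x y t) y t R (insert 1 K) * line_C M pm 1 (in_C x y t) y t (insert 1 K) S) +
         z * (line_R M 1 (in_R x y t) y t (R - {1}) K * line_C M pm 1 (in_C x y t) y t K S +
          line_R M 1 (in_R x y t) y t (R - {1}) (insert 1 K) * line_C M pm 1 (in_C x y t) y t (insert 1 K) S)
       else (line_R M 1 (in_R x y t) y t R K * line_C M pm 1 (in_C x y t) y t K S +
          line_R M 1 (in_R x y t) y t R (insert 1 K) * line_C M pm 1 (in_C x y t) y t (insert 1 K) S))"
  proof (intro sum.cong refl, goal_cases)
    case (1 K)
    let ?mR = "dif K (R - {1}) 1" and ?mC = "dif (S - {1}) K 1"
    let ?X' = "bd_pair pm y (row_weight (out_R x y t) y t) (col_weight (out_C x y t) y t) ?mR ?mC"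
    let ?X = "bd_pair pm y (row_weight (in_R x y t) y t) (col_weight (in_C x y t) y t) ?mR ?mC"
    have m1: "1 \<in> insert 1 S \<longleftrightarrow> True" "1 \<in> R - {1} \<longleftrightarrow> False" by auto
    have loc: "(if 1 \<in> S then q * ?X' (1 \<in> S) (1 \<in> R) else ?X' (1 \<in> S) (1 \<in> R) + z * ?X' True (1 \<in> R)) =
         (if 1 \<in> R then q * ?X (1 \<in> S) (1 \<in> R) + z * ?X (1 \<in> S) False else ?X (1 \<in> S) (1 \<in> R))"
      unfolding q_def z_def by (rule boundary_local)
    show ?case
      unfolding RC[OF 1 refl SR(2) refl SR(1)] RC[OF 1 refl SR(2) S'(1,2)] RC[OF 1 S'(3,4) refl SR(1)] m1
      using arg_cong[OF loc, of "(*) (PR K R * PC K S)"] by (auto simp: algebra_simps split: if_splits)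
  qed
  also have "\<dots> = vstep q z (\<lambda>R. \<Sum>K\<in>Pow {1..M}. line_R M 1 (in_R x y t) y t R K * line_C M pm 1 (in_C x y t) y t K S) R"
    unfolding sum_Pow_1[OF M] vstep_def sum_distrib_left
    by (cases "1 \<in> R") (simp_all flip: sum.distrib)
  finally show ?thesis .
qed

lemma boundary_op:
  assumes M: "1 \<le> M" and R: "R \<subseteq> {1..M}"
  shows "apply_op M (line_R M 1 (out_R x y t) y t) (apply_op M (line_C M pm 1 (out_C x y t) y t) (bd_step pm (-t) x F)) R =
    bd_step pm (-t) x (apply_op M (line_R M 1 (in_R x y t) y t) (apply_op M (line_C M pm 1 (in_C x y t) y t) F)) R"
proof -
  let ?q = "if pm then (1 - t * x) * (1 - t * x) else 1 - t * x"
  let ?z = "if pm then x + (1 - t * x) * x else x"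
  have st: "bd_step pm (-t) x G S = vstep ?q ?z G S" if "S \<subseteq> {1..M}" for G S
    using bd_step_eq[of S pm "-t" x G] that by force
  have "apply_op M (line_R M 1 (out_R x y t) y t) (apply_op M (line_C M pm 1 (out_C x y t) y t) (bd_step pm (-t) x F)) R =
     (\<Sum>K\<in>Pow {1..M}. line_R M 1 (out_R x y t) y t R K *
        (\<Sum>S\<in>Pow {1..M}. line_C M pm 1 (out_C x y t) y t K S * vstep ?q ?z F S))"
    unfolding apply_op_def by (intro sum.cong arg_cong2[where f = "(*)"] refl) (simp add: st)
  also have "\<dots> = (\<Sum>S\<in>Pow {1..M}. (\<Sum>K\<in>Pow {1..M}. line_R M 1 (out_R x y t) y t R K *
        vadj ?q ?z (line_C M pm 1 (out_C x y t) y t K) S) * F S)"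
    unfolding sum_vstep[OF M] sum_distrib_left sum_distrib_right
    by (subst sum.swap) (simp add: mult.assoc)
  also have "\<dots> = (\<Sum>S\<in>Pow {1..M}. vstep ?q ?z
      (\<lambda>R. \<Sum>K\<in>Pow {1..M}. line_R M 1 (in_R x y t) y t R K * line_C M pm 1 (in_C x y t) y t K S) R * F S)"
    using boundary_kernel[OF M _ R, of _ pm] by (intro sum.cong) auto
  also have "\<dots> = vstep ?q ?z (\<lambda>R. \<Sum>S\<in>Pow {1..M}. (\<Sum>K\<in>Pow {1..M}. line_R M 1 (in_R x y t) y t R K * line_C M pm 1 (in_C x y t) y t K S) * F S) R"
    by (rule sum_vstep_mult)
  also have "(\<lambda>R. \<Sum>S\<in>Pow {1..M}. (\<Sum>K\<in>Pow {1..M}. line_R M 1 (in_R x y t) y t R K * line_C M pm 1 (in_C x y t) y t K S) * F S) =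
      apply_op M (line_R M 1 (in_R x y t) y t) (apply_op M (line_C M pm 1 (in_C x y t) y t) F)"
    unfolding apply_op_def sum_distrib_left sum_distrib_right
    by (rule ext, subst sum.swap) (simp add: mult.assoc)
  finally show ?thesis using st[OF R] by simp
qed

end

section \<open>The truncated Cauchy identity\<close>

lemma box_step_cong:
  assumes "\<And>S. S \<subseteq> {1..M} \<Longrightarrow> F S = G S" "c < M" "R \<subseteq> {1..M}"
  shows "box_step b x c F R = box_step b x c G R"
  using assms rem_box_subset[OF assms(2,3)] by (simp add: box_step_def)

lemma apply_op_cong:
  assumes "\<And>S. S \<subseteq> {1..M} \<Longrightarrow> F S = G S"
  shows "apply_op M K F R = apply_op M K G R"
  using assms by (auto simp: apply_op_def intro!: sum.cong)

lemma fold_box_step_cong: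
  assumes "\<And>S. S \<subseteq> {1..M} \<Longrightarrow> F S = G S" "\<And>c. c \<in> set cs \<Longrightarrow> c < M" "R \<subseteq> {1..M}"
  shows "fold (box_step b x) cs F R = fold (box_step b x) cs G R"
  using assms
proof (induction cs arbitrary: F G)
  case (Cons c cs)
  have "box_step b x c F S = box_step b x c G S" if "S \<subseteq> {1..M}" for S
    using Cons.prems that by (intro box_step_cong) auto
  then show ?case
    using Cons.IH[of "box_step b x c F" "box_step b x c G"] Cons.prems by simp
qed auto

lemma box_step_smult: "box_step b x c (\<lambda>S. k * F S) = (\<lambda>S. k * box_step b x c F S)"
  by (auto simp: box_step_def algebra_simps)

lemma fold_box_step_smult: "fold (box_step b x) cs (\<lambda>S. k * F S) = (\<lambda>S. k * fold (box_step b x) cs F S)"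
  by (induction cs arbitrary: F) (simp_all add: box_step_smult)

lemma box_step_diff: "box_step b x c (\<lambda>S. F S - G S) = (\<lambda>S. box_step b x c F S - box_step b x c G S)"
  by (auto simp: box_step_def algebra_simps)

lemma col_weight_neg: "m < 0 \<Longrightarrow> col_weight p y t m a b = 0" and row_weight_neg: "m < 0 \<Longrightarrow> row_weight p y t m a b = 0"
  by (simp_all add: col_weight_def row_weight_def)

lemma bd_C_neg: "m < 0 \<Longrightarrow> bd_C pm y m = 0" and bd_R_neg: "m < 0 \<Longrightarrow> bd_R m = 0"
  by (auto simp: bd_C_def bd_R_def)

definition bd_steps :: "bool \<Rightarrow> nat list" where
  "bd_steps pm = (if pm then [0, 0] else [0])"

definition var_steps :: "bool \<Rightarrow> nat \<Rightarrow> nat list" where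
  "var_steps pm M = rev [1..<M] @ bd_steps pm @ [1..<M]"

lemma fold_bd_steps: "fold (box_step b x) (bd_steps pm) F = bd_step pm b x F"
  by (simp add: bd_steps_def bd_step_def)

context
  fixes x y t :: "'r::comm_ring_1" and M :: nat and pm :: bool
begin

text \<open>The line is pulled through a step from the outside, against the order in which the steps
  act; therefore the incoming weights are seen here to move from \<open>c\<close> to
  \<open>c + 1\<close>, and the outgoing ones from \<open>c + 1\<close> to \<open>c\<close>.\<close>

lemma line_C_in_step:
  assumes "1 \<le> c" "Suc c \<le> M" "R \<subseteq> {1..M}"
  shows "apply_op M (line_C M pm c (in_C x y t) y t) (box_step (-t) x c F) R =
    box_step (-t) x c (apply_op M (line_C M pm (Suc c) (in_C x y t) y t) F) R"
  unfolding line_C_def using assms exchanges_C_in[of t x y]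
  by (intro apply_op_exchange) (auto simp: col_weight_neg bd_C_neg)

lemma line_C_out_step:
  assumes "1 \<le> c" "Suc c \<le> M" "R \<subseteq> {1..M}"
  shows "apply_op M (line_C M pm (Suc c) (out_C x y t) y t) (box_step (-t) x c F) R =
    box_step (-t) x c (apply_op M (line_C M pm c (out_C x y t) y t) F) R"
  unfolding line_C_def using assms exchanges_C_out[of t x y]
  by (intro apply_op_exchange) (auto simp: col_weight_neg bd_C_neg)

lemma line_R_in_step:
  assumes "1 \<le> c" "Suc c \<le> M" "R \<subseteq> {1..M}"
  shows "apply_op M (line_R M c (in_R x y t) y t) (box_step (-t) x c F) R =
    box_step (-t) x c (apply_op M (line_R M (Suc c) (in_R x y t) y t) F) R"
  unfolding line_R_def using assms exchanges_R_in[of t x y]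
  by (intro apply_op_exchange) (auto simp: row_weight_neg bd_R_neg)

lemma line_R_out_step:
  assumes "1 \<le> c" "Suc c \<le> M" "R \<subseteq> {1..M}"
  shows "apply_op M (line_R M (Suc c) (out_R x y t) y t) (box_step (-t) x c F) R =
    box_step (-t) x c (apply_op M (line_R M c (out_R x y t) y t) F) R"
  unfolding line_R_def using assms exchanges_R_out[of t x y]
  by (intro apply_op_exchange) (auto simp: row_weight_neg bd_R_neg)

end

lemma fold_down:
  assumes st: "\<And>c F R. 1 \<le> c \<Longrightarrow> Suc c \<le> M \<Longrightarrow> R \<subseteq> {1..M} \<Longrightarrow>
      apply_op M (L c) (box_step b x c F) R = box_step b x c (apply_op M (L (Suc c)) F) R"
    and "1 \<le> k" "k \<le> M" "R \<subseteq> {1..M}"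
  shows "apply_op M (L k) (fold (box_step b x) (rev [k..<M]) F) R =
    fold (box_step b x) (rev [k..<M]) (apply_op M (L M) F) R"
  using assms(3,2,4)
proof (induction arbitrary: R rule: inc_induct)
  case (step k)
  then have "rev [k..<M] = rev [Suc k..<M] @ [k]"
    by (simp add: upt_conv_Cons)
  then have "apply_op M (L k) (fold (box_step b x) (rev [k..<M]) F) R =
      box_step b x k (apply_op M (L (Suc k)) (fold (box_step b x) (rev [Suc k..<M]) F)) R"
    using st[of k R] step by simp
  also have "\<dots> = box_step b x k (fold (box_step b x) (rev [Suc k..<M]) (apply_op M (L M) F)) R"
    by (rule box_step_cong[OF step.IH]) (use step in auto)
  finally show ?case using \<open>rev [k..<M] = _\<close> by simp
qed auto

lemma fold_up:
  assumes st: "\<And>c F R. 1 \<le> c \<Longrightarrow> Suc c \<le> M \<Longrightarrow> R \<subseteq> {1..M} \<Longrightarrow>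
      apply_op M (L (Suc c)) (box_step b x c F) R = box_step b x c (apply_op M (L c) F) R"
    and "1 \<le> k" "k \<le> M" "R \<subseteq> {1..M}"
  shows "apply_op M (L k) (fold (box_step b x) [1..<k] F) R =
    fold (box_step b x) [1..<k] (apply_op M (L 1) F) R"
  using assms(2,3,4)
proof (induction arbitrary: R rule: dec_induct)
  case (step k)
  then have "[1..<Suc k] = [1..<k] @ [k]" by simp
  then have "apply_op M (L (Suc k)) (fold (box_step b x) [1..<Suc k] F) R =
      box_step b x k (apply_op M (L k) (fold (box_step b x) [1..<k] F)) R"
    using st[of k R] step by simp
  also have "\<dots> = box_step b x k (fold (box_step b x) [1..<k] (apply_op M (L 1) F)) R"
    by (rule box_step_cong[OF step.IH]) (use step in auto)
  finally show ?case using \<open>[1..<Suc k] = _\<close> by simp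
qed auto

text \<open>The ascending steps act last, so the lines meet them first and their altered sites
  travel from \<open>M\<close> to 1 with outgoing weights. The wall turns these into incoming
  weights, and the descending steps carry the altered sites back to \<open>M\<close>.\<close>

lemma commute_special:
  fixes x y t :: "'r::comm_ring_1"
  assumes M: "1 \<le> M" and R: "R \<subseteq> {1..M}"
  shows "apply_op M (line_R M M (out_R x y t) y t) (apply_op M (line_C M pm M (out_C x y t) y t)
      (fold (box_step (-t) x) (var_steps pm M) F)) R =
    fold (box_step (-t) x) (var_steps pm M)
      (apply_op M (line_R M M (in_R x y t) y t) (apply_op M (line_C M pm M (in_C x y t) y t) F)) R"
proof -
  let ?st = "fold (box_step (-t) x)"
  define G where "G = ?st (rev [1..<M]) F"
  define H where "H = bd_step pm (-t) x G"
  have c: "c < M" if "c \<in> set [1..<M]" for c using that by auto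
  have c': "c < M" if "c \<in> set (rev [1..<M])" for c using that by auto
  have c0: "c < M" if "c \<in> set (bd_steps pm)" for c using that M by (auto simp: bd_steps_def split: if_splits)
  have A: "?st (var_steps pm M) E = ?st [1..<M] (bd_step pm (-t) x (?st (rev [1..<M]) E))" for E
    by (simp add: var_steps_def fold_bd_steps)
  have 1: "apply_op M (line_C M pm M (out_C x y t) y t) (?st [1..<M] H) S =
      ?st [1..<M] (apply_op M (line_C M pm 1 (out_C x y t) y t) H) S" if "S \<subseteq> {1..M}" for S
    by (rule fold_up[OF line_C_out_step M order.refl that])
  have "apply_op M (line_R M M (out_R x y t) y t) (apply_op M (line_C M pm M (out_C x y t) y t) (?st [1..<M] H)) R =
      apply_op M (line_R M M (out_R x y t) y t) (?st [1..<M] (apply_op M (line_C M pm 1 (out_C x y t) y t) H)) R"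
    by (rule apply_op_cong) (rule 1)
  also have "\<dots> = ?st [1..<M] (apply_op M (line_R M 1 (out_R x y t) y t) (apply_op M (line_C M pm 1 (out_C x y t) y t) H)) R"
    by (rule fold_up[OF line_R_out_step M order.refl R])
  also have "\<dots> = ?st [1..<M] (bd_step pm (-t) x
      (apply_op M (line_R M 1 (in_R x y t) y t) (apply_op M (line_C M pm 1 (in_C x y t) y t) G))) R"
    unfolding H_def by (rule fold_box_step_cong[OF boundary_op[OF M] c R])
  also have "\<dots> = ?st [1..<M] (bd_step pm (-t) x (?st (rev [1..<M])
      (apply_op M (line_R M M (in_R x y t) y t) (apply_op M (line_C M pm M (in_C x y t) y t) F)))) R"
    unfolding fold_bd_steps[symmetric]
  proof (rule fold_box_step_cong[OF _ c R], rule fold_box_step_cong[OF _ c0])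
    fix S assume S: "S \<subseteq> {1..M}"
    have "apply_op M (line_R M 1 (in_R x y t) y t) (apply_op M (line_C M pm 1 (in_C x y t) y t) G) S =
       apply_op M (line_R M 1 (in_R x y t) y t) (?st (rev [1..<M]) (apply_op M (line_C M pm M (in_C x y t) y t) F)) S"
      unfolding G_def by (rule apply_op_cong) (rule fold_down[OF line_C_in_step order.refl M])
    also have "\<dots> = ?st (rev [1..<M]) (apply_op M (line_R M M (in_R x y t) y t) (apply_op M (line_C M pm M (in_C x y t) y t) F)) S"
      by (rule fold_down[OF line_R_in_step order.refl M S])
    finally show "apply_op M (line_R M 1 (in_R x y t) y t) (apply_op M (line_C M pm 1 (in_C x y t) y t) G) S =
      ?st (rev [1..<M]) (apply_op M (line_R M M (in_R x y t) y t) (apply_op M (line_C M pm M (in_C x y t) y t) F)) S" .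
  qed
  finally show ?thesis
    unfolding A H_def G_def .
qed

lemma sum_eq_sum_cnt:
  assumes "S \<subseteq> {1..M}"
  shows "\<Sum>S = (\<Sum>c<M. cnt S c)"
proof -
  have fin: "finite S" using assms by (rule finite_subset) simp
  have "(\<Sum>c<M. cnt S c) = (\<Sum>c<M. \<Sum>p\<in>S. if c < p then 1 else 0)"
    using fin by (simp add: cnt_def sum.If_cases Int_def)
  also have "\<dots> = (\<Sum>p\<in>S. \<Sum>c<M. if c < p then 1 else 0)"
    by (rule sum.swap)
  also have "\<dots> = (\<Sum>p\<in>S. p)"
  proof (rule sum.cong)
    fix p assume "p \<in> S"
    then have "{..<M} \<inter> {c. c < p} = {..<p}" using assms by auto
    then show "(\<Sum>c<M. if c < p then 1 else 0) = p"
      by (simp add: sum.If_cases)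
  qed auto
  finally show ?thesis by simp
qed

text \<open>Every bond occupation is the argument of a site weight or of \<open>bd\<close>, so a
  negative one anywhere kills the product. A nonzero weight thus forces the inner shape into the
  outer one.\<close>

lemma line_nonzero_le:
  assumes "line M W bd R S \<noteq> 0" "S \<subseteq> {1..M}" "R \<subseteq> {1..M}"
    and neg: "\<And>d m a b. m < 0 \<Longrightarrow> W d m a b = 0" and bd: "\<And>m. m < 0 \<Longrightarrow> bd m = 0"
  shows "cnt R c \<le> cnt S c"
proof (rule ccontr)
  assume "\<not> cnt R c \<le> cnt S c"
  then have n: "dif S R c < 0" by (simp add: dif_def)
  then have "c < M" using cnt_eq_0[OF assms(2), of c] cnt_eq_0[OF assms(3), of c]
    by (force simp: dif_def not_less[symmetric])
  show False
  proof (cases "c = 0")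
    case True
    then show False using n bd assms(1) by (simp add: line_def)
  next
    case False
    then have "(\<Prod>c\<in>{1..M}. W c (dif S R c) (c \<in> S) (c \<in> R)) = 0"
      using neg[OF n] \<open>c < M\<close> by (intro prod_zero) (auto intro!: bexI[of _ c])
    then show False using assms(1) by (simp add: line_def)
  qed
qed

lemma line_nonzero_sum_le:
  assumes "line M W bd R S \<noteq> 0" "S \<subseteq> {1..M}" "R \<subseteq> {1..M}"
    and "\<And>d m a b. m < 0 \<Longrightarrow> W d m a b = 0" and "\<And>m. m < 0 \<Longrightarrow> bd m = 0"
  shows "\<Sum>R \<le> \<Sum>S"
  unfolding sum_eq_sum_cnt[OF assms(2)] sum_eq_sum_cnt[OF assms(3)]
  by (rule sum_mono) (rule line_nonzero_le[OF assms])

lemma sum_rem_box: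
  assumes "removable c S" "S \<subseteq> {1..M}"
  shows "\<Sum>S = Suc (\<Sum>(rem_box c S))"
proof -
  have fin: "finite S" using assms(2) by (rule finite_subset) simp
  have "\<Sum>S = Suc c + \<Sum>(S - {Suc c})"
    using assms fin by (subst sum.remove[of _ "Suc c"]) (auto simp: removable_def)
  also have "\<Sum>(rem_box c S) = c + \<Sum>(S - {Suc c})"
  proof (cases "c = 0")
    case True
    have "0 \<notin> S" using assms(2) by auto
    then have "rem_box c S = S - {Suc c}" using True by (auto simp: rem_box_def)
    then show ?thesis using True by simp
  next
    case False
    then have "rem_box c S = insert c (S - {Suc c})" "c \<notin> S - {Suc c}"
      using assms by (auto simp: rem_box_def removable_def)
    then show ?thesis using fin by simp
  qed
  ultimately show ?thesis by simp
qed

abbreviation "norm_C M pm \<equiv> line_C M pm 0 (1, 1, 1)"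
abbreviation "norm_R M \<equiv> line_R M 0 (1, 1, 1)"

text \<open>With the last site empty, the altered weight reduces to one entry of its triple: the
  second for a column line, where an empty site and occupation 0 select \<open>de\<close>, and the
  first for a row line, which reads the state of the site the other way round.\<close>

lemma line_C_last:
  assumes "1 \<le> M" "S \<subseteq> {1..M}" "R \<subseteq> {1..M}" "M \<notin> S"
  shows "line_C M pm M (al, de, ep) y t R S = de * norm_C M pm y t R S"
proof -
  have dM: "dif S R M = 0" using cnt_eq_0[OF assms(2)] cnt_eq_0[OF assms(3)] by (simp add: dif_def)
  have e: "{1..M} = insert M {1..<M}" using assms(1) by auto
  have "(\<Prod>c\<in>{1..<M}. (if c = M then col_weight (al, de, ep) y t else col_weight (1, 1, 1) y t) (dif S R c) (c \<in> S) (c \<in> R)) =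
     (\<Prod>c\<in>{1..<M}. (if c = 0 then col_weight (1, 1, 1) y t else col_weight (1, 1, 1) y t) (dif S R c) (c \<in> S) (c \<in> R))"
    by (rule prod.cong) auto
  then show ?thesis
    using assms(4) unfolding line_C_def line_def e
    by (simp add: dM col_weight_def line_factor_def mult.assoc)
qed

lemma line_R_last:
  assumes "1 \<le> M" "S \<subseteq> {1..M}" "R \<subseteq> {1..M}" "M \<notin> S"
  shows "line_R M M (al, de, ep) y t R S = al * norm_R M y t R S"
proof -
  have dM: "dif S R M = 0" using cnt_eq_0[OF assms(2)] cnt_eq_0[OF assms(3)] by (simp add: dif_def)
  have e: "{1..M} = insert M {1..<M}" using assms(1) by auto
  have "(\<Prod>c\<in>{1..<M}. (if c = M then row_weight (al, de, ep) y t else row_weight (1, 1, 1) y t) (dif S R c) (c \<in> S) (c \<in> R)) =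
     (\<Prod>c\<in>{1..<M}. (if c = 0 then row_weight (1, 1, 1) y t else row_weight (1, 1, 1) y t) (dif S R c) (c \<in> S) (c \<in> R))"
    by (rule prod.cong) auto
  then show ?thesis
    using assms(4) unfolding line_R_def line_def e
    by (simp add: dM row_weight_def line_factor_def mult.assoc)
qed

text \<open>One variable: its primed letter is the smaller one and fills the inner part between
  \<open>R\<close> and \<open>K\<close>, its unprimed letter the outer part between \<open>K\<close>
  and \<open>S\<close>.\<close>

definition dual_op :: "nat \<Rightarrow> bool \<Rightarrow> 'r::comm_ring_1 \<Rightarrow> 'r \<Rightarrow> nat set \<Rightarrow> nat set \<Rightarrow> 'r" where
  "dual_op M pm t y R S = (\<Sum>K\<in>Pow {1..M}. norm_R M y t R K * norm_C M pm y t K S)"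

lemma apply_dual_op:
  "apply_op M (dual_op M pm t y) F R = apply_op M (norm_R M y t) (apply_op M (norm_C M pm y t) F) R"
  unfolding apply_op_def dual_op_def sum_distrib_left sum_distrib_right
  by (subst sum.swap) (simp add: mult.assoc)

text \<open>The head of the list acts next to the outer shape, so it is the variable of the largest
  letters.\<close>

fun dual_chain :: "nat \<Rightarrow> bool \<Rightarrow> 'r::comm_ring_1 \<Rightarrow> 'r list \<Rightarrow> nat set \<Rightarrow> nat set \<Rightarrow> 'r" where
  "dual_chain M pm t [] S R = (if S = R then 1 else 0)"
| "dual_chain M pm t (y # ys) S R = (\<Sum>K\<in>Pow {1..M}. dual_chain M pm t ys K R * dual_op M pm t y K S)"

definition grow :: "nat \<Rightarrow> bool \<Rightarrow> 'r::comm_ring_1 \<Rightarrow> 'r list \<Rightarrow> nat set \<Rightarrow> 'r" where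
  "grow M pm b xs = foldr (\<lambda>x F. fold (box_step b x) (var_steps pm M) F) xs (\<lambda>S. if S = {} then 1 else 0)"

text \<open>
  Truncation to finitely many sites is harmless modulo high powers of the \<open>x\<close>-variables, since every
  added box costs one of them.
\<close>

locale filtration =
  fixes J :: "nat \<Rightarrow> 'r::comm_ring_1 set"
  assumes J_0: "J 0 = UNIV"
    and J_zero: "0 \<in> J n"
    and J_add: "a \<in> J n \<Longrightarrow> b \<in> J n \<Longrightarrow> a + b \<in> J n"
    and J_mult: "a \<in> J m \<Longrightarrow> b \<in> J n \<Longrightarrow> a * b \<in> J (m + n)"
    and J_antimono: "m \<le> n \<Longrightarrow> J n \<subseteq> J m"
begin

lemma J_ideal: "b \<in> J n \<Longrightarrow> a * b \<in> J n"
  using J_mult[of a 0 b n] J_0 by simp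

lemma J_sum: "(\<And>i. i \<in> A \<Longrightarrow> f i \<in> J n) \<Longrightarrow> sum f A \<in> J n"
  by (induction A rule: infinite_finite_induct) (auto simp: J_zero J_add)

lemma J_minus: "b \<in> J n \<Longrightarrow> - b \<in> J n"
  using J_ideal[of b n "-1"] by simp

definition adm :: "nat \<Rightarrow> (nat set \<Rightarrow> 'r) \<Rightarrow> bool" where
  "adm M F \<longleftrightarrow> (\<forall>S\<subseteq>{1..M}. F S \<in> J (\<Sum>S))"

definition eqJ :: "nat \<Rightarrow> (nat set \<Rightarrow> 'r) \<Rightarrow> (nat set \<Rightarrow> 'r) \<Rightarrow> bool" where
  "eqJ M F G \<longleftrightarrow> (\<forall>S\<subseteq>{1..M}. F S - G S \<in> J M)"

lemma eqJ_trans [trans]: "eqJ M F G \<Longrightarrow> eqJ M G H \<Longrightarrow> eqJ M F H"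
  unfolding eqJ_def using J_add[of "F S - G S" M "G S - H S" for S] by simp

lemma eqJ_sym: "eqJ M F G \<Longrightarrow> eqJ M G F"
  unfolding eqJ_def using J_minus[of "F S - G S" M for S] by simp

lemma eqJ_smult: "eqJ M F G \<Longrightarrow> eqJ M (\<lambda>S. k * F S) (\<lambda>S. k * G S)"
  unfolding eqJ_def right_diff_distrib[symmetric] by (blast intro: J_ideal)

lemma eqJ_apply: "eqJ M F G \<Longrightarrow> eqJ M (apply_op M K F) (apply_op M K G)"
  unfolding eqJ_def apply_op_def sum_subtractf[symmetric] right_diff_distrib[symmetric]
  by (auto intro!: J_sum J_ideal)

lemma adm_box_step:
  assumes "adm M F" "x \<in> J 1" "c < M"
  shows "adm M (box_step b x c F)"
  unfolding adm_def
proof (intro allI impI)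
  fix S assume S: "S \<subseteq> {1..M}"
  have "x * F (rem_box c S) \<in> J (\<Sum>S)" if "removable c S"
    using J_mult[OF assms(2), of "F (rem_box c S)" "\<Sum>(rem_box c S)"] assms(1)
      rem_box_subset[OF assms(3) S] sum_rem_box[OF that S]
    by (simp add: adm_def)
  then show "box_step b x c F S \<in> J (\<Sum>S)"
    using assms(1) S unfolding adm_def box_step_def by (auto intro!: J_add intro: J_ideal J_zero)
qed

lemma adm_fold_box_step:
  assumes "adm M F" "x \<in> J 1" "\<And>c. c \<in> set cs \<Longrightarrow> c < M"
  shows "adm M (fold (box_step b x) cs F)"
  using assms by (induction cs arbitrary: F) (auto simp: adm_box_step)

lemma eqJ_fold_box_step:
  assumes "eqJ M F G" "\<And>c. c \<in> set cs \<Longrightarrow> c < M"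
  shows "eqJ M (fold (box_step b x) cs F) (fold (box_step b x) cs G)"
  using assms
proof (induction cs arbitrary: F G)
  case (Cons c cs)
  have "eqJ M (box_step b x c F) (box_step b x c G)"
    unfolding eqJ_def
  proof (intro allI impI)
    fix S assume S: "S \<subseteq> {1..M}"
    have "rem_box c S \<subseteq> {1..M}" using rem_box_subset[OF _ S] Cons.prems by simp
    then have "box_step b x c (\<lambda>S. F S - G S) S \<in> J M"
      using Cons.prems S by (auto simp: box_step_def eqJ_def intro!: J_add J_ideal)
    then show "box_step b x c F S - box_step b x c G S \<in> J M"
      by (simp add: box_step_diff)
  qed
  then show ?case using Cons by simp
qed auto

lemma adm_apply_line:
  assumes "adm M F" and "\<And>d m a b. m < 0 \<Longrightarrow> W d m a b = 0" and "\<And>m. m < 0 \<Longrightarrow> bd m = 0"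
  shows "adm M (apply_op M (line M W bd) F)"
  unfolding adm_def
proof (intro allI impI)
  fix R assume R: "R \<subseteq> {1..M}"
  show "apply_op M (line M W bd) F R \<in> J (\<Sum>R)"
    unfolding apply_op_def
  proof (rule J_sum)
    fix S assume "S \<in> Pow {1..M}"
    then have S: "S \<subseteq> {1..M}" by simp
    show "line M W bd R S * F S \<in> J (\<Sum>R)"
    proof (cases "line M W bd R S = 0")
      case False
      from line_nonzero_sum_le[OF this S R assms(2,3)] show ?thesis
        using assms(1) S J_antimono[of "\<Sum>R" "\<Sum>S"] by (intro J_ideal) (auto simp: adm_def)
    qed (simp add: J_zero)
  qed
qed

lemma adm_apply_C: "adm M F \<Longrightarrow> adm M (apply_op M (line_C M pm s p y t) F)"
  unfolding line_C_def by (rule adm_apply_line) (auto simp: col_weight_neg bd_C_neg)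

text \<open>A shape that occupies site \<open>M\<close> has at least \<open>M\<close> boxes, so for
  admissible \<open>F\<close> it contributes to \<open>J M\<close> only; on all other shapes the two
  kernels are proportional.\<close>

lemma adm_apply_last:
  assumes "adm M F"
    and "\<And>R S. S \<subseteq> {1..M} \<Longrightarrow> R \<subseteq> {1..M} \<Longrightarrow> M \<notin> S \<Longrightarrow> K R S = k * L R S"
  shows "eqJ M (apply_op M K F) (\<lambda>R. k * apply_op M L F R)"
  unfolding eqJ_def
proof (intro allI impI)
  fix R assume R: "R \<subseteq> {1..M}"
  have "apply_op M K F R - k * apply_op M L F R = (\<Sum>S\<in>Pow {1..M}. (K R S - k * L R S) * F S)"
    by (simp add: apply_op_def sum_distrib_left sum_subtractf left_diff_distrib mult.assoc)
  also have "\<dots> \<in> J M"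
  proof (rule J_sum)
    fix S assume "S \<in> Pow {1..M}"
    then have S: "S \<subseteq> {1..M}" by simp
    show "(K R S - k * L R S) * F S \<in> J M"
    proof (cases "M \<in> S")
      case True
      have "finite S" using S by (rule finite_subset) simp
      then have "M \<le> \<Sum>S" using True by (intro member_le_sum) auto
      then show ?thesis using assms(1) S J_antimono[of M "\<Sum>S"] by (intro J_ideal) (auto simp: adm_def)
    qed (use assms(2) S R in \<open>simp add: J_zero\<close>)
  qed
  finally show "apply_op M K F R - k * apply_op M L F R \<in> J M" .
qed

text \<open>Far out, the pair of altered lines is the ordinary \<open>dual_op\<close> times the
  product of the two vacuum scalars.\<close>

lemma dual_op_special:
  assumes "adm M F" "1 \<le> M"
  shows "eqJ M (apply_op M (line_R M M (al, de, ep) y t) (apply_op M (line_C M pm M (al', de', ep') y t) F))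
     (\<lambda>R. al * de' * apply_op M (dual_op M pm t y) F R)"
proof -
  have "eqJ M (apply_op M (line_C M pm M (al', de', ep') y t) F) (\<lambda>R. de' * apply_op M (norm_C M pm y t) F R)"
    using assms by (intro adm_apply_last) (simp_all add: line_C_last)
  then have "eqJ M (apply_op M (line_R M M (al, de, ep) y t) (apply_op M (line_C M pm M (al', de', ep') y t) F))
     (apply_op M (line_R M M (al, de, ep) y t) (\<lambda>R. de' * apply_op M (norm_C M pm y t) F R))"
    by (rule eqJ_apply)
  also have "apply_op M (line_R M M (al, de, ep) y t) (\<lambda>R. de' * apply_op M (norm_C M pm y t) F R) =
      (\<lambda>R. de' * apply_op M (line_R M M (al, de, ep) y t) (apply_op M (norm_C M pm y t) F) R)"
    unfolding apply_op_def[of M "line_R M M (al, de, ep) y t"] sum_distrib_left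
    by (rule ext) (simp add: mult_ac)
  also have "eqJ M \<dots> (\<lambda>R. de' * (al * apply_op M (norm_R M y t) (apply_op M (norm_C M pm y t) F) R))"
    using assms by (intro eqJ_smult adm_apply_last adm_apply_C) (simp_all add: line_R_last)
  finally show ?thesis by (simp add: apply_dual_op mult_ac)
qed

lemma var_steps_less: "1 \<le> M \<Longrightarrow> c \<in> set (var_steps pm M) \<Longrightarrow> c < M"
  by (auto simp: var_steps_def bd_steps_def split: if_splits)

text \<open>\<open>commute_special\<close> with both ends replaced by scalars; the scalar of the
  outgoing weights is a unit with inverse \<open>u\<close>, which moves it to the other
  side.\<close>

lemma dual_op_commute:
  assumes F: "adm M F" and M: "1 \<le> M" and x: "x \<in> J 1"
    and u: "u * ((1 - t * x) * (1 - x * y)) = 1"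
  shows "eqJ M (apply_op M (dual_op M pm t y) (fold (box_step (-t) x) (var_steps pm M) F))
    (\<lambda>S. u * (1 - t * x + x * y) * fold (box_step (-t) x) (var_steps pm M) (apply_op M (dual_op M pm t y) F) S)"
proof -
  let ?st = "fold (box_step (-t) x) (var_steps pm M)" and ?B = "apply_op M (dual_op M pm t y)"
  have less: "\<And>c. c \<in> set (var_steps pm M) \<Longrightarrow> c < M" using var_steps_less[OF M] .
  have "adm M (?st F)" using adm_fold_box_step[OF F x less] .
  from dual_op_special[OF this M]
  have "eqJ M (\<lambda>R. (1 - t * x) * (1 - x * y) * ?B (?st F) R)
     (apply_op M (line_R M M (out_R x y t) y t) (apply_op M (line_C M pm M (out_C x y t) y t) (?st F)))"
    by (rule eqJ_sym)
  also have "eqJ M \<dots> (?st (apply_op M (line_R M M (in_R x y t) y t) (apply_op M (line_C M pm M (in_C x y t) y t) F)))"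
    unfolding eqJ_def commute_special[OF M] using J_zero commute_special[OF M, of _ t x y pm F] by simp
  also have "eqJ M \<dots> (?st (\<lambda>R. 1 * (1 - t * x + x * y) * ?B F R))"
    by (rule eqJ_fold_box_step[OF dual_op_special[OF F M] less])
  also have "\<dots> = (\<lambda>R. 1 * (1 - t * x + x * y) * ?st (?B F) R)"
    by (rule fold_box_step_smult)
  finally have "eqJ M (\<lambda>R. u * ((1 - t * x) * (1 - x * y) * ?B (?st F) R)) (\<lambda>R. u * (1 * (1 - t * x + x * y) * ?st (?B F) R))"
    by (rule eqJ_smult)
  moreover have "u * ((1 - t * x) * (1 - x * y) * z) = z" for z
    unfolding mult.assoc[symmetric] using u by (simp add: mult.assoc)
  ultimately show ?thesis by (simp add: mult.assoc)
qed

lemma adm_grow: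
  assumes "1 \<le> M" "set xs \<subseteq> J 1"
  shows "adm M (grow M pm b xs)"
  using assms(2)
proof (induction xs)
  case Nil
  then show ?case by (auto simp: grow_def adm_def J_zero J_0)
next
  case (Cons x xs)
  have "grow M pm b (x # xs) = fold (box_step b x) (var_steps pm M) (grow M pm b xs)"
    by (simp add: grow_def)
  then show ?case using Cons var_steps_less[OF assms(1)] by (simp add: adm_fold_box_step)
qed

end

lemma sum_le_0_empty:
  fixes M :: nat
  assumes "K \<subseteq> {1..M}" "\<Sum>K \<le> 0"
  shows "K = {}"
proof -
  have "finite K" using assms(1) by (rule finite_subset) simp
  then show ?thesis using assms by (auto simp: sum_eq_0_iff)
qed

text \<open>Lines only strip boxes, and nothing can be stripped from the empty shape:
  \<open>line_nonzero_sum_le\<close> bounds the size of the inner shape by 0.\<close>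

lemma dual_op_empty:
  assumes "R \<subseteq> {1..M}"
  shows "dual_op M pm t y R {} = (if R = {} then 1 else 0)"
proof -
  have C: "norm_C M pm y t K {} = (if K = {} then 1 else 0)" if "K \<subseteq> {1..M}" for K
  proof (cases "K = {}")
    case False
    then have "norm_C M pm y t K {} = 0"
      using line_nonzero_sum_le[of M "\<lambda>c. if c = 0 then col_weight (1, 1, 1) y t else col_weight (1, 1, 1) y t" "bd_C pm y" K "{}"]
        that sum_le_0_empty[OF that] unfolding line_C_def by (force simp: col_weight_neg bd_C_neg)
    then show ?thesis using False by simp
  qed (simp add: line_C_def line_def dif_def cnt_def col_weight_def line_factor_def bd_C_def)
  have R: "norm_R M y t K {} = (if K = {} then 1 else 0)" if "K \<subseteq> {1..M}" for K
  proof (cases "K = {}")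
    case False
    then have "norm_R M y t K {} = 0"
      using line_nonzero_sum_le[of M "\<lambda>c. if c = 0 then row_weight (1, 1, 1) y t else row_weight (1, 1, 1) y t" bd_R K "{}"]
        that sum_le_0_empty[OF that] unfolding line_R_def by (force simp: row_weight_neg bd_R_neg)
    then show ?thesis using False by simp
  qed (simp add: line_R_def line_def dif_def cnt_def row_weight_def line_factor_def bd_R_def)
  have "dual_op M pm t y R {} = (\<Sum>K\<in>Pow {1..M}. if K = {} then norm_R M y t R K else 0)"
    unfolding dual_op_def by (intro sum.cong) (auto simp: C)
  also have "\<dots> = norm_R M y t R {}"
    by (simp add: sum.delta)
  finally show ?thesis using R[OF assms] by simp
qed

lemma fold_box_step_empty: "fold (box_step b x) cs F {} = F {}"
  by (induction cs arbitrary: F) (simp_all add: box_step_def removable_def)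

lemma grow_Nil: "grow M pm b [] = (\<lambda>S. if S = {} then 1 else 0)"
  and grow_Cons: "grow M pm b (x # xs) = fold (box_step b x) (var_steps pm M) (grow M pm b xs)"
  by (simp_all add: grow_def)

lemma grow_empty: "grow M pm b xs {} = 1"
  by (induction xs) (simp_all add: grow_Nil grow_Cons fold_box_step_empty)

context filtration
begin

lemma dual_op_grow:
  assumes "1 \<le> M" "set xs \<subseteq> J 1"
    and "\<And>x. x \<in> set xs \<Longrightarrow> U x * ((1 - t * x) * (1 - x * y)) = 1"
  shows "eqJ M (apply_op M (dual_op M pm t y) (grow M pm (-t) xs))
    (\<lambda>S. (\<Prod>x\<leftarrow>xs. U x * (1 - t * x + x * y)) * grow M pm (-t) xs S)"
  using assms(2,3)
proof (induction xs)
  case Nil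
  have "apply_op M (dual_op M pm t y) (grow M pm (-t) []) R = grow M pm (-t) [] R" if "R \<subseteq> {1..M}" for R
  proof -
    have "apply_op M (dual_op M pm t y) (grow M pm (-t) []) R =
        (\<Sum>S\<in>Pow {1..M}. if S = {} then dual_op M pm t y R S else 0)"
      unfolding apply_op_def grow_Nil by (intro sum.cong) auto
    also have "\<dots> = dual_op M pm t y R {}"
      by (simp add: sum.delta)
    finally show ?thesis unfolding dual_op_empty[OF that] grow_Nil .
  qed
  then show ?case by (simp add: eqJ_def J_zero)
next
  case (Cons x xs)
  let ?st = "fold (box_step (-t) x) (var_steps pm M)" and ?B = "apply_op M (dual_op M pm t y)"
  let ?p = "\<Prod>x\<leftarrow>xs. U x * (1 - t * x + x * y)"
  let ?k = "U x * (1 - t * x + x * y)"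
  have less: "\<And>c. c \<in> set (var_steps pm M) \<Longrightarrow> c < M" using var_steps_less[OF assms(1)] .
  have "eqJ M (?B (?st (grow M pm (-t) xs))) (\<lambda>S. ?k * ?st (?B (grow M pm (-t) xs)) S)"
    using Cons.prems assms(1) by (intro dual_op_commute adm_grow) auto
  also have "eqJ M \<dots> (\<lambda>S. ?k * ?st (\<lambda>S. ?p * grow M pm (-t) xs S) S)"
    using Cons by (intro eqJ_smult eqJ_fold_box_step less) auto
  finally show ?case
    by (simp add: grow_Cons fold_box_step_smult mult.assoc)
qed

text \<open>Modulo \<open>J M\<close> each \<open>dual_op\<close> acts on \<open>grow\<close> as
  multiplication by the kernel product of its \<open>y\<close>. When all have been applied, only the
  value of \<open>grow\<close> at the empty shape is left, which is 1.\<close>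

theorem cauchy_truncated:
  assumes "1 \<le> M" "set xs \<subseteq> J 1"
    and "\<And>x y. x \<in> set xs \<Longrightarrow> y \<in> set ys \<Longrightarrow> U x y * ((1 - t * x) * (1 - x * y)) = 1"
  shows "(\<Sum>S\<in>Pow {1..M}. dual_chain M pm t ys S {} * grow M pm (-t) xs S) -
     (\<Prod>y\<leftarrow>ys. \<Prod>x\<leftarrow>xs. U x y * (1 - t * x + x * y)) \<in> J M"
  using assms(3)
proof (induction ys)
  case Nil
  have "(\<Sum>S\<in>Pow {1..M}. dual_chain M pm t [] S {} * grow M pm (-t) xs S) =
      (\<Sum>S\<in>Pow {1..M}. if S = {} then grow M pm (-t) xs S else 0)"
    by (intro sum.cong) auto
  then show ?case by (simp add: sum.delta grow_empty J_zero)
next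
  case (Cons y ys)
  let ?G = "grow M pm (-t) xs" and ?p = "\<Prod>x\<leftarrow>xs. U x y * (1 - t * x + x * y)"
  let ?D = "\<lambda>S. dual_chain M pm t ys S {}" and ?q = "\<Prod>y\<leftarrow>ys. \<Prod>x\<leftarrow>xs. U x y * (1 - t * x + x * y)"
  have "(\<Sum>S\<in>Pow {1..M}. dual_chain M pm t (y # ys) S {} * ?G S) =
      (\<Sum>S\<in>Pow {1..M}. \<Sum>K\<in>Pow {1..M}. ?D K * (dual_op M pm t y K S * ?G S))"
    by (simp add: sum_distrib_right mult.assoc)
  also have "\<dots> = (\<Sum>K\<in>Pow {1..M}. ?D K * apply_op M (dual_op M pm t y) ?G K)"
    unfolding apply_op_def sum_distrib_left by (rule sum.swap)
  finally have "(\<Sum>S\<in>Pow {1..M}. dual_chain M pm t (y # ys) S {} * ?G S) - ?p * ?q =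
     (\<Sum>K\<in>Pow {1..M}. ?D K * (apply_op M (dual_op M pm t y) ?G K - ?p * ?G K)) +
      ?p * ((\<Sum>K\<in>Pow {1..M}. ?D K * ?G K) - ?q)"
    by (simp add: right_diff_distrib sum_subtractf sum_distrib_left mult_ac)
  moreover have "eqJ M (apply_op M (dual_op M pm t y) ?G) (\<lambda>S. ?p * ?G S)"
    using Cons.prems assms by (intro dual_op_grow) auto
  then have "(\<Sum>K\<in>Pow {1..M}. ?D K * (apply_op M (dual_op M pm t y) ?G K - ?p * ?G K)) \<in> J M"
    by (intro J_sum J_ideal) (auto simp: eqJ_def)
  moreover have "(\<Sum>K\<in>Pow {1..M}. ?D K * ?G K) - ?q \<in> J M"
    using Cons by auto
  ultimately show ?case by (simp add: J_add J_ideal)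
qed

end

section \<open>Multivariate power series\<close>

lemma mps_nth_simps [simp]:
  "mps_nth 0 m = 0" "mps_nth (f + g) m = mps_nth f m + mps_nth g m"
  "mps_nth (f - g) m = mps_nth f m - mps_nth g m" "mps_nth (- f) m = - mps_nth f m"
  for f g :: "('v, 'a::comm_ring_1) mpser"
  by (simp_all add: zero_mpser.rep_eq plus_mpser.rep_eq minus_mpser.rep_eq uminus_mpser.rep_eq)

lemma mps_nth_1: "mps_nth (1 :: ('v, 'a::comm_ring_1) mpser) m = (if m = 0 then 1 else 0)"
  by (simp add: one_mpser.rep_eq)

lemma mps_nth_sum: "mps_nth (sum f A) m = (\<Sum>i\<in>A. mps_nth (f i :: ('v, 'a::comm_ring_1) mpser) m)"
  by (induction A rule: infinite_finite_induct) auto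

lemma mps_nth_mult: "mps_nth (f * g :: ('v, 'a::comm_ring_1) mpser) m = (\<Sum>(a, b)\<in>{(a, b). a + b = m}. mps_nth f a * mps_nth g b)"
  by (simp add: times_mpser.rep_eq)

definition mps_term :: "'a \<Rightarrow> ('v \<Rightarrow>\<^sub>0 nat) \<Rightarrow> ('v, 'a::zero) mpser" where
  "mps_term c e = Abs_mpser (\<lambda>m. if m = e then c else 0)"

lemma mps_nth_term: "mps_nth (mps_term c e) m = (if m = e then c else 0)"
  by (simp add: mps_term_def Abs_mpser_inverse)

lemma mps_term_mult: "mps_term c e * mps_term d f = mps_term (c * d :: 'a::comm_ring_1) (e + f)"
proof (rule mpser_eqI)
  fix m
  have "mps_nth (mps_term c e * mps_term d f) m =
      (\<Sum>p\<in>{(a, b). a + b = m}. if p = (e, f) then c * d else 0)"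
    unfolding mps_nth_mult by (intro sum.cong refl) (auto simp: mps_nth_term split: if_splits)
  also have "\<dots> = mps_nth (mps_term (c * d) (e + f)) m"
    using finite_exponent_splits[of m] by (simp add: sum.delta mps_nth_term)
  finally show "mps_nth (mps_term c e * mps_term d f) m = mps_nth (mps_term (c * d) (e + f)) m" .
qed

lemma one_eq_term: "1 = mps_term (1::'a::comm_ring_1) 0"
  by (rule mpser_eqI) (simp add: mps_nth_term mps_nth_1)

lemma beta_eq_term: "beta = mps_term [:0, 1:] 0"
  by (rule mpser_eqI) (simp add: beta_def mps_nth_term mps_const.rep_eq)

lemma var_eq_term: "mps_var v = mps_term (1::'a::comm_ring_1) (Poly_Mapping.single v 1)"
  by (rule mpser_eqI) (simp add: mps_nth_term mps_var.rep_eq)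

lemma var_power_eq_term: "mps_var v ^ n = mps_term (1::'a::comm_ring_1) (Poly_Mapping.single v n)"
  by (induction n) (simp_all add: one_eq_term var_eq_term mps_term_mult single_add[symmetric])

lemma const_term_power: "mps_term (c::'a::comm_ring_1) 0 ^ n = mps_term (c ^ n) 0"
  by (induction n) (simp_all add: one_eq_term mps_term_mult)

lemma neg_beta_power: "(- beta :: ('v, int poly) mpser) ^ n = mps_term ((- [:0, 1:]) ^ n) 0"
proof -
  have "(- beta :: ('v, int poly) mpser) = mps_term (- [:0, 1:]) 0"
    by (rule mpser_eqI) (simp add: beta_eq_term mps_nth_term)
  then show ?thesis by (simp only: const_term_power)
qed

lemma prod_term:
  "finite A \<Longrightarrow> (\<Prod>i\<in>A. mps_term (c i) (e i)) = mps_term (\<Prod>i\<in>A. c i :: 'a::comm_ring_1) (\<Sum>i\<in>A. e i)"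
  by (induction A rule: finite_induct) (simp_all add: one_eq_term mps_term_mult)

section \<open>Weighted degree, order ideals and inverses\<close>

definition wdeg :: "('v \<Rightarrow> nat) \<Rightarrow> ('v \<Rightarrow>\<^sub>0 nat) \<Rightarrow> nat" where
  "wdeg w e = (\<Sum>v\<in>Poly_Mapping.keys e. w v * Poly_Mapping.lookup e v)"

lemma wdeg_superset:
  assumes "finite A" "Poly_Mapping.keys e \<subseteq> A"
  shows "wdeg w e = (\<Sum>v\<in>A. w v * Poly_Mapping.lookup e v)"
  unfolding wdeg_def using assms by (intro sum.mono_neutral_left) (auto simp: in_keys_iff)

lemma wdeg_add: "wdeg w (a + b) = wdeg w a + wdeg w b"
proof -
  let ?A = "Poly_Mapping.keys a \<union> Poly_Mapping.keys b"
  have "Poly_Mapping.keys (a + b) \<subseteq> ?A" by (rule Poly_Mapping.keys_add)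
  then show ?thesis
    using wdeg_superset[of ?A a w] wdeg_superset[of ?A b w] wdeg_superset[of ?A "a + b" w]
    by (simp add: lookup_add sum.distrib distrib_left)
qed

lemma wdeg_0: "wdeg w 0 = 0"
  by (simp add: wdeg_def)

lemma wdeg_single: "wdeg w (Poly_Mapping.single v n) = w v * n"
  by (subst wdeg_superset[of "{v}"]) auto

lemma wdeg_sum: "wdeg w (\<Sum>i\<in>A. e i) = (\<Sum>i\<in>A. wdeg w (e i))"
  by (induction A rule: infinite_finite_induct) (simp_all add: wdeg_add wdeg_0)

definition order_ge :: "('v \<Rightarrow> nat) \<Rightarrow> nat \<Rightarrow> ('v, 'a::comm_ring_1) mpser set" where
  "order_ge w n = {f. \<forall>m. wdeg w m < n \<longrightarrow> mps_nth f m = 0}"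

text \<open>Weighted degrees add, so a term of low degree in a product has a factor of low degree.
  Taking weight 0 on the \<open>y\<close>-variables yields the ideals in which truncation is
  measured by the \<open>x\<close>-degree.\<close>

lemma filtration_order_ge: "filtration (order_ge w :: nat \<Rightarrow> ('v, 'a::comm_ring_1) mpser set)"
proof
  fix f g :: "('v, 'a) mpser" and m n
  assume f: "f \<in> order_ge w m" and g: "g \<in> order_ge w n"
  show "f * g \<in> order_ge w (m + n)"
    unfolding order_ge_def mem_Collect_eq mps_nth_mult
  proof (intro allI impI sum.neutral ballI)
    fix e p assume e: "wdeg w e < m + n" and p: "p \<in> {(a, b). a + b = e}"
    obtain a b where p': "p = (a, b)" "a + b = e" using p by auto
    then have "wdeg w a < m \<or> wdeg w b < n" using e wdeg_add[of w a b] by auto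
    then show "(case p of (a, b) \<Rightarrow> mps_nth f a * mps_nth g b) = 0"
      using f g p' by (auto simp: order_ge_def)
  qed
qed (auto simp: order_ge_def)

lemma order_ge_power:
  assumes "h \<in> order_ge w 1"
  shows "h ^ k \<in> order_ge w k"
proof -
  interpret filtration "order_ge w" by (rule filtration_order_ge)
  show ?thesis
    using assms by (induction k) (auto simp: J_0 dest: J_mult[OF assms])
qed

text \<open>The geometric series: \<open>h ^ k\<close> has no terms of degree below
  \<open>k\<close>, so each coefficient is read off from the partial sum up to the degree of its
  monomial.\<close>

lemma mps_inverse_exists:
  fixes h :: "('v, 'a::comm_ring_1) mpser"
  assumes "h \<in> order_ge (\<lambda>_. 1) 1"
  shows "\<exists>g. (1 - h) * g = 1"
proof -
  let ?d = "wdeg (\<lambda>_. 1)"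
  define s where "s n = (\<Sum>k\<le>n. h ^ k)" for n
  define g where "g = Abs_mpser (\<lambda>m. mps_nth (s (?d m)) m)"
  have van: "mps_nth (h ^ k) m = 0" if "?d m < k" for k m
    using order_ge_power[OF assms, of k] that by (auto simp: order_ge_def)
  have st: "mps_nth (s n) m = mps_nth (s (?d m)) m" if "?d m \<le> n" for n m
    unfolding s_def mps_nth_sum using that van by (intro sum.mono_neutral_right) auto
  have g: "mps_nth g m = mps_nth (s (?d m)) m" for m
    by (simp add: g_def Abs_mpser_inverse)
  have geo: "(1 - h) * s n = 1 - h ^ Suc n" for n
    unfolding s_def by (metis lessThan_Suc_atMost one_diff_power_eq)
  have "mps_nth ((1 - h) * g) m = mps_nth 1 m" for m
  proof -
    have "mps_nth ((1 - h) * g) m = mps_nth ((1 - h) * s (?d m)) m"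
      unfolding mps_nth_mult
    proof (intro sum.cong refl)
      fix p assume "p \<in> {(a, b). a + b = m}"
      then obtain a b where p: "p = (a, b)" "a + b = m" by auto
      then have "?d b \<le> ?d m" using wdeg_add[of "\<lambda>_. 1" a b] by simp
      then show "(case p of (a, b) \<Rightarrow> mps_nth (1 - h) a * mps_nth g b) =
        (case p of (a, b) \<Rightarrow> mps_nth (1 - h) a * mps_nth (s (?d m)) b)"
        using p st[of b "?d m"] g[of b] by simp
    qed
    also have "\<dots> = mps_nth 1 m"
      unfolding geo using van[of m "Suc (?d m)"] by simp
    finally show ?thesis .
  qed
  then show ?thesis by (blast intro: mpser_eqI)
qed

lemma mps_inverse_mult:
  fixes f :: "('v, 'a::comm_ring_1) mpser"
  assumes "1 - f \<in> order_ge (\<lambda>_. 1) 1"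
  shows "f * inverse f = 1"
proof -
  have f: "1 - (1 - f) = f" by simp
  obtain g where g: "f * g = 1" using mps_inverse_exists[OF assms] unfolding f by blast
  have uniq: "g' = g" if "f * g' = 1" for g'
  proof -
    have "g' = (f * g) * g'" using g by simp
    also have "\<dots> = (f * g') * g" by (simp only: mult_ac)
    finally show ?thesis using that by simp
  qed
  show ?thesis
    unfolding inverse_mpser_def by (rule theI[of "\<lambda>g. f * g = 1" g]) (fact g, fact uniq)
qed

section \<open>Renaming of variables\<close>

definition push :: "('v \<Rightarrow> 'w) \<Rightarrow> ('v \<Rightarrow>\<^sub>0 nat) \<Rightarrow> ('w \<Rightarrow>\<^sub>0 nat)" where
  "push \<phi> e = (\<Sum>v\<in>Poly_Mapping.keys e. Poly_Mapping.single (\<phi> v) (Poly_Mapping.lookup e v))"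

lemma lookup_sum: "Poly_Mapping.lookup (\<Sum>i\<in>A. f i) k = (\<Sum>i\<in>A. Poly_Mapping.lookup (f i) k)"
  by (induction A rule: infinite_finite_induct) (auto simp: lookup_add)

lemma lookup_push:
  assumes "inj \<phi>" shows "Poly_Mapping.lookup (push \<phi> e) (\<phi> v) = Poly_Mapping.lookup e v"
proof -
  have "Poly_Mapping.lookup (push \<phi> e) (\<phi> v) =
      (\<Sum>u\<in>Poly_Mapping.keys e. if u = v then Poly_Mapping.lookup e v else 0)"
    unfolding push_def lookup_sum
    by (intro sum.cong) (use assms in \<open>auto simp: lookup_single when_def inj_eq\<close>)
  then show ?thesis by (simp add: sum.delta in_keys_iff)
qed

lemma lookup_push_notin: "w \<notin> range \<phi> \<Longrightarrow> Poly_Mapping.lookup (push \<phi> e) w = 0"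
  unfolding push_def lookup_sum by (intro sum.neutral) (auto simp: lookup_single when_def)

lemma keys_push: "Poly_Mapping.keys (push \<phi> e) \<subseteq> range \<phi>"
  using lookup_push_notin by (metis in_keys_iff subsetI)

lemma lookup_map_key: "inj \<phi> \<Longrightarrow> Poly_Mapping.lookup (Poly_Mapping.map_key \<phi> m) v = Poly_Mapping.lookup m (\<phi> v)"
  by (simp add: map_key.rep_eq)

lemma map_key_push: "inj \<phi> \<Longrightarrow> Poly_Mapping.map_key \<phi> (push \<phi> e) = e"
  by (rule poly_mapping_eqI) (simp add: lookup_map_key lookup_push)

text \<open>Together with \<open>map_key_push\<close> this makes \<open>push\<close> and
  \<open>map_key\<close> inverse to each other between all exponent vectors and those supported in
  the range of \<open>\<phi>\<close>; products of renamed series are reindexed along this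
  bijection.\<close>

lemma push_map_key:
  assumes "inj \<phi>" "Poly_Mapping.keys m \<subseteq> range \<phi>"
  shows "push \<phi> (Poly_Mapping.map_key \<phi> m) = m"
proof (rule poly_mapping_eqI)
  fix w
  show "Poly_Mapping.lookup (push \<phi> (Poly_Mapping.map_key \<phi> m)) w = Poly_Mapping.lookup m w"
  proof (cases "w \<in> range \<phi>")
    case True
    then show ?thesis using assms by (auto simp: lookup_push lookup_map_key)
  next
    case False
    then show ?thesis using assms lookup_push_notin[OF False] by (metis in_keys_iff subsetD)
  qed
qed

lemma map_key_add: "inj \<phi> \<Longrightarrow> Poly_Mapping.map_key \<phi> (a + b) = Poly_Mapping.map_key \<phi> a + Poly_Mapping.map_key \<phi> (b :: _ \<Rightarrow>\<^sub>0 nat)"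
  by (rule poly_mapping_eqI) (simp add: lookup_map_key lookup_add)

lemma push_add:
  assumes "inj \<phi>" shows "push \<phi> (a + b) = push \<phi> a + push \<phi> b"
proof (rule poly_mapping_eqI)
  fix w show "Poly_Mapping.lookup (push \<phi> (a + b)) w = Poly_Mapping.lookup (push \<phi> a + push \<phi> b) w"
    using assms by (cases "w \<in> range \<phi>") (auto simp: lookup_push lookup_add lookup_push_notin)
qed

lemma keys_add_nat: "Poly_Mapping.keys (a + b) = Poly_Mapping.keys a \<union> Poly_Mapping.keys (b :: _ \<Rightarrow>\<^sub>0 nat)"
  by (auto simp: in_keys_iff lookup_add)

lemma mps_nth_rename: "mps_nth (mps_rename \<phi> f) m =
    (if Poly_Mapping.keys m \<subseteq> range \<phi> then mps_nth f (Poly_Mapping.map_key \<phi> m) else 0)"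
  by (simp add: mps_rename.rep_eq)

lemma mps_rename_term: "inj \<phi> \<Longrightarrow> mps_rename \<phi> (mps_term c e) = mps_term c (push \<phi> e)"
  by (rule mpser_eqI)
    (use keys_push[of \<phi> e] in \<open>auto simp: mps_nth_rename mps_nth_term map_key_push push_map_key\<close>)

lemma push_single: "push \<phi> (Poly_Mapping.single v n) = Poly_Mapping.single (\<phi> v) n"
  by (cases "n = 0") (simp_all add: push_def)

lemma mps_rename_add: "mps_rename \<phi> (f + g) = mps_rename \<phi> f + mps_rename \<phi> (g :: ('v, 'a::comm_ring_1) mpser)"
  by (rule mpser_eqI) (simp add: mps_nth_rename)

lemma mps_rename_0: "mps_rename \<phi> 0 = (0 :: ('v, 'a::comm_ring_1) mpser)"
  by (rule mpser_eqI) (simp add: mps_nth_rename)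

lemma mps_rename_uminus: "mps_rename \<phi> (- f) = - mps_rename \<phi> (f :: ('v, 'a::comm_ring_1) mpser)"
  by (rule mpser_eqI) (simp add: mps_nth_rename)

lemma mps_rename_mult:
  fixes f g :: "('v, 'a::comm_ring_1) mpser"
  assumes "inj \<phi>"
  shows "mps_rename \<phi> (f * g) = mps_rename \<phi> f * mps_rename \<phi> g"
proof (rule mpser_eqI)
  fix m
  let ?mk = "Poly_Mapping.map_key \<phi>"
  show "mps_nth (mps_rename \<phi> (f * g)) m = mps_nth (mps_rename \<phi> f * mps_rename \<phi> g) m"
  proof (cases "Poly_Mapping.keys m \<subseteq> range \<phi>")
    case True
    have "mps_nth (mps_rename \<phi> (f * g)) m = (\<Sum>(a, b)\<in>{(a, b). a + b = ?mk m}. mps_nth f a * mps_nth g b)"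
      using True by (simp add: mps_nth_rename mps_nth_mult)
    also have "\<dots> = (\<Sum>(a, b)\<in>{(a, b). a + b = m}. mps_nth (mps_rename \<phi> f) a * mps_nth (mps_rename \<phi> g) b)"
    proof (rule sum.reindex_bij_witness[of _ "\<lambda>(a, b). (?mk a, ?mk b)" "\<lambda>(a, b). (push \<phi> a, push \<phi> b)"])
      fix p assume "p \<in> {(a, b). a + b = m}"
      then obtain a b where p: "p = (a, b)" "a + b = m" by auto
      then have "Poly_Mapping.keys a \<subseteq> range \<phi>" "Poly_Mapping.keys b \<subseteq> range \<phi>"
        using True by (auto simp: keys_add_nat)
      then show "(case case p of (a, b) \<Rightarrow> (?mk a, ?mk b) of (a, b) \<Rightarrow> (push \<phi> a, push \<phi> b)) = p"
        using p assms by (simp add: push_map_key)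
      show "(case p of (a, b) \<Rightarrow> (?mk a, ?mk b)) \<in> {(a, b). a + b = ?mk m}"
        using p assms by (auto simp: map_key_add)
    next
      fix p assume "p \<in> {(a, b). a + b = ?mk m}"
      then obtain a b where p: "p = (a, b)" "a + b = ?mk m" by auto
      show "(case case p of (a, b) \<Rightarrow> (push \<phi> a, push \<phi> b) of (a, b) \<Rightarrow> (?mk a, ?mk b)) = p"
        using p assms by (simp add: map_key_push)
      show "(case p of (a, b) \<Rightarrow> (push \<phi> a, push \<phi> b)) \<in> {(a, b). a + b = m}"
        using p assms True by (auto simp: push_add[symmetric] push_map_key)
      show "(case case p of (a, b) \<Rightarrow> (push \<phi> a, push \<phi> b) of (a, b) \<Rightarrow>
          mps_nth (mps_rename \<phi> f) a * mps_nth (mps_rename \<phi> g) b) = (case p of (a, b) \<Rightarrow> mps_nth f a * mps_nth g b)"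
        using p assms keys_push[of \<phi> a] keys_push[of \<phi> b] by (simp add: mps_nth_rename map_key_push)
    qed
    finally show ?thesis by (simp add: mps_nth_mult)
  next
    case False
    have "(\<Sum>(a, b)\<in>{(a, b). a + b = m}. mps_nth (mps_rename \<phi> f) a * mps_nth (mps_rename \<phi> g) b) = 0"
    proof (intro sum.neutral ballI)
      fix p assume "p \<in> {(a, b). a + b = m}"
      then obtain a b where p: "p = (a, b)" "a + b = m" by auto
      then have "\<not> Poly_Mapping.keys a \<subseteq> range \<phi> \<or> \<not> Poly_Mapping.keys b \<subseteq> range \<phi>"
        using False by (auto simp: keys_add_nat)
      then show "(case p of (a, b) \<Rightarrow> mps_nth (mps_rename \<phi> f) a * mps_nth (mps_rename \<phi> g) b) = 0"
        using p by (auto simp: mps_nth_rename)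
    qed
    then show ?thesis using False by (simp add: mps_nth_rename mps_nth_mult)
  qed
qed

text \<open>An exponent vector in two alphabets splits uniquely into its two parts, so a single term
  of the convolution survives.\<close>

lemma mps_nth_Inl_mult_Inr:
  fixes f :: "('v, 'a::comm_ring_1) mpser" and g :: "('w, 'a) mpser"
  shows "mps_nth (mps_rename Inl f * mps_rename Inr g) m =
    mps_nth f (Poly_Mapping.map_key Inl m) * mps_nth g (Poly_Mapping.map_key Inr m)"
proof -
  let ?l = "Poly_Mapping.map_key Inl :: ('v + 'w \<Rightarrow>\<^sub>0 nat) \<Rightarrow> _"
  let ?r = "Poly_Mapping.map_key Inr :: ('v + 'w \<Rightarrow>\<^sub>0 nat) \<Rightarrow> _"
  have inj: "inj (Inl :: 'v \<Rightarrow> 'v + 'w)" "inj (Inr :: 'w \<Rightarrow> 'v + 'w)" by auto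
  have m: "push Inl (?l m) + push Inr (?r m) = m"
  proof (rule poly_mapping_eqI)
    fix k :: "'v + 'w"
    show "Poly_Mapping.lookup (push Inl (?l m) + push Inr (?r m)) k = Poly_Mapping.lookup m k"
    proof (cases k)
      case (Inl a)
      then have "k \<notin> range Inr" by auto
      from lookup_push_notin[OF this] show ?thesis
        using Inl inj by (simp add: lookup_add lookup_push lookup_map_key)
    next
      case (Inr a)
      then have "k \<notin> range Inl" by auto
      from lookup_push_notin[OF this] show ?thesis
        using Inr inj by (simp add: lookup_add lookup_push lookup_map_key)
    qed
  qed
  have "mps_nth (mps_rename Inl f * mps_rename Inr g) m =
      (\<Sum>p\<in>{(a, b). a + b = m}. if p = (push Inl (?l m), push Inr (?r m)) then mps_nth f (?l m) * mps_nth g (?r m) else 0)"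
    unfolding mps_nth_mult
  proof (intro sum.cong refl)
    fix p assume "p \<in> {(a, b). a + b = m}"
    then obtain a b where p: "p = (a, b)" "a + b = m" by auto
    show "(case p of (a, b) \<Rightarrow> mps_nth (mps_rename Inl f) a * mps_nth (mps_rename Inr g) b) =
       (if p = (push Inl (?l m), push Inr (?r m)) then mps_nth f (?l m) * mps_nth g (?r m) else 0)"
    proof (cases "Poly_Mapping.keys a \<subseteq> range Inl \<and> Poly_Mapping.keys b \<subseteq> range Inr")
      case True
      have "?l b = 0" "?r a = 0"
      proof -
        have "Inl v \<notin> Poly_Mapping.keys b" for v :: 'v using True by blast
        then show "?l b = 0" using inj by (intro poly_mapping_eqI) (simp add: lookup_map_key in_keys_iff)
        have "Inr v \<notin> Poly_Mapping.keys a" for v :: 'w using True by blast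
        then show "?r a = 0" using inj by (intro poly_mapping_eqI) (simp add: lookup_map_key in_keys_iff)
      qed
      then have "?l m = ?l a" "?r m = ?r b"
        using p inj map_key_add[OF inj(1), of a b] map_key_add[OF inj(2), of a b] by auto
      then show ?thesis using True p inj by (simp add: mps_nth_rename push_map_key)
    next
      case False
      then have "p \<noteq> (push Inl (?l m), push Inr (?r m))" using p keys_push[of Inl "?l m"] keys_push[of Inr "?r m"] by blast
      then show ?thesis using False p by (auto simp: mps_nth_rename)
    qed
  qed
  also have "\<dots> = mps_nth f (?l m) * mps_nth g (?r m)"
    using finite_exponent_splits[of m] m by (simp add: sum.delta)
  finally show ?thesis .
qed

lemma map_key_pushes:
  fixes a :: "'v \<Rightarrow>\<^sub>0 nat" and b :: "'w \<Rightarrow>\<^sub>0 nat"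
  shows "Poly_Mapping.map_key Inl (push Inl a + push Inr b) = a"
    and "Poly_Mapping.map_key Inr (push Inl a + push Inr b) = b"
proof -
  have inj: "inj (Inl :: 'v \<Rightarrow> 'v + 'w)" "inj (Inr :: 'w \<Rightarrow> 'v + 'w)" by auto
  have l0: "Poly_Mapping.map_key Inl (push Inr b :: 'v + 'w \<Rightarrow>\<^sub>0 nat) = 0"
    by (rule poly_mapping_eqI) (use inj in \<open>simp add: lookup_map_key lookup_push_notin image_iff\<close>)
  have r0: "Poly_Mapping.map_key Inr (push Inl a :: 'v + 'w \<Rightarrow>\<^sub>0 nat) = 0"
    by (rule poly_mapping_eqI) (use inj in \<open>simp add: lookup_map_key lookup_push_notin image_iff\<close>)
  show "Poly_Mapping.map_key Inl (push Inl a + push Inr b) = a" using inj l0 by (simp add: map_key_add map_key_push)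
  show "Poly_Mapping.map_key Inr (push Inl a + push Inr b) = b" using inj r0 by (simp add: map_key_add map_key_push)
qed

text \<open>Convergence means that each coefficient stabilises from some finite set of summands on.
  A further summand with nonzero coefficient would change it, so only finitely many contribute, and
  the coefficient of the sum is their finite sum.\<close>

lemma has_sum_mpser_iff:
  fixes f :: "'i \<Rightarrow> ('v, 'a::comm_ring_1) mpser"
  shows "(f has_sum s) A \<longleftrightarrow> (\<forall>m. finite {i\<in>A. mps_nth (f i) m \<noteq> 0} \<and>
     mps_nth s m = (\<Sum>i\<in>{i\<in>A. mps_nth (f i) m \<noteq> 0}. mps_nth (f i) m))"
proof -
  have "(\<forall>\<^sub>F F in finite_subsets_at_top A. mps_nth (sum f F) m = mps_nth s m) \<longleftrightarrow>
      finite {i\<in>A. mps_nth (f i) m \<noteq> 0} \<and> mps_nth s m = (\<Sum>i\<in>{i\<in>A. mps_nth (f i) m \<noteq> 0}. mps_nth (f i) m)" for m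
  proof (rule iffI)
    let ?Z = "{i\<in>A. mps_nth (f i) m \<noteq> 0}"
    assume "\<forall>\<^sub>F F in finite_subsets_at_top A. mps_nth (sum f F) m = mps_nth s m"
    then obtain X where "finite X \<and> X \<subseteq> A \<and>
        (\<forall>Y. finite Y \<and> X \<subseteq> Y \<and> Y \<subseteq> A \<longrightarrow> mps_nth (sum f Y) m = mps_nth s m)"
      unfolding eventually_finite_subsets_at_top by (elim exE)
    then have X: "finite X" "X \<subseteq> A"
      and eq: "\<And>Y. finite Y \<Longrightarrow> X \<subseteq> Y \<Longrightarrow> Y \<subseteq> A \<Longrightarrow> mps_nth (sum f Y) m = mps_nth s m"
      by simp_all
    have sub: "?Z \<subseteq> X"
    proof
      fix i assume i: "i \<in> ?Z"
      show "i \<in> X"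
      proof (rule ccontr)
        assume "i \<notin> X"
        then have "mps_nth (sum f (insert i X)) m = mps_nth (f i) m + mps_nth (sum f X) m"
          using X by simp
        moreover have "mps_nth (sum f (insert i X)) m = mps_nth (sum f X) m"
          using eq[of "insert i X"] eq[of X] X i by auto
        ultimately show False using i by simp
      qed
    qed
    moreover have "mps_nth (sum f X) m = (\<Sum>i\<in>?Z. mps_nth (f i) m)"
      unfolding mps_nth_sum using sub X by (intro sum.mono_neutral_right) auto
    ultimately show "finite ?Z \<and> mps_nth s m = (\<Sum>i\<in>?Z. mps_nth (f i) m)"
      using X eq[of X] finite_subset by auto
  next
    let ?Z = "{i\<in>A. mps_nth (f i) m \<noteq> 0}"
    assume Z: "finite ?Z \<and> mps_nth s m = (\<Sum>i\<in>?Z. mps_nth (f i) m)"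
    show "\<forall>\<^sub>F F in finite_subsets_at_top A. mps_nth (sum f F) m = mps_nth s m"
      unfolding eventually_finite_subsets_at_top
    proof (intro exI[of _ ?Z] conjI allI impI)
      fix Y assume Y: "finite Y \<and> ?Z \<subseteq> Y \<and> Y \<subseteq> A"
      show "mps_nth (sum f Y) m = mps_nth s m"
        unfolding mps_nth_sum conjunct2[OF Z] using Y by (intro sum.mono_neutral_right) auto
    qed (use Z in auto)
  qed
  then show ?thesis
    unfolding has_sum_def tendsto_mpser_iff by simp
qed

lemma mps_nth_infsum:
  fixes f :: "'i \<Rightarrow> ('v, 'a::comm_ring_1) mpser"
  assumes "\<And>m. finite {i\<in>A. mps_nth (f i) m \<noteq> 0}"
  shows "mps_nth (infsum f A) m = (\<Sum>i\<in>{i\<in>A. mps_nth (f i) m \<noteq> 0}. mps_nth (f i) m)"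
proof -
  have "(f has_sum Abs_mpser (\<lambda>m. \<Sum>i\<in>{i\<in>A. mps_nth (f i) m \<noteq> 0}. mps_nth (f i) m)) A"
    unfolding has_sum_mpser_iff using assms by (simp add: Abs_mpser_inverse)
  then show ?thesis
    by (simp add: infsumI Abs_mpser_inverse)
qed

section \<open>Shifted set-valued tableaux\<close>

lemma cnt_antimono: "finite S \<Longrightarrow> c \<le> d \<Longrightarrow> cnt S d \<le> cnt S c"
  unfolding cnt_def by (rule card_mono) auto

text \<open>This is where the parts being distinct enters: a site holds at most one particle, so
  raising the content by one loses at most one box.\<close>

lemma cnt_le_add:
  assumes "finite S"
  shows "cnt S c \<le> cnt S (c + d) + d"
proof (induction d)
  case (Suc d)
  then show ?case using cnt_rec[OF assms, of "c + d"] by (cases "Suc (c + d) \<in> S") auto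
qed simp

text \<open>On the diagonal of content \<open>c\<close> the boxes occupy the rows from 1 to
  \<open>cnt S c\<close>; this gives the shifted diagram without listing the parts in order.\<close>

definition dgm :: "nat set \<Rightarrow> (nat \<times> nat) set" where
  "dgm S = {(i, j). 1 \<le> i \<and> i \<le> j \<and> i \<le> cnt S (j - i)}"

lemma mem_dgm: "(i, i + c) \<in> dgm S \<longleftrightarrow> 1 \<le> i \<and> i \<le> cnt S c"
  by (auto simp: dgm_def)

lemma dgmD: "(i, j) \<in> dgm S \<Longrightarrow> 1 \<le> i \<and> i \<le> j \<and> i \<le> cnt S (j - i)"
  by (simp add: dgm_def)

lemma dgm_eq_UN:
  assumes "S \<subseteq> {1..M}"
  shows "dgm S = (\<Union>c<M. (\<lambda>i. (i, i + c)) ` {1..cnt S c})"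
proof -
  have "\<exists>c<M. (i, j) \<in> (\<lambda>i. (i, i + c)) ` {1..cnt S c}" if "(i, j) \<in> dgm S" for i j
  proof (intro exI[of _ "j - i"] conjI)
    show "j - i < M" using dgmD[OF that] cnt_eq_0[OF assms, of "j - i"] by (cases "j - i < M") auto
    show "(i, j) \<in> (\<lambda>i'. (i', i' + (j - i))) ` {1..cnt S (j - i)}"
      using dgmD[OF that] by force
  qed
  then have "dgm S \<subseteq> (\<Union>c<M. (\<lambda>i. (i, i + c)) ` {1..cnt S c})" by fast
  then show ?thesis by (auto simp: mem_dgm)
qed

lemma finite_dgm: "S \<subseteq> {1..M} \<Longrightarrow> finite (dgm S)"
  by (subst dgm_eq_UN) auto

lemma card_dgm:
  assumes "S \<subseteq> {1..M}"
  shows "card (dgm S) = \<Sum>S"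
proof -
  have "card (dgm S) = (\<Sum>c<M. card ((\<lambda>i. (i, i + c)) ` {1..cnt S c}))"
    unfolding dgm_eq_UN[OF assms] by (intro card_UN_disjoint) auto
  also have "\<dots> = (\<Sum>c<M. cnt S c)"
    by (intro sum.cong refl) (subst card_image, auto simp: inj_on_def)
  finally show ?thesis by (simp add: sum_eq_sum_cnt[OF assms])
qed

text \<open>In a decreasing list the parts greater than \<open>c\<close> form an initial segment, of
  length \<open>cnt (set lam) c\<close>.\<close>

lemma cnt_strict_partition:
  assumes "sorted_wrt (>) lam" "1 \<le> i"
  shows "i \<le> cnt (set lam) c \<longleftrightarrow> i \<le> length lam \<and> c < lam ! (i - 1)"
  using assms
proof (induction lam arbitrary: i)
  case (Cons a lam)
  have a: "a \<notin> set lam" using Cons.prems by auto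
  have split: "{p \<in> set (a # lam). c < p} = (if c < a then {a} else {}) \<union> {p \<in> set lam. c < p}"
    by auto
  have cnt: "cnt (set (a # lam)) c = (if c < a then 1 else 0) + cnt (set lam) c"
    unfolding cnt_def split using a by (subst card_Un_disjoint) auto
  have 0: "cnt (set lam) c = 0" if "\<not> c < a"
  proof -
    have "{p \<in> set lam. c < p} = {}" using that Cons.prems(1) by force
    then show ?thesis unfolding cnt_def by (simp only: card.empty)
  qed
  show ?case
  proof (cases "i = 1")
    case True
    then show ?thesis using cnt 0 by auto
  next
    case False
    then obtain i' where i': "i = Suc i'" "1 \<le> i'" using Cons.prems by (cases i) auto
    have "i' \<le> cnt (set lam) c \<longleftrightarrow> i' \<le> length lam \<and> c < lam ! (i' - 1)"
      using Cons.IH Cons.prems i' by simp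
    moreover have "(a # lam) ! (i - 1) = lam ! (i' - 1)" using i' by (cases i') auto
    ultimately show ?thesis using cnt 0 i' by (cases "c < a") auto
  qed
qed (simp add: cnt_def)

lemma shifted_diagram_eq:
  assumes "lam \<in> strict_partitions"
  shows "shifted_diagram lam = dgm (set lam)"
proof -
  have lam: "sorted_wrt (>) lam" using assms by (simp add: strict_partitions_def)
  have "(i, j) \<in> shifted_diagram lam \<longleftrightarrow> (i, j) \<in> dgm (set lam)" for i j
  proof
    assume "(i, j) \<in> shifted_diagram lam"
    then obtain j' where j': "j = i + j' - 1" "1 \<le> i" "i \<le> length lam" "1 \<le> j'" "j' \<le> lam ! (i - 1)"
      by (auto simp: shifted_diagram_def)
    then obtain c where "j' = Suc c" by (cases j') auto
    then show "(i, j) \<in> dgm (set lam)"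
      using j' cnt_strict_partition[OF lam j'(2), of c] by (simp add: mem_dgm)
  next
    assume "(i, j) \<in> dgm (set lam)"
    then have "1 \<le> i" "i \<le> j" "i \<le> length lam \<and> j - i < lam ! (i - 1)"
      using dgmD cnt_strict_partition[OF lam, of i "j - i"] by blast+
    then show "(i, j) \<in> shifted_diagram lam"
      unfolding shifted_diagram_def by (auto intro!: exI[of _ "Suc (j - i)"])
  qed
  then show ?thesis by auto
qed

lemma strict_partitions_props:
  assumes "lam \<in> strict_partitions"
  shows "finite (set lam)" "set lam \<subseteq> {1..Max (insert 1 (set lam))}" "sum_list lam = \<Sum>(set lam)"
proof -
  have "distinct lam" using assms by (induction lam) (auto simp: strict_partitions_def)
  then show "sum_list lam = \<Sum>(set lam)" by (simp add: distinct_sum_list_conv_Sum)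
  show "set lam \<subseteq> {1..Max (insert 1 (set lam))}"
    using assms by (auto simp: strict_partitions_def Suc_le_eq)
qed auto

lemma cnt_rem_box_eq:
  assumes "S \<subseteq> {1..M}" "removable c S"
  shows "cnt (rem_box c S) d = (if d = c then cnt S c - 1 else cnt S d)"
proof -
  have fin: "finite S" using assms(1) by (rule finite_subset) simp
  have 0: "0 \<notin> S" using assms(1) by auto
  have c: "Suc c \<in> S" using assms(2) by (simp add: removable_def)
  have "{p \<in> rem_box c S. c < p} = {p \<in> S. c < p} - {Suc c}"
    by (auto simp: rem_box_def)
  then have "cnt (rem_box c S) c = cnt S c - 1"
    using c fin by (simp add: cnt_def)
  moreover have "cnt (rem_box c S) d = cnt S d" if "d \<noteq> c"
  proof (cases "c = 0")
    case True
    then have "{p \<in> rem_box c S. d < p} = {p \<in> S. d < p}" using that by (auto simp: rem_box_def)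
    then show ?thesis by (simp add: cnt_def)
  next
    case False
    then show ?thesis using cnt_rem_box[OF fin assms(2) that _ 0] by simp
  qed
  ultimately show ?thesis by simp
qed

lemma dgm_rem_box:
  assumes "S \<subseteq> {1..M}" "removable c S"
  shows "dgm (rem_box c S) = dgm S - {(cnt S c, cnt S c + c)}"
proof -
  have "(i, j) \<in> dgm (rem_box c S) \<longleftrightarrow> (i, j) \<in> dgm S - {(cnt S c, cnt S c + c)}" for i j
  proof (cases "i \<le> j")
    case True
    then obtain d where "j = i + d" using le_Suc_ex by blast
    then show ?thesis using cnt_rem_box_eq[OF assms, of d] by (auto simp: mem_dgm)
  qed (auto simp: dgm_def)
  then show ?thesis by auto
qed

text \<open>The box to the right has content \<open>c + 1\<close>, whose count is smaller by one
  because \<open>Suc c\<close> is a part; the box below has content \<open>c - 1\<close>, whose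
  count is the same because \<open>c\<close> is not. Below content 0 there is no box.\<close>

lemma removable_corner:
  assumes "S \<subseteq> {1..M}" "removable c S"
  defines "i \<equiv> cnt S c"
  shows "(i, i + c) \<in> dgm S" "(i, Suc (i + c)) \<notin> dgm S" "(Suc i, i + c) \<notin> dgm S"
proof -
  have fin: "finite S" using assms(1) by (rule finite_subset) simp
  have "cnt S c = Suc (cnt S (Suc c))" using cnt_rec[OF fin, of c] assms(2) by (simp add: removable_def)
  then show "(i, i + c) \<in> dgm S" "(i, Suc (i + c)) \<notin> dgm S"
    using mem_dgm[of i c S] mem_dgm[of i "Suc c" S] by (simp_all add: i_def)
  show "(Suc i, i + c) \<notin> dgm S"
  proof (cases c)
    case 0
    then show ?thesis by (simp add: dgm_def)
  next
    case (Suc c')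
    then have "cnt S c' = cnt S c" using cnt_rec[OF fin, of c'] assms(2) by (simp add: removable_def)
    then show ?thesis using mem_dgm[of "Suc i" c' S] Suc by (simp add: i_def)
  qed
qed

lemma corner_removable:
  assumes "finite S" "(i, i + c) \<in> dgm S" "(i, Suc (i + c)) \<notin> dgm S" "(Suc i, i + c) \<notin> dgm S"
  shows "removable c S" "i = cnt S c"
proof -
  have i: "1 \<le> i" "i \<le> cnt S c" "\<not> i \<le> cnt S (Suc c)"
    using assms mem_dgm[of i c S] mem_dgm[of i "Suc c" S] by auto
  have r: "cnt S c = cnt S (Suc c) + of_bool (Suc c \<in> S)" by (rule cnt_rec[OF assms(1)])
  show "i = cnt S c" using i r by (cases "Suc c \<in> S") auto
  have "Suc c \<in> S" using i r by (cases "Suc c \<in> S") auto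
  moreover have "c \<notin> S" if "c = Suc c'" for c'
    using mem_dgm[of "Suc i" c' S] assms(4) that i cnt_rec[OF assms(1), of c'] by auto
  ultimately show "removable c S" by (cases c) (auto simp: removable_def)
qed

text \<open>\<open>W\<close> holds the permitted pairs of letter and content, so that tableaux can
  be built up pair by pair. The order conditions compare entries instead of \<open>Max\<close> and
  \<open>Min\<close>, which gives them a meaning for a box that is temporarily empty. Odd letters
  are the unprimed ones.\<close>

definition svalid :: "(nat \<times> nat) set \<Rightarrow> (nat \<times> nat) set \<Rightarrow> (nat \<times> nat \<Rightarrow> nat set) \<Rightarrow> bool" where
  "svalid D W T \<longleftrightarrow> (\<forall>b\<in>D. finite (T b)) \<and>
     (\<forall>i j k k'. (i, j) \<in> D \<longrightarrow> (Suc i, j) \<in> D \<longrightarrow> k \<in> T (i, j) \<longrightarrow> k' \<in> T (Suc i, j) \<longrightarrow> k \<le> k') \<and>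
     (\<forall>i j k k'. (i, j) \<in> D \<longrightarrow> (i, Suc j) \<in> D \<longrightarrow> k \<in> T (i, j) \<longrightarrow> k' \<in> T (i, Suc j) \<longrightarrow> k \<le> k') \<and>
     (\<forall>i i' j k. odd k \<longrightarrow> (i, j) \<in> D \<longrightarrow> (i', j) \<in> D \<longrightarrow> k \<in> T (i, j) \<longrightarrow> k \<in> T (i', j) \<longrightarrow> i = i') \<and>
     (\<forall>i j j' k. even k \<longrightarrow> (i, j) \<in> D \<longrightarrow> (i, j') \<in> D \<longrightarrow> k \<in> T (i, j) \<longrightarrow> k \<in> T (i, j') \<longrightarrow> j = j') \<and>
     (\<forall>i j k. (i, j) \<in> D \<longrightarrow> k \<in> T (i, j) \<longrightarrow> (k, j - i) \<in> W)"

lemmas svalid_finite = svalid_def[THEN iffD1, THEN conjunct1, rule_format]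
lemmas svalid_col_le = svalid_def[THEN iffD1, THEN conjunct2, THEN conjunct1, rule_format]
lemmas svalid_row_le = svalid_def[THEN iffD1, THEN conjunct2, THEN conjunct2, THEN conjunct1, rule_format]
lemmas svalid_odd = svalid_def[THEN iffD1, THEN conjunct2, THEN conjunct2, THEN conjunct2, THEN conjunct1, rule_format]
lemmas svalid_even = svalid_def[THEN iffD1, THEN conjunct2, THEN conjunct2, THEN conjunct2, THEN conjunct2, THEN conjunct1, rule_format]
lemmas svalidW = svalid_def[THEN iffD1, THEN conjunct2, THEN conjunct2, THEN conjunct2, THEN conjunct2, THEN conjunct2, rule_format]

definition stab :: "(nat \<times> nat) set \<Rightarrow> (nat \<times> nat) set \<Rightarrow> (nat \<times> nat \<Rightarrow> nat set) set" where
  "stab D W = {T \<in> extensional D. (\<forall>b\<in>D. T b \<noteq> {}) \<and> svalid D W T}"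

lemma finite_stab:
  assumes "finite D" "finite W"
  shows "finite (stab D W)"
proof (rule finite_subset)
  show "stab D W \<subseteq> PiE D (\<lambda>_. Pow (fst ` W))"
  proof
    fix T assume T: "T \<in> stab D W"
    have "T b \<subseteq> fst ` W" if "b \<in> D" for b
    proof
      fix k assume "k \<in> T b"
      then have "(k, snd b - fst b) \<in> W"
        using svalidW[of D W T "fst b" "snd b" k] T that by (simp add: stab_def)
      then show "k \<in> fst ` W" by force
    qed
    then show "T \<in> PiE D (\<lambda>_. Pow (fst ` W))" using T by (auto simp: stab_def PiE_def)
  qed
qed (use assms in \<open>auto intro!: finite_PiE\<close>)

text \<open>
  The order in which entries \<open>(k, c)\<close> (letter \<open>k\<close> in a box of content \<open>c\<close>) are inserted: with this
  order every new entry goes into a corner.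
\<close>

definition step_before :: "nat \<times> nat \<Rightarrow> nat \<times> nat \<Rightarrow> bool" where
  "step_before u w \<longleftrightarrow> fst u < fst w \<or> fst u = fst w \<and> (if odd (fst u) then snd u < snd w else snd w < snd u)"

definition box_weight :: "'r::comm_ring_1 \<Rightarrow> (nat \<Rightarrow> 'r) \<Rightarrow> nat set \<Rightarrow> 'r" where
  "box_weight b v A = b ^ (card A - 1) * (\<Prod>k\<in>A. v (k div 2))"

definition stab_gen :: "'r::comm_ring_1 \<Rightarrow> (nat \<Rightarrow> 'r) \<Rightarrow> (nat \<times> nat) set \<Rightarrow> nat set \<Rightarrow> 'r" where
  "stab_gen b v W S = (\<Sum>T\<in>stab (dgm S) W. \<Prod>B\<in>dgm S. box_weight b v (T B))"

lemma stab_new_entry: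
  assumes S: "S \<subseteq> {1..M}" and T: "T \<in> stab (dgm S) (insert (k, c) W)"
    and lt: "\<And>u. u \<in> W \<Longrightarrow> step_before u (k, c)" and i: "(i, i + c) \<in> dgm S" "k \<in> T (i, i + c)"
  shows "removable c S" "i = cnt S c"
proof -
  have fin: "finite S" using S by (rule finite_subset) simp
  have ne: "B \<in> dgm S \<Longrightarrow> T B \<noteq> {}" for B using T by (simp add: stab_def)
  have v: "svalid (dgm S) (insert (k, c) W) T" using T by (simp add: stab_def)
  have W: "(k', j' - i') \<in> insert (k, c) W" if "(i', j') \<in> dgm S" "k' \<in> T (i', j')" for i' j' k'
    using svalidW[OF v that] .
  have eq: "k' = k \<and> (d \<noteq> c \<longrightarrow> (if odd k then d < c else c < d))" if "(k', d) \<in> insert (k, c) W" "k \<le> k'" for k' d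
    using that lt[of "(k', d)"] by (auto simp: step_before_def split: if_splits)
  have 1: "(i, Suc (i + c)) \<notin> dgm S"
  proof
    assume r: "(i, Suc (i + c)) \<in> dgm S"
    then obtain k' where k': "k' \<in> T (i, Suc (i + c))" using ne by blast
    have "k \<le> k'" by (rule svalid_row_le[OF v i(1) r i(2) k'])
    with eq[OF W[OF r k']] have "k' = k" "even k" by (auto split: if_splits)
    then show False using svalid_even[OF v _ i(1) r i(2)] k' by simp
  qed
  have 2: "(Suc i, i + c) \<notin> dgm S"
  proof
    assume r: "(Suc i, i + c) \<in> dgm S"
    then obtain k' where k': "k' \<in> T (Suc i, i + c)" using ne by blast
    have "k \<le> k'" by (rule svalid_col_le[OF v i(1) r i(2) k'])
    moreover have "c \<noteq> 0" using r by (auto simp: dgm_def)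
    ultimately have "k' = k" "odd k" using eq[OF W[OF r k']] by (auto split: if_splits)
    then show False using svalid_odd[OF v _ i(1) r i(2)] k' by simp
  qed
  show "removable c S" "i = cnt S c" using corner_removable[OF fin i(1) 1 2] by auto
qed

text \<open>All earlier letters are at most \<open>k\<close>, so the inequalities survive at a
  corner. Another odd \<open>k\<close> in its column would have content below \<open>c\<close> and
  hence lie under the corner; another even \<open>k\<close> in its row would have content above
  \<open>c\<close> and hence lie to its right.\<close>

lemma svalid_insert_entry:
  assumes S: "S \<subseteq> {1..M}" and rem: "removable c S" and T: "svalid (dgm S) W T"
    and lt: "\<And>u. u \<in> W \<Longrightarrow> step_before u (k, c)"
  defines "B \<equiv> (cnt S c, cnt S c + c)"
  shows "svalid (dgm S) (insert (k, c) W) (T(B := insert k (T B)))"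
proof -
  let ?D = "dgm S" and ?i = "cnt S c"
  have fin: "finite S" using S by (rule finite_subset) simp
  note cor = removable_corner[OF S rem]
  have le: "k' \<le> k" if "(i, j) \<in> ?D" "k' \<in> T (i, j)" for i j k'
    using lt[OF svalidW[OF T that]] by (auto simp: step_before_def)
  have col: False if "odd k" "(i, ?i + c) \<in> ?D" "k \<in> T (i, ?i + c)" for i
  proof -
    have "(k, ?i + c - i) \<in> W" by (rule svalidW[OF T that(2,3)])
    from lt[OF this] have "?i + c - i < c" using that by (simp add: step_before_def)
    then have i: "?i < i" by linarith
    have d: "1 \<le> i" "i \<le> ?i + c" "i \<le> cnt S (?i + c - i)" using dgmD[OF that(2)] by auto
    have "cnt S (?i + c - i) \<le> cnt S (?i + c - i + (i - Suc ?i)) + (i - Suc ?i)"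
      by (rule cnt_le_add[OF fin])
    also have "?i + c - i + (i - Suc ?i) = ?i + c - Suc ?i" using i d by linarith
    finally have "Suc ?i \<le> cnt S (?i + c - Suc ?i)" using d i by linarith
    then have "(Suc ?i, ?i + c) \<in> ?D" using d i by (simp add: dgm_def)
    then show False using cor by blast
  qed
  have row: False if "even k" "(?i, j) \<in> ?D" "k \<in> T (?i, j)" for j
  proof -
    have "(k, j - ?i) \<in> W" by (rule svalidW[OF T that(2,3)])
    from lt[OF this] have j: "c < j - ?i" using that by (simp add: step_before_def)
    have d: "1 \<le> ?i" "?i \<le> j" "?i \<le> cnt S (j - ?i)" using dgmD[OF that(2)] by auto
    have "?i \<le> cnt S (Suc c)" using cnt_antimono[OF fin, of "Suc c" "j - ?i"] j d by linarith
    then have "(?i, ?i + Suc c) \<in> ?D" using d by (simp only: mem_dgm)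
    then show False using cor by simp
  qed
  show ?thesis
    unfolding svalid_def
  proof (intro conjI allI impI ballI)
    fix A assume "A \<in> ?D"
    then show "finite ((T(B := insert k (T B))) A)" using svalid_finite[OF T] cor(1) by (simp add: B_def)
  next
    fix i j k1 k2
    assume *: "(i, j) \<in> ?D" "(Suc i, j) \<in> ?D" "k1 \<in> (T(B := insert k (T B))) (i, j)"
       "k2 \<in> (T(B := insert k (T B))) (Suc i, j)"
    then have "(i, j) \<noteq> B" using cor by (auto simp: B_def)
    then have k1: "k1 \<in> T (i, j)" using * by simp
    show "k1 \<le> k2"
    proof (cases "k2 \<in> T (Suc i, j)")
      case True
      then show ?thesis using svalid_col_le[OF T *(1,2) k1] by simp
    next
      case False
      then have "k2 = k" using *(4) by (auto split: if_splits)
      then show ?thesis using le[OF *(1) k1] by simp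
    qed
  next
    fix i j k1 k2
    assume *: "(i, j) \<in> ?D" "(i, Suc j) \<in> ?D" "k1 \<in> (T(B := insert k (T B))) (i, j)"
       "k2 \<in> (T(B := insert k (T B))) (i, Suc j)"
    then have "(i, j) \<noteq> B" using cor by (auto simp: B_def)
    then have k1: "k1 \<in> T (i, j)" using * by simp
    show "k1 \<le> k2"
    proof (cases "k2 \<in> T (i, Suc j)")
      case True
      then show ?thesis using svalid_row_le[OF T *(1,2) k1] by simp
    next
      case False
      then have "k2 = k" using *(4) by (auto split: if_splits)
      then show ?thesis using le[OF *(1) k1] by simp
    qed
  next
    fix i i' j k1
    assume *: "odd k1" "(i, j) \<in> ?D" "(i', j) \<in> ?D" "k1 \<in> (T(B := insert k (T B))) (i, j)"
       "k1 \<in> (T(B := insert k (T B))) (i', j)"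
    show "i = i'"
    proof (cases "k1 \<in> T (i, j) \<and> k1 \<in> T (i', j)")
      case True
      then show ?thesis using svalid_odd[OF T *(1-3)] by simp
    next
      case False
      then have "k1 = k" "(i, j) = B \<or> (i', j) = B" using * by (auto split: if_splits)
      then show ?thesis using col[of i] col[of i'] * by (auto simp: B_def split: if_splits)
    qed
  next
    fix i j j' k1
    assume *: "even k1" "(i, j) \<in> ?D" "(i, j') \<in> ?D" "k1 \<in> (T(B := insert k (T B))) (i, j)"
       "k1 \<in> (T(B := insert k (T B))) (i, j')"
    show "j = j'"
    proof (cases "k1 \<in> T (i, j) \<and> k1 \<in> T (i, j')")
      case True
      then show ?thesis using svalid_even[OF T *(1-3)] by simp
    next
      case False
      then have "k1 = k" "(i, j) = B \<or> (i, j') = B" using * by (auto split: if_splits)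
      then show ?thesis using row[of j] row[of j'] * by (auto simp: B_def split: if_splits)
    qed
  next
    fix i j k1
    assume *: "(i, j) \<in> ?D" "k1 \<in> (T(B := insert k (T B))) (i, j)"
    show "(k1, j - i) \<in> insert (k, c) W"
    proof (cases "k1 \<in> T (i, j)")
      case True
      then show ?thesis using svalidW[OF T *(1)] by blast
    next
      case False
      then have "(i, j) = B" "k1 = k" using *(2) by (auto split: if_splits)
      then show ?thesis by (simp add: B_def)
    qed
  qed
qed

lemma svalid_mono: "svalid D W T \<Longrightarrow> (\<And>b. b \<in> D' \<Longrightarrow> T' b \<subseteq> T b) \<Longrightarrow> D' \<subseteq> D \<Longrightarrow>
    (\<And>i j k. (i, j) \<in> D' \<Longrightarrow> k \<in> T' (i, j) \<Longrightarrow> (k, j - i) \<in> W') \<Longrightarrow> svalid D' W' T'"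
  unfolding svalid_def by (intro conjI) (meson finite_subset subsetD)+

lemma svalid_add_empty:
  assumes "svalid (D - {B}) W T"
  shows "svalid D W (T(B := {}))"
  using assms unfolding svalid_def by (intro conjI) (auto split: if_splits)

lemma box_weight_insert:
  assumes "finite A" "k \<notin> A" "A \<noteq> {}"
  shows "box_weight b v (insert k A) = b * v (k div 2) * box_weight b v A"
proof -
  obtain n where "card A = Suc n" using assms by (cases "card A") auto
  then show ?thesis using assms by (simp add: box_weight_def mult_ac)
qed

text \<open>Tableaux either do not use the pair \<open>(k, c)\<close>, or have \<open>k\<close> in
  the corner together with other letters, or have \<open>k\<close> alone in the corner. Deleting
  \<open>k\<close>, respectively the corner, matches these classes with the three terms of
  \<open>box_step\<close>.\<close>

lemma stab_gen_insert:
  fixes b :: "'r::comm_ring_1"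
  assumes S: "S \<subseteq> {1..M}" and W: "finite W" and lt: "\<And>u. u \<in> W \<Longrightarrow> step_before u (k, c)"
  shows "stab_gen b v (insert (k, c) W) S = box_step b (v (k div 2)) c (stab_gen b v W) S"
proof -
  let ?D = "dgm S" and ?B = "(cnt S c, cnt S c + c)" and ?W = "insert (k, c) W"
  let ?wt = "\<lambda>T. \<Prod>B\<in>?D. box_weight b v (T B)"
  have kc: "(k, c) \<notin> W" using lt[of "(k, c)"] by (auto simp: step_before_def)
  have fD: "finite ?D" using finite_dgm[OF S] .
  have new: "removable c S \<and> (i, j) = ?B" if T: "T \<in> stab ?D ?W" and "(i, j) \<in> ?D" "k \<in> T (i, j)" "j - i = c" for T i j
  proof -
    have j: "j = i + c" using dgmD[OF that(2)] that(4) by auto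
    show ?thesis using stab_new_entry[OF S T lt, of i] that unfolding j by blast
  qed
  have sub: "stab ?D W \<subseteq> stab ?D ?W"
    unfolding stab_def using svalid_mono[of ?D W _ ?D _ ?W] svalidW[of ?D W] by blast
  have old: "T \<in> stab ?D W" if T: "T \<in> stab ?D ?W" and "\<not> (removable c S \<and> k \<in> T ?B)" for T
  proof -
    have "svalid ?D W T"
    proof (rule svalid_mono[of ?D ?W T])
      show "svalid ?D ?W T" using T by (simp add: stab_def)
      fix i j k' assume ij: "(i, j) \<in> ?D" "k' \<in> T (i, j)"
      then have "(k', j - i) \<in> ?W" using T svalidW[of ?D ?W T i j k'] by (simp add: stab_def)
      then show "(k', j - i) \<in> W" using new[OF T ij(1)] ij that(2) by auto
    qed auto
    then show ?thesis using T by (simp add: stab_def)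
  qed
  have notk: "k \<notin> T ?B" if "T \<in> stab ?D W" "?B \<in> ?D" for T
    using svalidW[of ?D W T "cnt S c" "cnt S c + c" k] that kc by (auto simp: stab_def)
  show ?thesis
  proof (cases "removable c S")
    case False
    then have "stab ?D ?W = stab ?D W" using sub old by blast
    then show ?thesis using False by (simp add: stab_gen_def box_step_def)
  next
    case True
    note cor = removable_corner[OF S True]
    define A2 where "A2 = {T \<in> stab ?D ?W. k \<in> T ?B \<and> T ?B \<noteq> {k}}"
    define A3 where "A3 = {T \<in> stab ?D ?W. T ?B = {k}}"
    have split: "stab ?D ?W = stab ?D W \<union> A2 \<union> A3"
      using sub old unfolding A2_def A3_def by blast
    have fin: "finite (stab ?D ?W)" using finite_stab[OF fD, of ?W] W by simp
    then have finA: "finite (stab ?D W)" "finite A2" "finite A3" unfolding split by auto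
    have disj: "stab ?D W \<inter> A2 = {}" "(stab ?D W \<union> A2) \<inter> A3 = {}"
      using notk cor(1) by (auto simp: A2_def A3_def)
    have fT: "finite (T B')" if "T \<in> stab ?D W'" "B' \<in> ?D" for T W' B'
      using svalid_finite[of ?D W' T B'] that by (simp add: stab_def)
    have rest: "(\<Prod>B'\<in>?D - {?B}. box_weight b v ((T(?B := A)) B')) = (\<Prod>B'\<in>?D - {?B}. box_weight b v (T B'))" for T A
      by (rule prod.cong) auto
    have wt_split: "?wt T = box_weight b v (T ?B) * (\<Prod>B'\<in>?D - {?B}. box_weight b v (T B'))" for T
      using fD cor(1) by (rule prod.remove)
    have "(\<Sum>T\<in>A2. ?wt T) = (\<Sum>T\<in>stab ?D W. b * v (k div 2) * ?wt T)"
    proof (rule sum.reindex_bij_witness[of _ "\<lambda>T. T(?B := insert k (T ?B))" "\<lambda>T. T(?B := T ?B - {k})"])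
      fix T assume T: "T \<in> A2"
      show "(T(?B := T ?B - {k}))(?B := insert k ((T(?B := T ?B - {k})) ?B)) = T"
        using T by (simp add: A2_def insert_absorb)
      have "svalid ?D W (T(?B := T ?B - {k}))"
      proof (rule svalid_mono[of ?D ?W T])
        show "svalid ?D ?W T" using T by (simp add: A2_def stab_def)
        fix i j k' assume ij: "(i, j) \<in> ?D" "k' \<in> (T(?B := T ?B - {k})) (i, j)"
        then have k': "k' \<in> T (i, j)" by (auto split: if_splits)
        then have "(k', j - i) \<in> ?W" using T ij svalidW[of ?D ?W T i j k'] by (simp add: A2_def stab_def)
        moreover have "(k', j - i) \<noteq> (k, c)"
        proof
          assume "(k', j - i) = (k, c)"
          then have "(i, j) = ?B" "k' = k" using new[of T i j] T ij k' by (auto simp: A2_def)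
          then show False using ij by simp
        qed
        ultimately show "(k', j - i) \<in> W" by blast
      qed auto
      then show "T(?B := T ?B - {k}) \<in> stab ?D W"
        using T cor(1) by (auto simp: A2_def stab_def extensional_def)
      have "T ?B = insert k (T ?B - {k})" using T by (auto simp: A2_def)
      moreover have "finite (T ?B - {k})" "T ?B - {k} \<noteq> {}"
        using T cor(1) fT[of T ?W ?B] by (auto simp: A2_def)
      ultimately have "box_weight b v (T ?B) = b * v (k div 2) * box_weight b v (T ?B - {k})"
        using box_weight_insert[of "T ?B - {k}" k b v] by simp
      then show "b * v (k div 2) * ?wt (T(?B := T ?B - {k})) = ?wt T"
        unfolding wt_split rest by (simp add: mult.assoc)
    next
      fix T assume T: "T \<in> stab ?D W"
      have k: "k \<notin> T ?B" using notk[OF T cor(1)] .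
      show "(T(?B := insert k (T ?B)))(?B := (T(?B := insert k (T ?B))) ?B - {k}) = T"
        using k by auto
      have "svalid ?D ?W (T(?B := insert k (T ?B)))"
        using T by (intro svalid_insert_entry[OF S True _ lt]) (auto simp: stab_def)
      moreover have "T ?B \<noteq> {}" using T cor(1) by (auto simp: stab_def)
      ultimately show "T(?B := insert k (T ?B)) \<in> A2"
        using T cor(1) k by (auto simp: A2_def stab_def extensional_def)
    qed
    \<comment> \<open>Removing the corner from the shape has to reset its value to
      \<open>undefined\<close>, the value off the diagram, to stay among extensional
      fillings.\<close>
    moreover have "(\<Sum>T\<in>A3. ?wt T) = (\<Sum>T\<in>stab (?D - {?B}) W. v (k div 2) * (\<Prod>B\<in>?D - {?B}. box_weight b v (T B)))"
    proof (rule sum.reindex_bij_witness[of _ "\<lambda>T. T(?B := {k})" "\<lambda>T. T(?B := undefined)"])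
      fix T assume T: "T \<in> A3"
      show "(T(?B := undefined))(?B := {k}) = T" using T by (simp add: A3_def fun_upd_idem)
      have "svalid (?D - {?B}) W (T(?B := undefined))"
      proof (rule svalid_mono[of ?D ?W T])
        show "svalid ?D ?W T" using T by (simp add: A3_def stab_def)
        fix i j k' assume ij: "(i, j) \<in> ?D - {?B}" "k' \<in> (T(?B := undefined)) (i, j)"
        then have k': "k' \<in> T (i, j)" by (auto split: if_splits)
        then have "(k', j - i) \<in> ?W" using T ij svalidW[of ?D ?W T i j k'] by (simp add: A3_def stab_def)
        moreover have "(k', j - i) \<noteq> (k, c)"
          using new[of T i j] T ij k' by (auto simp: A3_def)
        ultimately show "(k', j - i) \<in> W" by blast
      qed auto
      then show "T(?B := undefined) \<in> stab (?D - {?B}) W"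
        using T by (auto simp: A3_def stab_def extensional_def)
      show "v (k div 2) * (\<Prod>B\<in>?D - {?B}. box_weight b v ((T(?B := undefined)) B)) = ?wt T"
        unfolding wt_split rest using T by (simp add: A3_def box_weight_def)
    next
      fix T assume T: "T \<in> stab (?D - {?B}) W"
      then have "T ?B = undefined" by (auto simp: stab_def extensional_def)
      then show "(T(?B := {k}))(?B := undefined) = T" by (metis fun_upd_triv fun_upd_upd)
      have "svalid ?D W (T(?B := {}))" using T by (intro svalid_add_empty) (simp add: stab_def)
      from svalid_insert_entry[OF S True this lt]
      have "svalid ?D ?W (T(?B := {k}))" by simp
      then show "T(?B := {k}) \<in> A3"
        using T cor(1) by (auto simp: A3_def stab_def extensional_def)
    qed
    ultimately show ?thesis
      unfolding stab_gen_def box_step_def split using True finA disj dgm_rem_box[OF S True]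
      by (simp add: sum.union_disjoint sum_distrib_left add.assoc)
  qed
qed

lemma stab_gen_fold:
  assumes "sorted_wrt step_before us" "finite W" "\<And>w u. w \<in> W \<Longrightarrow> u \<in> set us \<Longrightarrow> step_before w u"
    and "\<And>u. u \<in> set us \<Longrightarrow> v (fst u div 2) = x" "\<And>u. u \<in> set us \<Longrightarrow> snd u < M" "S \<subseteq> {1..M}"
  shows "stab_gen b v (W \<union> set us) S = fold (box_step b x) (map snd us) (stab_gen b v W) S"
  using assms
proof (induction us arbitrary: W)
  case (Cons u us)
  have "stab_gen b v (W \<union> set (u # us)) S = stab_gen b v (insert u W \<union> set us) S" by simp
  also have "\<dots> = fold (box_step b x) (map snd us) (stab_gen b v (insert u W)) S"
  proof (rule Cons.IH)
    fix w u' assume "w \<in> insert u W" "u' \<in> set us"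
    then show "step_before w u'" using Cons.prems(1) Cons.prems(3)[of w u'] by auto
  next
    fix u' assume "u' \<in> set us"
    then show "v (fst u' div 2) = x" "snd u' < M" using Cons.prems(4,5)[of u'] by simp_all
  qed (use Cons.prems(1,2,6) in simp_all)
  also have "\<dots> = fold (box_step b x) (map snd us) (box_step b x (snd u) (stab_gen b v W)) S"
  proof (rule fold_box_step_cong)
    fix S' assume S': "S' \<subseteq> {1..M}"
    show "stab_gen b v (insert u W) S' = box_step b x (snd u) (stab_gen b v W) S'"
      using stab_gen_insert[OF S' Cons.prems(2), of "fst u" "snd u" b v] Cons.prems(3)[of _ u] Cons.prems(4)[of u] by simp
  next
    fix c assume "c \<in> set (map snd us)"
    then show "c < M" using Cons.prems(5) by force
  qed (rule Cons.prems(6))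
  finally show ?case by simp
qed simp

text \<open>The letters of the first \<open>n\<close> variables on the contents below
  \<open>M\<close>; without \<open>pm\<close> the pairs with a primed letter on the diagonal are
  left out.\<close>

definition letters :: "bool \<Rightarrow> nat \<Rightarrow> nat \<Rightarrow> (nat \<times> nat) set" where
  "letters pm M n = {(k, c). k < 2 * n \<and> c < M \<and> (pm \<or> odd k \<or> c \<noteq> 0)}"

lemma finite_letters: "finite (letters pm M n)"
  by (rule finite_subset[of _ "{..<2 * n} \<times> {..<M}"]) (auto simp: letters_def)

lemma stab_gen_empty:
  assumes "S \<subseteq> {1..M}"
  shows "stab_gen b v {} S = (if S = {} then 1 else 0)"
proof (cases "S = {}")
  case True
  then have "dgm S = {}" by (auto simp: dgm_def cnt_def)
  moreover have "stab {} {} = {\<lambda>_. undefined}"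
    by (auto simp: stab_def svalid_def extensional_def)
  ultimately show ?thesis using True by (simp add: stab_gen_def)
next
  case False
  have "finite S" using assms by (rule finite_subset) simp
  then have "0 < \<Sum>S" using False sum_le_0_empty[OF assms] by (cases "\<Sum>S") auto
  then obtain i j where B: "(i, j) \<in> dgm S" using card_dgm[OF assms] by (cases "dgm S = {}") auto
  have "stab (dgm S) {} = {}"
  proof (rule ccontr)
    assume "stab (dgm S) {} \<noteq> {}"
    then obtain T where T: "T \<in> stab (dgm S) {}" by blast
    then obtain k where "k \<in> T (i, j)" using B by (auto simp: stab_def)
    then show False using T B svalidW[of "dgm S" "{}" T i j k] by (simp add: stab_def)
  qed
  then show ?thesis using False by (simp add: stab_gen_def)
qed

text \<open>The pairs of a new variable are appended in insertion order, the primed letter by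
  decreasing and the unprimed one by increasing content; the list of their contents is
  \<open>var_steps\<close>.\<close>

lemma stab_gen_letters:
  assumes S: "S \<subseteq> {1..M}" and M: "1 \<le> M"
  shows "stab_gen b v (letters pm M n) S = grow M pm b (map v (rev [0..<n])) S"
  using S
proof (induction n arbitrary: S)
  case 0
  then show ?case by (simp add: letters_def stab_gen_empty grow_Nil)
next
  case (Suc n)
  define us where "us = map (\<lambda>c. (2 * n, c)) (rev [1..<M]) @ (if pm then [(2 * n, 0)] else []) @
    map (\<lambda>c. (2 * n + 1, c)) [0..<M]"
  have snd: "map snd us = var_steps pm M"
    using M by (simp add: us_def var_steps_def bd_steps_def o_def upt_rec[of 0 M] del: upt_Suc)
  have p: "step_before (2 * n, c) (2 * n, d) \<longleftrightarrow> d < c" "step_before (Suc (2 * n), c) (Suc (2 * n), d) \<longleftrightarrow> c < d"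
    "step_before (2 * n, c) (Suc (2 * n), d)" for c d
    by (auto simp: step_before_def)
  have "sorted_wrt step_before us"
    by (auto simp: us_def sorted_wrt_append sorted_wrt_map sorted_wrt_rev p)
  moreover have "letters pm M (Suc n) = letters pm M n \<union> set us"
  proof -
    have us: "set us = {2 * n} \<times> {1..<M} \<union> (if pm then {(2 * n, 0)} else {}) \<union> {2 * n + 1} \<times> {0..<M}"
      by (auto simp: us_def)
    have "(k, c) \<in> letters pm M (Suc n) \<longleftrightarrow> (k, c) \<in> letters pm M n \<union> set us" for k c
    proof -
      have "k < 2 * Suc n \<longleftrightarrow> k < 2 * n \<or> k = 2 * n \<or> k = 2 * n + 1" by arith
      then show ?thesis
        unfolding us letters_def mem_Collect_eq case_prod_conv using M by (cases c) (auto split: if_splits)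
    qed
    then show ?thesis by (intro set_eqI) (simp add: split_paired_all del: Un_iff)
  qed
  ultimately have "stab_gen b v (letters pm M (Suc n)) S = fold (box_step b (v n)) (map snd us) (stab_gen b v (letters pm M n)) S"
    using Suc.prems finite_letters M
    by (simp only:) (rule stab_gen_fold[where M = M], auto simp: us_def letters_def step_before_def split: if_splits)
  also have "\<dots> = fold (box_step b (v n)) (map snd us) (grow M pm b (map v (rev [0..<n]))) S"
    using Suc M by (intro fold_box_step_cong[where M = M]) (auto simp: us_def split: if_splits)
  finally show ?case by (simp add: snd grow_Cons)
qed

section \<open>Shifted plane partitions\<close>

lemma dgm_left:
  assumes "finite S" "(i, j') \<in> dgm S" "i \<le> j" "j \<le> j'"
  shows "(i, j) \<in> dgm S"
  using dgmD[OF assms(2)] cnt_antimono[OF assms(1), of "j - i" "j' - i"] diff_le_mono[OF assms(4), of i] assms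
  by (simp add: dgm_def)

lemma dgm_up:
  assumes "finite S" "(i', j) \<in> dgm S" "1 \<le> i" "i \<le> i'"
  shows "(i, j) \<in> dgm S"
proof -
  have d: "i' \<le> j" "i' \<le> cnt S (j - i')" using dgmD[OF assms(2)] by auto
  have "cnt S (j - i') \<le> cnt S (j - i' + (i' - i)) + (i' - i)" by (rule cnt_le_add[OF assms(1)])
  also have "j - i' + (i' - i) = j - i" using d assms by linarith
  finally show ?thesis using d assms by (simp add: dgm_def)
qed

lemma dgm_subset_iff: "dgm R \<subseteq> dgm S \<longleftrightarrow> (\<forall>c. cnt R c \<le> cnt S c)"
proof
  assume sub: "dgm R \<subseteq> dgm S"
  show "\<forall>c. cnt R c \<le> cnt S c"
  proof
    fix c
    show "cnt R c \<le> cnt S c"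
    proof (cases "cnt R c = 0")
      case False
      then have "(cnt R c, cnt R c + c) \<in> dgm R" by (simp add: mem_dgm)
      then have "(cnt R c, cnt R c + c) \<in> dgm S" using sub by blast
      then show ?thesis by (simp add: mem_dgm)
    qed simp
  qed
qed (auto simp: dgm_def intro: order_trans)

lemma cnt_eq_imp_eq:
  assumes "\<And>c. cnt R c = cnt S c" "finite R" "finite S" "0 \<notin> R" "0 \<notin> S"
  shows "R = S"
proof -
  have "p \<in> R \<longleftrightarrow> p \<in> S" for p
  proof (cases p)
    case (Suc c)
    then show ?thesis
      using cnt_rec[OF assms(2), of c] cnt_rec[OF assms(3), of c] assms(1)[of c] assms(1)[of "Suc c"]
      by (cases "p \<in> R"; cases "p \<in> S") auto
  qed (use assms in simp)
  then show ?thesis by auto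
qed

lemma dgm_inj:
  assumes "dgm R = dgm S" "R \<subseteq> {1..M}" "S \<subseteq> {1..M}"
  shows "R = S"
proof (rule cnt_eq_imp_eq)
  show "cnt R c = cnt S c" for c
    using assms(1) dgm_subset_iff[of R S] dgm_subset_iff[of S R] by (simp add: order.antisym)
qed (use assms in \<open>auto intro: finite_subset\<close>)

text \<open>A set closed to the left and upwards meets each diagonal in an initial segment, of
  length \<open>f c\<close>. Closure makes \<open>f\<close> drop by 0 or 1 from one content to the
  next, and the places of the drops are the parts of \<open>K\<close>.\<close>

lemma ideal_is_dgm:
  assumes S: "S \<subseteq> {1..M}" and E: "E \<subseteq> dgm S"
    and left: "\<And>i j. (i, Suc j) \<in> E \<Longrightarrow> i \<le> j \<Longrightarrow> (i, j) \<in> E"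
    and up: "\<And>i j. (Suc i, j) \<in> E \<Longrightarrow> 1 \<le> i \<Longrightarrow> (i, j) \<in> E"
  shows "\<exists>K\<subseteq>{1..M}. dgm K = E"
proof -
  define f where "f c = card {i. (i, i + c) \<in> E}" for c
  have sub: "{i. (i, i + c) \<in> E} \<subseteq> {1..cnt S c}" for c using E by (auto simp: mem_dgm)
  have down: "(i, i + c) \<in> E" if "(i', i' + c) \<in> E" "1 \<le> i" "i \<le> i'" for i i' c
    using that(3,1,2)
  proof (induction rule: inc_induct)
    case (step n)
    then have "(Suc n, Suc n + c) \<in> E" by simp
    then have "(n, Suc (n + c)) \<in> E" using up[of n] step by simp
    then show ?case using left by simp
  qed
  have f: "{i. (i, i + c) \<in> E} = {1..f c}" for c
  proof -
    let ?I = "{i. (i, i + c) \<in> E}"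
    have fin: "finite ?I" using sub[of c] by (rule finite_subset) simp
    show ?thesis
    proof (cases "?I = {}")
      case True
      then show ?thesis by (simp add: f_def)
    next
      case False
      have max: "Max ?I \<in> ?I" using fin False by (rule Max_in)
      have "?I = {1..Max ?I}"
      proof (rule equalityI)
        show "{1..Max ?I} \<subseteq> ?I"
        proof
          fix i assume "i \<in> {1..Max ?I}"
          then show "i \<in> ?I" using down[OF max[unfolded mem_Collect_eq], of i] by simp
        qed
        show "?I \<subseteq> {1..Max ?I}"
        proof
          fix i assume "i \<in> ?I"
          then show "i \<in> {1..Max ?I}" using subsetD[OF sub[of c], of i] Max_ge[OF fin, of i] by simp
        qed
      qed
      moreover from this have "f c = Max ?I" unfolding f_def by (metis card_atLeastAtMost diff_Suc_1)
      ultimately show ?thesis by simp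
    qed
  qed
  have mem: "(i, i + c) \<in> E \<longleftrightarrow> 1 \<le> i \<and> i \<le> f c" for i c
  proof -
    have "i \<in> {i. (i, i + c) \<in> E} \<longleftrightarrow> i \<in> {1..f c}" unfolding f ..
    then show ?thesis by simp
  qed
  have f1: "f (Suc c) \<le> f c" for c
  proof (cases "f (Suc c) = 0")
    case False
    then have "(f (Suc c), f (Suc c) + Suc c) \<in> E" by (simp add: mem del: add_Suc_right)
    then have "(f (Suc c), f (Suc c) + c) \<in> E" using left by simp
    then show ?thesis by (simp add: mem)
  qed simp
  have f2: "f c \<le> Suc (f (Suc c))" for c
  proof (cases "f c \<le> 1")
    case False
    then obtain i where i: "f c = Suc i" "1 \<le> i" by (cases "f c") auto
    have "(Suc i, Suc i + c) \<in> E" using i by (simp add: mem del: add_Suc)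
    then have "(i, i + Suc c) \<in> E" using up[of i "Suc i + c"] i by simp
    then show ?thesis using i by (simp add: mem del: add_Suc_right)
  qed simp
  have f0: "f c = 0" if "M \<le> c" for c
    using sub[of c] cnt_eq_0[OF S that] by (simp add: f_def)
  define K where "K = {p. 1 \<le> p \<and> f (p - 1) \<noteq> f p}"
  have K: "K \<subseteq> {1..M}"
  proof
    fix p assume p: "p \<in> K"
    have "\<not> M \<le> p - 1"
    proof
      assume "M \<le> p - 1"
      then have "f (p - 1) = f p" using f0[of "p - 1"] f0[of p] by simp
      then show False using p by (simp add: K_def)
    qed
    then show "p \<in> {1..M}" using p by (auto simp: K_def)
  qed
  have fin: "finite K" using K by (rule finite_subset) simp
  have "cnt K c = f c" for c
  proof (cases "M \<le> c")
    case True
    then show ?thesis using f0 cnt_eq_0[OF K] by simp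
  next
    case False
    then have "c \<le> M" by simp
    then show ?thesis
    proof (induction rule: inc_induct)
      case base
      then show ?case using f0 cnt_eq_0[OF K] by simp
    next
      case (step n)
      then show ?case using cnt_rec[OF fin, of n] f1[of n] f2[of n] by (auto simp: K_def)
    qed
  qed
  then have "(i, j) \<in> dgm K \<longleftrightarrow> (i, j) \<in> E" for i j
  proof (cases "i \<le> j")
    case True
    then obtain c where "j = i + c" using le_Suc_ex by blast
    then show ?thesis using \<open>\<And>c. cnt K c = f c\<close> by (simp add: mem_dgm mem)
  next
    case False
    then show ?thesis using E by (auto simp: dgm_def)
  qed
  then show ?thesis using K by auto
qed

section \<open>Plane partitions as chains of shapes\<close>

definition lines :: "nat \<Rightarrow> (nat \<times> nat) set \<Rightarrow> nat" where
  "lines l L = (if odd l then card (snd ` L) else card (fst ` L))"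

definition letter_weight :: "'r::comm_ring_1 \<Rightarrow> 'r \<Rightarrow> nat \<Rightarrow> (nat \<times> nat) set \<Rightarrow> 'r" where
  "letter_weight t y l L = t ^ (card L - lines l L) * y ^ lines l L"

definition pp_set :: "bool \<Rightarrow> nat \<Rightarrow> nat set \<Rightarrow> nat set \<Rightarrow> (nat \<times> nat \<Rightarrow> nat) set" where
  "pp_set pm k S R = {T \<in> extensional (dgm S - dgm R). dgm R \<subseteq> dgm S \<and>
     (\<forall>i j j'. (i, j) \<in> dgm S - dgm R \<longrightarrow> (i, j') \<in> dgm S - dgm R \<longrightarrow> j \<le> j' \<longrightarrow> T (i, j) \<le> T (i, j')) \<and>
     (\<forall>i i' j. (i, j) \<in> dgm S - dgm R \<longrightarrow> (i', j) \<in> dgm S - dgm R \<longrightarrow> i \<le> i' \<longrightarrow> T (i, j) \<le> T (i', j)) \<and>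
     (\<forall>b\<in>dgm S - dgm R. T b < k) \<and>
     (\<forall>i. (i, i) \<in> dgm S - dgm R \<longrightarrow> pm \<longrightarrow> even (T (i, i)))}"

definition pp_weight :: "'r::comm_ring_1 \<Rightarrow> (nat \<Rightarrow> 'r) \<Rightarrow> nat \<Rightarrow> (nat \<times> nat) set \<Rightarrow> (nat \<times> nat \<Rightarrow> nat) \<Rightarrow> 'r" where
  "pp_weight t v k D T = (\<Prod>l<k. letter_weight t (v (l div 2)) l {b \<in> D. T b = l})"

definition pp_gen :: "bool \<Rightarrow> 'r::comm_ring_1 \<Rightarrow> (nat \<Rightarrow> 'r) \<Rightarrow> nat \<Rightarrow> nat set \<Rightarrow> nat set \<Rightarrow> 'r" where
  "pp_gen pm t v k S R = (\<Sum>T\<in>pp_set pm k S R. pp_weight t v k (dgm S - dgm R) T)"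

lemma finite_pp_set: "S \<subseteq> {1..M} \<Longrightarrow> finite (pp_set pm k S R)"
proof (rule finite_subset)
  assume S: "S \<subseteq> {1..M}"
  show "pp_set pm k S R \<subseteq> PiE (dgm S - dgm R) (\<lambda>_. {..<k})"
    by (auto simp: pp_set_def PiE_def)
  show "finite (PiE (dgm S - dgm R) (\<lambda>_. {..<k}))"
    using finite_dgm[OF S] by (intro finite_PiE) auto
qed

definition level_ok :: "bool \<Rightarrow> nat \<Rightarrow> nat set \<Rightarrow> nat set \<Rightarrow> bool" where
  "level_ok pm k K S \<longleftrightarrow> dgm K \<subseteq> dgm S \<and> (pm \<longrightarrow> odd k \<longrightarrow> (\<forall>i. (i, i) \<notin> dgm S - dgm K))"

lemmas pp_set_row = pp_set_def[THEN equalityD1, THEN subsetD, THEN CollectD, THEN conjunct2, THEN conjunct2, THEN conjunct1, rule_format]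
lemmas pp_set_col = pp_set_def[THEN equalityD1, THEN subsetD, THEN CollectD, THEN conjunct2, THEN conjunct2, THEN conjunct2, THEN conjunct1, rule_format]
lemmas pp_set_less = pp_set_def[THEN equalityD1, THEN subsetD, THEN CollectD, THEN conjunct2, THEN conjunct2, THEN conjunct2, THEN conjunct2, THEN conjunct1, rule_format]
lemmas pp_set_even = pp_set_def[THEN equalityD1, THEN subsetD, THEN CollectD, THEN conjunct2, THEN conjunct2, THEN conjunct2, THEN conjunct2, THEN conjunct2, rule_format]

lemma pp_set_ext: "T \<in> pp_set pm k S R \<Longrightarrow> T \<in> extensional (dgm S - dgm R)"
  and pp_set_sub: "T \<in> pp_set pm k S R \<Longrightarrow> dgm R \<subseteq> dgm S"
  by (simp_all add: pp_set_def)

lemma pp_setI: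
  assumes "T \<in> extensional (dgm S - dgm R)" "dgm R \<subseteq> dgm S"
    "\<And>i j j'. (i, j) \<in> dgm S - dgm R \<Longrightarrow> (i, j') \<in> dgm S - dgm R \<Longrightarrow> j \<le> j' \<Longrightarrow> T (i, j) \<le> T (i, j')"
    "\<And>i i' j. (i, j) \<in> dgm S - dgm R \<Longrightarrow> (i', j) \<in> dgm S - dgm R \<Longrightarrow> i \<le> i' \<Longrightarrow> T (i, j) \<le> T (i', j)"
    "\<And>b. b \<in> dgm S - dgm R \<Longrightarrow> T b < k"
    "\<And>i. (i, i) \<in> dgm S - dgm R \<Longrightarrow> pm \<Longrightarrow> even (T (i, i))"
  shows "T \<in> pp_set pm k S R"
  unfolding pp_set_def mem_Collect_eq by (intro conjI allI impI ballI assms)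

text \<open>The boxes with letters below \<open>k\<close>, together with the inner shape, form a
  diagram \<open>K\<close>. Cutting there separates the plane partition into one with letters below
  \<open>k\<close> and the skew region occupied by the top letter \<open>k\<close>.\<close>

lemma pp_gen_Suc:
  fixes t :: "'r::comm_ring_1"
  assumes S: "S \<subseteq> {1..M}" and R: "R \<subseteq> {1..M}"
  shows "pp_gen pm t v (Suc k) S R = (\<Sum>K\<in>Pow {1..M}. pp_gen pm t v k K R *
     (if level_ok pm k K S then letter_weight t (v (k div 2)) k (dgm S - dgm K) else 0))"
proof -
  have finS: "finite S" using S by (rule finite_subset) simp
  have finR: "finite R" using R by (rule finite_subset) simp
  let ?I = "{K \<in> Pow {1..M}. level_ok pm k K S}"
  let ?A = "SIGMA K:?I. pp_set pm k K R"
  let ?w = "\<lambda>K. letter_weight t (v (k div 2)) k (dgm S - dgm K)"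
  define glue where "glue K T' = (\<lambda>b. if b \<in> dgm K - dgm R then T' b else if b \<in> dgm S - dgm K then k else undefined)"
    for K and T' :: "nat \<times> nat \<Rightarrow> nat"
  define shape where "shape T = (THE K. K \<subseteq> {1..M} \<and> dgm K = dgm R \<union> {b \<in> dgm S - dgm R. T b < k})"
    for T :: "nat \<times> nat \<Rightarrow> nat"
  have shape: "shape T \<subseteq> {1..M} \<and> dgm (shape T) = dgm R \<union> {b \<in> dgm S - dgm R. T b < k}"
    if T: "T \<in> pp_set pm (Suc k) S R" for T
  proof -
    let ?E = "dgm R \<union> {b \<in> dgm S - dgm R. T b < k}"
    note sub = pp_set_sub[OF T]
    have "\<exists>K\<subseteq>{1..M}. dgm K = ?E"
    proof (rule ideal_is_dgm[OF S])
      show "?E \<subseteq> dgm S" using sub by auto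
      fix i j assume "(i, Suc j) \<in> ?E" "i \<le> j"
      then show "(i, j) \<in> ?E"
        using dgm_left[OF finR, of i "Suc j" j] dgm_left[OF finS, of i "Suc j" j] sub
          pp_set_row[OF T, of i j "Suc j"] by (auto intro: le_less_trans)
    next
      fix i j assume "(Suc i, j) \<in> ?E" "1 \<le> i"
      then show "(i, j) \<in> ?E"
        using dgm_up[OF finR, of "Suc i" j i] dgm_up[OF finS, of "Suc i" j i] sub
          pp_set_col[OF T, of i j "Suc i"] by (auto intro: le_less_trans)
    qed
    then obtain K where K: "K \<subseteq> {1..M} \<and> dgm K = ?E" by blast
    show ?thesis unfolding shape_def
    proof (rule theI)
      show "K \<subseteq> {1..M} \<and> dgm K = ?E" by (fact K)
      fix K' assume "K' \<subseteq> {1..M} \<and> dgm K' = ?E"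
      then show "K' = K" using K by (intro dgm_inj[of _ _ M]) simp_all
    qed
  qed
  have "pp_gen pm t v (Suc k) S R = (\<Sum>(K, T')\<in>?A. pp_weight t v k (dgm K - dgm R) T' * ?w K)"
    unfolding pp_gen_def
  proof (rule sum.reindex_bij_witness[of _ "\<lambda>(K, T'). glue K T'"
        "\<lambda>T. (shape T, restrict T (dgm (shape T) - dgm R))"])
    fix T assume T: "T \<in> pp_set pm (Suc k) S R"
    note sh = conjunct1[OF shape[OF T]] conjunct2[OF shape[OF T]]
    note sub = pp_set_sub[OF T]
    have lev: "T b = k" if "b \<in> dgm S - dgm (shape T)" for b
      using that pp_set_less[OF T, of b] sh(2) by force
    show "(case (shape T, restrict T (dgm (shape T) - dgm R)) of (K, T') \<Rightarrow> glue K T') = T"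
    proof (rule ext)
      fix b
      show "(case (shape T, restrict T (dgm (shape T) - dgm R)) of (K, T') \<Rightarrow> glue K T') b = T b"
        using lev[of b] extensional_arb[OF pp_set_ext[OF T], of b] sh(2) sub by (auto simp: glue_def)
    qed
    have "restrict T (dgm (shape T) - dgm R) \<in> pp_set pm k (shape T) R"
    proof (rule pp_setI)
      fix i j j' assume *: "(i, j) \<in> dgm (shape T) - dgm R" "(i, j') \<in> dgm (shape T) - dgm R" "j \<le> j'"
      then have "T (i, j) \<le> T (i, j')" using sh(2) by (intro pp_set_row[OF T]) auto
      then show "restrict T (dgm (shape T) - dgm R) (i, j) \<le> restrict T (dgm (shape T) - dgm R) (i, j')"
        using * by simp
    next
      fix i i' j assume *: "(i, j) \<in> dgm (shape T) - dgm R" "(i', j) \<in> dgm (shape T) - dgm R" "i \<le> i'"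
      then have "T (i, j) \<le> T (i', j)" using sh(2) by (intro pp_set_col[OF T]) auto
      then show "restrict T (dgm (shape T) - dgm R) (i, j) \<le> restrict T (dgm (shape T) - dgm R) (i', j)"
        using * by simp
    next
      fix b assume "b \<in> dgm (shape T) - dgm R"
      then show "restrict T (dgm (shape T) - dgm R) b < k" using sh(2) by auto
    next
      fix i assume *: "(i, i) \<in> dgm (shape T) - dgm R" pm
      then have "even (T (i, i))" using sh(2) by (intro pp_set_even[OF T]) auto
      then show "even (restrict T (dgm (shape T) - dgm R) (i, i))" using * by simp
    qed (use sh(2) in auto)
    moreover have "level_ok pm k (shape T) S"
      unfolding level_ok_def
    proof (intro conjI impI allI notI)
      show "dgm (shape T) \<subseteq> dgm S" using sh(2) sub by auto
      fix i assume *: pm "odd k" "(i, i) \<in> dgm S - dgm (shape T)"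
      have "(i, i) \<in> dgm S - dgm R" using *(3) unfolding sh(2) by blast
      then have "even (T (i, i))" using pp_set_even[OF T] *(1) by blast
      then show False using lev[OF *(3)] *(2) by simp
    qed
    ultimately show "(shape T, restrict T (dgm (shape T) - dgm R)) \<in> ?A" using sh(1) by simp
    have l1: "{b \<in> dgm S - dgm R. T b = l} = {b \<in> dgm (shape T) - dgm R. restrict T (dgm (shape T) - dgm R) b = l}"
      if "l < k" for l using that sh(2) by auto
    have l2: "{b \<in> dgm S - dgm R. T b = k} = dgm S - dgm (shape T)" using lev unfolding sh(2) by force
    show "(case (shape T, restrict T (dgm (shape T) - dgm R)) of (K, T') \<Rightarrow> pp_weight t v k (dgm K - dgm R) T' * ?w K) =
        pp_weight t v (Suc k) (dgm S - dgm R) T"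
      unfolding pp_weight_def case_prod_conv prod.lessThan_Suc l2
      by (intro arg_cong2[where f = "(*)"] prod.cong refl) (simp only: l1 lessThan_iff)
  next
    fix KT assume "KT \<in> ?A"
    then obtain K T' where KT: "KT = (K, T')" and K: "K \<subseteq> {1..M}" and ok: "level_ok pm k K S"
      and T': "T' \<in> pp_set pm k K R" by auto
    have finK: "finite K" using K by (rule finite_subset) simp
    have KS: "dgm K \<subseteq> dgm S" using ok by (simp add: level_ok_def)
    note RK = pp_set_sub[OF T']
    have g1: "glue K T' b = T' b" "glue K T' b < k" if "b \<in> dgm K - dgm R" for b
      using that pp_set_less[OF T', of b] by (auto simp: glue_def)
    have g2: "glue K T' b = k" if "b \<in> dgm S - dgm K" for b
      using that by (auto simp: glue_def)
    have g: "glue K T' b \<le> k" if "b \<in> dgm S - dgm R" for b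
      using g1[of b] g2[of b] that by (cases "b \<in> dgm K") auto
    have G: "glue K T' \<in> pp_set pm (Suc k) S R"
    proof (rule pp_setI)
      show "glue K T' \<in> extensional (dgm S - dgm R)" using KS RK by (auto simp: extensional_def glue_def)
      show "dgm R \<subseteq> dgm S" using KS RK by blast
      fix i j j' assume *: "(i, j) \<in> dgm S - dgm R" "(i, j') \<in> dgm S - dgm R" "j \<le> j'"
      show "glue K T' (i, j) \<le> glue K T' (i, j')"
      proof (cases "(i, j') \<in> dgm K")
        case True
        moreover have "i \<le> j" using * by (auto simp: dgm_def)
        ultimately have "(i, j) \<in> dgm K" using dgm_left[OF finK True _ *(3)] by simp
        then show ?thesis using True * g1 pp_set_row[OF T', of i j j'] by auto
      next
        case False
        then show ?thesis using g2[of "(i, j')"] g[of "(i, j)"] * by simp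
      qed
    next
      fix i i' j assume *: "(i, j) \<in> dgm S - dgm R" "(i', j) \<in> dgm S - dgm R" "i \<le> i'"
      show "glue K T' (i, j) \<le> glue K T' (i', j)"
      proof (cases "(i', j) \<in> dgm K")
        case True
        moreover have "1 \<le> i" using * by (auto simp: dgm_def)
        ultimately have "(i, j) \<in> dgm K" using dgm_up[OF finK True _ *(3)] by simp
        then show ?thesis using True * g1 pp_set_col[OF T', of i j i'] by auto
      next
        case False
        then show ?thesis using g2[of "(i', j)"] g[of "(i, j)"] * by simp
      qed
    next
      fix b assume "b \<in> dgm S - dgm R"
      then show "glue K T' b < Suc k" using g by (simp add: less_Suc_eq_le)
    next
      fix i assume *: "(i, i) \<in> dgm S - dgm R" pm
      show "even (glue K T' (i, i))"
      proof (cases "(i, i) \<in> dgm K")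
        case True
        then show ?thesis using * g1(1)[of "(i, i)"] pp_set_even[OF T', of i] by simp
      next
        case False
        then show ?thesis using * g2[of "(i, i)"] ok by (auto simp: level_ok_def)
      qed
    qed
    then show "(case KT of (K, T') \<Rightarrow> glue K T') \<in> pp_set pm (Suc k) S R" by (simp add: KT)
    have "dgm (shape (glue K T')) = dgm R \<union> {b \<in> dgm S - dgm R. glue K T' b < k}" "shape (glue K T') \<subseteq> {1..M}"
      using shape[OF G] by auto
    moreover have "dgm R \<union> {b \<in> dgm S - dgm R. glue K T' b < k} = dgm K"
    proof -
      have "glue K T' b < k \<longleftrightarrow> b \<in> dgm K" if "b \<in> dgm S - dgm R" for b
        using that g1(2)[of b] g2[of b] by (cases "b \<in> dgm K") auto
      then show ?thesis using RK KS by auto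
    qed
    ultimately have sh: "shape (glue K T') = K" using dgm_inj K by metis
    have "restrict (glue K T') (dgm K - dgm R) = T'"
      using pp_set_ext[OF T'] by (intro extensionalityI[of _ "dgm K - dgm R"]) (auto simp: glue_def)
    then show "(shape (case KT of (K, T') \<Rightarrow> glue K T'),
        restrict (case KT of (K, T') \<Rightarrow> glue K T') (dgm (shape (case KT of (K, T') \<Rightarrow> glue K T')) - dgm R)) = KT"
      by (simp add: KT sh)
  qed
  also have "\<dots> = (\<Sum>K\<in>?I. \<Sum>T'\<in>pp_set pm k K R. pp_weight t v k (dgm K - dgm R) T' * ?w K)"
    by (rule sum.Sigma[symmetric]) (auto intro: finite_pp_set[unfolded One_nat_def])
  also have "\<dots> = (\<Sum>K\<in>?I. pp_gen pm t v k K R * ?w K)"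
    by (simp add: pp_gen_def sum_distrib_right)
  also have "\<dots> = (\<Sum>K\<in>Pow {1..M}. if level_ok pm k K S then pp_gen pm t v k K R * ?w K else 0)"
    by (rule sum.inter_filter) simp
  also have "\<dots> = (\<Sum>K\<in>Pow {1..M}. pp_gen pm t v k K R * (if level_ok pm k K S then ?w K else 0))"
    by (intro sum.cong) auto
  finally show ?thesis .
qed

lemma pp_gen_0:
  assumes S: "S \<subseteq> {1..M}" and R: "R \<subseteq> {1..M}"
  shows "pp_gen pm t v 0 S R = (if S = R then 1 else 0)"
proof (cases "S = R")
  case True
  then have "pp_set pm 0 S R = {\<lambda>_. undefined}" by (auto simp: pp_set_def extensional_def)
  then show ?thesis using True by (simp add: pp_gen_def pp_weight_def)
next
  case False
  have "pp_set pm 0 S R = {}"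
  proof (rule ccontr)
    assume "pp_set pm 0 S R \<noteq> {}"
    then have "dgm R \<subseteq> dgm S" "dgm S - dgm R = {}" by (auto simp: pp_set_def)
    then have "dgm S = dgm R" by blast
    then show False using dgm_inj[OF _ S R] False by simp
  qed
  then show ?thesis using False by (simp add: pp_gen_def)
qed

lemma card_skew:
  assumes "S \<subseteq> {1..M}" "K \<subseteq> {1..M}" "dgm K \<subseteq> dgm S"
  shows "card (dgm S - dgm K) = (\<Sum>c<M. cnt S c - cnt K c)"
proof -
  have le: "cnt K c \<le> cnt S c" for c using assms(3) by (simp add: dgm_subset_iff)
  have "card (dgm S - dgm K) = (\<Sum>c<M. cnt S c) - (\<Sum>c<M. cnt K c)"
    using card_Diff_subset[OF finite_dgm[OF assms(2)] assms(3)] card_dgm[OF assms(1)] card_dgm[OF assms(2)]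
    by (simp add: sum_eq_sum_cnt[OF assms(1)] sum_eq_sum_cnt[OF assms(2)])
  also have "\<dots> = (\<Sum>c<M. cnt S c - cnt K c)"
    using le by (intro sum_subtractf_nat[symmetric]) auto
  finally show ?thesis .
qed

section \<open>Counting the rows and columns met by one letter\<close>

context
  fixes S K :: "nat set" and M :: nat
  assumes S: "S \<subseteq> {1..M}" and K: "K \<subseteq> {1..M}" and KS: "dgm K \<subseteq> dgm S"
begin

lemma le_KS: "cnt K c \<le> cnt S c"
  using KS by (simp add: dgm_subset_iff)

lemma fin_SK: "finite S" "finite K"
  using S K by (auto intro: finite_subset)

lemma mem_skew: "(i, i + c) \<in> dgm S - dgm K \<longleftrightarrow> cnt K c < i \<and> i \<le> cnt S c"
  by (auto simp: mem_dgm)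

lemma skew_cases:
  assumes "(i, j) \<in> dgm S - dgm K"
  obtains c where "j = i + c" "cnt K c < i" "i \<le> cnt S c" "c < M"
proof -
  obtain c where c: "j = i + c" using dgmD[of i j S] assms le_Suc_ex by blast
  then have *: "cnt K c < i \<and> i \<le> cnt S c" using assms mem_skew by blast
  then have "c < M" using cnt_eq_0[OF S, of c] by (cases "c < M") auto
  then show ?thesis using that c * by blast
qed

text \<open>Each row is counted at its last box. On the diagonal of content \<open>c\<close> only
  the lowest box can end a row, and it does so exactly when \<open>c + 1\<close> is a part of the
  outer shape.\<close>

lemma rows_count: "card (fst ` (dgm S - dgm K)) = card {c. c < M \<and> cnt K c < cnt S c \<and> Suc c \<in> S}"
proof -
  let ?C = "{c. c < M \<and> cnt K c < cnt S c \<and> Suc c \<in> S}"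
  have "fst ` (dgm S - dgm K) = cnt S ` ?C"
  proof (intro equalityI subsetI)
    fix i assume "i \<in> fst ` (dgm S - dgm K)"
    then obtain j where ij: "(i, j) \<in> dgm S - dgm K" by force
    obtain c where c: "j = i + c" "cnt K c < i" "i \<le> cnt S c" "c < M" using skew_cases[OF ij] .
    \<comment> \<open>The content of the last box of row \<open>i\<close> in the outer
      shape.\<close>
    let ?d = "Max {d. d < M \<and> i \<le> cnt S d}"
    have fin: "finite {d. d < M \<and> i \<le> cnt S d}" by simp
    have "?d \<in> {d. d < M \<and> i \<le> cnt S d}" using c by (intro Max_in) auto
    then have d: "?d < M" "i \<le> cnt S ?d" by auto
    have "c \<le> ?d" using c fin by (intro Max_ge) auto
    then have kd: "cnt K ?d < i" using cnt_antimono[OF fin_SK(2), of c ?d] c by linarith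
    have "\<not> i \<le> cnt S (Suc ?d)"
    proof
      assume *: "i \<le> cnt S (Suc ?d)"
      then have "Suc ?d < M" using cnt_eq_0[OF S, of "Suc ?d"] c by (cases "Suc ?d < M") auto
      then have "Suc ?d \<le> ?d" using * fin by (intro Max_ge) auto
      then show False by simp
    qed
    then have "Suc ?d \<in> S" "i = cnt S ?d" using cnt_rec[OF fin_SK(1), of ?d] d by (cases "Suc ?d \<in> S"; simp)+
    moreover from this have "cnt K ?d < cnt S ?d" using kd by simp
    ultimately show "i \<in> cnt S ` ?C" using d(1) by (intro image_eqI[of _ _ ?d] CollectI conjI)
  next
    fix i assume "i \<in> cnt S ` ?C"
    then obtain c where "i = cnt S c" "cnt K c < cnt S c" by blast
    then have "(i, i + c) \<in> dgm S - dgm K" unfolding mem_skew by simp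
    then show "i \<in> fst ` (dgm S - dgm K)" by force
  qed
  moreover have "inj_on (cnt S) ?C"
  proof (rule linorder_inj_onI)
    fix c d assume "c < d" "c \<in> ?C" "d \<in> ?C"
    then have "cnt S d < cnt S c"
      using cnt_rec[OF fin_SK(1), of c] cnt_antimono[OF fin_SK(1), of "Suc c" d] by simp
    then show "cnt S c \<noteq> cnt S d" by simp
  qed auto
  ultimately show ?thesis by (simp add: card_image)
qed

text \<open>Each column is counted at its lowest box. On the main diagonal every box is the lowest
  of its column; on content \<open>c\<close> at least 1 only the last box of the diagonal can be,
  and it is so exactly when \<open>c\<close> is not a part of the outer shape.\<close>

lemma cols_count: "card (snd ` (dgm S - dgm K)) =
    (cnt S 0 - cnt K 0) + card {c. 1 \<le> c \<and> c < M \<and> cnt K c < cnt S c \<and> c \<notin> S}"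
proof -
  let ?C = "{c. 1 \<le> c \<and> c < M \<and> cnt K c < cnt S c \<and> c \<notin> S}"
  let ?g = "\<lambda>c. cnt S c + c" and ?I = "{cnt K 0<..cnt S 0}"
  have sub: "cnt S c + c \<le> cnt S d + d" if "c \<le> d" for c d
    using cnt_le_add[OF fin_SK(1), of c "d - c"] that by simp
  have "snd ` (dgm S - dgm K) = ?I \<union> ?g ` ?C"
  proof (intro equalityI subsetI)
    fix j assume "j \<in> snd ` (dgm S - dgm K)"
    then obtain i where ij: "(i, j) \<in> dgm S - dgm K" by force
    obtain c where c: "j = i + c" "cnt K c < i" "i \<le> cnt S c" "c < M" using skew_cases[OF ij] .
    let ?P = "\<lambda>d. d \<le> j \<and> j - d \<le> cnt S d"
    \<comment> \<open>The content of the lowest box of column \<open>j\<close>: contents decrease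
      down a column.\<close>
    let ?d = "LEAST d. ?P d"
    have Pc: "?P c" using c by simp
    then have d: "?P ?d" by (rule LeastI)
    have dc: "?d \<le> c" using Pc by (rule Least_le)
    have kd: "cnt K ?d < j - ?d"
      using cnt_le_add[OF fin_SK(2), of ?d "c - ?d"] dc c by simp
    have dM: "?d < M" using dc c by simp
    show "j \<in> ?I \<union> ?g ` ?C"
    proof (cases "?d")
      case 0
      then show ?thesis using d kd by auto
    next
      case (Suc e)
      then have "\<not> ?P e" using not_less_Least[of e ?P] by simp
      then have "cnt S e < j - e" using d Suc by simp
      then have "?d \<notin> S" "j - ?d = cnt S ?d"
        using cnt_rec[OF fin_SK(1), of e] d Suc by (cases "?d \<in> S"; simp)+
      then have "j = ?g ?d" using d by simp
      moreover have "?d \<in> ?C" using \<open>?d \<notin> S\<close> \<open>j - ?d = cnt S ?d\<close> kd dM Suc by (intro CollectI conjI) simp_all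
      ultimately show ?thesis by (intro UnI2 image_eqI[of _ _ ?d])
    qed
  next
    fix j assume "j \<in> ?I \<union> ?g ` ?C"
    then consider "j \<in> ?I" | c where "j = ?g c" "cnt K c < cnt S c" by blast
    then show "j \<in> snd ` (dgm S - dgm K)"
    proof cases
      case 1
      then have "(j, j + 0) \<in> dgm S - dgm K" by (simp only: mem_skew) auto
      then show ?thesis by force
    next
      case (2 c)
      then have "(cnt S c, cnt S c + c) \<in> dgm S - dgm K" unfolding mem_skew by simp
      then show ?thesis using 2 by force
    qed
  qed
  moreover have "inj_on ?g ?C"
  proof (rule linorder_inj_onI)
    fix c d assume *: "c < d" "c \<in> ?C" "d \<in> ?C"
    then obtain e where e: "d = Suc e" by (cases d) auto
    then have "cnt S e = cnt S d" using cnt_rec[OF fin_SK(1), of e] * by simp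
    then have "?g c < ?g d" using sub[of c e] * e by simp
    then show "?g c \<noteq> ?g d" by simp
  qed auto
  moreover have "?I \<inter> ?g ` ?C = {}"
  proof (rule equals0I)
    fix j assume "j \<in> ?I \<inter> ?g ` ?C"
    then obtain d where j: "j \<le> cnt S 0" and d: "j = ?g d" "d \<in> ?C" by auto
    then obtain e where e: "d = Suc e" by (cases d) auto
    then have "cnt S e = cnt S d" using cnt_rec[OF fin_SK(1), of e] d by simp
    then have "?g 0 < ?g d" using sub[of 0 e] e by simp
    then show False using j d by simp
  qed
  moreover have "finite ?C" by simp
  ultimately show ?thesis by (simp add: card_Un_disjoint card_image)
qed

lemma prod_power_split:
  fixes t y :: "'r::comm_ring_1"
  assumes "finite A"
  shows "(\<Prod>c\<in>A. if P c then y * t ^ (m c - 1) else t ^ m c) =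
    t ^ (\<Sum>c\<in>A. if P c then m c - 1 else m c) * y ^ card {c \<in> A. P c}"
  using assms
proof (induction A rule: finite_induct)
  case (insert a A)
  have "{c \<in> insert a A. P c} = (if P a then insert a {c \<in> A. P c} else {c \<in> A. P c})" by auto
  then show ?case using insert by (simp add: power_add mult_ac)
qed simp

lemma sum_split_card:
  assumes "finite A" "\<And>c. c \<in> A \<Longrightarrow> P c \<Longrightarrow> 0 < (m c :: nat)"
  shows "(\<Sum>c\<in>A. if P c then m c - 1 else m c) = (\<Sum>c\<in>A. m c) - card {c \<in> A. P c}"
proof -
  have "(\<Sum>c\<in>A. m c) = (\<Sum>c\<in>A. (if P c then m c - 1 else m c) + (if P c then 1 else 0))"
    using assms(2) by (intro sum.cong) auto
  also have "\<dots> = (\<Sum>c\<in>A. if P c then m c - 1 else m c) + card {c \<in> A. P c}"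
    using assms(1) by (simp add: sum.distrib sum.If_cases Int_def)
  finally show ?thesis by simp
qed

text \<open>A row line at site \<open>c + 1\<close> reads the bond to its left, that is content
  \<open>c\<close>, where by \<open>rows_count\<close> a row can end if the site is occupied. This
  leaves a factor \<open>y\<close> for each row and \<open>t\<close> for every other box.\<close>

lemma norm_R_eq: "norm_R M y t K S = letter_weight t y (2 * l) (dgm S - dgm K)"
proof -
  let ?m = "\<lambda>c. cnt S c - cnt K c"
  have dif: "dif S K c = int (?m c)" for c using le_KS[of c] by (simp add: dif_def)
  have bij: "{1..M} = Suc ` {..<M}" by (simp add: image_Suc_lessThan)
  let ?P = "\<lambda>c. Suc c \<in> S \<and> 0 < ?m c"
  have w: "row_weight (1, 1, 1) y t (dif S K (Suc c)) (Suc c \<in> S) (Suc c \<in> K) =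
      (if ?P c then y * t ^ (?m c - 1) else t ^ ?m c)" for c
  proof -
    have "nat (dif S K (Suc c) + of_bool (Suc c \<in> S) - of_bool (Suc c \<in> K)) = ?m c"
      using dif_rec[OF fin_SK, of c] dif[of c] by simp
    moreover have "(dif S K (Suc c) < 0) = False" unfolding dif by simp
    ultimately show ?thesis unfolding row_weight_def line_factor_def by (simp only: if_False) auto
  qed
  have "norm_R M y t K S = (\<Prod>c\<in>{1..M}. row_weight (1, 1, 1) y t (dif S K c) (c \<in> S) (c \<in> K))"
    unfolding line_R_def line_def by (simp add: dif[of 0] bd_R_def)
  also have "\<dots> = (\<Prod>c<M. row_weight (1, 1, 1) y t (dif S K (Suc c)) (Suc c \<in> S) (Suc c \<in> K))"
    unfolding bij by (simp add: prod.reindex)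
  also have "\<dots> = (\<Prod>c<M. if ?P c then y * t ^ (?m c - 1) else t ^ ?m c)"
    by (simp only: w)
  also have "\<dots> = t ^ ((\<Sum>c<M. ?m c) - card {c \<in> {..<M}. ?P c}) * y ^ card {c \<in> {..<M}. ?P c}"
    by (subst prod_power_split, simp, subst sum_split_card) auto
  also have "{c \<in> {..<M}. ?P c} = {c. c < M \<and> cnt K c < cnt S c \<and> Suc c \<in> S}" by auto
  finally show ?thesis
    by (simp add: letter_weight_def lines_def rows_count card_skew[OF S K KS])
qed

text \<open>The columns at content at least 1 are collected from the sites, those on the main
  diagonal from the wall weight, which also enforces the diagonal condition of
  \<open>pm\<close>.\<close>

lemma norm_C_eq: "norm_C M pm y t K S =
   (if pm \<and> cnt K 0 < cnt S 0 then 0 else letter_weight t y (Suc (2 * l)) (dgm S - dgm K))"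
proof (cases "M = 0")
  case True
  then show ?thesis using S K
    by (simp add: line_C_def line_def dif_def cnt_def letter_weight_def lines_def bd_C_def dgm_def)
next
  case False
  let ?m = "\<lambda>c. cnt S c - cnt K c"
  have dif: "dif S K c = int (?m c)" for c using le_KS[of c] by (simp add: dif_def)
  let ?P = "\<lambda>c. c \<notin> S \<and> 0 < ?m c"
  have w: "col_weight (1, 1, 1) y t (dif S K c) (c \<in> S) (c \<in> K) =
      (if ?P c then y * t ^ (?m c - 1) else t ^ ?m c)" for c
    unfolding col_weight_def line_factor_def dif nat_int by auto
  have mM: "?m M = 0" using cnt_eq_0[OF S] by simp
  have e: "{1..M} = insert M {1..<M}" "{..<M} = insert 0 {1..<M}" using False by auto
  have cards: "{c \<in> {1..<M}. ?P c} = {c. 1 \<le> c \<and> c < M \<and> cnt K c < cnt S c \<and> c \<notin> S}" by auto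
  let ?e = "card {c \<in> {1..<M}. ?P c}"
  have "(\<Prod>c\<in>{1..M}. col_weight (1, 1, 1) y t (dif S K c) (c \<in> S) (c \<in> K)) =
      (\<Prod>c\<in>{1..<M}. if ?P c then y * t ^ (?m c - 1) else t ^ ?m c)"
    unfolding e(1) w using mM by simp
  also have "\<dots> = t ^ ((\<Sum>c\<in>{1..<M}. ?m c) - ?e) * y ^ ?e"
    by (subst prod_power_split, simp, subst sum_split_card) auto
  finally have p: "norm_C M pm y t K S = t ^ ((\<Sum>c\<in>{1..<M}. ?m c) - ?e) * y ^ ?e * bd_C pm y (int (?m 0))"
    unfolding line_C_def line_def by (simp add: dif[of 0])
  have tot: "card (dgm S - dgm K) = ?m 0 + (\<Sum>c\<in>{1..<M}. ?m c)"
    unfolding card_skew[OF S K KS] e(2) by (subst sum.insert) auto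
  show ?thesis
  proof (cases "pm \<and> cnt K 0 < cnt S 0")
    case True
    then show ?thesis unfolding p by (simp add: bd_C_def)
  next
    case F: False
    then have "bd_C pm y (int (?m 0)) = y ^ ?m 0" by (auto simp: bd_C_def)
    then have "norm_C M pm y t K S = t ^ (card (dgm S - dgm K) - (?m 0 + ?e)) * y ^ (?m 0 + ?e)"
      unfolding p tot by (simp add: power_add mult_ac)
    moreover have "lines (Suc (2 * l)) (dgm S - dgm K) = ?m 0 + ?e"
      unfolding lines_def cards cols_count[symmetric] by simp
    ultimately show ?thesis
      unfolding if_not_P[OF F] letter_weight_def by (simp only:)
  qed
qed

lemma level_ok_diag: "level_ok pm k K S \<longleftrightarrow> \<not> (pm \<and> odd k \<and> cnt K 0 < cnt S 0)"
proof -
  have "(\<exists>i. (i, i + 0) \<in> dgm S - dgm K) \<longleftrightarrow> cnt K 0 < cnt S 0"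
    unfolding mem_skew using le_KS[of 0] by (meson le_less_trans less_le_trans order.refl not_le)
  then show ?thesis using KS by (auto simp: level_ok_def)
qed

end

lemma line_C_nonsub:
  assumes "S \<subseteq> {1..M}" "K \<subseteq> {1..M}" "\<not> dgm K \<subseteq> dgm S"
  shows "norm_C M pm y t K S = 0"
proof (rule ccontr)
  assume "norm_C M pm y t K S \<noteq> 0"
  then have "\<forall>c. cnt K c \<le> cnt S c"
    unfolding line_C_def using line_nonzero_le[OF _ assms(1,2)] col_weight_neg bd_C_neg by (metis (no_types, lifting))
  then show False using assms(3) by (simp add: dgm_subset_iff)
qed

lemma line_R_nonsub:
  assumes "S \<subseteq> {1..M}" "K \<subseteq> {1..M}" "\<not> dgm K \<subseteq> dgm S"
  shows "norm_R M y t K S = 0"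
proof (rule ccontr)
  assume "norm_R M y t K S \<noteq> 0"
  then have "\<forall>c. cnt K c \<le> cnt S c"
    unfolding line_R_def using line_nonzero_le[OF _ assms(1,2)] row_weight_neg bd_R_neg by (metis (no_types, lifting))
  then show False using assms(3) by (simp add: dgm_subset_iff)
qed

lemma level_weight_eq:
  assumes "S \<subseteq> {1..M}" "K \<subseteq> {1..M}"
  shows "(if level_ok pm k K S then letter_weight t y k (dgm S - dgm K) else 0) =
    (if odd k then norm_C M pm y t K S else norm_R M y t K S)"
proof (cases "dgm K \<subseteq> dgm S")
  case True
  show ?thesis
  proof (cases "odd k")
    case odd: True
    then obtain l where "k = Suc (2 * l)" by (auto elim: oddE)
    then show ?thesis
      using level_ok_diag[OF assms True, of pm k] norm_C_eq[OF assms True, of pm y t l] by simp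
  next
    case False
    then obtain l where "k = 2 * l" by (auto elim: evenE)
    then show ?thesis
      using level_ok_diag[OF assms True, of pm k] norm_R_eq[OF assms True, of y t l] by simp
  qed
next
  case False
  then show ?thesis
    using line_C_nonsub[OF assms False, of pm y t] line_R_nonsub[OF assms False, of y t] by (simp add: level_ok_def)
qed

text \<open>Peeling off the letters \<open>2 * n + 1\<close> and \<open>2 * n\<close> in turn yields
  a column line next to the outer shape and a row line inside it, which together are
  \<open>dual_op\<close>.\<close>

lemma pp_gen_eq_dual_chain:
  assumes S: "S \<subseteq> {1..M}" and R: "R \<subseteq> {1..M}"
  shows "pp_gen pm t v (2 * n) S R = dual_chain M pm t (map v (rev [0..<n])) S R"
  using S
proof (induction n arbitrary: S)
  case 0
  then show ?case using pp_gen_0[OF 0 R, of pm t v] by simp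
next
  case (Suc n)
  let ?y = "v n" and ?P = "Pow {1..M}"
  have d: "2 * n div 2 = n" "Suc (2 * n) div 2 = n" by simp_all
  have odd: "pp_gen pm t v (Suc (2 * n)) L R = (\<Sum>K\<in>?P. dual_chain M pm t (map v (rev [0..<n])) K R * norm_R M ?y t K L)"
    if L: "L \<subseteq> {1..M}" for L
    unfolding pp_gen_Suc[OF L R]
  proof (intro sum.cong refl)
    fix K assume "K \<in> ?P"
    then have K: "K \<subseteq> {1..M}" by simp
    show "pp_gen pm t v (2 * n) K R * (if level_ok pm (2 * n) K L then letter_weight t (v (2 * n div 2)) (2 * n) (dgm L - dgm K) else 0) =
      dual_chain M pm t (map v (rev [0..<n])) K R * norm_R M ?y t K L"
      unfolding d level_weight_eq[OF L K] Suc.IH[OF K] by simp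
  qed
  have "pp_gen pm t v (2 * Suc n) S R = pp_gen pm t v (Suc (Suc (2 * n))) S R" by simp
  also have "\<dots> = (\<Sum>L\<in>?P. pp_gen pm t v (Suc (2 * n)) L R * norm_C M pm ?y t L S)"
    unfolding pp_gen_Suc[OF Suc.prems R]
  proof (intro sum.cong refl)
    fix L assume "L \<in> ?P"
    then have L: "L \<subseteq> {1..M}" by simp
    show "pp_gen pm t v (Suc (2 * n)) L R * (if level_ok pm (Suc (2 * n)) L S then letter_weight t (v (Suc (2 * n) div 2)) (Suc (2 * n)) (dgm S - dgm L) else 0) =
      pp_gen pm t v (Suc (2 * n)) L R * norm_C M pm ?y t L S"
      unfolding d level_weight_eq[OF Suc.prems L] by simp
  qed
  also have "\<dots> = (\<Sum>L\<in>?P. \<Sum>K\<in>?P. dual_chain M pm t (map v (rev [0..<n])) K R * (norm_R M ?y t K L * norm_C M pm ?y t L S))"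
    by (intro sum.cong refl) (simp add: odd sum_distrib_right mult.assoc)
  also have "\<dots> = (\<Sum>K\<in>?P. dual_chain M pm t (map v (rev [0..<n])) K R * dual_op M pm t ?y K S)"
    unfolding dual_op_def sum_distrib_left by (rule sum.swap)
  finally show ?case by simp
qed

section \<open>Triangularity\<close>

text \<open>Fillings with one letter per box, as for Schur Q-functions. They are the common extreme
  case of both models: set-valued tableaux all of whose boxes are singletons, and plane partitions
  in which each letter has as many lines as boxes.\<close>

definition semistandard :: "(nat \<times> nat) set \<Rightarrow> (nat \<times> nat \<Rightarrow> nat) \<Rightarrow> bool" where
  "semistandard D T \<longleftrightarrow>
     (\<forall>i j. (i, j) \<in> D \<longrightarrow> (i, Suc j) \<in> D \<longrightarrow> T (i, j) \<le> T (i, Suc j)) \<and>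
     (\<forall>i j. (i, j) \<in> D \<longrightarrow> (Suc i, j) \<in> D \<longrightarrow> T (i, j) \<le> T (Suc i, j)) \<and>
     (\<forall>i j. (i, j) \<in> D \<longrightarrow> (Suc i, j) \<in> D \<longrightarrow> T (i, j) = T (Suc i, j) \<longrightarrow> even (T (i, j))) \<and>
     (\<forall>i j. (i, j) \<in> D \<longrightarrow> (i, Suc j) \<in> D \<longrightarrow> T (i, j) = T (i, Suc j) \<longrightarrow> odd (T (i, j)))"

lemmas semistandard_row = semistandard_def[THEN iffD1, THEN conjunct1, rule_format]
lemmas semistandard_col = semistandard_def[THEN iffD1, THEN conjunct2, THEN conjunct1, rule_format]
lemmas semistandard_even = semistandard_def[THEN iffD1, THEN conjunct2, THEN conjunct2, THEN conjunct1, rule_format]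
lemmas semistandard_odd = semistandard_def[THEN iffD1, THEN conjunct2, THEN conjunct2, THEN conjunct2, rule_format]

text \<open>The parts in increasing order, padded by zeros.\<close>

definition asc_part :: "nat set \<Rightarrow> nat \<Rightarrow> nat" where
  "asc_part S i = (if i < card S then card {c. card S \<le> i + cnt S c} else 0)"

text \<open>
  The filling in which the \<open>i\<close>-th largest part contributes the border strip that is peeled off in step \<open>i\<close>;
  the parity \<open>e\<close> of the diagonal entries is free.
\<close>

definition fill :: "nat \<Rightarrow> nat set \<Rightarrow> nat \<times> nat \<Rightarrow> nat" where
  "fill e S b = (case b of (i, j) \<Rightarrow> 2 * (card S - cnt S (j - i) + i - 1) +
     (if j = i then e else if j - i \<in> S then 0 else 1))"

lemma cnt_le_card: "finite S \<Longrightarrow> cnt S c \<le> card S"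
  unfolding cnt_def by (rule card_mono) auto

lemma fill_eq: "fill e S (i, i + c) = 2 * (card S - cnt S c + i - 1) + (if c = 0 then e else if c \<in> S then 0 else 1)"
  by (simp add: fill_def)

text \<open>Between the contents \<open>c\<close> and \<open>c + 1\<close> the same test, whether
  \<open>Suc c\<close> is a part, decides which neighbour relation leaves the index unchanged and
  which parity the box of content \<open>c + 1\<close> has; this settles every tie.\<close>

lemma semistandard_fill:
  assumes "finite S" "e \<le> 1"
  shows "semistandard (dgm S) (fill e S)"
proof -
  have row: "fill e S (i, j) \<le> fill e S (i, Suc j) \<and> (fill e S (i, j) = fill e S (i, Suc j) \<longrightarrow> odd (fill e S (i, j)))"
    if "(i, j) \<in> dgm S" "(i, Suc j) \<in> dgm S" for i j
  proof -
    have "i \<le> j" using dgmD[OF that(1)] by simp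
    then obtain c where c: "j = i + c" using le_Suc_ex by blast
    have i: "1 \<le> i" using dgmD[OF that(1)] by simp
    have r: "cnt S c = cnt S (Suc c) + of_bool (Suc c \<in> S)" by (rule cnt_rec[OF assms(1)])
    have le: "cnt S c \<le> card S" by (rule cnt_le_card[OF assms(1)])
    have 1: "fill e S (i, j) = 2 * (card S - cnt S c + i - 1) + (if c = 0 then e else if c \<in> S then 0 else 1)"
      unfolding c by (rule fill_eq)
    have 2: "fill e S (i, Suc j) = 2 * (card S - cnt S (Suc c) + i - 1) + (if Suc c \<in> S then 0 else 1)"
      using fill_eq[of e S i "Suc c"] by (simp add: c)
    show ?thesis
    proof (cases "Suc c \<in> S")
      case True
      then have eq: "card S - cnt S (Suc c) + i - 1 = Suc (card S - cnt S c + i - 1)" using r le i by simp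
      show ?thesis unfolding 1 2 eq using True assms(2) by auto
    next
      case False
      then have eq: "cnt S (Suc c) = cnt S c" using r by simp
      show ?thesis unfolding 1 2 eq using False assms(2) by auto
    qed
  qed
  have col: "fill e S (i, j) \<le> fill e S (Suc i, j) \<and> (fill e S (i, j) = fill e S (Suc i, j) \<longrightarrow> even (fill e S (i, j)))"
    if "(i, j) \<in> dgm S" "(Suc i, j) \<in> dgm S" for i j
  proof -
    have "Suc i \<le> j" using dgmD[OF that(2)] by simp
    then obtain c where c: "j = Suc i + c" using le_Suc_ex by blast
    have i: "1 \<le> i" using dgmD[OF that(1)] by simp
    have r: "cnt S c = cnt S (Suc c) + of_bool (Suc c \<in> S)" by (rule cnt_rec[OF assms(1)])
    have le: "cnt S c \<le> card S" by (rule cnt_le_card[OF assms(1)])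
    have 1: "fill e S (Suc i, j) = 2 * (card S - cnt S c + Suc i - 1) + (if c = 0 then e else if c \<in> S then 0 else 1)"
      unfolding c by (rule fill_eq)
    have 2: "fill e S (i, j) = 2 * (card S - cnt S (Suc c) + i - 1) + (if Suc c \<in> S then 0 else 1)"
      using fill_eq[of e S i "Suc c"] by (simp add: c)
    show ?thesis
    proof (cases "Suc c \<in> S")
      case True
      then have eq: "card S - cnt S (Suc c) + i - 1 = card S - cnt S c + Suc i - 1" using r le i by simp
      show ?thesis unfolding 1 2 eq using True by auto
    next
      case False
      then have eq: "card S - cnt S c + Suc i - 1 = Suc (card S - cnt S (Suc c) + i - 1)" using r le i by simp
      show ?thesis unfolding 1 2 eq using False by auto
    qed
  qed
  show ?thesis unfolding semistandard_def using row col by blast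
qed

text \<open>A diagonal has at most one box of a given index, at a fixed distance from its end, so
  these boxes can be counted by their contents.\<close>

lemma fill_count:
  assumes S: "S \<subseteq> {1..M}" and e: "e \<le> 1"
  shows "card {b \<in> dgm S. fill e S b div 2 = k} = asc_part S k"
proof -
  have fin: "finite S" using S by (rule finite_subset) simp
  have d: "fill e S (i, i + c) div 2 = card S - cnt S c + i - 1" for i c
    unfolding fill_eq using e by auto
  show ?thesis
  proof (cases "k < card S")
    case True
    let ?C = "{c. card S \<le> k + cnt S c}"
    let ?g = "\<lambda>c. (Suc k + cnt S c - card S, Suc k + cnt S c - card S + c)"
    have "{b \<in> dgm S. fill e S b div 2 = k} = ?g ` ?C"
    proof (intro equalityI subsetI)
      fix b assume "b \<in> {b \<in> dgm S. fill e S b div 2 = k}"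
      then obtain i j where b: "b = (i, j)" "(i, j) \<in> dgm S" "fill e S (i, j) div 2 = k" by (cases b) auto
      obtain c where c: "j = i + c" using dgmD[OF b(2)] le_Suc_ex by blast
      have "1 \<le> i" "i \<le> cnt S c" using b(2) unfolding c mem_dgm by auto
      moreover have "card S - cnt S c + i - 1 = k" using b(3) unfolding c d .
      ultimately have "i = Suc k + cnt S c - card S" "c \<in> ?C" using cnt_le_card[OF fin, of c] by auto
      then show "b \<in> ?g ` ?C" using b(1) c by (intro image_eqI[of _ _ c]) auto
    next
      fix b assume "b \<in> ?g ` ?C"
      then obtain c where c: "b = ?g c" "card S \<le> k + cnt S c" by blast
      have "?g c \<in> dgm S" unfolding mem_dgm using c True by auto
      moreover have "fill e S (?g c) div 2 = k" unfolding d using c cnt_le_card[OF fin, of c] by auto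
      ultimately show "b \<in> {b \<in> dgm S. fill e S b div 2 = k}" using c by blast
    qed
    moreover have "inj_on ?g ?C" by (auto simp: inj_on_def)
    ultimately have "card {b \<in> dgm S. fill e S b div 2 = k} = card ?C" by (simp only: card_image)
    then show ?thesis unfolding asc_part_def using True by simp
  next
    case False
    have "{b \<in> dgm S. fill e S b div 2 = k} = {}"
    proof (rule equals0I)
      fix b assume "b \<in> {b \<in> dgm S. fill e S b div 2 = k}"
      then obtain i j where b: "(i, j) \<in> dgm S" "fill e S (i, j) div 2 = k" by (cases b) auto
      obtain c where c: "j = i + c" using dgmD[OF b(1)] le_Suc_ex by blast
      have "1 \<le> i" "i \<le> cnt S c" using b(1) unfolding c mem_dgm by auto
      moreover have "card S - cnt S c + i - 1 = k" using b(2) unfolding c d .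
      ultimately show False using cnt_le_card[OF fin, of c] False by auto
    qed
    then have "card {b \<in> dgm S. fill e S b div 2 = k} = 0" by (simp only: card.empty)
    then show ?thesis using False by (simp add: asc_part_def)
  qed
qed

text \<open>Encodes the lexicographic order, beginning with the largest part, in the natural
  numbers: the largest element in which two sets differ decides.\<close>

definition binary_value :: "nat set \<Rightarrow> nat" where
  "binary_value S = (\<Sum>p\<in>S. 2 ^ p)"

lemma binary_value_less: "S \<subseteq> {..<n} \<Longrightarrow> binary_value S < 2 ^ n"
proof -
  assume "S \<subseteq> {..<n}"
  then have "binary_value S \<le> (\<Sum>p<n. 2 ^ p)" unfolding binary_value_def by (intro sum_mono2) auto
  also have "\<dots> < 2 ^ n" by (induction n) auto
  finally show ?thesis .
qed

text \<open>In the diagram, dropping the largest part shortens every nonempty diagonal by one box,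
  and since diagonals are filled from the top this strips the rim.\<close>

lemma cnt_remove_Max:
  assumes "finite S" "S \<noteq> {}"
  shows "cnt (S - {Max S}) c = cnt S c - 1"
proof (cases "c < Max S")
  case True
  have "{p \<in> S - {Max S}. c < p} = {p \<in> S. c < p} - {Max S}" by auto
  moreover have "Max S \<in> {p \<in> S. c < p}" using assms True by simp
  ultimately show ?thesis using assms(1) by (simp add: cnt_def)
next
  case False
  then have "{p \<in> S. c < p} = {}" using assms by (auto simp: not_less dest: Max_ge order_trans)
  then have "cnt S c = 0" unfolding cnt_def by (simp only: card.empty)
  moreover have "{p \<in> S - {Max S}. c < p} = {}" using \<open>{p \<in> S. c < p} = {}\<close> by auto
  ultimately show ?thesis unfolding cnt_def by (simp only: card.empty)
qed

lemma cnt_pos_iff: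
  assumes "finite S" "S \<noteq> {}"
  shows "0 < cnt S c \<longleftrightarrow> c < Max S"
proof -
  have "0 < cnt S c \<longleftrightarrow> {p \<in> S. c < p} \<noteq> {}" using assms unfolding cnt_def by (simp add: card_gt_0_iff)
  also have "\<dots> \<longleftrightarrow> c < Max S" using assms by (auto simp: Max_gr_iff)
  finally show ?thesis .
qed

lemma asc_part_last:
  assumes "finite S" "S \<noteq> {}"
  shows "asc_part S (card S - 1) = Max S"
proof -
  have pos: "0 < card S" using assms by (simp add: card_gt_0_iff)
  have "{c. card S \<le> card S - 1 + cnt S c} = {c. c < Max S}"
    unfolding cnt_pos_iff[OF assms, symmetric] using pos by auto
  then show ?thesis using pos by (simp add: asc_part_def)
qed

lemma asc_part_remove_Max:
  assumes "finite S" "S \<noteq> {}"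
  shows "asc_part (S - {Max S}) i = (if i = card S - 1 then 0 else asc_part S i)"
proof -
  have pos: "0 < card S" using assms by (simp add: card_gt_0_iff)
  have cd: "card (S - {Max S}) = card S - 1" using assms by simp
  have "{c. card S - 1 \<le> i + cnt (S - {Max S}) c} = {c. card S \<le> i + cnt S c}" if "i < card S - 1"
    unfolding cnt_remove_Max[OF assms] using that by auto
  then show ?thesis unfolding asc_part_def cd using pos by auto
qed

section \<open>Shape and content of semistandard fillings\<close>

lemma div2_chain:
  fixes a b c :: nat
  assumes "a \<le> b" "b \<le> c" "a = b \<Longrightarrow> odd a" "b = c \<Longrightarrow> even b"
  shows "a div 2 < c div 2"
proof -
  consider "a = b" "b = c" | "a = b" "b < c" | "a < b" "b = c" | "a < b" "b < c"
    using assms by linarith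
  then show ?thesis
  proof cases
    case 2
    then obtain m where "a = 2 * m + 1" using assms(3) by (auto elim: oddE)
    then show ?thesis using 2 div_le_mono[of "2 * m + 2" c 2] by simp
  next
    case 3
    then obtain m where "c = 2 * m" using assms(4) by (auto elim: evenE)
    then show ?thesis using 3 less_mult_imp_div_less[of a m 2] by simp
  next
    case 4
    then show ?thesis using div_le_mono[of "a + 2" c 2] by simp
  qed (use assms in auto)
qed

text \<open>A diagonal step is a row step followed by a column step; the first may repeat only an
  odd letter and the second only an even one, so one variable cannot serve both ends.\<close>

lemma semistandard_diag_step:
  assumes "finite S" "semistandard (dgm S) T" "(Suc i, Suc j) \<in> dgm S" "1 \<le> i" "i \<le> j"
  shows "(i, j) \<in> dgm S" "T (i, j) div 2 < T (Suc i, Suc j) div 2"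
proof -
  have m: "(i, Suc j) \<in> dgm S" using dgm_up[OF assms(1,3,4)] by simp
  show ij: "(i, j) \<in> dgm S" using dgm_left[OF assms(1) m assms(5)] by simp
  have le: "T (i, j) \<le> T (i, Suc j)" "T (i, Suc j) \<le> T (Suc i, Suc j)"
    using semistandard_row[OF assms(2) ij m] semistandard_col[OF assms(2) m assms(3)] by auto
  have ne: "T (i, j) = T (i, Suc j) \<Longrightarrow> odd (T (i, j))" "T (i, Suc j) = T (Suc i, Suc j) \<Longrightarrow> even (T (i, Suc j))"
    using semistandard_odd[OF assms(2) ij m] semistandard_even[OF assms(2) m assms(3)] by auto
  show "T (i, j) div 2 < T (Suc i, Suc j) div 2"
    using div2_chain[OF le ne] .
qed

lemma semistandard_diag_less:
  assumes "finite S" "semistandard (dgm S) T" "(i + Suc d, i + Suc d + c) \<in> dgm S" "1 \<le> i"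
  shows "T (i, i + c) div 2 < T (i + Suc d, i + Suc d + c) div 2"
  using assms(3)
proof (induction d)
  case 0
  then show ?case using semistandard_diag_step(2)[OF assms(1,2), of i "i + c"] assms(4) by simp
next
  case (Suc d)
  have "(Suc (i + Suc d), Suc (i + Suc d + c)) \<in> dgm S" using Suc.prems by simp
  from semistandard_diag_step[OF assms(1,2) this]
  have "(i + Suc d, i + Suc d + c) \<in> dgm S"
    "T (i + Suc d, i + Suc d + c) div 2 < T (i + Suc (Suc d), i + Suc (Suc d) + c) div 2" by auto
  then show ?case using Suc.IH by linarith
qed

lemma semistandard_mono: "semistandard D T \<Longrightarrow> D' \<subseteq> D \<Longrightarrow> semistandard D' T"
  unfolding semistandard_def by (meson subsetD)

text \<open>Indices increase along diagonals, so the boxes of the largest index are ends of distinct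
  diagonals. Their number, the largest part of \<open>S'\<close>, is therefore at most the number of
  diagonals, the largest part of \<open>S\<close>. If the two agree, these boxes form the whole rim;
  stripping it removes the largest part on both sides, and induction applies.\<close>

lemma semistandard_triangular:
  assumes "S' \<subseteq> {1..M}" "S \<subseteq> {1..M}" "semistandard (dgm S) T"
    and "\<And>k. card {b \<in> dgm S. T b div 2 = k} = asc_part S' k"
  shows "S = S' \<or> binary_value S' < binary_value S"
  using assms
proof (induction "card S'" arbitrary: S S' rule: less_induct)
  case less
  have fin: "finite S" "finite S'" using less.prems by (auto intro: finite_subset)
  have fD: "finite (dgm S)" using finite_dgm[OF less.prems(2)] .
  show ?case
  proof (cases "S' = {}")
    case True
    have "dgm S = {}"
    proof (rule ccontr)
      assume "dgm S \<noteq> {}"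
      then obtain b where "b \<in> dgm S" by blast
      then have "{b' \<in> dgm S. T b' div 2 = T b div 2} \<noteq> {}" by blast
      moreover have "finite {b' \<in> dgm S. T b' div 2 = T b div 2}" using fD by simp
      moreover have "card {b' \<in> dgm S. T b' div 2 = T b div 2} = 0"
        unfolding less.prems(4) True asc_part_def by simp
      ultimately show False by (metis card_0_eq)
    qed
    moreover have "dgm {} = {}" by (auto simp: dgm_def cnt_def)
    ultimately have "S = {}" using dgm_inj[of S "{}" M] less.prems(2) by simp
    then show ?thesis using True by simp
  next
    case ne: False
    define p where "p = Max S'"
    define k where "k = card S' - 1"
    have "p \<in> S'" using ne fin by (simp add: p_def)
    then have p: "p \<in> S'" "1 \<le> p" using less.prems(1) by auto
    define E where "E = {b \<in> dgm S. T b div 2 = k}"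
    have cE: "card E = p" unfolding E_def less.prems(4) k_def p_def by (rule asc_part_last[OF fin(2) ne])
    have top: "T b div 2 \<le> k" if "b \<in> dgm S" for b
    proof (rule ccontr)
      assume "\<not> T b div 2 \<le> k"
      then have "asc_part S' (T b div 2) = 0" by (simp add: asc_part_def k_def)
      then have "card {b' \<in> dgm S. T b' div 2 = T b div 2} = 0" unfolding less.prems(4) .
      moreover have "finite {b' \<in> dgm S. T b' div 2 = T b div 2}" using fD by simp
      ultimately have "{b' \<in> dgm S. T b' div 2 = T b div 2} = {}" by (simp only: card_0_eq)
      then show False using that by blast
    qed
    have Sne: "S \<noteq> {}"
    proof
      assume "S = {}"
      then have "E = {}" by (auto simp: E_def dgm_def cnt_def)
      then show False using cE p by simp
    qed
    have uniq: "i = cnt S c" if "(i, i + c) \<in> E" for i c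
    proof (rule ccontr)
      assume "i \<noteq> cnt S c"
      moreover have i: "1 \<le> i" "i \<le> cnt S c" using that unfolding E_def mem_Collect_eq mem_dgm by auto
      ultimately obtain d where d: "cnt S c = i + Suc d" using less_imp_Suc_add[of i "cnt S c"] by auto
      have "(i + Suc d, i + Suc d + c) \<in> dgm S" unfolding mem_dgm d[symmetric] using i d by simp
      from semistandard_diag_less[OF fin(1) less.prems(3) this i(1)] top[OF this] that show False by (simp add: E_def)
    qed
    define C where "C = {c. (cnt S c, cnt S c + c) \<in> E}"
    have E_eq: "E = (\<lambda>c. (cnt S c, cnt S c + c)) ` C"
    proof (intro equalityI subsetI)
      fix b assume b: "b \<in> E"
      then obtain i j where ij: "b = (i, j)" "(i, j) \<in> dgm S" by (cases b) (auto simp: E_def)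
      obtain c where c: "j = i + c" using dgmD[OF ij(2)] le_Suc_ex by blast
      have "i = cnt S c" using uniq[of i c] b ij c by simp
      then show "b \<in> (\<lambda>c. (cnt S c, cnt S c + c)) ` C" using b ij c by (auto simp: C_def)
    qed (auto simp: C_def)
    have C_sub: "C \<subseteq> {..<Max S}"
    proof
      fix c assume "c \<in> C"
      then have "0 < cnt S c" by (auto simp: C_def E_def mem_dgm)
      then show "c \<in> {..<Max S}" using cnt_pos_iff[OF fin(1) Sne] by simp
    qed
    have cC: "card C = p" using cE unfolding E_eq by (subst (asm) card_image) (auto simp: inj_on_def)
    then have le: "p \<le> Max S" using card_mono[OF _ C_sub] by simp
    have MS: "Max S \<in> S" using fin Sne by simp
    show ?thesis
    proof (cases "p = Max S")
      case False
      then have "p < Max S" using le by simp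
      then have "S' \<subseteq> {..<Max S}"
        using Max_ge[OF fin(2)] unfolding p_def by (meson le_less_trans lessThan_iff subsetI)
      then have "binary_value S' < 2 ^ Max S" by (rule binary_value_less)
      also have "\<dots> \<le> binary_value S" unfolding binary_value_def using fin MS by (intro member_le_sum) auto
      finally show ?thesis by simp
    next
      case True
      \<comment> \<open>As many ends as diagonals: every diagonal loses its last box, which is what
        makes \<open>dgm ?S\<close> the complement of \<open>E\<close>.\<close>
      then have C: "C = {..<Max S}" using card_subset_eq[OF _ C_sub] cC by simp
      let ?S = "S - {Max S}" and ?S' = "S' - {Max S'}"
      have D: "dgm ?S = dgm S - E"
      proof -
        have "(i, j) \<in> dgm ?S \<longleftrightarrow> (i, j) \<in> dgm S - E" for i j
        proof (cases "i \<le> j")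
          case True
          then obtain c where c: "j = i + c" using le_Suc_ex by blast
          have "(i, i + c) \<in> E \<longleftrightarrow> i = cnt S c \<and> c < Max S"
            unfolding E_eq C by auto
          then show ?thesis
            unfolding c Diff_iff mem_dgm cnt_remove_Max[OF fin(1) Sne] cnt_pos_iff[OF fin(1) Sne, symmetric] by auto
        qed (auto simp: dgm_def)
        then show ?thesis by auto
      qed
      have cnt': "card {b \<in> dgm ?S. T b div 2 = l} = asc_part ?S' l" for l
      proof (cases "l = k")
        case True
        then have "{b \<in> dgm ?S. T b div 2 = l} = {}" unfolding D by (auto simp: E_def)
        then have "card {b \<in> dgm ?S. T b div 2 = l} = 0" by (simp only: card.empty)
        then show ?thesis unfolding asc_part_remove_Max[OF fin(2) ne] using True by (simp add: k_def)
      next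
        case False
        then have "{b \<in> dgm ?S. T b div 2 = l} = {b \<in> dgm S. T b div 2 = l}" unfolding D by (auto simp: E_def)
        then show ?thesis unfolding asc_part_remove_Max[OF fin(2) ne] using False less.prems(4) by (simp add: k_def)
      qed
      have lt: "card ?S' < card S'" using card_Diff1_less[OF fin(2) p(1)] by (simp only: p_def)
      have sub: "?S' \<subseteq> {1..M}" "?S \<subseteq> {1..M}" using less.prems(1,2) by auto
      have st: "semistandard (dgm ?S) T" using semistandard_mono[OF less.prems(3)] D by blast
      have "?S = ?S' \<or> binary_value ?S' < binary_value ?S" by (rule less.hyps[OF lt sub st cnt'])
      moreover have "binary_value S = 2 ^ p + binary_value ?S" "binary_value S' = 2 ^ p + binary_value ?S'"
        unfolding binary_value_def using sum.remove[OF fin(1) MS, of "(^) 2"] sum.remove[OF fin(2) p(1), of "(^) 2"] True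
        by (simp_all add: p_def)
      moreover have "S = insert p ?S" "S' = insert p ?S'" using MS p(1) True by (auto simp: p_def)
      ultimately show ?thesis by auto
    qed
  qed
qed

section \<open>Coefficients of the generating functions\<close>

definition allowed :: "bool \<Rightarrow> (nat \<times> nat) set" where
  "allowed pm = {(k, c). pm \<or> odd k \<or> c \<noteq> 0}"

lemma Max_le_Min_iff:
  fixes A B :: "nat set"
  assumes "finite A" "A \<noteq> {}" "finite B" "B \<noteq> {}"
  shows "Max A \<le> Min B \<longleftrightarrow> (\<forall>a\<in>A. \<forall>b\<in>B. a \<le> b)"
  using assms by (auto simp: Max_le_iff Min_ge_iff)

lemma set_tableaux_Q_eq:
  "set_tableaux_Q lam = stab (shifted_diagram lam) UNIV"
proof (intro equalityI subsetI)
  let ?D = "shifted_diagram lam"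
  fix T assume T: "T \<in> set_tableaux_Q lam"
  note h = T[unfolded set_tableaux_Q_def, THEN CollectD]
  note h2 = h[THEN conjunct2, THEN conjunct1, rule_format]
  note h3 = h[THEN conjunct2, THEN conjunct2, THEN conjunct1, rule_format]
  note h4 = h[THEN conjunct2, THEN conjunct2, THEN conjunct2, THEN conjunct1, rule_format]
  note h5 = h[THEN conjunct2, THEN conjunct2, THEN conjunct2, THEN conjunct2, THEN conjunct1, rule_format]
  note h6 = h[THEN conjunct2, THEN conjunct2, THEN conjunct2, THEN conjunct2, THEN conjunct2, rule_format]
  have "svalid ?D UNIV T"
    unfolding svalid_def
  proof (intro conjI allI impI ballI)
    fix b assume "b \<in> ?D" then show "finite (T b)" using h2 by blast
  next
    fix i j k k' assume *: "(i, j) \<in> ?D" "(Suc i, j) \<in> ?D" "k \<in> T (i, j)" "k' \<in> T (Suc i, j)"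
    then have "Max (T (i, j)) \<le> Min (T (Suc i, j))" using h3[of i j] by simp
    then show "k \<le> k'" using Max_le_Min_iff[of "T (i, j)" "T (Suc i, j)"] h2[OF *(1)] h2[OF *(2)] * by blast
  next
    fix i j k k' assume *: "(i, j) \<in> ?D" "(i, Suc j) \<in> ?D" "k \<in> T (i, j)" "k' \<in> T (i, Suc j)"
    then have "Max (T (i, j)) \<le> Min (T (i, Suc j))" using h4[of i j] by simp
    then show "k \<le> k'" using Max_le_Min_iff[of "T (i, j)" "T (i, Suc j)"] h2[OF *(1)] h2[OF *(2)] * by blast
  next
    fix i i' j k assume *: "odd k" "(i, j) \<in> ?D" "(i', j) \<in> ?D" "k \<in> T (i, j)" "k \<in> T (i', j)"
    obtain a where a: "k = unprimed a" using *(1) unfolding unprimed_def by (elim oddE)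
    show "i = i'"
    proof (rule ccontr)
      assume "i \<noteq> i'"
      then show False using h5[of i j i' a] * a by simp
    qed
  next
    fix i j j' k assume *: "even k" "(i, j) \<in> ?D" "(i, j') \<in> ?D" "k \<in> T (i, j)" "k \<in> T (i, j')"
    obtain a where a: "k = primed a" using *(1) unfolding primed_def by (elim evenE)
    show "j = j'"
    proof (rule ccontr)
      assume "j \<noteq> j'"
      then show False using h6[of i j j' a] * a by simp
    qed
  qed simp
  moreover have "\<forall>b\<in>?D. T b \<noteq> {}" using h2 by blast
  ultimately show "T \<in> stab ?D UNIV" using h[THEN conjunct1] unfolding stab_def by blast
next
  let ?D = "shifted_diagram lam"
  fix T assume T: "T \<in> stab ?D UNIV"
  then have v: "svalid ?D UNIV T" and ne: "\<And>b. b \<in> ?D \<Longrightarrow> T b \<noteq> {}" and ext: "T \<in> extensional ?D"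
    by (simp_all add: stab_def)
  note fin = svalid_finite[OF v]
  show "T \<in> set_tableaux_Q lam"
    unfolding set_tableaux_Q_def mem_Collect_eq
  proof (intro conjI allI impI ballI)
    fix i j assume *: "(i, j) \<in> ?D \<and> (i + 1, j) \<in> ?D"
    then show "Max (T (i, j)) \<le> Min (T (i + 1, j))"
      using svalid_col_le[OF v, of i j] by (subst Max_le_Min_iff) (simp_all add: fin ne)
  next
    fix i j assume *: "(i, j) \<in> ?D \<and> (i, j + 1) \<in> ?D"
    then show "Max (T (i, j)) \<le> Min (T (i, j + 1))"
      using svalid_row_le[OF v, of i j] by (subst Max_le_Min_iff) (simp_all add: fin ne)
  next
    fix a i i' j assume *: "(i, j) \<in> ?D \<and> (i', j) \<in> ?D \<and> i \<noteq> i'"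
    then show "\<not> (unprimed a \<in> T (i, j) \<and> unprimed a \<in> T (i', j))"
      using svalid_odd[OF v, of "unprimed a" i j i'] by (simp add: unprimed_def) blast
  next
    fix a i j j' assume *: "(i, j) \<in> ?D \<and> (i, j') \<in> ?D \<and> j \<noteq> j'"
    then show "\<not> (primed a \<in> T (i, j) \<and> primed a \<in> T (i, j'))"
      using svalid_even[OF v, of "primed a" i j j'] by (simp add: primed_def) blast
  qed (use ext fin ne in auto)
qed

lemma svalid_restrict: "svalid D W T \<longleftrightarrow> svalid D UNIV T \<and> (\<forall>i j k. (i, j) \<in> D \<longrightarrow> k \<in> T (i, j) \<longrightarrow> (k, j - i) \<in> W)"
  unfolding svalid_def by simp

lemma stab_mono:
  assumes "W \<subseteq> W'"
  shows "stab D W \<subseteq> stab D W'"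
proof
  fix T assume T: "T \<in> stab D W"
  then have v: "svalid D W T" by (simp add: stab_def)
  have "svalid D W' T"
    unfolding svalid_restrict[of D W']
  proof (intro conjI allI impI)
    show "svalid D UNIV T" by (rule svalid_restrict[THEN iffD1, THEN conjunct1, OF v])
    show "(k, j - i) \<in> W'" if "(i, j) \<in> D" "k \<in> T (i, j)" for i j k
      using svalidW[OF v that] assms by blast
  qed
  then show "T \<in> stab D W'" using T by (simp add: stab_def)
qed

lemma set_tableaux_eq:
  assumes "lam \<in> strict_partitions"
  shows "(if pm then set_tableaux_Q lam else set_tableaux_P lam) = stab (dgm (set lam)) (allowed pm)"
proof (cases pm)
  case True
  then have "allowed pm = UNIV" by (auto simp: allowed_def)
  then show ?thesis using True by (simp add: set_tableaux_Q_eq shifted_diagram_eq[OF assms])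
next
  case False
  let ?D = "dgm (set lam)"
  have "(\<forall>a i. (i, i) \<in> ?D \<longrightarrow> primed a \<notin> T (i, i)) \<longleftrightarrow>
      (\<forall>i j k. (i, j) \<in> ?D \<longrightarrow> k \<in> T (i, j) \<longrightarrow> (k, j - i) \<in> allowed pm)" for T :: "nat \<times> nat \<Rightarrow> nat set"
  proof (intro iffI allI impI)
    fix i j k assume h: "\<forall>a i. (i, i) \<in> ?D \<longrightarrow> primed a \<notin> T (i, i)" and *: "(i, j) \<in> ?D" "k \<in> T (i, j)"
    show "(k, j - i) \<in> allowed pm"
    proof (rule ccontr)
      assume "(k, j - i) \<notin> allowed pm"
      then have "even k" "j - i = 0" by (auto simp: allowed_def)
      moreover from this have "j = i" using dgmD[OF *(1)] by simp
      moreover obtain a where "k = primed a" using \<open>even k\<close> unfolding primed_def by (elim evenE)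
      ultimately show False using h * by simp
    qed
  next
    fix a i assume h: "\<forall>i j k. (i, j) \<in> ?D \<longrightarrow> k \<in> T (i, j) \<longrightarrow> (k, j - i) \<in> allowed pm" and *: "(i, i) \<in> ?D"
    show "primed a \<notin> T (i, i)"
    proof
      assume "primed a \<in> T (i, i)"
      then have "(primed a, i - i) \<in> allowed pm" using h * by blast
      then show False using False by (simp add: allowed_def primed_def)
    qed
  qed
  then show ?thesis
    using False unfolding set_tableaux_P_def set_tableaux_Q_eq shifted_diagram_eq[OF assms] stab_def
    by (subst svalid_restrict[of _ "allowed pm"]) auto
qed

section \<open>Coefficients of the tableau sums\<close>

definition stexp :: "(nat \<times> nat) set \<Rightarrow> (nat \<times> nat \<Rightarrow> nat set) \<Rightarrow> (nat \<Rightarrow>\<^sub>0 nat)" where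
  "stexp D T = (\<Sum>B\<in>D. \<Sum>k\<in>T B. Poly_Mapping.single (k div 2) 1)"

lemma card_div2_eq:
  fixes A :: "nat set"
  assumes "finite A"
  shows "card {k\<in>A. k div 2 = i} = of_bool (2 * i + 1 \<in> A) + of_bool (2 * i \<in> A)"
proof -
  have "k div 2 = i \<longleftrightarrow> k = 2 * i + 1 \<or> k = 2 * i" for k by linarith
  then have "{k\<in>A. k div 2 = i} = (if 2 * i + 1 \<in> A then {2 * i + 1} else {}) \<union> (if 2 * i \<in> A then {2 * i} else {})"
    by auto
  then show ?thesis by auto
qed

lemma lookup_stexp:
  assumes "finite D" "\<And>B. B \<in> D \<Longrightarrow> finite (T B)"
  shows "Poly_Mapping.lookup (stexp D T) i = card {B\<in>D. unprimed i \<in> T B} + card {B\<in>D. primed i \<in> T B}"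
proof -
  have "Poly_Mapping.lookup (stexp D T) i = (\<Sum>B\<in>D. card {k\<in>T B. k div 2 = i})"
    unfolding stexp_def lookup_sum
  proof (intro sum.cong refl)
    fix B assume "B \<in> D"
    then show "(\<Sum>k\<in>T B. Poly_Mapping.lookup (Poly_Mapping.single (k div 2) 1) i) = card {k\<in>T B. k div 2 = i}"
      using assms(2) by (simp add: lookup_single when_def sum.If_cases Int_def)
  qed
  also have "\<dots> = (\<Sum>B\<in>D. of_bool (unprimed i \<in> T B) + of_bool (primed i \<in> T B))"
    using assms(2) by (intro sum.cong refl) (simp add: card_div2_eq unprimed_def primed_def)
  also have "\<dots> = card {B\<in>D. unprimed i \<in> T B} + card {B\<in>D. primed i \<in> T B}"
    using assms(1) by (simp add: sum.distrib of_bool_def sum.If_cases Int_def)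
  finally show ?thesis .
qed

lemma wdeg_stexp: "wdeg (\<lambda>_. 1) (stexp D T) = (\<Sum>B\<in>D. card (T B))"
  by (simp add: stexp_def wdeg_sum wdeg_single)

lemma lookup_sum_single:
  fixes n :: nat
  shows "Poly_Mapping.lookup (\<Sum>i<n. Poly_Mapping.single i (f i)) j = (if j < n then f j else 0)"
proof -
  have "Poly_Mapping.lookup (\<Sum>i<n. Poly_Mapping.single i (f i)) j = (\<Sum>i<n. if j = i then f j else 0)"
    unfolding lookup_sum by (intro sum.cong) (auto simp: lookup_single when_def)
  then show ?thesis by simp
qed

lemma box_weight_term:
  assumes "finite A"
  shows "box_weight beta mps_var A = mps_term ([:0, 1:] ^ (card A - 1)) (\<Sum>k\<in>A. Poly_Mapping.single (k div 2) 1)"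
  unfolding box_weight_def beta_eq_term const_term_power var_eq_term prod_term[OF assms] mps_term_mult by simp

lemma prod_box_weight_term:
  assumes "finite D" "\<And>B. B \<in> D \<Longrightarrow> finite (T B)"
  shows "(\<Prod>B\<in>D. box_weight beta mps_var (T B)) = mps_term ([:0, 1:] ^ (\<Sum>B\<in>D. card (T B) - 1)) (stexp D T)"
proof -
  have "(\<Prod>B\<in>D. box_weight beta mps_var (T B)) =
      (\<Prod>B\<in>D. mps_term ([:0, 1:] ^ (card (T B) - 1)) (\<Sum>k\<in>T B. Poly_Mapping.single (k div 2) 1))"
    using assms(2) by (intro prod.cong refl) (simp add: box_weight_term)
  then show ?thesis unfolding prod_term[OF assms(1)] stexp_def by (simp add: power_sum)
qed

text \<open>Since the boxes are nonempty, the exponent of \<open>beta\<close> is the sum over the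
  boxes of the number of surplus letters; the whole term then factors over the boxes.\<close>

lemma st_term_eq:
  assumes lam: "lam \<in> strict_partitions" and T: "T \<in> stab (dgm (set lam)) W"
  shows "beta ^ (st_size lam T - sum_list lam) * st_monomial lam T =
    (\<Prod>B\<in>dgm (set lam). box_weight beta mps_var (T B))"
proof -
  let ?D = "dgm (set lam)"
  note sp = strict_partitions_props[OF lam]
  have fD: "finite ?D" by (rule finite_dgm[OF sp(2)])
  have v: "svalid ?D W T" and ne: "\<And>B. B \<in> ?D \<Longrightarrow> T B \<noteq> {}" using T by (simp_all add: stab_def)
  have fin: "\<And>B. B \<in> ?D \<Longrightarrow> finite (T B)" using svalid_finite[OF v] .
  have "(\<Sum>B\<in>?D. card (T B) - 1) = (\<Sum>B\<in>?D. card (T B)) - (\<Sum>B\<in>?D. 1)"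
    using fin ne by (intro sum_subtractf_nat) (simp add: Suc_le_eq card_gt_0_iff)
  then have e: "st_size lam T - sum_list lam = (\<Sum>B\<in>?D. card (T B) - 1)"
    using card_dgm[OF sp(2)] sp(3) by (simp add: st_size_def shifted_diagram_eq[OF lam])
  let ?f = "\<lambda>i. card {B\<in>?D. unprimed i \<in> T B} + card {B\<in>?D. primed i \<in> T B}"
  have lk: "Poly_Mapping.lookup (stexp ?D T) i = ?f i" for i by (rule lookup_stexp[OF fD fin])
  have "finite (Poly_Mapping.keys (stexp ?D T))" by simp
  then obtain n where n: "Poly_Mapping.keys (stexp ?D T) \<subseteq> {..<n}"
    using finite_nat_iff_bounded by blast
  have f0: "?f i = 0" if "\<not> i < n" for i
    using n that lk[of i] by (metis in_keys_iff lessThan_iff subsetD)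
  have "st_monomial lam T = Prod_any (\<lambda>i. mps_var i ^ ?f i)"
    unfolding st_monomial_def shifted_diagram_eq[OF lam] ..
  also have "\<dots> = (\<Prod>i<n. mps_var i ^ ?f i)"
  proof (rule Prod_any.expand_superset)
    show "{i. mps_var i ^ ?f i \<noteq> (1 :: series)} \<subseteq> {..<n}"
    proof
      fix i assume "i \<in> {i. mps_var i ^ ?f i \<noteq> (1 :: series)}"
      then have "?f i \<noteq> 0" by (metis (mono_tags, lifting) mem_Collect_eq power_0)
      then show "i \<in> {..<n}" using f0[of i] by (metis lessThan_iff)
    qed
  qed simp
  also have "\<dots> = mps_term 1 (\<Sum>i<n. Poly_Mapping.single i (?f i))"
    by (simp add: var_power_eq_term prod_term)
  also have "(\<Sum>i<n. Poly_Mapping.single i (?f i)) = stexp ?D T"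
    by (rule poly_mapping_eqI) (simp only: lookup_sum_single lk, use f0 in simp)
  finally have mono: "st_monomial lam T = mps_term 1 (stexp ?D T)" .
  have "beta ^ k * mps_term 1 (stexp ?D T) = mps_term ([:0, 1:] ^ k) (stexp ?D T)" for k
    by (simp add: beta_eq_term const_term_power mps_term_mult)
  then show ?thesis unfolding e mono using prod_box_weight_term[of ?D T] fD fin by simp
qed

text \<open>The third assumption says that a monomial in the first \<open>n\<close> variables only
  sees the finite set \<open>B n\<close>, so its coefficient in the infinite sum is that of a finite
  sum.\<close>

lemma infsum_nth_eq:
  fixes f :: "'i \<Rightarrow> series"
  assumes "\<And>n. finite (B n)" "\<And>n. B n \<subseteq> A"
    and "\<And>m n T. Poly_Mapping.keys m \<subseteq> {..<n} \<Longrightarrow> T \<in> A \<Longrightarrow> mps_nth (f T) m \<noteq> 0 \<Longrightarrow> T \<in> B n"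
    and m: "Poly_Mapping.keys m \<subseteq> {..<n}"
  shows "mps_nth (infsum f A) m = mps_nth (\<Sum>T\<in>B n. f T) m"
proof -
  have fin: "finite {T\<in>A. mps_nth (f T) m \<noteq> 0}" for m
  proof -
    obtain n where "Poly_Mapping.keys m \<subseteq> {..<n}" using finite_nat_iff_bounded finite_keys by blast
    then have "{T\<in>A. mps_nth (f T) m \<noteq> 0} \<subseteq> B n" using assms(3) by blast
    then show ?thesis using assms(1) finite_subset by blast
  qed
  have "mps_nth (infsum f A) m = (\<Sum>T\<in>{T\<in>A. mps_nth (f T) m \<noteq> 0}. mps_nth (f T) m)"
    by (rule mps_nth_infsum[OF fin])
  also have "\<dots> = (\<Sum>T\<in>B n. mps_nth (f T) m)"
    using assms(1,2) assms(3)[OF m] by (intro sum.mono_neutral_left) auto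
  finally show ?thesis by (simp add: mps_nth_sum)
qed

definition GQP :: "bool \<Rightarrow> nat list \<Rightarrow> series" where
  "GQP pm lam = (if pm then GQ lam else GP lam)"

lemma GQP_nth:
  assumes lam: "lam \<in> strict_partitions" and M: "set lam \<subseteq> {1..M}" and m: "Poly_Mapping.keys m \<subseteq> {..<n}"
  shows "mps_nth (GQP pm lam) m = mps_nth (stab_gen beta mps_var (letters pm M n) (set lam)) m"
proof -
  let ?D = "dgm (set lam)" and ?A = "stab (dgm (set lam)) (allowed pm)"
  let ?f = "\<lambda>T. beta ^ (st_size lam T - sum_list lam) * st_monomial lam T :: series"
  have fD: "finite ?D" by (rule finite_dgm[OF M])
  have "GQP pm lam = infsum ?f ?A"
    using set_tableaux_eq[OF lam, of pm] by (simp add: GQP_def GQ_def GP_def split: if_splits)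
  also have "mps_nth \<dots> m = mps_nth (\<Sum>T\<in>stab ?D (letters pm M n). ?f T) m"
  proof (rule infsum_nth_eq[where B = "\<lambda>n. stab ?D (letters pm M n)", OF _ _ _ m])
    show "finite (stab ?D (letters pm M n))" for n by (rule finite_stab[OF fD finite_letters])
    have "letters pm M n \<subseteq> allowed pm" for n by (auto simp: letters_def allowed_def)
    then show "stab ?D (letters pm M n) \<subseteq> ?A" for n by (rule stab_mono)
    fix m n T assume m: "Poly_Mapping.keys m \<subseteq> {..<n}" and T: "T \<in> ?A" and nz: "mps_nth (?f T) m \<noteq> 0"
    have v: "svalid ?D (allowed pm) T" using T by (simp add: stab_def)
    note fin = svalid_finite[OF v]
    have "m = stexp ?D T"
      using nz unfolding st_term_eq[OF lam T] prod_box_weight_term[of ?D T, OF fD fin, simplified] mps_nth_term by (simp split: if_splits)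
    have "svalid ?D (letters pm M n) T"
      unfolding svalid_restrict[of ?D "letters pm M n"]
    proof (intro conjI allI impI)
      show "svalid ?D UNIV T" by (rule svalid_restrict[THEN iffD1, THEN conjunct1, OF v])
      fix i j k assume *: "(i, j) \<in> ?D" "k \<in> T (i, j)"
      have "{B\<in>?D. k \<in> T B} \<noteq> {}" using * by blast
      moreover have "finite {B\<in>?D. k \<in> T B}" using fD by simp
      ultimately have nz: "card {B\<in>?D. k \<in> T B} \<noteq> 0" by (simp only: card_0_eq not_False_eq_True)
      have lk: "Poly_Mapping.lookup m l = card {B\<in>?D. unprimed l \<in> T B} + card {B\<in>?D. primed l \<in> T B}" for l
        unfolding \<open>m = _\<close> using fD fin by (intro lookup_stexp) auto
      have "Poly_Mapping.lookup m (k div 2) \<noteq> 0"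
      proof (cases "odd k")
        case True
        then have "unprimed (k div 2) = k" by (simp add: unprimed_def)
        then show ?thesis using nz lk[of "k div 2"] by simp
      next
        case False
        then have "primed (k div 2) = k" by (simp add: primed_def)
        then show ?thesis using nz lk[of "k div 2"] by simp
      qed
      then have "k div 2 \<in> Poly_Mapping.keys m" by (simp add: in_keys_iff)
      then have "k div 2 < n" using m by blast
      then have "k < 2 * n" by linarith
      moreover have "j - i < M"
        using dgmD[OF *(1)] cnt_eq_0[OF M, of "j - i"] by (cases "j - i < M") auto
      moreover have "(k, j - i) \<in> allowed pm" by (rule svalidW[OF v *])
      ultimately show "(k, j - i) \<in> letters pm M n" by (simp add: letters_def allowed_def)
    qed
    then show "T \<in> stab ?D (letters pm M n)" using T by (simp add: stab_def)
  qed
  also have "(\<Sum>T\<in>stab ?D (letters pm M n). ?f T) = stab_gen beta mps_var (letters pm M n) (set lam)"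
    unfolding stab_gen_def by (intro sum.cong refl) (rule st_term_eq[OF lam])
  finally show ?thesis .
qed

text \<open>In the lowest possible degree, the size of the shape, every box holds exactly one letter
  and no \<open>beta\<close> appears.\<close>

lemma GQP_nth_count:
  assumes lam: "lam \<in> strict_partitions" and M: "set lam \<subseteq> {1..M}" and m: "Poly_Mapping.keys m \<subseteq> {..<n}"
    and deg: "wdeg (\<lambda>_. 1) m = \<Sum>(set lam)"
  shows "mps_nth (GQP pm lam) m =
    of_nat (card {T \<in> stab (dgm (set lam)) (letters pm M n). stexp (dgm (set lam)) T = m \<and> (\<forall>B\<in>dgm (set lam). card (T B) = 1)})"
proof -
  let ?D = "dgm (set lam)" and ?A = "stab (dgm (set lam)) (letters pm M n)"
  have fD: "finite ?D" by (rule finite_dgm[OF M])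
  have "mps_nth (\<Prod>B\<in>?D. box_weight beta mps_var (T B)) m =
     (if stexp ?D T = m \<and> (\<forall>B\<in>?D. card (T B) = 1) then 1 else 0)" if T: "T \<in> ?A" for T
  proof -
    have v: "svalid ?D (letters pm M n) T" and ne: "\<And>B. B \<in> ?D \<Longrightarrow> T B \<noteq> {}" using T by (simp_all add: stab_def)
    note fin = svalid_finite[OF v]
    have pos: "1 \<le> card (T B)" if "B \<in> ?D" for B using that ne fin by (simp add: Suc_le_eq card_gt_0_iff)
    have all1: "\<forall>B\<in>?D. card (T B) = 1" if "stexp ?D T = m"
    proof (rule ccontr)
      assume "\<not> (\<forall>B\<in>?D. card (T B) = 1)"
      then obtain B where B: "B \<in> ?D" "1 < card (T B)" using pos by (metis le_neq_implies_less)
      have "(\<Sum>B\<in>?D. 1) < (\<Sum>B\<in>?D. card (T B))"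
        using B pos by (intro sum_strict_mono_ex1[OF fD]) auto
      then show False using deg wdeg_stexp[of ?D T] card_dgm[OF M] that by simp
    qed
    then have "stexp ?D T = m \<Longrightarrow> (\<Sum>B\<in>?D. card (T B) - 1) = 0" by simp
    then show ?thesis
      unfolding prod_box_weight_term[of ?D T, OF fD fin, simplified] mps_nth_term using all1 by auto
  qed
  then have "mps_nth (GQP pm lam) m = (\<Sum>T\<in>?A. if stexp ?D T = m \<and> (\<forall>B\<in>?D. card (T B) = 1) then 1 else 0)"
    unfolding GQP_nth[OF lam M m] stab_gen_def mps_nth_sum by (intro sum.cong) auto
  also have "\<dots> = of_nat (card {T \<in> ?A. stexp ?D T = m \<and> (\<forall>B\<in>?D. card (T B) = 1)})"
    using finite_stab[OF fD finite_letters[of pm M n]] by (simp add: sum.If_cases Int_def)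
  finally show ?thesis .
qed

section \<open>Coefficients of the plane partition sums\<close>

lemma sum_pairs:
  fixes f :: "nat \<Rightarrow> 'a::comm_monoid_add"
  shows "(\<Sum>l<2 * n. f l) = (\<Sum>i<n. f (2 * i + 1) + f (2 * i))"
  by (induction n) (simp_all add: ac_simps)

definition ppexp :: "nat \<Rightarrow> (nat \<times> nat) set \<Rightarrow> (nat \<times> nat \<Rightarrow> nat) \<Rightarrow> (nat \<Rightarrow>\<^sub>0 nat)" where
  "ppexp k D T = (\<Sum>l<k. Poly_Mapping.single (l div 2) (lines l {b \<in> D. T b = l}))"

lemma ppexp_eq: "ppexp (2 * n) D T =
    (\<Sum>i<n. Poly_Mapping.single i (lines (2 * i + 1) {b \<in> D. T b = 2 * i + 1} + lines (2 * i) {b \<in> D. T b = 2 * i}))"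
  unfolding ppexp_def sum_pairs by (simp add: single_add)

lemma lookup_ppexp: "Poly_Mapping.lookup (ppexp (2 * n) D T) i =
    (if i < n then lines (2 * i + 1) {b \<in> D. T b = 2 * i + 1} + lines (2 * i) {b \<in> D. T b = 2 * i} else 0)"
  unfolding ppexp_eq by (rule lookup_sum_single)

lemma pp_weight_term:
  "pp_weight (- beta) mps_var k D T =
    mps_term ((- [:0, 1:]) ^ (\<Sum>l<k. card {b \<in> D. T b = l} - lines l {b \<in> D. T b = l})) (ppexp k D T)"
proof -
  have "letter_weight (- beta) (mps_var v) l L = mps_term ((- [:0, 1:]) ^ (card L - lines l L)) (Poly_Mapping.single v (lines l L))"
    for v l and L :: "(nat \<times> nat) set"
    unfolding letter_weight_def neg_beta_power var_power_eq_term mps_term_mult by simp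
  then have "pp_weight (- beta) mps_var k D T = (\<Prod>l<k. mps_term ((- [:0, 1:]) ^ (card {b \<in> D. T b = l} - lines l {b \<in> D. T b = l}))
      (Poly_Mapping.single (l div 2) (lines l {b \<in> D. T b = l})))"
    unfolding pp_weight_def by (intro prod.cong) auto
  then show ?thesis
    unfolding prod_term[OF finite_lessThan] ppexp_def by (simp only: power_sum)
qed

lemma lines_le: "finite L \<Longrightarrow> lines l L \<le> card L"
  by (simp add: lines_def card_image_le)

lemma lines_pos: "finite L \<Longrightarrow> L \<noteq> {} \<Longrightarrow> lines l L \<noteq> 0"
  by (auto simp: lines_def card_gt_0_iff)

lemma wdeg_ppexp: "wdeg (\<lambda>_. 1) (ppexp k D T) = (\<Sum>l<k. lines l {b \<in> D. T b = l})"
  by (simp add: ppexp_def wdeg_sum wdeg_single)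

lemma card_levels:
  assumes "finite D" "\<And>b. b \<in> D \<Longrightarrow> f b < (k::nat)"
  shows "card D = (\<Sum>l<k. card {b \<in> D. f b = l})"
proof -
  have "(\<Sum>l<k. \<Sum>b\<in>{b \<in> D. f b = l}. 1) = (\<Sum>b\<in>D. 1::nat)"
    by (rule sum.group[OF assms(1)]) (use assms(2) in auto)
  then show ?thesis by simp
qed

text \<open>The exponent of \<open>- beta\<close> thus depends only on the shape and on the degree
  of the monomial, which is the homogeneity behind the uniqueness of the skew functions.\<close>

lemma pp_exponent:
  assumes "finite D" "\<And>b. b \<in> D \<Longrightarrow> T b < k"
  shows "(\<Sum>l<k. card {b \<in> D. T b = l} - lines l {b \<in> D. T b = l}) = card D - wdeg (\<lambda>_. 1) (ppexp k D T)"
    and "wdeg (\<lambda>_. 1) (ppexp k D T) \<le> card D"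
proof -
  have le: "lines l {b \<in> D. T b = l} \<le> card {b \<in> D. T b = l}" for l
    using assms(1) by (intro lines_le) simp
  have c: "card D = (\<Sum>l<k. card {b \<in> D. T b = l})"
    using assms by (intro card_levels) auto
  show "(\<Sum>l<k. card {b \<in> D. T b = l} - lines l {b \<in> D. T b = l}) = card D - wdeg (\<lambda>_. 1) (ppexp k D T)"
    unfolding wdeg_ppexp c using le by (intro sum_subtractf_nat) auto
  show "wdeg (\<lambda>_. 1) (ppexp k D T) \<le> card D"
    unfolding wdeg_ppexp c using le by (intro sum_mono) auto
qed

lemma skew_diagram_eq:
  "lam \<in> strict_partitions \<Longrightarrow> mu \<in> strict_partitions \<Longrightarrow> skew_diagram lam mu = dgm (set lam) - dgm (set mu)"
  by (simp add: skew_diagram_def shifted_diagram_eq)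

lemma wt_PP_eq:
  assumes "lam \<in> strict_partitions" "mu \<in> strict_partitions"
  defines "D \<equiv> dgm (set lam) - dgm (set mu)"
  shows "wt_PP lam mu T i = lines (2 * i + 1) {b \<in> D. T b = 2 * i + 1} + lines (2 * i) {b \<in> D. T b = 2 * i}"
proof -
  have "{c. \<exists>r. (r, c) \<in> D \<and> T (r, c) = unprimed i} = snd ` {b \<in> D. T b = 2 * i + 1}"
    "{r. \<exists>c. (r, c) \<in> D \<and> T (r, c) = primed i} = fst ` {b \<in> D. T b = 2 * i}"
    by (force simp: unprimed_def primed_def)+
  then show ?thesis
    by (simp add: wt_PP_def skew_diagram_eq[OF assms(1,2)] lines_def D_def)
qed

lemma card_skew_diagram:
  assumes "lam \<in> strict_partitions" "mu \<in> strict_partitions" "dgm (set mu) \<subseteq> dgm (set lam)"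
  shows "card (dgm (set lam) - dgm (set mu)) = sum_list lam - sum_list mu"
proof -
  note l = strict_partitions_props[OF assms(1)] and m = strict_partitions_props[OF assms(2)]
  show ?thesis
    using card_Diff_subset[OF finite_dgm[OF m(2)] assms(3)] card_dgm[OF l(2)] card_dgm[OF m(2)] l(3) m(3) by simp
qed

lemma pp_term_eq:
  assumes lam: "lam \<in> strict_partitions" and mu: "mu \<in> strict_partitions"
    and T: "T \<in> pp_set pm (2 * n) (set lam) (set mu)"
  shows "pp_term lam mu T = pp_weight (- beta) mps_var (2 * n) (dgm (set lam) - dgm (set mu)) T"
proof -
  let ?D = "dgm (set lam) - dgm (set mu)"
  let ?f = "wt_PP lam mu T"
  have fD: "finite ?D" using finite_dgm[OF strict_partitions_props(2)[OF lam]] by simp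
  have less: "T b < 2 * n" if "b \<in> ?D" for b using pp_set_less[OF T that] .
  have f0: "?f i = 0" if "\<not> i < n" for i
  proof -
    have "{b \<in> ?D. T b = 2 * i + 1} = {}" "{b \<in> ?D. T b = 2 * i} = {}" using less that by force+
    then show ?thesis unfolding wt_PP_eq[OF lam mu] lines_def by (simp only: image_empty card.empty) simp
  qed
  have lk: "ppexp (2 * n) ?D T = (\<Sum>i<n. Poly_Mapping.single i (?f i))"
    unfolding ppexp_eq wt_PP_eq[OF lam mu] ..
  have "Sum_any ?f = (\<Sum>i<n. ?f i)"
  proof (rule Sum_any.expand_superset)
    show "{i. ?f i \<noteq> 0} \<subseteq> {..<n}"
    proof
      fix i assume "i \<in> {i. ?f i \<noteq> 0}"
      then show "i \<in> {..<n}" using f0[of i] by (metis (mono_tags, lifting) lessThan_iff mem_Collect_eq)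
    qed
  qed simp
  also have "\<dots> = wdeg (\<lambda>_. 1) (ppexp (2 * n) ?D T)"
    unfolding lk by (simp add: wdeg_sum wdeg_single)
  finally have S: "Sum_any ?f = wdeg (\<lambda>_. 1) (ppexp (2 * n) ?D T)" .
  have "Prod_any (\<lambda>i. mps_var i ^ ?f i) = (\<Prod>i<n. mps_var i ^ ?f i :: series)"
  proof (rule Prod_any.expand_superset)
    show "{i. mps_var i ^ ?f i \<noteq> (1 :: series)} \<subseteq> {..<n}"
    proof
      fix i assume "i \<in> {i. mps_var i ^ ?f i \<noteq> (1 :: series)}"
      then have "?f i \<noteq> 0" by (metis (mono_tags, lifting) mem_Collect_eq power_0)
      then show "i \<in> {..<n}" using f0[of i] by (metis lessThan_iff)
    qed
  qed simp
  also have "\<dots> = mps_term 1 (ppexp (2 * n) ?D T)"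
    unfolding lk by (simp add: var_power_eq_term prod_term)
  finally have P: "Prod_any (\<lambda>i. mps_var i ^ ?f i) = (mps_term 1 (ppexp (2 * n) ?D T) :: series)" .
  have E: "(\<Sum>l<2 * n. card {b \<in> ?D. T b = l} - lines l {b \<in> ?D. T b = l}) =
      sum_list lam - sum_list mu - Sum_any ?f"
    using pp_exponent(1)[of ?D T "2 * n"] fD less card_skew_diagram[OF lam mu pp_set_sub[OF T]] S by simp
  show ?thesis
    unfolding pp_term_def P pp_weight_term E neg_beta_power mps_term_mult by simp
qed

definition g_comb :: "bool \<Rightarrow> nat list \<Rightarrow> nat list \<Rightarrow> series" where
  "g_comb pm lam mu = (if pm then gp_comb lam mu else gq_comb lam mu)"

definition ShPP :: "bool \<Rightarrow> nat list \<Rightarrow> nat list \<Rightarrow> (nat \<times> nat \<Rightarrow> nat) set" where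
  "ShPP pm lam mu = (if pm then ShPP_P lam mu else ShPP_Q lam mu)"

lemma pp_set_ShPP:
  assumes lam: "lam \<in> strict_partitions" and mu: "mu \<in> strict_partitions"
  shows "T \<in> pp_set pm k (set lam) (set mu) \<longleftrightarrow>
    T \<in> ShPP pm lam mu \<and> (\<forall>b\<in>dgm (set lam) - dgm (set mu). T b < k)"
proof -
  let ?D = "dgm (set lam) - dgm (set mu)"
  have ev: "(\<forall>i. (i, i) \<in> ?D \<longrightarrow> pm \<longrightarrow> even (T (i, i))) \<longleftrightarrow> (pm \<longrightarrow> (\<forall>a i. (i, i) \<in> ?D \<longrightarrow> T (i, i) \<noteq> unprimed a))"
  proof -
    have "even k \<longleftrightarrow> (\<forall>a. k \<noteq> unprimed a)" for k unfolding unprimed_def by (metis oddE odd_two_times_div_two_succ dvd_triv_left even_Suc Suc_eq_plus1)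
    then show ?thesis by auto
  qed
  have Q: "T \<in> ShPP_Q lam mu \<longleftrightarrow> T \<in> extensional ?D \<and> dgm (set mu) \<subseteq> dgm (set lam) \<and>
     (\<forall>i j j'. (i, j) \<in> ?D \<longrightarrow> (i, j') \<in> ?D \<longrightarrow> j \<le> j' \<longrightarrow> T (i, j) \<le> T (i, j')) \<and>
     (\<forall>i i' j. (i, j) \<in> ?D \<longrightarrow> (i', j) \<in> ?D \<longrightarrow> i \<le> i' \<longrightarrow> T (i, j) \<le> T (i', j))"
    unfolding ShPP_Q_def part_subset_def skew_diagram_eq[OF lam mu] shifted_diagram_eq[OF lam]
      shifted_diagram_eq[OF mu] mem_Collect_eq imp_conjL ..
  have "T \<in> ShPP pm lam mu \<longleftrightarrow> T \<in> ShPP_Q lam mu \<and> (pm \<longrightarrow> (\<forall>a i. (i, i) \<in> ?D \<longrightarrow> T (i, i) \<noteq> unprimed a))"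
    by (simp add: ShPP_def ShPP_P_def skew_diagram_eq[OF lam mu])
  then show ?thesis
    unfolding pp_set_def mem_Collect_eq ev Q by argo
qed

lemma g_comb_nth:
  assumes lam: "lam \<in> strict_partitions" and mu: "mu \<in> strict_partitions" and m: "Poly_Mapping.keys m \<subseteq> {..<n}"
  shows "mps_nth (g_comb pm lam mu) m = mps_nth (pp_gen pm (- beta) mps_var (2 * n) (set lam) (set mu)) m"
proof -
  let ?D = "dgm (set lam) - dgm (set mu)" and ?B = "\<lambda>n. pp_set pm (2 * n) (set lam) (set mu)"
  note sp = strict_partitions_props[OF lam]
  have fD: "finite ?D" using finite_dgm[OF sp(2)] by simp
  have "g_comb pm lam mu = infsum (pp_term lam mu) (ShPP pm lam mu)"
    by (simp add: g_comb_def gp_comb_def gq_comb_def ShPP_def)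
  also have "mps_nth \<dots> m = mps_nth (\<Sum>T\<in>?B n. pp_term lam mu T) m"
  proof (rule infsum_nth_eq[where B = ?B, OF _ _ _ m])
    show "finite (?B n)" for n by (rule finite_pp_set[OF sp(2)])
    show "?B n \<subseteq> ShPP pm lam mu" for n using pp_set_ShPP[OF lam mu] by blast
    fix m n T assume m: "Poly_Mapping.keys m \<subseteq> {..<n}" and T: "T \<in> ShPP pm lam mu"
      and nz: "mps_nth (pp_term lam mu T) m \<noteq> 0"
    have "finite (T ` ?D)" using fD by simp
    \<comment> \<open>Any crude bound on the letters makes \<open>pp_term\<close> a single monomial;
      the support of that monomial then gives the sharp bound \<open>2 * n\<close>.\<close>
    then obtain k where k: "T ` ?D \<subseteq> {..<k}" using finite_nat_iff_bounded by blast
    then have "\<forall>b\<in>?D. T b < 2 * k" by force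
    then have Tk: "T \<in> ?B k" using pp_set_ShPP[OF lam mu] T by blast
    have mk: "m = ppexp (2 * k) ?D T"
      using nz unfolding pp_term_eq[OF lam mu Tk] pp_weight_term mps_nth_term by (simp split: if_splits)
    have "T b < 2 * n" if b: "b \<in> ?D" for b
    proof -
      let ?i = "T b div 2"
      have ik: "?i < k" using k b by force
      have ne: "{b' \<in> ?D. T b' = T b} \<noteq> {}" "finite {b' \<in> ?D. T b' = T b}"
        using b by blast (rule finite_subset[OF _ fD], blast)
      have pos: "lines (T b) {b' \<in> ?D. T b' = T b} \<noteq> 0" by (rule lines_pos[OF ne(2,1)])
      have "Poly_Mapping.lookup m ?i \<noteq> 0"
      proof (cases "odd (T b)")
        case True
        then have "2 * ?i + 1 = T b" by simp
        then show ?thesis unfolding mk lookup_ppexp using ik pos by simp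
      next
        case False
        then have "2 * ?i = T b" by simp
        then show ?thesis unfolding mk lookup_ppexp using ik pos by simp
      qed
      then have "?i \<in> Poly_Mapping.keys m" by (simp add: in_keys_iff)
      then have "?i < n" using m by blast
      then show ?thesis by linarith
    qed
    then show "T \<in> ?B n" using pp_set_ShPP[OF lam mu] T by blast
  qed
  also have "(\<Sum>T\<in>?B n. pp_term lam mu T) = pp_gen pm (- beta) mps_var (2 * n) (set lam) (set mu)"
    unfolding pp_gen_def by (intro sum.cong refl) (rule pp_term_eq[OF lam mu])
  finally show ?thesis .
qed

text \<open>All plane partitions with the same monomial carry the same power of
  \<open>- beta\<close>, so they are merely counted and cannot cancel.\<close>

lemma g_comb_nth_count:
  assumes lam: "lam \<in> strict_partitions" and m: "Poly_Mapping.keys m \<subseteq> {..<n}"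
  shows "mps_nth (g_comb pm lam []) m =
    of_nat (card {T \<in> pp_set pm (2 * n) (set lam) {}. ppexp (2 * n) (dgm (set lam)) T = m}) *
    (- [:0, 1:]) ^ (\<Sum>(set lam) - wdeg (\<lambda>_. 1) m)"
proof -
  let ?D = "dgm (set lam)" and ?A = "pp_set pm (2 * n) (set lam) {}"
  note sp = strict_partitions_props[OF lam]
  have fD: "finite ?D" using finite_dgm[OF sp(2)] .
  have mt: "[] \<in> strict_partitions" by (simp add: strict_partitions_def)
  have D0: "?D - dgm {} = ?D" by (auto simp: dgm_def cnt_def)
  have cD: "card ?D = \<Sum>(set lam)" by (rule card_dgm[OF sp(2)])
  have "mps_nth (pp_weight (- beta) mps_var (2 * n) ?D T) m =
    (if ppexp (2 * n) ?D T = m then (- [:0, 1:]) ^ (\<Sum>(set lam) - wdeg (\<lambda>_. 1) m) else 0)" if T: "T \<in> ?A" for T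
  proof -
    have "T b < 2 * n" if "b \<in> ?D" for b using pp_set_less[OF T, of b] that D0 by blast
    then show ?thesis using pp_exponent(1)[of ?D T "2 * n"] fD
      unfolding pp_weight_term mps_nth_term using cD by auto
  qed
  then have "mps_nth (g_comb pm lam []) m =
     (\<Sum>T\<in>?A. if ppexp (2 * n) ?D T = m then (- [:0, 1:]) ^ (\<Sum>(set lam) - wdeg (\<lambda>_. 1) m) else 0)"
    unfolding g_comb_nth[OF lam mt m] pp_gen_def mps_nth_sum list.set(1) D0 by (intro sum.cong) auto
  also have "\<dots> = of_nat (card {T \<in> ?A. ppexp (2 * n) ?D T = m}) * (- [:0, 1:]) ^ (\<Sum>(set lam) - wdeg (\<lambda>_. 1) m)"
    using finite_pp_set[OF sp(2)] by (simp add: sum.If_cases Int_def)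
  finally show ?thesis .
qed

lemma g_comb_nth_nonzero:
  assumes lam: "lam \<in> strict_partitions" and m: "Poly_Mapping.keys m \<subseteq> {..<n}" and nz: "mps_nth (g_comb pm lam []) m \<noteq> 0"
  obtains T where "T \<in> pp_set pm (2 * n) (set lam) {}" "ppexp (2 * n) (dgm (set lam)) T = m" "wdeg (\<lambda>_. 1) m \<le> \<Sum>(set lam)"
proof -
  note sp = strict_partitions_props[OF lam]
  have "card {T \<in> pp_set pm (2 * n) (set lam) {}. ppexp (2 * n) (dgm (set lam)) T = m} \<noteq> 0"
    using nz unfolding g_comb_nth_count[OF lam m] by (metis mult_zero_left of_nat_0)
  then obtain T where T: "T \<in> pp_set pm (2 * n) (set lam) {}" "ppexp (2 * n) (dgm (set lam)) T = m"
    by (metis (mono_tags, lifting) card.empty Collect_empty_eq)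
  have D0: "dgm (set lam) - dgm {} = dgm (set lam)" by (auto simp: dgm_def cnt_def)
  have "T b < 2 * n" if "b \<in> dgm (set lam)" for b using pp_set_less[OF T(1), of b] that D0 by blast
  with pp_exponent(2)[of "dgm (set lam)" T "2 * n"] finite_dgm[OF sp(2)]
  have "wdeg (\<lambda>_. 1) m \<le> \<Sum>(set lam)" using T(2) card_dgm[OF sp(2)] by simp
  then show ?thesis using that T by blast
qed

section \<open>Leading coefficients\<close>

lemma semistandard_row_le:
  assumes "finite S" "semistandard (dgm S) T" "(i, j) \<in> dgm S" "j \<le> j'" "(i, j') \<in> dgm S"
  shows "T (i, j) \<le> T (i, j')"
  using assms(4,5)
proof (induction rule: dec_induct)
  case (step n)
  have "i \<le> j" using dgmD[OF assms(3)] by simp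
  then have "(i, n) \<in> dgm S" using dgm_left[OF assms(1) step.prems, of n] step.hyps by simp
  then show ?case using step.IH semistandard_row[OF assms(2) _ step.prems] by (meson order_trans)
qed simp

lemma semistandard_col_le:
  assumes "finite S" "semistandard (dgm S) T" "(i, j) \<in> dgm S" "i \<le> i'" "(i', j) \<in> dgm S"
  shows "T (i, j) \<le> T (i', j)"
  using assms(4,5)
proof (induction rule: dec_induct)
  case (step n)
  have "1 \<le> i" using dgmD[OF assms(3)] by simp
  then have "(n, j) \<in> dgm S" using dgm_up[OF assms(1) step.prems, of n] step.hyps by simp
  then show ?case using step.IH semistandard_col[OF assms(2) _ step.prems] by (meson order_trans)
qed simp

lemma semistandard_odd_col:
  assumes "finite S" "semistandard (dgm S) T" "(i, j) \<in> dgm S" "(i', j) \<in> dgm S" "T (i, j) = T (i', j)" "odd (T (i, j))"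
  shows "i = i'"
proof -
  have *: False if "i < i'" "(i, j) \<in> dgm S" "(i', j) \<in> dgm S" "T (i, j) = T (i', j)" "odd (T (i, j))" for i i'
  proof -
    have "1 \<le> i" using dgmD[OF that(2)] by simp
    then have m: "(Suc i, j) \<in> dgm S" using dgm_up[OF assms(1) that(3), of "Suc i"] that(1) by simp
    have "T (i, j) \<le> T (Suc i, j)" "T (Suc i, j) \<le> T (i', j)"
      using semistandard_col[OF assms(2) that(2) m] semistandard_col_le[OF assms(1,2) m _ that(3)] that(1) by auto
    then have "T (i, j) = T (Suc i, j)" using that(4) by simp
    then show False using semistandard_even[OF assms(2) that(2) m] that(5) by simp
  qed
  show ?thesis using *[of i i'] *[of i' i] assms(3-6) by (metis nat_neq_iff)
qed

lemma semistandard_even_row: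
  assumes "finite S" "semistandard (dgm S) T" "(i, j) \<in> dgm S" "(i, j') \<in> dgm S" "T (i, j) = T (i, j')" "even (T (i, j))"
  shows "j = j'"
proof -
  have *: False if "j < j'" "(i, j) \<in> dgm S" "(i, j') \<in> dgm S" "T (i, j) = T (i, j')" "even (T (i, j))" for j j'
  proof -
    have "i \<le> j" using dgmD[OF that(2)] by simp
    then have m: "(i, Suc j) \<in> dgm S" using dgm_left[OF assms(1) that(3), of "Suc j"] that(1) by simp
    have "T (i, j) \<le> T (i, Suc j)" "T (i, Suc j) \<le> T (i, j')"
      using semistandard_row[OF assms(2) that(2) m] semistandard_row_le[OF assms(1,2) m _ that(3)] that(1) by auto
    then have "T (i, j) = T (i, Suc j)" using that(4) by simp
    then show False using semistandard_odd[OF assms(2) that(2) m] that(5) by simp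
  qed
  show ?thesis using *[of j j'] *[of j' j] assms(3-6) by (metis nat_neq_iff)
qed

text \<open>The leading exponent: later variables get larger parts, in accordance with
  \<open>fill\<close>, where the largest index occupies the rim.\<close>

definition expo :: "nat set \<Rightarrow> (nat \<Rightarrow>\<^sub>0 nat)" where
  "expo S = (\<Sum>i<card S. Poly_Mapping.single i (asc_part S i))"

lemma lookup_expo: "Poly_Mapping.lookup (expo S) i = asc_part S i"
  by (simp add: expo_def lookup_sum_single asc_part_def)

lemma keys_expo: "Poly_Mapping.keys (expo S) \<subseteq> {..<card S}"
proof
  fix i assume "i \<in> Poly_Mapping.keys (expo S)"
  then have "asc_part S i \<noteq> 0" by (simp add: in_keys_iff lookup_expo)
  then show "i \<in> {..<card S}" by (simp add: asc_part_def split: if_splits)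
qed

lemma fill_less:
  assumes "S \<subseteq> {1..M}" "e \<le> 1" "b \<in> dgm S"
  shows "fill e S b < 2 * card S"
proof -
  have "fill e S b div 2 < card S"
  proof (rule ccontr)
    assume "\<not> ?thesis"
    then have "card {b' \<in> dgm S. fill e S b' div 2 = fill e S b div 2} = 0"
      unfolding fill_count[OF assms(1,2)] by (simp add: asc_part_def)
    moreover have "finite {b' \<in> dgm S. fill e S b' div 2 = fill e S b div 2}" using finite_dgm[OF assms(1)] by simp
    ultimately have "{b' \<in> dgm S. fill e S b' div 2 = fill e S b div 2} = {}" by (simp only: card_0_eq)
    then show False using assms(3) by blast
  qed
  then show ?thesis by linarith
qed

lemma wdeg_expo:
  assumes "S \<subseteq> {1..M}"
  shows "wdeg (\<lambda>_. 1) (expo S) = \<Sum>S"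
proof -
  have "fill 0 S b div 2 < card S" if "b \<in> dgm S" for b using fill_less[OF assms _ that, of 0] by simp
  then have "card (dgm S) = (\<Sum>i<card S. card {b \<in> dgm S. fill 0 S b div 2 = i})"
    using finite_dgm[OF assms] by (intro card_levels) auto
  also have "\<dots> = (\<Sum>i<card S. asc_part S i)" by (simp add: fill_count[OF assms])
  finally show ?thesis
    by (simp add: expo_def wdeg_sum wdeg_single card_dgm[OF assms])
qed

lemma strict_partitions_common_bound:
  assumes "lam \<in> strict_partitions" "mu \<in> strict_partitions"
  obtains M where "1 \<le> M" "set lam \<subseteq> {1..M}" "set mu \<subseteq> {1..M}"
proof -
  let ?a = "Max (insert 1 (set lam))" and ?b = "Max (insert 1 (set mu))"
  have "1 \<le> max ?a ?b" by (meson List.finite_set Max_ge finite_insert insertI1 le_max_iff_disj)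
  moreover have "set lam \<subseteq> {1..max ?a ?b}" "set mu \<subseteq> {1..max ?a ?b}"
    using strict_partitions_props(2)[OF assms(1)] strict_partitions_props(2)[OF assms(2)]
    by (auto simp: le_max_iff_disj dest!: subsetD)
  ultimately show ?thesis using that by blast
qed

text \<open>In this degree the boxes are singletons, so a counted tableau is a semistandard filling
  with prescribed index counts, to which \<open>semistandard_triangular\<close> applies.\<close>

lemma GQP_triangular:
  assumes lam: "lam \<in> strict_partitions" and mu: "mu \<in> strict_partitions"
    and eq: "\<Sum>(set lam) = \<Sum>(set mu)" and nz: "mps_nth (GQP pm lam) (expo (set mu)) \<noteq> 0"
  shows "set lam = set mu \<or> binary_value (set mu) < binary_value (set lam)"
proof -
  obtain M where M: "set lam \<subseteq> {1..M}" "set mu \<subseteq> {1..M}" using strict_partitions_common_bound[OF lam mu] .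
  let ?D = "dgm (set lam)"
  have fin: "finite (set lam)" by simp
  have fD: "finite ?D" by (rule finite_dgm[OF M(1)])
  have deg: "wdeg (\<lambda>_. 1) (expo (set mu)) = \<Sum>(set lam)" using wdeg_expo[OF M(2)] eq by simp
  let ?P = "\<lambda>T. stexp ?D T = expo (set mu) \<and> (\<forall>B\<in>?D. card (T B) = 1)"
  let ?A = "{T \<in> stab ?D (letters pm M (card (set mu))). ?P T}"
  have "card ?A \<noteq> 0" using nz unfolding GQP_nth_count[OF lam M(1) keys_expo deg] by (metis of_nat_0)
  then have "?A \<noteq> {}" by (metis card.empty)
  then obtain T where T: "T \<in> stab ?D (letters pm M (card (set mu)))" "stexp ?D T = expo (set mu)"
    "\<And>B. B \<in> ?D \<Longrightarrow> card (T B) = 1" by blast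
  have v: "svalid ?D (letters pm M (card (set mu))) T" using T(1) by (simp add: stab_def)
  define t where "t B = the_elem (T B)" for B
  have t: "T B = {t B}" if "B \<in> ?D" for B
    using T(3)[OF that] unfolding t_def by (metis card_1_singletonE the_elem_eq)
  have "semistandard ?D t"
    unfolding semistandard_def
  proof (intro conjI allI impI)
    fix i j assume *: "(i, j) \<in> ?D" "(i, Suc j) \<in> ?D"
    show "t (i, j) \<le> t (i, Suc j)" using svalid_row_le[OF v *] t[OF *(1)] t[OF *(2)] by simp
    show "odd (t (i, j))" if "t (i, j) = t (i, Suc j)"
      using svalid_even[OF v _ *, of "t (i, j)"] t[OF *(1)] t[OF *(2)] that by auto
  next
    fix i j assume *: "(i, j) \<in> ?D" "(Suc i, j) \<in> ?D"
    show "t (i, j) \<le> t (Suc i, j)" using svalid_col_le[OF v *] t[OF *(1)] t[OF *(2)] by simp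
    show "even (t (i, j))" if "t (i, j) = t (Suc i, j)"
      using svalid_odd[OF v _ *, of "t (i, j)"] t[OF *(1)] t[OF *(2)] that by auto
  qed
  moreover have "card {b \<in> ?D. t b div 2 = k} = asc_part (set mu) k" for k
  proof -
    have "k' div 2 = k \<longleftrightarrow> k' = unprimed k \<or> k' = primed k" for k' unfolding unprimed_def primed_def by linarith
    then have "{b \<in> ?D. t b div 2 = k} = {b \<in> ?D. unprimed k \<in> T b} \<union> {b \<in> ?D. primed k \<in> T b}" using t by auto
    moreover have "{b \<in> ?D. unprimed k \<in> T b} \<inter> {b \<in> ?D. primed k \<in> T b} = {}"
      using t by (auto simp: unprimed_def primed_def)
    ultimately have "card {b \<in> ?D. t b div 2 = k} = card {b \<in> ?D. unprimed k \<in> T b} + card {b \<in> ?D. primed k \<in> T b}"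
      using fD by (simp add: card_Un_disjoint)
    also have "\<dots> = Poly_Mapping.lookup (stexp ?D T) k"
      using lookup_stexp[of ?D T k] fD t by simp
    finally show ?thesis unfolding T(2) lookup_expo .
  qed
  ultimately show ?thesis using semistandard_triangular[OF M(2,1), of t] by blast
qed

lemma GQP_diag:
  assumes lam: "lam \<in> strict_partitions"
  shows "mps_nth (GQP pm lam) (expo (set lam)) \<noteq> 0"
proof -
  obtain M where M: "set lam \<subseteq> {1..M}" using strict_partitions_common_bound[OF lam lam] .
  let ?D = "dgm (set lam)" and ?S = "set lam"
  have fin: "finite ?S" by simp
  have fD: "finite ?D" by (rule finite_dgm[OF M])
  have deg: "wdeg (\<lambda>_. 1) (expo ?S) = \<Sum>?S" by (rule wdeg_expo[OF M])
  \<comment> \<open>Odd, that is unprimed, diagonal entries are permitted for both values of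
    \<open>pm\<close>.\<close>
  let ?f = "fill 1 ?S"
  define T where "T = restrict (\<lambda>b. {?f b}) ?D"
  have T: "T b = {?f b}" if "b \<in> ?D" for b using that by (simp add: T_def)
  have "svalid ?D (letters pm M (card ?S)) T"
    unfolding svalid_def
  proof (intro conjI allI impI ballI)
    fix b assume "b \<in> ?D" then show "finite (T b)" by (simp add: T)
  next
    fix i j k k' assume *: "(i, j) \<in> ?D" "(Suc i, j) \<in> ?D" "k \<in> T (i, j)" "k' \<in> T (Suc i, j)"
    then show "k \<le> k'" using semistandard_col[OF semistandard_fill[OF fin, of 1] *(1,2)] by (simp add: T)
  next
    fix i j k k' assume *: "(i, j) \<in> ?D" "(i, Suc j) \<in> ?D" "k \<in> T (i, j)" "k' \<in> T (i, Suc j)"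
    then show "k \<le> k'" using semistandard_row[OF semistandard_fill[OF fin, of 1] *(1,2)] by (simp add: T)
  next
    fix i i' j k assume *: "odd k" "(i, j) \<in> ?D" "(i', j) \<in> ?D" "k \<in> T (i, j)" "k \<in> T (i', j)"
    then show "i = i'" using semistandard_odd_col[OF fin semistandard_fill[OF fin, of 1] *(2,3)] by (simp add: T)
  next
    fix i j j' k assume *: "even k" "(i, j) \<in> ?D" "(i, j') \<in> ?D" "k \<in> T (i, j)" "k \<in> T (i, j')"
    then show "j = j'" using semistandard_even_row[OF fin semistandard_fill[OF fin, of 1] *(2,3)] by (simp add: T)
  next
    fix i j k assume *: "(i, j) \<in> ?D" "k \<in> T (i, j)"
    then have k: "k = ?f (i, j)" by (simp add: T)
    have "k < 2 * card ?S" using fill_less[OF M _ *(1), of 1] k by simp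
    moreover have "j - i < M" using dgmD[OF *(1)] cnt_eq_0[OF M, of "j - i"] by (cases "j - i < M") auto
    moreover have "odd k" if "j - i = 0"
    proof -
      have "j = i" using dgmD[OF *(1)] that by simp
      then show ?thesis unfolding k by (simp add: fill_def)
    qed
    ultimately show "(k, j - i) \<in> letters pm M (card ?S)" by (auto simp: letters_def)
  qed
  then have "T \<in> stab ?D (letters pm M (card ?S))" by (simp add: stab_def T_def)
  moreover have "stexp ?D T = expo ?S"
  proof (rule poly_mapping_eqI)
    fix k
    have "k' div 2 = k \<longleftrightarrow> k' = unprimed k \<or> k' = primed k" for k' unfolding unprimed_def primed_def by linarith
    then have "{b \<in> ?D. ?f b div 2 = k} = {b \<in> ?D. unprimed k \<in> T b} \<union> {b \<in> ?D. primed k \<in> T b}" using T by auto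
    moreover have "{b \<in> ?D. unprimed k \<in> T b} \<inter> {b \<in> ?D. primed k \<in> T b} = {}"
      using T by (auto simp: unprimed_def primed_def)
    ultimately have "card {b \<in> ?D. ?f b div 2 = k} = card {b \<in> ?D. unprimed k \<in> T b} + card {b \<in> ?D. primed k \<in> T b}"
      using fD by (simp add: card_Un_disjoint)
    also have "\<dots> = Poly_Mapping.lookup (stexp ?D T) k"
      using lookup_stexp[of ?D T k] fD T by simp
    finally show "Poly_Mapping.lookup (stexp ?D T) k = Poly_Mapping.lookup (expo ?S) k"
      unfolding lookup_expo by (simp add: fill_count[OF M])
  qed
  moreover have "\<forall>B\<in>?D. card (T B) = 1" by (simp add: T)
  ultimately have ne: "{T \<in> stab ?D (letters pm M (card ?S)). stexp ?D T = expo ?S \<and> (\<forall>B\<in>?D. card (T B) = 1)} \<noteq> {}" by blast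
  moreover have "finite {T \<in> stab ?D (letters pm M (card ?S)). stexp ?D T = expo ?S \<and> (\<forall>B\<in>?D. card (T B) = 1)}"
    using finite_stab[OF fD finite_letters[of pm M "card ?S"]] by simp
  ultimately have "card {T \<in> stab ?D (letters pm M (card ?S)). stexp ?D T = expo ?S \<and> (\<forall>B\<in>?D. card (T B) = 1)} \<noteq> 0"
    by (simp only: card_0_eq not_False_eq_True)
  then show ?thesis unfolding GQP_nth_count[OF lam M keys_expo deg] by (simp only: of_nat_eq_0_iff not_False_eq_True)
qed

lemma inj_on_lines:
  assumes "finite L" "lines l L = card L"
  shows "odd l \<Longrightarrow> inj_on snd L" "even l \<Longrightarrow> inj_on fst L"
  using assms by (simp_all add: lines_def eq_card_imp_inj_on)

text \<open>The monomial has the top degree, so every letter meets as many lines as it has boxes: an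
  unprimed letter repeats in no column and a primed one in no row, which is
  semistandardness.\<close>

lemma g_comb_triangular:
  assumes lam: "lam \<in> strict_partitions" and mu: "mu \<in> strict_partitions"
    and eq: "\<Sum>(set lam) = \<Sum>(set mu)" and nz: "mps_nth (g_comb pm lam []) (expo (set mu)) \<noteq> 0"
  shows "set lam = set mu \<or> binary_value (set mu) < binary_value (set lam)"
proof -
  obtain M where M: "set lam \<subseteq> {1..M}" "set mu \<subseteq> {1..M}" using strict_partitions_common_bound[OF lam mu] .
  let ?D = "dgm (set lam)" and ?n = "card (set mu)"
  have fin: "finite (set lam)" by simp
  have fD: "finite ?D" by (rule finite_dgm[OF M(1)])
  have D0: "?D - dgm {} = ?D" by (auto simp: dgm_def cnt_def)
  have deg: "wdeg (\<lambda>_. 1) (expo (set mu)) = card ?D" using wdeg_expo[OF M(2)] eq card_dgm[OF M(1)] by simp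
  obtain T where T: "T \<in> pp_set pm (2 * ?n) (set lam) {}" "ppexp (2 * ?n) ?D T = expo (set mu)"
    using g_comb_nth_nonzero[OF lam keys_expo nz] .
  have less: "T b < 2 * ?n" if "b \<in> ?D" for b using pp_set_less[OF T(1), of b] that D0 by blast
  let ?L = "\<lambda>l. {b \<in> ?D. T b = l}"
  have fL: "finite (?L l)" for l using fD by simp
  have "(\<Sum>l<2 * ?n. card (?L l) - lines l (?L l)) = 0"
    using pp_exponent(1)[of ?D T "2 * ?n"] fD less deg T(2) by simp
  then have z: "card (?L l) - lines l (?L l) = 0" if "l < 2 * ?n" for l using that by simp
  have full: "lines l (?L l) = card (?L l)" if "l < 2 * ?n" for l
    using z[OF that] lines_le[OF fL[of l], of l] by simp
  have "semistandard ?D T"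
    unfolding semistandard_def
  proof (intro conjI allI impI)
    fix i j assume *: "(i, j) \<in> ?D" "(i, Suc j) \<in> ?D"
    show "T (i, j) \<le> T (i, Suc j)" using pp_set_row[OF T(1), of i j "Suc j"] * D0 by simp
    show "odd (T (i, j))" if e: "T (i, j) = T (i, Suc j)"
    proof (rule ccontr)
      assume "\<not> odd (T (i, j))"
      then have "inj_on fst (?L (T (i, j)))" using inj_on_lines(2)[OF fL full[OF less[OF *(1)]]] by simp
      then have "(i, j) = (i, Suc j)" by (rule inj_onD) (use * e in auto)
      then show False by simp
    qed
  next
    fix i j assume *: "(i, j) \<in> ?D" "(Suc i, j) \<in> ?D"
    show "T (i, j) \<le> T (Suc i, j)" using pp_set_col[OF T(1), of i j "Suc i"] * D0 by simp
    show "even (T (i, j))" if e: "T (i, j) = T (Suc i, j)"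
    proof (rule ccontr)
      assume "\<not> even (T (i, j))"
      then have "inj_on snd (?L (T (i, j)))" using inj_on_lines(1)[OF fL full[OF less[OF *(1)]]] by simp
      then have "(i, j) = (Suc i, j)" by (rule inj_onD) (use * e in auto)
      then show False by simp
    qed
  qed
  moreover have "card {b \<in> ?D. T b div 2 = k} = asc_part (set mu) k" for k
  proof (cases "k < ?n")
    case True
    have "l div 2 = k \<longleftrightarrow> l = 2 * k + 1 \<or> l = 2 * k" for l by linarith
    then have "{b \<in> ?D. T b div 2 = k} = ?L (2 * k + 1) \<union> ?L (2 * k)" by auto
    moreover have "?L (2 * k + 1) \<inter> ?L (2 * k) = {}" by auto
    ultimately have "card {b \<in> ?D. T b div 2 = k} = card (?L (2 * k + 1)) + card (?L (2 * k))"
      using card_Un_disjoint[OF fL fL, of "2 * k + 1" "2 * k"] by (simp only:)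
    also have "\<dots> = Poly_Mapping.lookup (ppexp (2 * ?n) ?D T) k"
      unfolding lookup_ppexp using True full[of "2 * k + 1"] full[of "2 * k"] by simp
    finally show ?thesis unfolding T(2) lookup_expo .
  next
    case False
    then have "{b \<in> ?D. T b div 2 = k} = {}" using less by force
    then have "card {b \<in> ?D. T b div 2 = k} = 0" by (simp only: card.empty)
    then show ?thesis using False by (simp add: asc_part_def)
  qed
  ultimately show ?thesis using semistandard_triangular[OF M(2,1), of T] by blast
qed

lemma g_comb_diag:
  assumes lam: "lam \<in> strict_partitions"
  shows "mps_nth (g_comb pm lam []) (expo (set lam)) \<noteq> 0"
proof -
  obtain M where M: "set lam \<subseteq> {1..M}" using strict_partitions_common_bound[OF lam lam] .
  let ?D = "dgm (set lam)" and ?S = "set lam"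
  \<comment> \<open>For plane partitions the even, that is primed, diagonal entries are those
    permitted for both values of \<open>pm\<close>.\<close>
  let ?n = "card ?S" and ?f = "fill 0 ?S"
  have fin: "finite ?S" by simp
  have fD: "finite ?D" by (rule finite_dgm[OF M])
  have D0: "?D - dgm {} = ?D" by (auto simp: dgm_def cnt_def)
  have ss: "semistandard ?D ?f" by (rule semistandard_fill[OF fin]) simp
  define T where "T = restrict ?f ?D"
  have T: "T b = ?f b" if "b \<in> ?D" for b using that by (simp add: T_def)
  have "T \<in> pp_set pm (2 * ?n) ?S {}"
  proof (rule pp_setI, unfold D0)
    show "T \<in> extensional ?D" by (simp add: T_def)
    show "dgm {} \<subseteq> ?D" by (auto simp: dgm_def cnt_def)
    show "T (i, j) \<le> T (i, j')" if "(i, j) \<in> ?D" "(i, j') \<in> ?D" "j \<le> j'" for i j j'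
      using semistandard_row_le[OF fin ss that(1,3,2)] that by (simp add: T)
    show "T (i, j) \<le> T (i', j)" if "(i, j) \<in> ?D" "(i', j) \<in> ?D" "i \<le> i'" for i i' j
      using semistandard_col_le[OF fin ss that(1,3,2)] that by (simp add: T)
    show "T b < 2 * ?n" if "b \<in> ?D" for b using fill_less[OF M _ that, of 0] that by (simp add: T)
    show "even (T (i, i))" if "(i, i) \<in> ?D" for i using that by (simp add: T fill_def)
  qed
  moreover have "ppexp (2 * ?n) ?D T = expo ?S"
  proof (rule poly_mapping_eqI)
    fix k
    let ?L = "\<lambda>l. {b \<in> ?D. T b = l}"
    have fL: "finite (?L l)" for l using fD by simp
    have full: "lines l (?L l) = card (?L l)" for l
    proof (cases "odd l")
      case True
      have "inj_on snd (?L l)"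
      proof (rule inj_onI)
        fix b b' assume b: "b \<in> ?L l" "b' \<in> ?L l" "snd b = snd b'"
        obtain i j i' j' where ij: "b = (i, j)" "b' = (i', j')" by (cases b, cases b')
        then have "i = i'" using semistandard_odd_col[OF fin ss, of i j i'] b True T[of "(i, j)"] T[of "(i', j)"] by auto
        then show "b = b'" using ij b by simp
      qed
      then show ?thesis using True by (simp add: lines_def card_image)
    next
      case False
      have "inj_on fst (?L l)"
      proof (rule inj_onI)
        fix b b' assume b: "b \<in> ?L l" "b' \<in> ?L l" "fst b = fst b'"
        obtain i j i' j' where ij: "b = (i, j)" "b' = (i', j')" by (cases b, cases b')
        then have "j = j'" using semistandard_even_row[OF fin ss, of i j j'] b False T[of "(i, j)"] T[of "(i, j')"] by auto
        then show "b = b'" using ij b by simp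
      qed
      then show ?thesis using False by (simp add: lines_def card_image)
    qed
    show "Poly_Mapping.lookup (ppexp (2 * ?n) ?D T) k = Poly_Mapping.lookup (expo ?S) k"
    proof (cases "k < ?n")
      case True
      have "l div 2 = k \<longleftrightarrow> l = 2 * k + 1 \<or> l = 2 * k" for l by linarith
      then have "{b \<in> ?D. ?f b div 2 = k} = ?L (2 * k + 1) \<union> ?L (2 * k)" using T by auto
      moreover have "?L (2 * k + 1) \<inter> ?L (2 * k) = {}" by auto
      ultimately have "card {b \<in> ?D. ?f b div 2 = k} = card (?L (2 * k + 1)) + card (?L (2 * k))"
        using card_Un_disjoint[OF fL fL, of "2 * k + 1" "2 * k"] by (simp only:)
      then show ?thesis unfolding lookup_ppexp lookup_expo full using True fill_count[OF M, of 0 k] by simp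
    next
      case False
      then show ?thesis unfolding lookup_ppexp lookup_expo by (simp add: asc_part_def)
    qed
  qed
  ultimately have "{T \<in> pp_set pm (2 * ?n) ?S {}. ppexp (2 * ?n) ?D T = expo ?S} \<noteq> {}" by blast
  moreover have "finite {T \<in> pp_set pm (2 * ?n) ?S {}. ppexp (2 * ?n) ?D T = expo ?S}"
    using finite_pp_set[OF M, of pm "2 * ?n" "{}"] by simp
  ultimately have "card {T \<in> pp_set pm (2 * ?n) ?S {}. ppexp (2 * ?n) ?D T = expo ?S} \<noteq> 0"
    by (simp only: card_0_eq not_False_eq_True)
  then show ?thesis
    unfolding g_comb_nth_count[OF lam keys_expo] by (simp add: wdeg_expo[OF M])
qed

section \<open>Symmetry of the dual functions\<close>

text \<open>\<open>grow\<close> and \<open>dual_chain\<close> are built from their arguments by ring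
  operations, and renaming variables is a ring homomorphism; this carries both into one ring with
  two alphabets.\<close>

definition ring_hom :: "('r::comm_ring_1 \<Rightarrow> 's::comm_ring_1) \<Rightarrow> bool" where
  "ring_hom h \<longleftrightarrow> h 0 = 0 \<and> h 1 = 1 \<and> (\<forall>a b. h (a + b) = h a + h b) \<and> (\<forall>a b. h (a * b) = h a * h b)"

context
  fixes h :: "'r::comm_ring_1 \<Rightarrow> 's::comm_ring_1"
  assumes h: "ring_hom h"
begin

lemma hom_simps: "h 0 = 0" "h 1 = 1" "h (a + b) = h a + h b" "h (a * b) = h a * h b"
  using h by (simp_all add: ring_hom_def)

lemma hom_sum: "h (sum f A) = (\<Sum>i\<in>A. h (f i))"
  by (induction A rule: infinite_finite_induct) (simp_all add: hom_simps)

lemma hom_prod: "h (prod f A) = (\<Prod>i\<in>A. h (f i))"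
  by (induction A rule: infinite_finite_induct) (simp_all add: hom_simps)

lemma hom_power: "h (a ^ n) = h a ^ n"
  by (induction n) (simp_all add: hom_simps)

lemma hom_fold_box_step:
  "h (fold (box_step b x) cs F S) = fold (box_step (h b) (h x)) cs (\<lambda>S. h (F S)) S"
proof (induction cs arbitrary: F)
  case (Cons c cs)
  have "(\<lambda>S. h (box_step b x c F S)) = box_step (h b) (h x) c (\<lambda>S. h (F S))"
    by (auto simp: box_step_def hom_simps)
  then show ?case using Cons[of "box_step b x c F"] by simp
qed simp

lemma hom_grow: "h (grow M pm b xs S) = grow M pm (h b) (map h xs) S"
proof (induction xs arbitrary: S)
  case Nil
  then show ?case by (simp add: grow_Nil hom_simps)
next
  case (Cons x xs)
  have "(\<lambda>S. h (grow M pm b xs S)) = grow M pm (h b) (map h xs)" using Cons by blast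
  then show ?case by (simp add: grow_Cons hom_fold_box_step)
qed

lemma hom_dual_op: "h (dual_op M pm t y R S) = dual_op M pm (h t) (h y) R S"
proof -
  have C: "h (col_weight (1, 1, 1) y t m a b) = col_weight (1, 1, 1) (h y) (h t) m a b" for m a b
    by (simp add: col_weight_def line_factor_def hom_simps hom_power)
  have R: "h (row_weight (1, 1, 1) y t m a b) = row_weight (1, 1, 1) (h y) (h t) m a b" for m a b
    by (simp add: row_weight_def line_factor_def hom_simps hom_power)
  have bC: "h (bd_C pm y m) = bd_C pm (h y) m" for m by (simp add: bd_C_def hom_simps hom_power)
  have bR: "h (bd_R m) = bd_R m" for m by (simp add: bd_R_def hom_simps)
  show ?thesis
    unfolding dual_op_def hom_sum hom_simps line_C_def line_R_def line_def hom_prod if_cancel C R bC bR ..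
qed

lemma hom_dual_chain: "h (dual_chain M pm t ys S R) = dual_chain M pm (h t) (map h ys) S R"
  by (induction ys arbitrary: S) (simp_all add: hom_simps hom_sum hom_dual_op)

end

lemma ring_hom_rename: "inj \<phi> \<Longrightarrow> ring_hom (mps_rename \<phi> :: ('v, 'a::comm_ring_1) mpser \<Rightarrow> ('w, 'a) mpser)"
  unfolding ring_hom_def
  by (simp add: mps_rename_0 mps_rename_add mps_rename_mult one_eq_term mps_rename_term push_def)

lemma mps_rename_beta: "inj \<phi> \<Longrightarrow> mps_rename \<phi> beta = beta"
  by (simp add: beta_eq_term mps_rename_term push_def)

lemma mps_rename_var: "inj \<phi> \<Longrightarrow> mps_rename \<phi> (mps_var v) = (mps_var (\<phi> v) :: ('w, 'a::comm_ring_1) mpser)"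
  by (simp add: var_eq_term mps_rename_term push_single)

definition kfac :: "('v, int poly) mpser \<Rightarrow> ('v, int poly) mpser \<Rightarrow> ('v, int poly) mpser" where
  "kfac x y = (1 - mps_bar x * y) / (1 - x * y)"

abbreviation "deg1 \<equiv> wdeg (\<lambda>_. 1)"
abbreviation "xwt \<equiv> case_sum (\<lambda>_. 1) (\<lambda>_. 0 :: nat)"

lemma var_order_ge: "n \<le> w v \<Longrightarrow> (mps_var v :: ('v, 'a::comm_ring_1) mpser) \<in> order_ge w n"
  by (auto simp: order_ge_def var_eq_term mps_nth_term wdeg_single)

lemma order_ge_ideal: "b \<in> order_ge w n \<Longrightarrow> a * b \<in> (order_ge w n :: ('v, 'a::comm_ring_1) mpser set)"
  using filtration.J_ideal[OF filtration_order_ge] .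

lemma kfac_inverses:
  fixes u v :: 'v
  defines "x \<equiv> mps_var u :: ('v, int poly) mpser" and "y \<equiv> mps_var v"
  shows "(1 + beta * x) * inverse (1 + beta * x) = 1" "(1 - x * y) * inverse (1 - x * y) = 1"
proof -
  have x: "x \<in> order_ge (\<lambda>_. 1) 1" and y: "y \<in> order_ge (\<lambda>_. 1) 1" unfolding x_def y_def by (simp_all add: var_order_ge)
  have 1: "1 - (1 + beta * x) = (- beta) * x" by simp
  show "(1 + beta * x) * inverse (1 + beta * x) = 1"
    by (rule mps_inverse_mult) (unfold 1, rule order_ge_ideal[OF x])
  have 2: "1 - (1 - x * y) = x * y" by simp
  show "(1 - x * y) * inverse (1 - x * y) = 1"
    by (rule mps_inverse_mult) (unfold 2, rule order_ge_ideal[OF y])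
qed

text \<open>The shape in which the factor comes out of the exchange relations with
  \<open>t = - beta\<close>: the inverse of the outgoing scalar times the incoming one.\<close>

lemma kfac_eq:
  fixes u v :: 'v
  defines "x \<equiv> mps_var u :: ('v, int poly) mpser" and "y \<equiv> mps_var v"
  shows "kfac x y = inverse (1 + beta * x) * inverse (1 - x * y) * (1 + beta * x + x * y)"
proof -
  note i = kfac_inverses(1)[of u, folded x_def]
  have "kfac x y = (1 + x * inverse (1 + beta * x) * y) * inverse (1 - x * y)"
    by (simp add: kfac_def mps_bar_def divide_mpser_def)
  also have "\<dots> = ((1 + beta * x) * inverse (1 + beta * x) + x * inverse (1 + beta * x) * y) * inverse (1 - x * y)"
    by (simp add: i)
  also have "\<dots> = inverse (1 + beta * x) * inverse (1 - x * y) * (1 + beta * x + x * y)"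
    by (simp add: algebra_simps)
  finally show ?thesis .
qed

text \<open>The numerator is \<open>(1 + beta * x) * (1 - x * y)\<close> plus a multiple of
  \<open>x * y\<close>, so the factor is 1 modulo \<open>x * y\<close>. This is what makes the
  infinite product converge.\<close>

lemma kfac_split:
  fixes u v :: 'v
  defines "x \<equiv> mps_var u :: ('v, int poly) mpser" and "y \<equiv> mps_var v"
  shows "\<exists>z. kfac x y = 1 + z * (x * y)"
proof -
  let ?i = "inverse (1 + beta * x)" and ?j = "inverse (1 - x * y)"
  note i = kfac_inverses(1)[of u, folded x_def] and j = kfac_inverses(2)[of u v, folded x_def y_def]
  have "kfac x y = ?i * ?j * ((1 + beta * x) * (1 - x * y) + (1 + (1 + beta * x)) * (x * y))"
    unfolding x_def y_def kfac_eq by (simp add: algebra_simps)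
  also have "\<dots> = ((1 + beta * x) * ?i) * ((1 - x * y) * ?j) + ?i * ?j * (1 + (1 + beta * x)) * (x * y)"
  proof -
    have "i * j * (a * b + c * d) = (a * i) * (b * j) + i * j * c * d" for i j a b c d :: "('v, int poly) mpser"
      by (simp add: algebra_simps)
    then show ?thesis .
  qed
  finally show ?thesis unfolding i j by auto
qed

lemma wdeg_map_key_Inl: "wdeg xwt m = deg1 (Poly_Mapping.map_key Inl m)"
proof -
  let ?m = "Poly_Mapping.map_key Inl m"
  have inj: "inj Inl" by simp
  have "wdeg xwt m = (\<Sum>v\<in>Inl ` Poly_Mapping.keys ?m. xwt v * Poly_Mapping.lookup m v)"
    unfolding wdeg_def
  proof (rule sum.mono_neutral_right)
    show "Inl ` Poly_Mapping.keys ?m \<subseteq> Poly_Mapping.keys m"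
      by (auto simp: in_keys_iff lookup_map_key)
    show "\<forall>v\<in>Poly_Mapping.keys m - Inl ` Poly_Mapping.keys ?m. xwt v * Poly_Mapping.lookup m v = 0"
    proof
      fix v assume v: "v \<in> Poly_Mapping.keys m - Inl ` Poly_Mapping.keys ?m"
      show "xwt v * Poly_Mapping.lookup m v = 0"
      proof (cases v)
        case (Inl a)
        then have "a \<notin> Poly_Mapping.keys ?m" using v by blast
        then show ?thesis using Inl by (simp add: in_keys_iff lookup_map_key)
      qed simp
    qed
  qed simp
  also have "\<dots> = deg1 ?m"
    unfolding wdeg_def by (subst sum.reindex) (auto simp: lookup_map_key)
  finally show ?thesis .
qed

text \<open>Truncation is measured by the degree in the \<open>x\<close>-variables alone. The index
  type of the \<open>y\<close>-variables is left open, because the symmetry statement is later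
  applied with both original alphabets together in the role of \<open>y\<close>.\<close>

lemma cauchy_series:
  fixes vs :: "'v list"
  assumes "1 \<le> M"
  shows "(\<Sum>S\<in>Pow {1..M}. mps_rename Inl (grow M pm beta (map mps_var (rev [0..<n])) S) *
       mps_rename Inr (dual_chain M pm (- beta) (map mps_var vs) S {})) -
     (\<Prod>v\<leftarrow>vs. \<Prod>i\<leftarrow>rev [0..<n]. kfac (mps_var (Inl i)) (mps_var (Inr v))) \<in>
     (order_ge xwt M :: (nat + 'v, int poly) mpser set)"
proof -
  interpret filtration "order_ge xwt :: nat \<Rightarrow> (nat + 'v, int poly) mpser set" by (rule filtration_order_ge)
  let ?X = "map (\<lambda>i. mps_var (Inl i)) (rev [0..<n]) :: (nat + 'v, int poly) mpser list"
  let ?Y = "map (\<lambda>v. mps_var (Inr v)) vs :: (nat + 'v, int poly) mpser list"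
  define U where "U x y = inverse (1 + beta * x) * inverse (1 - x * y)" for x y :: "(nat + 'v, int poly) mpser"
  have X: "set ?X \<subseteq> order_ge xwt 1" by (auto simp: var_order_ge)
  have "U x y * ((1 - (- beta) * x) * (1 - x * y)) = 1" if "x \<in> set ?X" "y \<in> set ?Y" for x y
  proof -
    from that have "\<exists>i. x = mps_var (Inl i)" "\<exists>v. y = mps_var (Inr v)" by auto
    then obtain i v where iv: "x = mps_var (Inl i)" "y = mps_var (Inr v)" by blast
    have "U x y * ((1 - (- beta) * x) * (1 - x * y)) =
        ((1 + beta * x) * inverse (1 + beta * x)) * ((1 - x * y) * inverse (1 - x * y))"
      unfolding U_def by (simp add: mult_ac)
    then show ?thesis unfolding iv kfac_inverses by simp
  qed
  from cauchy_truncated[where ys = "?Y" and U = U and t = "- beta" and pm = pm, OF assms X this]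
  have "(\<Sum>S\<in>Pow {1..M}. dual_chain M pm (- beta) ?Y S {} * grow M pm beta ?X S) -
      (\<Prod>y\<leftarrow>?Y. \<Prod>x\<leftarrow>?X. U x y * (1 - (- beta) * x + x * y)) \<in> order_ge xwt M" by simp
  moreover have "(\<Prod>y\<leftarrow>?Y. \<Prod>x\<leftarrow>?X. U x y * (1 - (- beta) * x + x * y)) =
      (\<Prod>v\<leftarrow>vs. \<Prod>i\<leftarrow>rev [0..<n]. kfac (mps_var (Inl i)) (mps_var (Inr v)))"
    unfolding kfac_eq U_def by (simp add: o_def)
  moreover have "mps_rename Inl (grow M pm beta (map mps_var (rev [0..<n])) S) = grow M pm beta ?X S" for S
    using hom_grow[OF ring_hom_rename[of "Inl :: nat \<Rightarrow> nat + 'v"], of M pm beta "map mps_var (rev [0..<n])" S]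
    by (simp add: mps_rename_beta mps_rename_var o_def)
  moreover have "mps_rename Inr (dual_chain M pm (- beta) (map mps_var vs) S {}) = dual_chain M pm (- beta) ?Y S {}" for S
    using hom_dual_chain[OF ring_hom_rename[of "Inr :: 'v \<Rightarrow> nat + 'v"], of M pm "- beta" "map mps_var vs" S "{}"]
    by (simp add: mps_rename_beta mps_rename_var mps_rename_uminus o_def)
  ultimately show ?thesis by (simp add: mult.commute)
qed

definition partition_of :: "nat set \<Rightarrow> nat list" where
  "partition_of S = rev (sorted_list_of_set S)"

lemma partition_of_in:
  assumes "S \<subseteq> {1..M}"
  shows "partition_of S \<in> strict_partitions" "set (partition_of S) = S"
proof -
  have fin: "finite S" using assms by (rule finite_subset) simp
  then show "set (partition_of S) = S" by (simp add: partition_of_def)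
  then show "partition_of S \<in> strict_partitions"
    using assms by (auto simp: strict_partitions_def partition_of_def sorted_wrt_rev)
qed

lemma partition_of_set:
  assumes "lam \<in> strict_partitions"
  shows "partition_of (set lam) = lam"
proof -
  have "sorted_wrt (<) (rev lam)" using assms by (simp add: strict_partitions_def sorted_wrt_rev)
  then have "sorted_list_of_set (set (rev lam)) = rev lam"
    by (intro sorted_list_of_set.idem_if_sorted_distinct) (auto simp: strict_sorted_iff)
  then show ?thesis by (simp add: partition_of_def)
qed

lemma GQP_grow:
  assumes "S \<subseteq> {1..M}" "1 \<le> M" "Poly_Mapping.keys a \<subseteq> {..<n}"
  shows "mps_nth (GQP pm (partition_of S)) a = mps_nth (grow M pm beta (map mps_var (rev [0..<n])) S) a"
  using GQP_nth[OF partition_of_in(1)[OF assms(1)] _ assms(3), of M pm] partition_of_in(2)[OF assms(1)] assms(1)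
    stab_gen_letters[OF assms(1,2), of beta mps_var pm n] by simp

lemma g_comb_dual:
  assumes "S \<subseteq> {1..M}" "R \<subseteq> {1..M}" "Poly_Mapping.keys a \<subseteq> {..<n}"
  shows "mps_nth (g_comb pm (partition_of S) (partition_of R)) a = mps_nth (dual_chain M pm (- beta) (map mps_var (rev [0..<n])) S R) a"
  using g_comb_nth[OF partition_of_in(1)[OF assms(1)] partition_of_in(1)[OF assms(2)] assms(3), of pm]
    partition_of_in(2)[OF assms(1)] partition_of_in(2)[OF assms(2)]
    pp_gen_eq_dual_chain[OF assms(1,2), of pm "- beta" mps_var n] by simp

lemma keys_bounded: obtains n where "Poly_Mapping.keys (a :: nat \<Rightarrow>\<^sub>0 nat) \<subseteq> {..<n}"
  using finite_nat_iff_bounded finite_keys by blast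

text \<open>Every box costs a variable: \<open>adm_grow\<close> for the filtration by total
  degree.\<close>

lemma GQP_low:
  assumes "lam \<in> strict_partitions" "mps_nth (GQP pm lam) a \<noteq> 0"
  shows "\<Sum>(set lam) \<le> deg1 a"
proof -
  interpret filtration "order_ge (\<lambda>_. 1) :: nat \<Rightarrow> series set" by (rule filtration_order_ge)
  obtain n where n: "Poly_Mapping.keys a \<subseteq> {..<n}" by (rule keys_bounded)
  obtain M where M: "1 \<le> M" "set lam \<subseteq> {1..M}" "set lam \<subseteq> {1..M}"
    by (rule strict_partitions_common_bound[OF assms(1) assms(1)])
  have "adm M (grow M pm beta (map mps_var (rev [0..<n])))"
    using M by (intro adm_grow) (auto simp: var_order_ge)
  then have "grow M pm beta (map mps_var (rev [0..<n])) (set lam) \<in> order_ge (\<lambda>_. 1) (\<Sum>(set lam))"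
    using M unfolding adm_def by blast
  moreover have "mps_nth (grow M pm beta (map mps_var (rev [0..<n])) (set lam)) a \<noteq> 0"
    using GQP_grow[OF M(2,1) n, of pm] partition_of_set[OF assms(1)] assms(2) by simp
  ultimately show ?thesis unfolding order_ge_def by (metis (mono_tags, lifting) mem_Collect_eq not_le)
qed

lemma sum_le_subset:
  assumes "finite S" "0 \<notin> S" "\<Sum>S \<le> (d::nat)"
  shows "S \<subseteq> {1..d}"
proof
  fix p assume "p \<in> S"
  then show "p \<in> {1..d}"
    using assms member_le_sum[of p S "\<lambda>p. p"] by (cases p) auto
qed

lemma finite_sum_le: "finite {S. finite S \<and> 0 \<notin> S \<and> \<Sum>S \<le> (d::nat)}"
  by (rule finite_subset[of _ "Pow {1..d}"]) (use sum_le_subset in auto)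

lemma exists_max_on:
  fixes f :: "'a \<Rightarrow> nat"
  assumes "finite A" "A \<noteq> {}"
  shows "\<exists>x\<in>A. \<forall>y\<in>A. f y \<le> f x"
proof -
  have "Max (f ` A) \<in> f ` A" using assms by simp
  then obtain x where x: "x \<in> A" "Max (f ` A) = f x" by (rule imageE) simp
  have "f y \<le> f x" if "y \<in> A" for y
    unfolding x(2)[symmetric] using assms that by simp
  then show ?thesis using x(1) by blast
qed

text \<open>Among the shapes with \<open>h S\<close> nonzero take the smallest size and there the
  largest \<open>binary_value\<close>. At the leading exponent of this shape larger shapes do not
  occur by degree, smaller ones by minimality, and others of the same size by triangularity, so a
  single nonzero product would have to vanish.\<close>

lemma GQP_indep:
  fixes h :: "nat set \<Rightarrow> int poly"
  assumes "\<And>M a. 1 \<le> M \<Longrightarrow> deg1 a < M \<Longrightarrow> (\<Sum>S\<in>Pow {1..M}. mps_nth (GQP pm (partition_of S)) a * h S) = 0"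
    and "finite S" "0 \<notin> S"
  shows "h S = 0"
proof (rule ccontr)
  assume nz: "h S \<noteq> 0"
  let ?P = "\<lambda>d. \<exists>S. finite S \<and> 0 \<notin> S \<and> \<Sum>S = d \<and> h S \<noteq> 0"
  define d where "d = (LEAST d. ?P d)"
  have Pd: "?P d" unfolding d_def by (rule LeastI[of ?P "\<Sum>S"]) (use assms nz in blast)
  have least: "d \<le> \<Sum>S" if "finite S" "0 \<notin> S" "h S \<noteq> 0" for S
    unfolding d_def by (rule Least_le) (use that in blast)
  let ?A = "{S. finite S \<and> 0 \<notin> S \<and> \<Sum>S = d \<and> h S \<noteq> 0}"
  have "finite ?A" by (rule finite_subset[OF _ finite_sum_le[of d]]) auto
  moreover have "?A \<noteq> {}" using Pd by blast
  ultimately have "\<exists>S0\<in>?A. \<forall>S\<in>?A. binary_value S \<le> binary_value S0"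
    by (rule exists_max_on[where f = binary_value])
  then obtain S0 where A0: "S0 \<in> ?A" and max': "\<forall>S\<in>?A. binary_value S \<le> binary_value S0" by (rule bexE)
  from A0 have S0: "finite S0" "0 \<notin> S0" "\<Sum>S0 = d" "h S0 \<noteq> 0" by simp_all
  have max: "binary_value S \<le> binary_value S0" if "finite S" "0 \<notin> S" "\<Sum>S = d" "h S \<noteq> 0" for S
    by (rule bspec[OF max']) (use that in simp)
  \<comment> \<open>\<open>Suc d\<close> instead of \<open>d\<close>, because the hypothesis asks
    for a bound exceeding the degree of the tested monomial, which is \<open>d\<close>.\<close>
  have S0M: "S0 \<subseteq> {1..Suc d}" using sum_le_subset[OF S0(1,2), of "Suc d"] S0(3) by simp
  have sp0: "partition_of S0 \<in> strict_partitions" "set (partition_of S0) = S0" using partition_of_in[OF S0M] by auto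
  let ?a = "expo S0"
  have deg: "deg1 ?a = d" using wdeg_expo[OF S0M] S0(3) by simp
  have "mps_nth (GQP pm (partition_of S)) ?a * h S = 0" if S: "S \<subseteq> {1..Suc d}" "S \<noteq> S0" for S
  proof (rule ccontr)
    assume n: "mps_nth (GQP pm (partition_of S)) ?a * h S \<noteq> 0"
    have sp: "partition_of S \<in> strict_partitions" "set (partition_of S) = S" using partition_of_in[OF S(1)] by auto
    have fin: "finite S" "0 \<notin> S" using S(1) by (auto intro: finite_subset)
    have "\<Sum>S \<le> d" using GQP_low[OF sp(1), of pm ?a] n deg sp(2) by auto
    then have e: "\<Sum>S = d" using least[OF fin] n by force
    have "S = S0 \<or> binary_value S0 < binary_value S"
      using GQP_triangular[OF sp(1) sp0(1), of pm] n e S0(3) sp(2) sp0(2) by auto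
    then show False using S(2) max[OF fin e] n by force
  qed
  then have "(\<Sum>S\<in>Pow {1..Suc d}. mps_nth (GQP pm (partition_of S)) ?a * h S) =
      (\<Sum>S\<in>{S0}. mps_nth (GQP pm (partition_of S)) ?a * h S)"
    using S0M by (intro sum.mono_neutral_right) auto
  moreover have "(\<Sum>S\<in>Pow {1..Suc d}. mps_nth (GQP pm (partition_of S)) ?a * h S) = 0"
    using deg by (intro assms(1)) auto
  moreover have "mps_nth (GQP pm (partition_of S0)) ?a \<noteq> 0" using GQP_diag[OF sp0(1), of pm] sp0(2) by simp
  ultimately show False using S0(4) by simp
qed

lemma cauchy_coeff:
  fixes vs :: "'v list" and m :: "nat + 'v \<Rightarrow>\<^sub>0 nat"
  assumes M: "1 \<le> M" "wdeg xwt m < M" and n: "Poly_Mapping.keys (Poly_Mapping.map_key Inl m) \<subseteq> {..<n}"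
  shows "(\<Sum>S\<in>Pow {1..M}. mps_nth (GQP pm (partition_of S)) (Poly_Mapping.map_key Inl m) *
      mps_nth (dual_chain M pm (- beta) (map mps_var vs) S {}) (Poly_Mapping.map_key Inr m)) =
    mps_nth (\<Prod>v\<leftarrow>vs. \<Prod>i\<leftarrow>rev [0..<n]. kfac (mps_var (Inl i)) (mps_var (Inr v))) m"
proof -
  let ?P = "\<Prod>v\<leftarrow>vs. \<Prod>i\<leftarrow>rev [0..<n]. kfac (mps_var (Inl i)) (mps_var (Inr v)) :: (nat + 'v, int poly) mpser"
  have "(\<Sum>S\<in>Pow {1..M}. mps_nth (GQP pm (partition_of S)) (Poly_Mapping.map_key Inl m) *
      mps_nth (dual_chain M pm (- beta) (map mps_var vs) S {}) (Poly_Mapping.map_key Inr m)) =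
    mps_nth (\<Sum>S\<in>Pow {1..M}. mps_rename Inl (grow M pm beta (map mps_var (rev [0..<n])) S) *
       mps_rename Inr (dual_chain M pm (- beta) (map mps_var vs) S {})) m"
    unfolding mps_nth_sum mps_nth_Inl_mult_Inr using GQP_grow[OF _ M(1) n, of _ pm] by (intro sum.cong) auto
  also have "\<dots> = mps_nth ?P m"
    using cauchy_series[OF M(1), of pm n vs] M(2) by (simp add: order_ge_def)
  finally show ?thesis .
qed

lemma dual_chain_pp_gen:
  assumes "S \<subseteq> {1..M}" "R \<subseteq> {1..M}"
  shows "dual_chain M pm t ys S R = pp_gen pm t (\<lambda>i. rev ys ! i) (2 * length ys) S R"
proof -
  have "map (\<lambda>i. rev ys ! i) (rev [0..<length ys]) = ys"
    by (metis length_rev map_nth rev_map rev_rev_ident)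
  then show ?thesis using pp_gen_eq_dual_chain[OF assms, of pm t "\<lambda>i. rev ys ! i" "length ys"] by simp
qed

text \<open>The kernel product does not change when the \<open>y\<close>-variables are permuted, so
  both chains have the same pairing with the functions \<open>GQP\<close>, which are
  independent.\<close>

lemma dual_chain_symmetric:
  fixes vs vs' :: "'v list"
  assumes "mset vs = mset vs'" "S \<subseteq> {1..M}"
  shows "dual_chain M pm (- beta) (map mps_var vs) S {} = dual_chain M pm (- beta) (map mps_var vs') S {}"
proof (rule mpser_eqI)
  fix b :: "'v \<Rightarrow>\<^sub>0 nat"
  \<comment> \<open>The coefficient is expressed through \<open>pp_gen\<close>, which does not
    mention \<open>M\<close>, since the independence is tested with all bounds at once.\<close>
  define P where "P us S = mps_nth (pp_gen pm (- beta) (\<lambda>i. rev (map mps_var us) ! i) (2 * length us) S {}) b"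
    for us :: "'v list" and S
  have P: "mps_nth (dual_chain M pm (- beta) (map mps_var us) S {}) b = P us S" if "S \<subseteq> {1..M}" for us M S
    using dual_chain_pp_gen[OF that, of "{}" pm "- beta" "map mps_var us"] by (simp add: P_def)
  have "P vs S - P vs' S = 0"
  proof (rule GQP_indep[where h = "\<lambda>S. P vs S - P vs' S" and pm = pm])
    fix M and a :: "nat \<Rightarrow>\<^sub>0 nat" assume M: "1 \<le> M" "deg1 a < M"
    let ?m = "push Inl a + push Inr b :: nat + 'v \<Rightarrow>\<^sub>0 nat"
    have m: "wdeg xwt ?m < M" unfolding wdeg_map_key_Inl map_key_pushes using M by simp
    obtain n where n: "Poly_Mapping.keys a \<subseteq> {..<n}" by (rule keys_bounded)
    have "(\<Sum>S\<in>Pow {1..M}. mps_nth (GQP pm (partition_of S)) a * P us S) =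
      mps_nth (\<Prod>v\<leftarrow>us. \<Prod>i\<leftarrow>rev [0..<n]. kfac (mps_var (Inl i)) (mps_var (Inr v))) ?m" for us
      using cauchy_coeff[OF M(1) m, of n pm us] n unfolding map_key_pushes by (simp add: P)
    moreover have "(\<Prod>v\<leftarrow>vs. \<Prod>i\<leftarrow>rev [0..<n]. kfac (mps_var (Inl i)) (mps_var (Inr v))) =
      (\<Prod>v\<leftarrow>vs'. \<Prod>i\<leftarrow>rev [0..<n]. kfac (mps_var (Inl i)) (mps_var (Inr v)) :: (nat + 'v, int poly) mpser)"
      unfolding prod_mset_prod_list[symmetric] mset_map assms(1) ..
    ultimately show "(\<Sum>S\<in>Pow {1..M}. mps_nth (GQP pm (partition_of S)) a * (P vs S - P vs' S)) = 0"
      by (simp add: right_diff_distrib sum_subtractf)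
  qed (use assms(2) in \<open>auto intro: finite_subset\<close>)
  then show "mps_nth (dual_chain M pm (- beta) (map mps_var vs) S {}) b =
      mps_nth (dual_chain M pm (- beta) (map mps_var vs') S {}) b"
    unfolding P[OF assms(2)] by simp
qed

section \<open>The Cauchy identity and the branching rule\<close>

text \<open>The series that vanish when all variables outside \<open>V\<close> are set to 0; working
  modulo them replaces this substitution.\<close>

definition vanishing_on :: "'v set \<Rightarrow> ('v, 'a::comm_ring_1) mpser set" where
  "vanishing_on V = {f. \<forall>m. Poly_Mapping.keys m \<subseteq> V \<longrightarrow> mps_nth f m = 0}"

lemma vanishing_on_mult: "f \<in> vanishing_on V \<Longrightarrow> g * f \<in> (vanishing_on V :: ('v, 'a::comm_ring_1) mpser set)"
  unfolding vanishing_on_def mem_Collect_eq mps_nth_mult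
proof (intro allI impI sum.neutral ballI)
  fix m :: "'v \<Rightarrow>\<^sub>0 nat" and p
  assume f: "\<forall>m. Poly_Mapping.keys m \<subseteq> V \<longrightarrow> mps_nth f m = 0" and m: "Poly_Mapping.keys m \<subseteq> V"
    and p: "p \<in> {(a, b). a + b = m}"
  obtain a b where ab: "p = (a, b)" "a + b = m" using p by auto
  then have "Poly_Mapping.keys b \<subseteq> V" using m keys_add_nat[of a b] by blast
  then show "(case p of (a, b) \<Rightarrow> mps_nth g a * mps_nth f b) = 0" using f ab by simp
qed

lemma vanishing_on_add: "f \<in> vanishing_on V \<Longrightarrow> g \<in> vanishing_on V \<Longrightarrow> f + g \<in> vanishing_on V"
  by (simp add: vanishing_on_def)

lemma vanishing_on_var: "v \<notin> V \<Longrightarrow> mps_var v \<in> vanishing_on V"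
  by (auto simp: vanishing_on_def var_eq_term mps_nth_term)

lemma prod_vanishing_on:
  assumes "finite A" "\<And>i. i \<in> A \<Longrightarrow> f i - 1 \<in> vanishing_on V"
  shows "prod f A - 1 \<in> (vanishing_on V :: ('v, 'a::comm_ring_1) mpser set)"
  using assms
proof (induction A rule: finite_induct)
  case empty
  then show ?case by (simp add: vanishing_on_def)
next
  case (insert a A)
  have "prod f (insert a A) - 1 = f a * (prod f A - 1) + (f a - 1)"
    using insert.hyps by (simp add: right_diff_distrib)
  moreover have "f a * (prod f A - 1) \<in> vanishing_on V" "f a - 1 \<in> vanishing_on V"
    using insert by (auto intro!: vanishing_on_mult)
  ultimately show ?case by (simp only: vanishing_on_add)
qed

abbreviation "kernel_entry \<equiv> \<lambda>(i, j). kfac (mps_var (Inl i)) (mps_var (Inr j)) :: series2"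

lemma kernel_entry_vanishing_on:
  assumes "i \<notin> A \<or> j \<notin> B"
  shows "kernel_entry (i, j) - 1 \<in> vanishing_on (Inl ` A \<union> Inr ` B)"
proof -
  obtain z where z: "kernel_entry (i, j) = 1 + z * (mps_var (Inl i) * mps_var (Inr j))"
    using kfac_split[of "Inl i" "Inr j"] by auto
  have "mps_var (Inl i) * mps_var (Inr j) \<in> (vanishing_on (Inl ` A \<union> Inr ` B) :: series2 set)"
  proof (cases "j \<in> B")
    case False
    then have "Inr j \<notin> Inl ` A \<union> Inr ` B" by auto
    then show ?thesis by (intro vanishing_on_mult vanishing_on_var)
  next
    case True
    then have "Inl i \<notin> Inl ` A \<union> Inr ` B" using assms by auto
    then have "mps_var (Inr j) * mps_var (Inl i) \<in> (vanishing_on (Inl ` A \<union> Inr ` B) :: series2 set)" by (intro vanishing_on_mult vanishing_on_var)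
    then show ?thesis by (simp add: mult.commute)
  qed
  then show ?thesis unfolding z by (simp add: vanishing_on_mult)
qed

text \<open>A factor outside the square contains an \<open>x\<close> or a \<open>y\<close> of index
  at least \<open>n\<close>, hence is 1 modulo the series vanishing on the first \<open>n\<close>
  variables of each alphabet.\<close>

lemma prod_kernel_entry_nth:
  assumes "finite I" "{..<n} \<times> {..<n} \<subseteq> I" "Poly_Mapping.keys m \<subseteq> Inl ` {..<n} \<union> Inr ` {..<n}"
  shows "mps_nth (prod kernel_entry I) m = mps_nth (prod kernel_entry ({..<n} \<times> {..<n})) m"
proof -
  let ?B = "{..<n} \<times> {..<n}" and ?V = "Inl ` {..<n} \<union> Inr ` {..<n}"
  have "prod kernel_entry (I - ?B) - 1 \<in> vanishing_on ?V"
  proof (rule prod_vanishing_on)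
    fix u assume u: "u \<in> I - ?B"
    obtain i j where "u = (i, j)" by (cases u)
    then show "kernel_entry u - 1 \<in> vanishing_on ?V" using kernel_entry_vanishing_on[of i "{..<n}" j "{..<n}"] u by auto
  qed (use assms in auto)
  then have "prod kernel_entry ?B * (prod kernel_entry (I - ?B) - 1) \<in> vanishing_on ?V" by (rule vanishing_on_mult)
  moreover have "prod kernel_entry I = prod kernel_entry ?B * prod kernel_entry (I - ?B)"
    using prod.subset_diff[OF assms(2,1), of kernel_entry] by (simp add: mult.commute)
  ultimately have "prod kernel_entry I - prod kernel_entry ?B \<in> vanishing_on ?V" by (simp add: right_diff_distrib)
  then show ?thesis using assms(3) by (simp add: vanishing_on_def)
qed

lemma keys_bounded_sum: obtains n where "Poly_Mapping.keys (m :: nat + nat \<Rightarrow>\<^sub>0 nat) \<subseteq> Inl ` {..<n} \<union> Inr ` {..<n}"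
proof -
  define f :: "nat + nat \<Rightarrow> nat" where "f = case_sum id id"
  have "finite (f ` Poly_Mapping.keys m)" by simp
  then obtain n where n: "f ` Poly_Mapping.keys m \<subseteq> {..<n}" using finite_nat_iff_bounded by blast
  have "v \<in> Inl ` {..<n} \<union> Inr ` {..<n}" if "v \<in> Poly_Mapping.keys m" for v
  proof -
    have "f v < n" using n that by blast
    then show ?thesis by (cases v) (auto simp: f_def)
  qed
  then show ?thesis using that by blast
qed

text \<open>To evaluate \<open>Lim\<close>, a limit is assembled coefficientwise from squares large
  enough for the given exponent vector; two such squares give the same coefficient.\<close>

lemma cauchy_kernel_nth:
  assumes "Poly_Mapping.keys m \<subseteq> Inl ` {..<n} \<union> Inr ` {..<n}"
  shows "mps_nth cauchy_kernel m = mps_nth (prod kernel_entry ({..<n} \<times> {..<n})) m"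
proof -
  define N where "N m = (SOME n. Poly_Mapping.keys m \<subseteq> Inl ` {..<n} \<union> Inr ` {..<n})" for m :: "nat + nat \<Rightarrow>\<^sub>0 nat"
  have N: "Poly_Mapping.keys m \<subseteq> Inl ` {..<N m} \<union> Inr ` {..<N m}" for m
    unfolding N_def by (rule someI_ex) (use keys_bounded_sum[of m] in blast)
  define L :: series2 where "L = Abs_mpser (\<lambda>m. mps_nth (prod kernel_entry ({..<N m} \<times> {..<N m})) m)"
  have L: "mps_nth L m = mps_nth (prod kernel_entry ({..<N m} \<times> {..<N m})) m" for m
    by (simp add: L_def Abs_mpser_inverse)
  have "((\<lambda>I. prod kernel_entry I) \<longlongrightarrow> L) (finite_subsets_at_top UNIV)"
    unfolding tendsto_mpser_iff
  proof
    fix m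
    show "\<forall>\<^sub>F I in finite_subsets_at_top UNIV. mps_nth (prod kernel_entry I) m = mps_nth L m"
      unfolding eventually_finite_subsets_at_top
    proof (intro exI[of _ "{..<N m} \<times> {..<N m}"] conjI allI impI)
      fix I :: "(nat \<times> nat) set" assume "finite I \<and> {..<N m} \<times> {..<N m} \<subseteq> I \<and> I \<subseteq> UNIV"
      then show "mps_nth (prod kernel_entry I) m = mps_nth L m" unfolding L using N by (intro prod_kernel_entry_nth) auto
    qed auto
  qed
  then have "Lim (finite_subsets_at_top UNIV) (\<lambda>I. prod kernel_entry I) = L"
    by (intro tendsto_Lim) auto
  moreover have "cauchy_kernel = Lim (finite_subsets_at_top UNIV) (\<lambda>I. prod kernel_entry I)"
    unfolding cauchy_kernel_def kfac_def ..
  ultimately have K: "cauchy_kernel = L" by simp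
  let ?n = "max n (N m)"
  have "mps_nth (prod kernel_entry ({..<?n} \<times> {..<?n})) m = mps_nth (prod kernel_entry ({..<N m} \<times> {..<N m})) m"
    using N by (intro prod_kernel_entry_nth) auto
  moreover have "mps_nth (prod kernel_entry ({..<?n} \<times> {..<?n})) m = mps_nth (prod kernel_entry ({..<n} \<times> {..<n})) m"
    using assms by (intro prod_kernel_entry_nth) auto
  ultimately show ?thesis unfolding K L by simp
qed

lemma prod_list_rev_upt: "(\<Prod>i\<leftarrow>rev [0..<n]. f i) = (\<Prod>i<n. f i :: 'a::comm_monoid_mult)"
  by (induction n) (simp_all add: mult.commute)

lemma prod_list_kernel_entry: "(\<Prod>j\<leftarrow>rev [0..<n]. \<Prod>i\<leftarrow>rev [0..<n]. kfac (mps_var (Inl i)) (mps_var (Inr j))) = prod kernel_entry ({..<n} \<times> {..<n})"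
proof -
  have "(\<Prod>j<n. \<Prod>i<n. kernel_entry (i, j)) = (\<Prod>i<n. \<Prod>j<n. kernel_entry (i, j))" by (rule prod.swap)
  also have "\<dots> = prod kernel_entry ({..<n} \<times> {..<n})" by (simp add: prod.cartesian_product)
  finally show ?thesis unfolding prod_list_rev_upt by simp
qed

lemma has_sum_finite_support:
  fixes f :: "'i \<Rightarrow> ('v, 'a::comm_ring_1) mpser"
  assumes "\<And>m. finite (F m)" "\<And>m. F m \<subseteq> A" "\<And>m i. i \<in> A \<Longrightarrow> mps_nth (f i) m \<noteq> 0 \<Longrightarrow> i \<in> F m"
  shows "(f has_sum s) A \<longleftrightarrow> (\<forall>m. (\<Sum>i\<in>F m. mps_nth (f i) m) = mps_nth s m)"
proof -
  have 1: "finite {i\<in>A. mps_nth (f i) m \<noteq> 0}" for m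
    by (rule finite_subset[OF _ assms(1)[of m]]) (use assms(3) in blast)
  have 2: "(\<Sum>i\<in>{i\<in>A. mps_nth (f i) m \<noteq> 0}. mps_nth (f i) m) = (\<Sum>i\<in>F m. mps_nth (f i) m)" for m
    using assms by (intro sum.mono_neutral_left) auto
  have "(f has_sum s) A \<longleftrightarrow> (\<forall>m. mps_nth s m = (\<Sum>i\<in>F m. mps_nth (f i) m))"
    unfolding has_sum_mpser_iff 2 by (simp only: 1 simp_thms)
  then show ?thesis by metis
qed

lemma sum_part:
  "(\<Sum>lam\<in>partition_of ` Pow {1..M}. f lam) = (\<Sum>S\<in>Pow {1..M}. f (partition_of S))"
proof (subst sum.reindex)
  show "inj_on partition_of (Pow {1..M})"
    by (rule inj_onI) (metis PowD partition_of_in(2))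
qed simp

text \<open>By \<open>GQP_low\<close> only shapes of size at most the \<open>x\<close>-degree reach
  a given coefficient, so the infinite sum is finite in each coefficient, whatever \<open>g\<close>
  is.\<close>

lemma has_sum_GQP_iff:
  fixes g :: "nat list \<Rightarrow> series"
  shows "((\<lambda>lam. in_x (GQP pm lam) * in_y (g lam)) has_sum s) strict_partitions \<longleftrightarrow>
    (\<forall>m. (\<Sum>S\<in>Pow {1..Suc (wdeg xwt m)}. mps_nth (GQP pm (partition_of S)) (Poly_Mapping.map_key Inl m) *
       mps_nth (g (partition_of S)) (Poly_Mapping.map_key Inr m)) = mps_nth s m)"
proof -
  let ?F = "\<lambda>m :: nat + nat \<Rightarrow>\<^sub>0 nat. partition_of ` Pow {1..Suc (wdeg xwt m)}"
  have "((\<lambda>lam. in_x (GQP pm lam) * in_y (g lam)) has_sum s) strict_partitions \<longleftrightarrow>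
    (\<forall>m. (\<Sum>lam\<in>?F m. mps_nth (in_x (GQP pm lam) * in_y (g lam)) m) = mps_nth s m)"
  proof (rule has_sum_finite_support)
    show "finite (?F m)" for m by simp
    show "?F m \<subseteq> strict_partitions" for m using partition_of_in(1) by blast
    fix m lam assume lam: "lam \<in> strict_partitions" and nz: "mps_nth (in_x (GQP pm lam) * in_y (g lam)) m \<noteq> 0"
    have "mps_nth (GQP pm lam) (Poly_Mapping.map_key Inl m) \<noteq> 0"
      using nz unfolding in_x_def in_y_def mps_nth_Inl_mult_Inr by auto
    then have "\<Sum>(set lam) \<le> wdeg xwt m" using GQP_low[OF lam] wdeg_map_key_Inl[of m] by simp
    moreover have "0 \<notin> set lam" using lam by (auto simp: strict_partitions_def)
    ultimately have "set lam \<subseteq> {1..Suc (wdeg xwt m)}" by (intro sum_le_subset) auto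
    then show "lam \<in> ?F m" using partition_of_set[OF lam] by (metis PowI image_eqI)
  qed
  then show ?thesis unfolding sum_part in_x_def in_y_def mps_nth_Inl_mult_Inr .
qed

lemma keys_map_key:
  assumes "inj \<phi>" "Poly_Mapping.keys m \<subseteq> V"
  shows "Poly_Mapping.keys (Poly_Mapping.map_key \<phi> m) \<subseteq> \<phi> -` V"
  using assms by (auto simp: in_keys_iff lookup_map_key subset_iff)

lemma cauchy_identity:
  "((\<lambda>lam. in_x (GQP pm lam) * in_y (g_comb pm lam [])) has_sum cauchy_kernel) strict_partitions"
  unfolding has_sum_GQP_iff
proof
  fix m :: "nat + nat \<Rightarrow>\<^sub>0 nat"
  let ?M = "Suc (wdeg xwt m)"
  obtain n where n: "Poly_Mapping.keys m \<subseteq> Inl ` {..<n} \<union> Inr ` {..<n}" by (rule keys_bounded_sum)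
  have l: "Poly_Mapping.keys (Poly_Mapping.map_key Inl m) \<subseteq> {..<n}"
    using keys_map_key[of Inl, OF _ n] by auto
  have r: "Poly_Mapping.keys (Poly_Mapping.map_key Inr m) \<subseteq> {..<n}"
    using keys_map_key[of Inr, OF _ n] by auto
  have "partition_of {} = []" by (simp add: partition_of_def)
  then have "(\<Sum>S\<in>Pow {1..?M}. mps_nth (GQP pm (partition_of S)) (Poly_Mapping.map_key Inl m) *
       mps_nth (g_comb pm (partition_of S) []) (Poly_Mapping.map_key Inr m)) =
     (\<Sum>S\<in>Pow {1..?M}. mps_nth (GQP pm (partition_of S)) (Poly_Mapping.map_key Inl m) *
       mps_nth (dual_chain ?M pm (- beta) (map mps_var (rev [0..<n])) S {}) (Poly_Mapping.map_key Inr m))"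
    using g_comb_dual[OF _ _ r, of _ ?M "{}" pm] by (intro sum.cong refl) auto
  also have "\<dots> = mps_nth cauchy_kernel m"
    using cauchy_coeff[of ?M m n pm "rev [0..<n]"] l unfolding prod_list_kernel_entry cauchy_kernel_nth[OF n] by simp
  finally show "(\<Sum>S\<in>Pow {1..?M}. mps_nth (GQP pm (partition_of S)) (Poly_Mapping.map_key Inl m) *
       mps_nth (g_comb pm (partition_of S) []) (Poly_Mapping.map_key Inr m)) = mps_nth cauchy_kernel m" .
qed

text \<open>For a fixed \<open>y\<close>-monomial the differences of the coefficients form a family
  to which \<open>GQP_indep\<close> applies; enlarging \<open>M\<close> adds only zero
  terms.\<close>

lemma has_sum_GQP_unique:
  fixes g g' :: "nat list \<Rightarrow> series"
  assumes "((\<lambda>lam. in_x (GQP pm lam) * in_y (g lam)) has_sum s) strict_partitions"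
    and "((\<lambda>lam. in_x (GQP pm lam) * in_y (g' lam)) has_sum s) strict_partitions"
    and lam: "lam \<in> strict_partitions"
  shows "g lam = g' lam"
proof (rule mpser_eqI)
  fix b
  have "mps_nth (g (partition_of (set lam))) b - mps_nth (g' (partition_of (set lam))) b = 0"
  proof (rule GQP_indep[where h = "\<lambda>S. mps_nth (g (partition_of S)) b - mps_nth (g' (partition_of S)) b" and pm = pm])
    fix M and a :: "nat \<Rightarrow>\<^sub>0 nat" assume M: "1 \<le> M" "deg1 a < M"
    let ?m = "push Inl a + push Inr b"
    let ?f = "\<lambda>S. mps_nth (GQP pm (partition_of S)) a * (mps_nth (g (partition_of S)) b - mps_nth (g' (partition_of S)) b)"
    have w: "wdeg xwt ?m = deg1 a" unfolding wdeg_map_key_Inl map_key_pushes ..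
    have "(\<Sum>S\<in>Pow {1..M}. ?f S) = (\<Sum>S\<in>Pow {1..Suc (deg1 a)}. ?f S)"
    proof (rule sum.mono_neutral_right)
      show "Pow {1..Suc (deg1 a)} \<subseteq> Pow {1..M}" using M by auto
      show "\<forall>S\<in>Pow {1..M} - Pow {1..Suc (deg1 a)}. ?f S = 0"
      proof
        fix S assume S: "S \<in> Pow {1..M} - Pow {1..Suc (deg1 a)}"
        then have SM: "S \<subseteq> {1..M}" by simp
        have "mps_nth (GQP pm (partition_of S)) a = 0"
        proof (rule ccontr)
          assume "mps_nth (GQP pm (partition_of S)) a \<noteq> 0"
          then have "\<Sum>S \<le> deg1 a" using GQP_low[OF partition_of_in(1)[OF SM], of pm a] partition_of_in(2)[OF SM] by simp
          moreover have "finite S" "0 \<notin> S" using SM by (auto intro: finite_subset)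
          ultimately have "S \<subseteq> {1..Suc (deg1 a)}" by (intro sum_le_subset) auto
          then show False using S by simp
        qed
        then show "?f S = 0" by simp
      qed
    qed simp
    also have "\<dots> = 0"
      using spec[OF assms(1)[unfolded has_sum_GQP_iff], of ?m] spec[OF assms(2)[unfolded has_sum_GQP_iff], of ?m]
      unfolding w map_key_pushes right_diff_distrib sum_subtractf by simp
    finally show "(\<Sum>S\<in>Pow {1..M}. ?f S) = 0" .
  qed (use lam in \<open>auto simp: strict_partitions_def\<close>)
  then show "mps_nth (g lam) b = mps_nth (g' lam) b" using partition_of_set[OF lam] by simp
qed

section \<open>Identification of the dual functions\<close>

lemma THE_extensional:
  assumes "P (restrict f A)" "\<And>g. P g \<Longrightarrow> g \<in> extensional A \<Longrightarrow> (\<And>a. a \<in> A \<Longrightarrow> g a = f a)"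
  shows "(THE g. g \<in> extensional A \<and> P g) = restrict f A"
proof (rule the_equality)
  show "restrict f A \<in> extensional A \<and> P (restrict f A)" using assms(1) by simp
  fix g assume g: "g \<in> extensional A \<and> P g"
  show "g = restrict f A"
    by (rule extensionalityI[of _ A]) (use g assms(2) in auto)
qed

lemma dual_function_eq:
  "(THE g. g \<in> extensional strict_partitions \<and>
     ((\<lambda>lam. in_x (GQP pm lam) * in_y (g lam)) has_sum cauchy_kernel) strict_partitions) =
   restrict (\<lambda>lam. g_comb pm lam []) strict_partitions"
proof (rule THE_extensional)
  show "((\<lambda>lam. in_x (GQP pm lam) * in_y (restrict (\<lambda>lam. g_comb pm lam []) strict_partitions lam)) has_sum cauchy_kernel) strict_partitions"
    using cauchy_identity[of pm] by (rule has_sum_cong[THEN iffD1, rotated]) simp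
  show "g lam = g_comb pm lam []"
    if "((\<lambda>lam. in_x (GQP pm lam) * in_y (g lam)) has_sum cauchy_kernel) strict_partitions" "lam \<in> strict_partitions" for g lam
    by (rule has_sum_GQP_unique[OF that(1) cauchy_identity that(2)])
qed

lemma gp_eq: "gp = restrict (\<lambda>lam. g_comb True lam []) strict_partitions"
  unfolding gp_def using dual_function_eq[of True] by (simp add: GQP_def)

lemma gq_eq: "gq = restrict (\<lambda>lam. g_comb False lam []) strict_partitions"
  unfolding gq_def using dual_function_eq[of False] by (simp add: GQP_def)

text \<open>Joining alphabets is a matrix product; the front part of the list has the larger letters
  and therefore takes the outer region.\<close>

lemma dual_chain_append:
  assumes "S \<subseteq> {1..M}" "R \<subseteq> {1..M}"
  shows "dual_chain M pm t (ys @ xs) S R = (\<Sum>K\<in>Pow {1..M}. dual_chain M pm t xs K R * dual_chain M pm t ys S K)"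
  using assms(1)
proof (induction ys arbitrary: S)
  case Nil
  have "(\<Sum>K\<in>Pow {1..M}. dual_chain M pm t xs K R * dual_chain M pm t [] S K) =
      (\<Sum>K\<in>Pow {1..M}. if K = S then dual_chain M pm t xs K R else 0)"
    by (intro sum.cong) auto
  then show ?case using Nil by simp
next
  case (Cons y ys)
  have "dual_chain M pm t ((y # ys) @ xs) S R =
      (\<Sum>L\<in>Pow {1..M}. (\<Sum>K\<in>Pow {1..M}. dual_chain M pm t xs K R * dual_chain M pm t ys L K) * dual_op M pm t y L S)"
    using Cons.IH by simp
  also have "\<dots> = (\<Sum>L\<in>Pow {1..M}. \<Sum>K\<in>Pow {1..M}. dual_chain M pm t xs K R * (dual_chain M pm t ys L K * dual_op M pm t y L S))"
    by (simp add: sum_distrib_right mult.assoc)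
  also have "\<dots> = (\<Sum>K\<in>Pow {1..M}. \<Sum>L\<in>Pow {1..M}. dual_chain M pm t xs K R * (dual_chain M pm t ys L K * dual_op M pm t y L S))"
    by (rule sum.swap)
  finally show ?case by (simp add: sum_distrib_left)
qed

section \<open>Interleaved alphabets and the branching rule\<close>

definition interleave :: "nat \<Rightarrow> nat + nat" where
  "interleave k = (if even k then Inl (k div 2) else Inr (k div 2))"

lemma inj_interleave: "inj interleave"
proof (rule injI)
  fix a b assume "interleave a = interleave b"
  then have "even a = even b" "a div 2 = b div 2" by (auto simp: interleave_def split: if_splits)
  then show "a = b" by (metis div_mult_mod_eq even_iff_mod_2_eq_zero odd_iff_mod_2_eq_one)
qed

lemma range_interleave: "range interleave = UNIV"
proof -
  have "v \<in> range interleave" for v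
  proof (cases v)
    case (Inl a)
    then have "v = interleave (2 * a)" by (simp add: interleave_def)
    then show ?thesis by blast
  next
    case (Inr a)
    then have "v = interleave (2 * a + 1)" by (simp add: interleave_def)
    then show ?thesis by blast
  qed
  then show ?thesis by auto
qed

lemma mset_interleave: "mset (map interleave (rev [0..<2 * n])) = mset (map Inr (rev [0..<n]) @ map Inl (rev [0..<n]))"
proof (induction n)
  case (Suc n)
  have "[0..<2 * Suc n] = [0..<2 * n] @ [2 * n, Suc (2 * n)]" by simp
  then show ?case using Suc by (simp add: interleave_def)
qed simp

text \<open>Only \<open>mu\<close> contained in \<open>lam\<close> contribute, so all shapes stay
  below one bound \<open>M\<close>. For each monomial the chain over the interleaved variables is
  permuted into one with the alphabets consecutive and then cut between them.\<close>

lemma skew_identity: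
  assumes lam: "lam \<in> strict_partitions"
  shows "((\<lambda>mu. in_x (g_comb pm mu []) * in_y (g_comb pm lam mu)) has_sum in_xy (g_comb pm lam [])) strict_partitions"
proof -
  obtain M where M: "1 \<le> M" "set lam \<subseteq> {1..M}" "set lam \<subseteq> {1..M}"
    by (rule strict_partitions_common_bound[OF lam lam])
  let ?F = "partition_of ` Pow {1..M}"
  have pl: "partition_of (set lam) = lam" by (rule partition_of_set[OF lam])
  have p0: "partition_of {} = []" by (simp add: partition_of_def)
  have "((\<lambda>mu. in_x (g_comb pm mu []) * in_y (g_comb pm lam mu)) has_sum in_xy (g_comb pm lam [])) strict_partitions \<longleftrightarrow>
    (\<forall>m. (\<Sum>mu\<in>?F. mps_nth (in_x (g_comb pm mu []) * in_y (g_comb pm lam mu)) m) = mps_nth (in_xy (g_comb pm lam [])) m)"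
  proof (rule has_sum_finite_support)
    show "?F \<subseteq> strict_partitions" using partition_of_in(1) by blast
    fix m mu assume mu: "mu \<in> strict_partitions" and nz: "mps_nth (in_x (g_comb pm mu []) * in_y (g_comb pm lam mu)) m \<noteq> 0"
    have "mps_nth (g_comb pm lam mu) (Poly_Mapping.map_key Inr m) \<noteq> 0"
      using nz unfolding in_x_def in_y_def mps_nth_Inl_mult_Inr by auto
    moreover obtain n where n: "Poly_Mapping.keys (Poly_Mapping.map_key Inr m) \<subseteq> {..<n}" by (rule keys_bounded)
    ultimately have "pp_gen pm (- beta) mps_var (2 * n) (set lam) (set mu) \<noteq> (0 :: series)"
      using g_comb_nth[OF lam mu n, of pm] by auto
    then have "pp_set pm (2 * n) (set lam) (set mu) \<noteq> {}" by (auto simp: pp_gen_def)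
    then have sub: "dgm (set mu) \<subseteq> dgm (set lam)" using pp_set_sub by blast
    have "set mu \<subseteq> {1..M}"
    proof
      fix p assume p: "p \<in> set mu"
      have p0: "p \<noteq> 0" using mu p by (auto simp: strict_partitions_def)
      have "p \<le> M"
      proof (rule ccontr)
        assume "\<not> p \<le> M"
        then have "p \<in> {q \<in> set mu. M < q}" using p by simp
        then have "cnt (set mu) M \<noteq> 0" unfolding cnt_def by (auto simp: card_eq_0_iff)
        moreover have "cnt (set mu) M \<le> cnt (set lam) M" using sub unfolding dgm_subset_iff by blast
        ultimately show False using cnt_eq_0[OF M(2), of M] by simp
      qed
      then show "p \<in> {1..M}" using p0 by simp
    qed
    then show "mu \<in> ?F" using partition_of_set[OF mu] by (metis PowI image_eqI)
  qed simp
  also have "\<dots>"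
  proof
    fix m :: "nat + nat \<Rightarrow>\<^sub>0 nat"
    obtain n where n: "Poly_Mapping.keys m \<subseteq> Inl ` {..<n} \<union> Inr ` {..<n}" by (rule keys_bounded_sum)
    have l: "Poly_Mapping.keys (Poly_Mapping.map_key Inl m) \<subseteq> {..<n}"
      using keys_map_key[of Inl, OF _ n] by auto
    have r: "Poly_Mapping.keys (Poly_Mapping.map_key Inr m) \<subseteq> {..<n}"
      using keys_map_key[of Inr, OF _ n] by auto
    have x: "Poly_Mapping.keys (Poly_Mapping.map_key interleave m) \<subseteq> {..<2 * n}"
    proof -
      have "interleave -` (Inl ` {..<n} \<union> Inr ` {..<n}) \<subseteq> {..<2 * n}"
        by (auto simp: interleave_def split: if_splits)
      then show ?thesis using keys_map_key[OF inj_interleave n] by blast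
    qed
    let ?dc = "\<lambda>vs :: (nat + nat) list. dual_chain M pm (- beta) (map mps_var vs)"
    let ?vs = "map mps_var (rev [0..<n]) :: series list"
    have hx: "mps_rename Inl (dual_chain M pm (- beta) ?vs S R) = ?dc (map Inl (rev [0..<n])) S R" for S R
      using hom_dual_chain[OF ring_hom_rename[of "Inl :: nat \<Rightarrow> nat + nat"], of M pm "- beta" ?vs S R]
      by (simp add: mps_rename_beta mps_rename_var mps_rename_uminus o_def)
    have hy: "mps_rename Inr (dual_chain M pm (- beta) ?vs S R) = ?dc (map Inr (rev [0..<n])) S R" for S R
      using hom_dual_chain[OF ring_hom_rename[of "Inr :: nat \<Rightarrow> nat + nat"], of M pm "- beta" ?vs S R]
      by (simp add: mps_rename_beta mps_rename_var mps_rename_uminus o_def)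
    have hxy: "mps_rename interleave (dual_chain M pm (- beta) (map mps_var (rev [0..<2 * n])) S R) = ?dc (map interleave (rev [0..<2 * n])) S R" for S R
      using hom_dual_chain[OF ring_hom_rename[OF inj_interleave], of M pm "- beta" "map mps_var (rev [0..<2 * n])" S R]
      by (simp add: mps_rename_beta[OF inj_interleave] mps_rename_var[OF inj_interleave] mps_rename_uminus o_def)
    have "interleave = (\<lambda>k. if even k then Inl (k div 2) else Inr (k div 2))" by (rule ext) (simp add: interleave_def)
    then have in_xy_interleave: "in_xy = mps_rename interleave" by (simp only: in_xy_def)
    have "(\<Sum>mu\<in>?F. mps_nth (in_x (g_comb pm mu []) * in_y (g_comb pm lam mu)) m) =
      (\<Sum>S\<in>Pow {1..M}. mps_nth (g_comb pm (partition_of S) []) (Poly_Mapping.map_key Inl m) *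
         mps_nth (g_comb pm lam (partition_of S)) (Poly_Mapping.map_key Inr m))"
      unfolding sum_part in_x_def in_y_def mps_nth_Inl_mult_Inr ..
    also have "\<dots> = (\<Sum>S\<in>Pow {1..M}. mps_nth (dual_chain M pm (- beta) ?vs S {}) (Poly_Mapping.map_key Inl m) *
         mps_nth (dual_chain M pm (- beta) ?vs (set lam) S) (Poly_Mapping.map_key Inr m))"
    proof (intro sum.cong refl)
      fix S assume "S \<in> Pow {1..M}"
      then have S: "S \<subseteq> {1..M}" by simp
      show "mps_nth (g_comb pm (partition_of S) []) (Poly_Mapping.map_key Inl m) *
         mps_nth (g_comb pm lam (partition_of S)) (Poly_Mapping.map_key Inr m) =
         mps_nth (dual_chain M pm (- beta) ?vs S {}) (Poly_Mapping.map_key Inl m) *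
         mps_nth (dual_chain M pm (- beta) ?vs (set lam) S) (Poly_Mapping.map_key Inr m)"
        using g_comb_dual[OF S _ l, of "{}" pm] g_comb_dual[OF M(2) S r, of pm] by (simp add: p0 pl)
    qed
    also have "\<dots> = mps_nth (\<Sum>S\<in>Pow {1..M}. mps_rename Inl (dual_chain M pm (- beta) ?vs S {}) *
          mps_rename Inr (dual_chain M pm (- beta) ?vs (set lam) S)) m"
      unfolding mps_nth_sum mps_nth_Inl_mult_Inr ..
    \<comment> \<open>The \<open>y\<close>-variables stand in front, so they have the larger letters
      and fill the outer region, as the skew factor requires.\<close>
    also have "(\<Sum>S\<in>Pow {1..M}. mps_rename Inl (dual_chain M pm (- beta) ?vs S {}) *
          mps_rename Inr (dual_chain M pm (- beta) ?vs (set lam) S)) =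
        ?dc (map Inr (rev [0..<n]) @ map Inl (rev [0..<n])) (set lam) {}"
      unfolding hx hy map_append by (subst dual_chain_append) (use M in auto)
    also have "\<dots> = ?dc (map interleave (rev [0..<2 * n])) (set lam) {}"
      by (rule dual_chain_symmetric[OF mset_interleave[symmetric] M(2)])
    also have "mps_nth \<dots> m = mps_nth (in_xy (g_comb pm lam [])) m"
    proof -
      have "mps_nth (g_comb pm lam []) (Poly_Mapping.map_key interleave m) =
          mps_nth (dual_chain M pm (- beta) (map mps_var (rev [0..<2 * n])) (set lam) {}) (Poly_Mapping.map_key interleave m)"
        using g_comb_dual[OF M(2) _ x, of "{}" pm] by (simp add: p0 pl)
      then show ?thesis unfolding in_xy_interleave hxy[symmetric] mps_nth_rename range_interleave by simp
    qed
    finally show "(\<Sum>mu\<in>?F. mps_nth (in_x (g_comb pm mu []) * in_y (g_comb pm lam mu)) m) = mps_nth (in_xy (g_comb pm lam [])) m" .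
  qed
  finally show ?thesis by simp
qed

section \<open>Uniqueness of the skew functions\<close>

lemma neg_X_power: "(- [:0, 1:] :: int poly) ^ k = monom ((- 1) ^ k) k"
  by (induction k) (simp_all add: monom_0 monom_Suc minus_monom)

text \<open>The coefficient at \<open>a\<close> is a number times a power of \<open>- beta\<close>
  with exponent the size of \<open>lam\<close> minus the degree of \<open>a\<close>. Hence
  \<open>N\<close> acts as a total degree in which \<open>\<beta>\<close> counts 1, and the
  coefficient of \<open>p\<close> involved depends on \<open>N\<close> and the size of
  \<open>lam\<close> only.\<close>

lemma coeff_g_comb_mult:
  assumes lam: "lam \<in> strict_partitions" and d: "deg1 a \<le> N" and nz: "coeff (mps_nth (g_comb pm lam []) a * p) (N - deg1 a) \<noteq> 0"
  shows "mps_nth (g_comb pm lam []) a \<noteq> 0" "deg1 a \<le> \<Sum>(set lam)" "\<Sum>(set lam) \<le> N" "coeff p (N - \<Sum>(set lam)) \<noteq> 0"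
proof -
  obtain n where n: "Poly_Mapping.keys a \<subseteq> {..<n}" by (rule keys_bounded)
  show nz': "mps_nth (g_comb pm lam []) a \<noteq> 0" using nz by auto
  obtain T where "deg1 a \<le> \<Sum>(set lam)" by (rule g_comb_nth_nonzero[OF lam n nz'])
  then show le: "deg1 a \<le> \<Sum>(set lam)" .
  let ?k = "\<Sum>(set lam) - deg1 a"
  obtain c :: nat where c: "mps_nth (g_comb pm lam []) a = of_nat c * monom ((- 1) ^ ?k) ?k"
    using g_comb_nth_count[OF lam n, of pm] unfolding neg_X_power by blast
  have "coeff (mps_nth (g_comb pm lam []) a * p) (N - deg1 a) =
      of_nat c * (if ?k \<le> N - deg1 a then (- 1) ^ ?k * coeff p (N - deg1 a - ?k) else 0)"
    unfolding c mult.assoc of_nat_poly by (simp add: coeff_monom_mult)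
  then have "?k \<le> N - deg1 a" "coeff p (N - deg1 a - ?k) \<noteq> 0" using nz by (auto split: if_splits)
  then show "\<Sum>(set lam) \<le> N" "coeff p (N - \<Sum>(set lam)) \<noteq> 0" using le d by auto
qed

lemma coeff_g_comb_mult_diag:
  assumes lam: "lam \<in> strict_partitions" and N: "\<Sum>(set lam) \<le> N" and nz: "coeff p (N - \<Sum>(set lam)) \<noteq> 0"
  shows "coeff (mps_nth (g_comb pm lam []) (expo (set lam)) * p) (N - \<Sum>(set lam)) \<noteq> 0"
proof -
  have deg: "deg1 (expo (set lam)) = \<Sum>(set lam)" by (rule wdeg_expo[OF strict_partitions_props(2)[OF lam]])
  have "\<exists>c :: nat. mps_nth (g_comb pm lam []) (expo (set lam)) = of_nat c"
    unfolding g_comb_nth_count[OF lam keys_expo[of "set lam"]] deg by (rule exI) simp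
  then obtain c :: nat where c: "mps_nth (g_comb pm lam []) (expo (set lam)) = of_nat c" by blast
  moreover have "c \<noteq> 0" using g_comb_diag[OF lam, of pm] c by auto
  ultimately show ?thesis using nz by (simp add: of_nat_poly)
qed

text \<open>
  The functions are inhomogeneous in \<open>x\<close>, but homogeneous once \<open>\<beta>\<close> has degree 1. Hence a fixed total
  degree \<open>N\<close> involves only partitions of size at most \<open>N\<close>, so infinite sums cause no trouble.
\<close>

lemma has_sum_g_comb_unique:
  fixes g g' :: "nat list \<Rightarrow> series"
  assumes s: "((\<lambda>mu. in_x (g_comb pm mu []) * in_y (g mu)) has_sum s) strict_partitions"
    and s': "((\<lambda>mu. in_x (g_comb pm mu []) * in_y (g' mu)) has_sum s) strict_partitions"
    and mu: "mu \<in> strict_partitions"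
  shows "g mu = g' mu"
proof (rule mpser_eqI, rule ccontr)
  fix b assume ne: "mps_nth (g mu) b \<noteq> mps_nth (g' mu) b"
  define h where "h lam = mps_nth (g lam) b - mps_nth (g' lam) b" for lam
  have "h mu \<noteq> 0" using ne by (simp add: h_def)
  then obtain e where e: "coeff (h mu) e \<noteq> 0" by (metis leading_coeff_0_iff)
  let ?s = "\<lambda>lam :: nat list. \<Sum>(set lam)"
  \<comment> \<open>The total degree of a term in which the two families differ; it bounds the sizes
    under consideration, so a largest one exists.\<close>
  define N where "N = ?s mu + e"
  let ?A = "{lam \<in> strict_partitions. ?s lam \<le> N \<and> coeff (h lam) (N - ?s lam) \<noteq> 0}"
  have "finite ?A"
  proof (rule finite_subset)
    show "?A \<subseteq> partition_of ` Pow {1..N}"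
    proof
      fix lam assume "lam \<in> ?A"
      then have lam: "lam \<in> strict_partitions" "?s lam \<le> N" by auto
      then have "set lam \<subseteq> {1..N}" by (intro sum_le_subset) (auto simp: strict_partitions_def)
      then show "lam \<in> partition_of ` Pow {1..N}" using partition_of_set[OF lam(1)] by (metis PowI image_eqI)
    qed
  qed simp
  moreover have "mu \<in> ?A" using mu e by (simp add: N_def)
  then have "?A \<noteq> {}" by blast
  ultimately have "\<exists>l\<in>?A. \<forall>l'\<in>?A. ?s l' \<le> ?s l" by (rule exists_max_on[where f = ?s])
  then obtain l where l: "l \<in> ?A" and lmax: "\<forall>l'\<in>?A. ?s l' \<le> ?s l" by (rule bexE)
  \<comment> \<open>Size is maximised before \<open>binary_value\<close>: at the leading exponent
    smaller shapes are excluded because degrees do not exceed sizes, larger ones by maximality, and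
    triangularity compares shapes of equal size.\<close>
  let ?B = "{l' \<in> ?A. ?s l' = ?s l}"
  have "finite ?B" by (rule finite_subset[OF _ \<open>finite ?A\<close>]) blast
  moreover have "?B \<noteq> {}" using l by blast
  ultimately have "\<exists>l\<in>?B. \<forall>l'\<in>?B. binary_value (set l') \<le> binary_value (set l)" by (rule exists_max_on[where f = "\<lambda>l. binary_value (set l)"])
  then obtain nu where nu: "nu \<in> ?B" and numax: "\<forall>l'\<in>?B. binary_value (set l') \<le> binary_value (set nu)" by (rule bexE)
  have nuP: "nu \<in> strict_partitions" "?s nu \<le> N" "coeff (h nu) (N - ?s nu) \<noteq> 0" "?s nu = ?s l" using nu by auto
  let ?a = "expo (set nu)"
  have deg: "deg1 ?a = ?s nu" by (rule wdeg_expo[OF strict_partitions_props(2)[OF nuP(1)]])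
  let ?m = "push Inl ?a + push Inr b"
  let ?c = "\<lambda>lam. mps_nth (g_comb pm lam []) ?a"
  have nth: "mps_nth (in_x (g_comb pm lam []) * in_y (f lam)) ?m = ?c lam * mps_nth (f lam) b" for lam and f :: "nat list \<Rightarrow> series"
    unfolding in_x_def in_y_def mps_nth_Inl_mult_Inr map_key_pushes ..
  let ?Z = "\<lambda>f. {lam \<in> strict_partitions. ?c lam * mps_nth (f lam :: series) b \<noteq> 0}"
  have Z: "finite (?Z f) \<and> mps_nth s ?m = (\<Sum>lam\<in>?Z f. ?c lam * mps_nth (f lam) b)"
    if "((\<lambda>mu. in_x (g_comb pm mu []) * in_y (f mu)) has_sum s) strict_partitions" for f
    using spec[OF that[unfolded has_sum_mpser_iff], of ?m] unfolding nth .
  let ?F = "?Z g \<union> ?Z g'"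
  \<comment> \<open>The supports are finite by the assumed summability; unlike for
    \<open>GQ\<close>, this does not follow from the degree of the monomial.\<close>
  have fF: "finite ?F" using Z[OF s] Z[OF s'] by blast
  have "(\<Sum>lam\<in>?F. ?c lam * mps_nth (g lam) b) = mps_nth s ?m"
    unfolding conjunct2[OF Z[OF s]] using fF by (intro sum.mono_neutral_right) auto
  moreover have "(\<Sum>lam\<in>?F. ?c lam * mps_nth (g' lam) b) = mps_nth s ?m"
    unfolding conjunct2[OF Z[OF s']] using fF by (intro sum.mono_neutral_right) auto
  ultimately have z0: "(\<Sum>lam\<in>?F. ?c lam * h lam) = 0"
    by (simp add: h_def right_diff_distrib sum_subtractf)
  have z: "(\<Sum>lam\<in>?F. coeff (?c lam * h lam) (N - ?s nu)) = 0"
    unfolding coeff_sum[symmetric] z0 by simp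
  have only: "lam = nu" if lam: "lam \<in> strict_partitions" and n: "coeff (?c lam * h lam) (N - ?s nu) \<noteq> 0" for lam
  proof -
    have dN: "deg1 ?a \<le> N" using deg nuP(2) by simp
    have n': "coeff (?c lam * h lam) (N - deg1 ?a) \<noteq> 0" using n deg by simp
    note c = coeff_g_comb_mult[OF lam dN n']
    have lA: "lam \<in> ?A" using lam c by blast
    have "?s lam \<le> ?s l" by (rule bspec[OF lmax lA])
    then have eq: "?s lam = ?s nu" using c(2) deg nuP(4) by simp
    then have lB: "lam \<in> ?B" using lA nuP(4) by simp
    have "set lam = set nu \<or> binary_value (set nu) < binary_value (set lam)"
      by (rule g_comb_triangular[OF lam nuP(1) eq c(1)])
    moreover have "binary_value (set lam) \<le> binary_value (set nu)" by (rule bspec[OF numax lB])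
    ultimately have "set lam = set nu" by simp
    then have "partition_of (set lam) = partition_of (set nu)" by (rule arg_cong)
    then show ?thesis unfolding partition_of_set[OF lam] partition_of_set[OF nuP(1)] .
  qed
  have nz: "coeff (?c nu * h nu) (N - ?s nu) \<noteq> 0"
    by (rule coeff_g_comb_mult_diag[OF nuP(1-3)])
  have "nu \<in> ?F"
  proof (rule ccontr)
    assume "nu \<notin> ?F"
    then have "?c nu * mps_nth (g nu) b = 0" "?c nu * mps_nth (g' nu) b = 0" using nuP(1) by auto
    then have "?c nu * h nu = 0" by (auto simp: h_def)
    then have "coeff (?c nu * h nu) (N - ?s nu) = 0" by (simp only: coeff_0)
    then show False using nz by simp
  qed
  then have "(\<Sum>lam\<in>?F. coeff (?c lam * h lam) (N - ?s nu)) = (\<Sum>lam\<in>{nu}. coeff (?c lam * h lam) (N - ?s nu))"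
    using only fF by (intro sum.mono_neutral_right) blast+
  then show False using z nz by simp
qed

lemma skew_function_eq:
  assumes lam: "lam \<in> strict_partitions"
  shows "(THE g. g \<in> extensional strict_partitions \<and>
     ((\<lambda>mu. in_x (restrict (\<lambda>lam. g_comb pm lam []) strict_partitions mu) * in_y (g mu)) has_sum
        in_xy (restrict (\<lambda>lam. g_comb pm lam []) strict_partitions lam)) strict_partitions) =
   restrict (g_comb pm lam) strict_partitions"
proof (rule THE_extensional)
  have cong: "((\<lambda>mu. in_x (restrict (\<lambda>lam. g_comb pm lam []) strict_partitions mu) * in_y (g mu)) has_sum
        in_xy (restrict (\<lambda>lam. g_comb pm lam []) strict_partitions lam)) strict_partitions \<longleftrightarrow>
     ((\<lambda>mu. in_x (g_comb pm mu []) * in_y (g mu)) has_sum in_xy (g_comb pm lam [])) strict_partitions" for g :: "nat list \<Rightarrow> series"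
    unfolding restrict_apply'[OF lam] by (rule has_sum_cong) simp
  show "((\<lambda>mu. in_x (restrict (\<lambda>lam. g_comb pm lam []) strict_partitions mu) * in_y (restrict (g_comb pm lam) strict_partitions mu)) has_sum
        in_xy (restrict (\<lambda>lam. g_comb pm lam []) strict_partitions lam)) strict_partitions"
    unfolding cong using skew_identity[OF lam, of pm] by (rule has_sum_cong[THEN iffD1, rotated]) simp
  show "g mu = g_comb pm lam mu"
    if "((\<lambda>mu. in_x (restrict (\<lambda>lam. g_comb pm lam []) strict_partitions mu) * in_y (g mu)) has_sum
        in_xy (restrict (\<lambda>lam. g_comb pm lam []) strict_partitions lam)) strict_partitions" "mu \<in> strict_partitions" for g mu
    by (rule has_sum_g_comb_unique[OF that(1)[unfolded cong] skew_identity[OF lam] that(2)])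
qed

theorem theorem4p24:
  fixes lam mu :: "nat list"
  assumes "mu \<in> strict_partitions" and "lam \<in> strict_partitions"
  shows "gp_skew lam mu = gp_comb lam mu \<and> gq_skew lam mu = gq_comb lam mu"
proof
  show "gp_skew lam mu = gp_comb lam mu"
    unfolding gp_skew_def gp_eq skew_function_eq[OF assms(2)] using assms(1) by (simp add: g_comb_def)
  show "gq_skew lam mu = gq_comb lam mu"
    unfolding gq_skew_def gq_eq skew_function_eq[OF assms(2)] using assms(1) by (simp add: g_comb_def)
qed

end
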